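(* Let $f$ have rank $r$, and let $p=n^{-1}(\ln n)^{1+\kappa}$ for some $\kappa>0$. Let $t=\big\lceil \frac{\ln(0.08/p)}{\ln(0.275\,np)}-r'\big\rceil$ and let $\hat F$ be the nearest neighbor estimate built from the distance estimates $$\hat d(u,v)=\tfrac1{p'}\sum_{\ell\in[r']}z_\ell\,(\tilde N_{u,t}-\tilde N_{v,t})^T(M''+M'_{\mathrm{ind}})(\tilde N_{u,t+\ell}-\tilde N_{v,t+\ell}),\qquad (u,v)\in[n]^2,$$ with threshold $\eta=\Theta\big((\ln n)^{-\frac12(\kappa-\rho)}\big)$, for any $\rho\in(0,\kappa)$. Then with probability $1-o(1)$, $$\max_{u,v\in[n]}|\hat F(u,v)-F(u,v)|=O\Big((\ln n)^{-\frac14(\kappa-\rho)}\Big).$$ Furthermore, $$\mathrm{MSE}(\hat F)=O\Big((\ln n)^{-\frac12(\kappa-\rho)}\Big).$$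
   Context: Asymptotics are as $n\to\infty$ with $f,\kappa,\rho$ fixed. Model. $\theta_1,\dots,\theta_n$ are i.i.d. uniform on $[0,1]$. $f:[0,1]^2\to[0,1]$ is a fixed (independent of $n$) symmetric Lipschitz function, and $F(u,v)=f(\theta_u,\theta_v)$ for $u,v\in[n]$. Given the latent variables, $\{Z(u,v)\}_{(u,v)\in[n]^2}$ are independent, $[0,1]$-valued, with $\mathbb E[Z(u,v)]=F(u,v)$. Each ordered pair $(u,v)\in[n]^2$ belongs to the observed set $\mathcal E$ independently with probability $p$ (independently of all else). $M(u,v)=Z(u,v)$ if $(u,v)\in\mathcal E$ and $M(u,v)=0$ otherwise. Rank. $f$ has rank $r$ if $f(x,y)=\sum_{k=1}^r\lambda_k q_k(x)q_k(y)$ for all $x,y\in[0,1]$, where $\lambda_k\in\mathbb R$, $|\lambda_1|\ge\dots\ge|\lambda_r|>0$, the $q_k$ are orthonormal in $L^2[0,1]$, and $\sup_{y\in[0,1]}|q_k(y)|\le B$ for all $k$, for some constant $B$. $r'\le r$ is the number of distinct values among $\lambda_1,\dots,\lambda_r$. $\Lambda=\mathrm{diag}(\lambda_1,\dots,\lambda_r)$, and $\tilde\Lambda$ is the $r\times r'$ matrix with $\tilde\Lambda(a,b)=\lambda_a^{b-1}$. The algorithm knows the eigenvalues, and $z\in\mathbb R^{r'}$ is the unique vector with $\Lambda^{2t+2}\tilde\Lambda z=\Lambda^2\mathbf 1$. Sample splitting. Each element of $\mathcal E$ is placed independently in $\mathcal E'$ with probability $1/4$, in $\mathcal E''$ with probability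 $1/4$, and in $\mathcal E'''$ with probability $1/2$. Put $p'=\frac{p}{4-p}$. Conditioned on $\mathcal E'$, $\mathcal E'_{\mathrm{ind}}\subseteq\mathcal E'$ includes each element of $\mathcal E'$ independently with probability $p'$. $M',M'_{\mathrm{ind}},M'',M'''$ are the $n\times n$ matrices equal to $M$ on $\mathcal E',\mathcal E'_{\mathrm{ind}},\mathcal E'',\mathcal E'''$ respectively and $0$ elsewhere. Neighborhood vectors. Consider the directed graph $([n],\mathcal E')$. $\mathcal S_{u,s}$ is the set of vertices $i$ whose shortest path from $u$ has length $s$. $\mathcal T_u$ is a breadth-first tree rooted at $u$, chosen uniformly at random among the valid ones. $N_{u,s}\in[0,1]^n$ is given by $N_{u,s}(i)=\prod_{(a,b)\in\mathrm{path}_{\mathcal T_u}(u,i)}M'(a,b)$ if $i\in\mathcal S_{u,s}$, and $0$ otherwise, where the product is over the edges of the tree path from $u$ to $i$. $\tilde N_{u,s}=N_{u,s}/|\mathcal S_{u,s}|$ (and $0$ if $\mathcal S_{u,s}=\emptyset$). Nearest neighbor estimate. Given $\hat d$ and threshold $\eta$, let $\mathcal E'''_{uv}=\{(a,b)\in\mathcal E''' : \hat d(u,a)<\eta,\ \hat d(v,b)<\eta\}$ and $\hat F(u,v)=\frac{1}{|\mathcal E'''_{uv}|}\sum_{(a,b)\in\mathcal E'''_{uv}}M'''(a,b)$ (with an arbitrary value in $[0,1]$ if $\mathcal E'''_{uv}=\emptyset$). $\mathrm{MSE}(\hat F)=\frac1{n^2}\mathbb E\big[\sum_{u,v}(\hat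 F(u,v)-F(u,v))^2\big]$, with expectation over all the randomness. *)

theory Defs
  imports "HOL-Probability.Probability" "HOL-Library.Landau_Symbols"
begin

text \<open>
  \<open>f\<close> is a function on the unit square; its values elsewhere are never used.
\<close>

definition latent_function :: "(real \<Rightarrow> real \<Rightarrow> real) \<Rightarrow> bool" where
  "latent_function f \<longleftrightarrow>
     (\<forall>x\<in>{0..1}. \<forall>y\<in>{0..1}. f x y \<in> {0..1} \<and> f x y = f y x) \<and>
     (\<exists>L. L-lipschitz_on ({0..1} \<times> {0..1}) (\<lambda>(x, y). f x y))"

text \<open>
  \<open>f\<close> has rank \<open>r\<close>, with eigenvalues \<open>lam 1, ..., lam r\<close> and eigenfunctions \<open>q 1, ..., q r\<close>.
\<close>

definition has_rank ::
  "(real \<Rightarrow> real \<Rightarrow> real) \<Rightarrow> nat \<Rightarrow> (nat \<Rightarrow> real) \<Rightarrow> (nat \<Rightarrow> real \<Rightarrow> real) \<Rightarrow> bool" where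
  "has_rank f r lam q \<longleftrightarrow>
     (\<forall>x\<in>{0..1}. \<forall>y\<in>{0..1}. f x y = (\<Sum>k=1..r. lam k * q k x * q k y)) \<and>
     (\<forall>k\<in>{1..r}. lam k \<noteq> 0) \<and>
     (\<forall>j\<in>{1..r}. \<forall>k\<in>{1..r}. j \<le> k \<longrightarrow> \<bar>lam k\<bar> \<le> \<bar>lam j\<bar>) \<and>
     (\<forall>k\<in>{1..r}. q k \<in> borel_measurable (lebesgue_on {0..1})) \<and>
     (\<forall>j\<in>{1..r}. \<forall>k\<in>{1..r}.
        (LINT x|lebesgue_on {0..1}. q j x * q k x) = (if j = k then 1 else 0)) \<and>
     (\<exists>B. \<forall>k\<in>{1..r}. \<forall>y\<in>{0..1}. \<bar>q k y\<bar> \<le> B)"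

definition num_distinct :: "nat \<Rightarrow> (nat \<Rightarrow> real) \<Rightarrow> nat" where
  "num_distinct r lam = card (lam ` {1..r})"

text \<open>
  The \<open>a\<close>-th coordinate of the \<open>r\<close>-dimensional equation
  \<open>Lambda^(2t+2) tLambda z = Lambda^2 1\<close>, where \<open>Lambda\<close> is the diagonal matrix of the
  eigenvalues and \<open>tLambda a b = lam a ^ (b - 1)\<close>. After dropping repeated rows this is an
  invertible Vandermonde system, so it determines \<open>z 1, ..., z r'\<close>; no other values of \<open>z\<close> are used.
\<close>

definition solves_weights :: "nat \<Rightarrow> (nat \<Rightarrow> real) \<Rightarrow> nat \<Rightarrow> (nat \<Rightarrow> real) \<Rightarrow> bool" where
  "solves_weights r lam t z \<longleftrightarrow>
     (\<forall>a\<in>{1..r}. lam a ^ (2 * t + 2) * (\<Sum>b=1..num_distinct r lam. lam a ^ (b - 1) * z b)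
        = lam a ^ 2 * 1)"

type_synonym edges = "(nat \<times> nat) set"

definition sphere :: "edges \<Rightarrow> nat \<Rightarrow> nat \<Rightarrow> nat set" where
  "sphere E u s = {i. (u, i) \<in> E ^^ s \<and> (\<forall>k<s. (u, i) \<notin> E ^^ k)}"

definition walk :: "edges \<Rightarrow> nat \<Rightarrow> nat list \<Rightarrow> nat \<Rightarrow> bool" where
  "walk E u xs i \<longleftrightarrow>
     xs \<noteq> [] \<and> hd xs = u \<and> last xs = i \<and> successively (\<lambda>a b. (a, b) \<in> E) xs"

text \<open>
  A breadth-first tree of \<open>E\<close> rooted at \<open>u\<close>, given by its edges: it spans the vertices reachable
  from \<open>u\<close>, it is an arborescence (from \<open>u\<close> there is exactly one walk to each of its vertices), and
  its walks from \<open>u\<close> are shortest paths of \<open>E\<close>.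
\<close>

definition bfs_trees :: "edges \<Rightarrow> nat \<Rightarrow> edges set" where
  "bfs_trees E u = {T. T \<subseteq> E \<and> (\<forall>(a, b)\<in>T. (u, a) \<in> E\<^sup>*) \<and>
     (\<forall>i. (u, i) \<in> E\<^sup>* \<longrightarrow> (\<exists>!xs. walk T u xs i)) \<and>
     (\<forall>i xs. walk T u xs i \<longrightarrow> i \<in> sphere E u (length xs - 1))}"

definition tree_path :: "edges \<Rightarrow> nat \<Rightarrow> nat \<Rightarrow> nat list" where
  "tree_path T u i = (THE xs. walk T u xs i)"

definition nbr_vec ::
  "edges \<Rightarrow> edges \<Rightarrow> (nat \<Rightarrow> nat \<Rightarrow> real) \<Rightarrow> nat \<Rightarrow> nat \<Rightarrow> nat \<Rightarrow> real" where
  "nbr_vec E T A u s i =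
     (if i \<in> sphere E u s
      then (let xs = tree_path T u i in \<Prod>(a, b)\<leftarrow>zip xs (tl xs). A a b)
      else 0)"

text \<open>Division by zero yields \<open>0\<close>, as wanted for an empty sphere.\<close>

definition nbr_vec_normalized ::
  "edges \<Rightarrow> edges \<Rightarrow> (nat \<Rightarrow> nat \<Rightarrow> real) \<Rightarrow> nat \<Rightarrow> nat \<Rightarrow> nat \<Rightarrow> real" where
  "nbr_vec_normalized E T A u s i = nbr_vec E T A u s i / real (card (sphere E u s))"

datatype part = Part1 | Part2 | Part3

text \<open>
  All the randomness for one value of \<open>n\<close>, as random variables on one probability space.
  Splitting labels and thinning coins are attached to every pair; they only matter for pairs that
  are observed (for \<open>label\<close>), or observed and of label \<open>Part1\<close> (for \<open>thin\<close>).
  \<open>fallback u v\<close> is the estimate that is used when no neighboring sample is available.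
\<close>

record 'a icf =
  spc :: "'a measure"
  theta :: "nat \<Rightarrow> 'a \<Rightarrow> real"
  Zvar :: "nat \<times> nat \<Rightarrow> 'a \<Rightarrow> real"
  obs :: "nat \<times> nat \<Rightarrow> 'a \<Rightarrow> bool"
  label :: "nat \<times> nat \<Rightarrow> 'a \<Rightarrow> part"
  thin :: "nat \<times> nat \<Rightarrow> 'a \<Rightarrow> bool"
  tree :: "nat \<Rightarrow> 'a \<Rightarrow> edges"
  fallback :: "nat \<Rightarrow> nat \<Rightarrow> 'a \<Rightarrow> real"

abbreviation pairs :: "nat \<Rightarrow> edges" where
  "pairs n \<equiv> {1..n} \<times> {1..n}"

definition Eobs :: "nat \<Rightarrow> 'a icf \<Rightarrow> 'a \<Rightarrow> edges" where
  "Eobs n X \<omega> = {e \<in> pairs n. obs X e \<omega>}"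

definition Epart :: "nat \<Rightarrow> 'a icf \<Rightarrow> part \<Rightarrow> 'a \<Rightarrow> edges" where
  "Epart n X k \<omega> = {e \<in> Eobs n X \<omega>. label X e \<omega> = k}"

definition Eind :: "nat \<Rightarrow> 'a icf \<Rightarrow> 'a \<Rightarrow> edges" where
  "Eind n X \<omega> = {e \<in> Epart n X Part1 \<omega>. thin X e \<omega>}"

definition thin_prob :: "real \<Rightarrow> real" where
  "thin_prob p = p / (4 - p)"

definition part_pmf :: "part pmf" where
  "part_pmf = pmf_of_list [(Part1, 1/4), (Part2, 1/4), (Part3, 1/2)]"

definition coins :: "'a icf \<Rightarrow> nat \<times> nat \<Rightarrow> 'a \<Rightarrow> bool \<times> part \<times> bool" where
  "coins X e \<omega> = (obs X e \<omega>, label X e \<omega>, thin X e \<omega>)"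

definition theta_vec :: "nat \<Rightarrow> 'a icf \<Rightarrow> 'a \<Rightarrow> nat \<Rightarrow> real" where
  "theta_vec n X \<omega> = (\<lambda>u\<in>{1..n}. theta X u \<omega>)"

definition Z_vec :: "nat \<Rightarrow> 'a icf \<Rightarrow> 'a \<Rightarrow> nat \<times> nat \<Rightarrow> real" where
  "Z_vec n X \<omega> = (\<lambda>e\<in>pairs n. Zvar X e \<omega>)"

definition coins_vec :: "nat \<Rightarrow> 'a icf \<Rightarrow> 'a \<Rightarrow> nat \<times> nat \<Rightarrow> bool \<times> part \<times> bool" where
  "coins_vec n X \<omega> = (\<lambda>e\<in>pairs n. coins X e \<omega>)"

definition latent_space :: "nat \<Rightarrow> (nat \<Rightarrow> real) measure" where
  "latent_space n = PiM {1..n} (\<lambda>_. borel)"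

definition Z_space :: "nat \<Rightarrow> (nat \<times> nat \<Rightarrow> real) measure" where
  "Z_space n = PiM (pairs n) (\<lambda>_. borel)"

definition coins_space :: "nat \<Rightarrow> (nat \<times> nat \<Rightarrow> bool \<times> part \<times> bool) measure" where
  "coins_space n = PiM (pairs n) (\<lambda>_. count_space UNIV)"

text \<open>The sigma-algebras generated by the latent variables, and by everything but the trees.\<close>

definition latent_algebra :: "nat \<Rightarrow> 'a icf \<Rightarrow> 'a measure" where
  "latent_algebra n X = vimage_algebra (space (spc X)) (theta_vec n X) (latent_space n)"

definition data_algebra :: "nat \<Rightarrow> 'a icf \<Rightarrow> 'a measure" where
  "data_algebra n X = vimage_algebra (space (spc X))
     (\<lambda>\<omega>. (theta_vec n X \<omega>, Z_vec n X \<omega>, coins_vec n X \<omega>))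
     (latent_space n \<Otimes>\<^sub>M (Z_space n \<Otimes>\<^sub>M coins_space n))"

definition Fmat :: "(real \<Rightarrow> real \<Rightarrow> real) \<Rightarrow> 'a icf \<Rightarrow> 'a \<Rightarrow> nat \<Rightarrow> nat \<Rightarrow> real" where
  "Fmat f X \<omega> u v = f (theta X u \<omega>) (theta X v \<omega>)"

text \<open>
  Independence of the \<open>Z\<close> variables given the latent variables is the factorization of the
  conditional probabilities of all events \<open>Z e \<in> A e\<close>; subfamilies are covered by \<open>A e = UNIV\<close>.
\<close>

definition latent_model :: "nat \<Rightarrow> (real \<Rightarrow> real \<Rightarrow> real) \<Rightarrow> 'a icf \<Rightarrow> bool" where
  "latent_model n f X \<longleftrightarrow> (let M = spc X; G = latent_algebra n X in
     (\<forall>u\<in>{1..n}. theta X u \<in> space M \<rightarrow> {0..1} \<and>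
        distr M borel (theta X u) = uniform_measure lborel {0..1}) \<and>
     prob_space.indep_vars M (\<lambda>_. borel) (theta X) {1..n} \<and>
     (\<forall>e\<in>pairs n. Zvar X e \<in> borel_measurable M \<and> Zvar X e \<in> space M \<rightarrow> {0..1}) \<and>
     (\<forall>A. (\<forall>e\<in>pairs n. A e \<in> sets borel) \<longrightarrow>
        (AE \<omega> in M. real_cond_exp M G (\<lambda>\<omega>. \<Prod>e\<in>pairs n. indicat_real (A e) (Zvar X e \<omega>)) \<omega>
           = (\<Prod>e\<in>pairs n. real_cond_exp M G (\<lambda>\<omega>. indicat_real (A e) (Zvar X e \<omega>)) \<omega>))) \<and>
     (\<forall>u\<in>{1..n}. \<forall>v\<in>{1..n}. AE \<omega> in M. real_cond_exp M G (Zvar X (u, v)) \<omega> = Fmat f X \<omega> u v))"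

definition sampling_model :: "nat \<Rightarrow> real \<Rightarrow> 'a icf \<Rightarrow> bool" where
  "sampling_model n p X \<longleftrightarrow> (let M = spc X in
     prob_space.indep_vars M (\<lambda>_. count_space UNIV) (coins X) (pairs n) \<and>
     (\<forall>e\<in>pairs n. distr M (count_space UNIV) (coins X e) =
        measure_pmf (pair_pmf (bernoulli_pmf p)
          (pair_pmf part_pmf (bernoulli_pmf (thin_prob p))))) \<and>
     prob_space.indep_set M
       (sets (vimage_algebra (space M) (\<lambda>\<omega>. (theta_vec n X \<omega>, Z_vec n X \<omega>))
          (latent_space n \<Otimes>\<^sub>M Z_space n)))
       (sets (vimage_algebra (space M) (coins_vec n X) (coins_space n))))"

text \<open>
  Given all the other data, the trees are independent, and each of them is uniform among the
  breadth-first trees of the first part of the split with the respective root.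
\<close>

definition tree_model :: "nat \<Rightarrow> 'a icf \<Rightarrow> bool" where
  "tree_model n X \<longleftrightarrow> (let M = spc X in
     (\<forall>u\<in>{1..n}. tree X u \<in> measurable M (count_space UNIV) \<and>
        (\<forall>\<omega>\<in>space M. tree X u \<omega> \<in> bfs_trees (Epart n X Part1 \<omega>) u)) \<and>
     (\<forall>\<tau>. AE \<omega> in M.
        real_cond_exp M (data_algebra n X) (\<lambda>\<omega>. \<Prod>u\<in>{1..n}. indicat_real {\<tau> u} (tree X u \<omega>)) \<omega>
          = (\<Prod>u\<in>{1..n}. pmf (pmf_of_set (bfs_trees (Epart n X Part1 \<omega>) u)) (\<tau> u))))"

definition icf_model :: "nat \<Rightarrow> real \<Rightarrow> (real \<Rightarrow> real \<Rightarrow> real) \<Rightarrow> 'a icf \<Rightarrow> bool" where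
  "icf_model n p f X \<longleftrightarrow>
     prob_space (spc X) \<and> latent_model n f X \<and> sampling_model n p X \<and> tree_model n X \<and>
     (\<forall>u\<in>{1..n}. \<forall>v\<in>{1..n}. fallback X u v \<in> borel_measurable (spc X) \<and>
        fallback X u v \<in> space (spc X) \<rightarrow> {0..1})"

definition Mmat :: "nat \<Rightarrow> 'a icf \<Rightarrow> 'a \<Rightarrow> nat \<Rightarrow> nat \<Rightarrow> real" where
  "Mmat n X \<omega> u v = (if (u, v) \<in> Eobs n X \<omega> then Zvar X (u, v) \<omega> else 0)"

definition mat_on :: "edges \<Rightarrow> (nat \<Rightarrow> nat \<Rightarrow> real) \<Rightarrow> nat \<Rightarrow> nat \<Rightarrow> real" where
  "mat_on E A u v = (if (u, v) \<in> E then A u v else 0)"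

definition Nvec :: "nat \<Rightarrow> 'a icf \<Rightarrow> 'a \<Rightarrow> nat \<Rightarrow> nat \<Rightarrow> nat \<Rightarrow> real" where
  "Nvec n X \<omega> u s = nbr_vec_normalized (Epart n X Part1 \<omega>) (tree X u \<omega>)
     (mat_on (Epart n X Part1 \<omega>) (Mmat n X \<omega>)) u s"

definition d_hat ::
  "nat \<Rightarrow> real \<Rightarrow> 'a icf \<Rightarrow> nat \<Rightarrow> (nat \<Rightarrow> real) \<Rightarrow> nat \<Rightarrow> 'a \<Rightarrow> nat \<Rightarrow> nat \<Rightarrow> real" where
  "d_hat n p X r' z t \<omega> u v = 1 / thin_prob p *
     (\<Sum>l=1..r'. z l * (\<Sum>i=1..n. \<Sum>j=1..n.
        (Nvec n X \<omega> u t i - Nvec n X \<omega> v t i) *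
        (mat_on (Epart n X Part2 \<omega>) (Mmat n X \<omega>) i j + mat_on (Eind n X \<omega>) (Mmat n X \<omega>) i j) *
        (Nvec n X \<omega> u (t + l) j - Nvec n X \<omega> v (t + l) j)))"

definition near_samples ::
  "nat \<Rightarrow> 'a icf \<Rightarrow> (nat \<Rightarrow> nat \<Rightarrow> real) \<Rightarrow> real \<Rightarrow> 'a \<Rightarrow> nat \<Rightarrow> nat \<Rightarrow> edges" where
  "near_samples n X d \<eta> \<omega> u v = {(a, b) \<in> Epart n X Part3 \<omega>. d u a < \<eta> \<and> d v b < \<eta>}"

definition nn_estimate ::
  "nat \<Rightarrow> 'a icf \<Rightarrow> (nat \<Rightarrow> nat \<Rightarrow> real) \<Rightarrow> real \<Rightarrow> 'a \<Rightarrow> nat \<Rightarrow> nat \<Rightarrow> real" where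
  "nn_estimate n X d \<eta> \<omega> u v =
     (let S = near_samples n X d \<eta> \<omega> u v in
      if S = {} then fallback X u v \<omega>
      else (\<Sum>(a, b)\<in>S. mat_on (Epart n X Part3 \<omega>) (Mmat n X \<omega>) a b) / real (card S))"

definition MSE ::
  "nat \<Rightarrow> (real \<Rightarrow> real \<Rightarrow> real) \<Rightarrow> 'a icf \<Rightarrow> ('a \<Rightarrow> nat \<Rightarrow> nat \<Rightarrow> real) \<Rightarrow> real" where
  "MSE n f X Fh = 1 / (real n)\<^sup>2 *
     (LINT \<omega>|spc X. (\<Sum>u=1..n. \<Sum>v=1..n. (Fh \<omega> u v - Fmat f X \<omega> u v)\<^sup>2))"

end

theory Submission
  imports Defs "HOL-Computational_Algebra.Polynomial" "HOL-Real_Asymp.Real_Asymp"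
begin

text \<open>The average of the eigenfunction \<open>q k\<close> over the \<open>s\<close>-th layer of the neighborhood of \<open>u\<close>,
with each vertex weighted by the product of the entries on its tree path, is multiplied by nearly \<open>lam k\<close> when
\<open>s\<close> grows by one. The layers grow geometrically, so the errors sum to a small multiple of the first one,
and these averages determine \<open>q k (theta u)\<close>. The weights \<open>z\<close> are chosen so that the bilinear form in the
distance estimate becomes \<open>\<Sum>k. (lam k)\<^sup>2 (q k (theta u) - q k (theta v))\<^sup>2\<close> up to an error
\<open>o(\<eta>)\<close>; this distance controls \<open>f\<close>, so averaging the fresh samples near \<open>(u, v)\<close> gives the estimate.

Two devices replace a direct computation with the random trees. Permuting the vertices of one layer on the
parent side of the edges preserves the law of the graph with its trees, so the parents of the next layer may be
averaged over all permutations. The entries are known only through their conditional means, so exponential moments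
are compared, by convexity, with those of two-point distributions on 0 and 1.\<close>

section \<open>Breadth-first trees\<close>

text \<open>The depth \<open>t\<close> is of order ln n / ln ln n. Layers grow by a factor between
  about np/10 and 0.275 np per step; the two rates differ by a constant factor only, and a constant
  to the power \<open>t\<close> is n^o(1). Hence layers \<open>t\<close> to \<open>t + r'\<close>
  have at least n^(9/10) vertices, while every layer that still has to expand stays below 0.08/p.
  The weights \<open>z\<close> may be as large as a constant to the power \<open>2 * t\<close>.
  Whatever they multiply must be a negative power of n: passing from layer \<open>t\<close> to layer
  \<open>t + l\<close> costs about the inverse square root of the layer size, and the bilinear form
  may fluctuate by n^(-1/5). The admissible scale of the threshold comes from the first step: about
  np/10 vertices give a squared error of order (ln n)^(rho/2 - kappa), where rho/2 pays for the
  union bound over the vertices. The neighborhood vectors depend on the pairs of E'. Outside E' a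
  pair belongs to E'' with conditional probability p / (4 - p), which explains
  \<open>thin_prob\<close>; inside E' there are too few pairs, compared with the square of the layer
  size, to matter.\<close>

lemma sphere_0 [simp]: "sphere E u 0 = {u}"
 by (auto simp: sphere_def)

lemma relpow_imp_sphere: "(u, i) \<in> E ^^ k ==> \<exists>m\<le>k. i \<in> sphere E u m"
proof -
 assume k: "(u, i) \<in> E ^^ k"
 let ?m = "LEAST m. (u, i) \<in> E ^^ m"
 have "(u, i) \<in> E ^^ ?m" using k by (rule LeastI)
 moreover have "\<forall>k<?m. (u, i) \<notin> E ^^ k" using not_less_Least by blast
 moreover have "?m <= k" using k by (rule Least_le)
 ultimately show ?thesis unfolding sphere_def by blast
qed

lemma sphere_Suc:
 "sphere E u (Suc s) = {i. (\<exists>a\<in>sphere E u s. (a, i) \<in> E) \<and> (\<forall>k\<le>s. i \<notin> sphere E u k)}"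
proof (intro equalityI subsetI)
 fix i assume i: "i \<in> sphere E u (Suc s)"
 then obtain a where a: "(u, a) \<in> E ^^ s" "(a, i) \<in> E" by (auto simp: sphere_def)
 have "\<forall>k<s. (u, a) \<notin> E ^^ k"
 proof (intro allI impI notI)
  fix k assume "k < s" "(u, a) \<in> E ^^ k"
  then have "Suc k < Suc s" "(u, i) \<in> E ^^ Suc k" using a(2) by auto
  moreover have "\<forall>k<Suc s. (u, i) \<notin> E ^^ k" using i by (auto simp: sphere_def)
  ultimately show False by blast
 qed
 then have "a \<in> sphere E u s" using a by (simp add: sphere_def)
 moreover have "\<forall>k\<le>s. i \<notin> sphere E u k" using i by (auto simp: sphere_def)
 ultimately show "i \<in> {i. (\<exists>a\<in>sphere E u s. (a, i) \<in> E) \<and> (\<forall>k\<le>s. i \<notin> sphere E u k)}"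
  using a by blast
next
 fix i assume "i \<in> {i. (\<exists>a\<in>sphere E u s. (a, i) \<in> E) \<and> (\<forall>k\<le>s. i \<notin> sphere E u k)}"
 then obtain a where a: "a \<in> sphere E u s" "(a, i) \<in> E" and n: "\<forall>k\<le>s. i \<notin> sphere E u k"
  by blast
 have "(u, i) \<in> E ^^ Suc s" using a by (auto simp: sphere_def)
 moreover have "(u, i) \<notin> E ^^ k" if "k < Suc s" for k
  using relpow_imp_sphere[of u i k E] n that by (meson le_trans less_Suc_eq_le)
 ultimately show "i \<in> sphere E u (Suc s)" by (simp add: sphere_def)
qed

lemma sphere_disjoint: "i \<in> sphere E u s ==> i \<in> sphere E u k ==> s = k"
 by (auto simp: sphere_def) (metis linorder_neqE_nat)

lemma reachable_iff_sphere: "(u, i) \<in> E\<^sup>* \<longleftrightarrow> (\<exists>s. i \<in> sphere E u s)"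
 by (metis (no_types, lifting) mem_Collect_eq relpow_imp_sphere rtrancl_power sphere_def)

lemma sphere_Suc_subset: "E \<subseteq> {1..n} \<times> {1..n} ==> sphere E u (Suc s) \<subseteq> {1..n}"
 by (auto simp: sphere_Suc)

lemma sphere_subset: "E \<subseteq> {1..n} \<times> {1..n} ==> u \<in> {1..n} ==> sphere E u s \<subseteq> {1..n}"
 by (cases s) (use sphere_Suc_subset in auto)

lemma walk_snoc: "walk T u (xs @ [b]) i \<longleftrightarrow>
 (b = i \<and> (if xs = [] then b = u else walk T u xs (last xs) \<and> (last xs, b) \<in> T))"
 by (cases xs rule: rev_cases) (auto simp: walk_def successively_append_iff hd_append)

lemma walk_Nil [simp]: "\<not> walk T u [] i"
 by (simp add: walk_def)

lemma walk_snocI: "walk T u xs a ==> (a, b) \<in> T ==> walk T u (xs @ [b]) b"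
 by (auto simp: walk_snoc) (auto simp: walk_def)

lemma walk_last: "walk T u xs i ==> last xs = i"
 by (simp add: walk_def)

text \<open>All later arguments use this local form: edges lead from a layer to the next one, and
  each vertex beyond the root has one incoming edge. Unlike a condition on walks, it can be checked
  edge by edge, and it is visibly stable under rewiring two adjacent layers.\<close>

lemma bfs_trees_iff:
 "T \<in> bfs_trees E u \<longleftrightarrow>
  T \<subseteq> E \<and> (\<forall>(a, b)\<in>T. \<exists>k. a \<in> sphere E u k \<and> b \<in> sphere E u (Suc k)) \<and>
  (\<forall>k. \<forall>b\<in>sphere E u (Suc k). \<exists>!a. (a, b) \<in> T)" (is "_ \<longleftrightarrow> ?R")
proof
 assume T: "T \<in> bfs_trees E u"
 have sub: "T \<subseteq> E" and reach: "\<And>a b. (a, b) \<in> T ==> (u, a) \<in> E\<^sup>*"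
  and uniq: "\<And>i. (u, i) \<in> E\<^sup>* ==> \<exists>!xs. walk T u xs i"
  and len: "\<And>i xs. walk T u xs i ==> i \<in> sphere E u (length xs - 1)"
  using T by (auto simp: bfs_trees_def)
 have lev: "\<exists>k. a \<in> sphere E u k \<and> b \<in> sphere E u (Suc k)" if ab: "(a, b) \<in> T" for a b
 proof -
  obtain xs where xs: "walk T u xs a" using uniq[OF reach[OF ab]] by blast
  have "walk T u (xs @ [b]) b" using xs ab by (rule walk_snocI)
  from len[OF xs] len[OF this] xs show ?thesis
   by (cases xs) auto
 qed
 moreover have "\<exists>!a. (a, b) \<in> T" if b: "b \<in> sphere E u (Suc k)" for k b
 proof -
  have rb: "(u, b) \<in> E\<^sup>*" using b reachable_iff_sphere by blast
  then obtain xs where xs: "walk T u xs b" using uniq by blast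
  have "Suc k = length xs - 1" using len[OF xs] b sphere_disjoint by blast
  then obtain ys where ys: "xs = ys @ [b]" "ys \<noteq> []"
   using xs by (cases xs rule: rev_cases) (fastforce simp: walk_def)+
  then have 1: "(last ys, b) \<in> T" using xs by (auto simp: walk_snoc)
  \<comment> \<open>Extending the walk to \<open>a\<close> by \<open>b\<close> gives a second walk
    to \<open>b\<close>, so uniqueness of walks identifies the parents.\<close>
  have "a = last ys" if a: "(a, b) \<in> T" for a
  proof -
   obtain zs where zs: "walk T u zs a" using uniq[OF reach[OF a]] by blast
   have "walk T u (zs @ [b]) b" using zs a by (rule walk_snocI)
   with xs uniq[OF rb] have "zs @ [b] = xs" by blast
   with ys have "zs = ys" by simp
   with walk_last[OF zs] show ?thesis by simp
  qed
  with 1 show ?thesis by blast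
 qed
 ultimately show ?R using sub by (intro conjI) blast+
next
 assume R: ?R
 have lev: "a \<in> sphere E u k \<longleftrightarrow> b \<in> sphere E u (Suc k)" if ab: "(a, b) \<in> T" for a b k
 proof -
  obtain m where m: "a \<in> sphere E u m" "b \<in> sphere E u (Suc m)"
   using bspec[OF conjunct1[OF conjunct2[OF R]] ab] by auto
  have "a \<in> sphere E u k \<longleftrightarrow> k = m" "b \<in> sphere E u (Suc k) \<longleftrightarrow> Suc k = Suc m"
   using m sphere_disjoint[OF m(1), of k] sphere_disjoint[OF m(2), of "Suc k"] by auto
  then show ?thesis by simp
 qed
 have len: "walk T u xs i ==> i \<in> sphere E u (length xs - 1)" for i xs
 proof (induction xs arbitrary: i rule: rev_induct)
  case (snoc b xs)
  show ?case
  proof (cases "xs = []")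
   case False
   with snoc.prems have w: "walk T u xs (last xs)" "(last xs, b) \<in> T" "b = i"
    by (auto simp: walk_snoc)
   with snoc.IH[OF w(1)] lev[OF w(2)] False show ?thesis by (cases xs) auto
  next
   case True
   have "i = u" using snoc.prems unfolding walk_snoc True by simp
   then show ?thesis using True by simp
  qed
 qed simp
 have uniq: "\<exists>!xs. walk T u xs i" if "i \<in> sphere E u k" for i k
  using that
 proof (induction k arbitrary: i)
  case 0
  then have "i = u" by simp
  have "xs = [u]" if "walk T u xs u" for xs
   using len[OF that] sphere_disjoint[of u E u 0 "length xs - 1"] that
   by (cases xs rule: rev_cases) (auto simp: walk_def)
  moreover have "walk T u [u] u" by (simp add: walk_def)
  ultimately show ?case unfolding \<open>i = u\<close> by blast
 next
  case (Suc k)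
  obtain a where a: "(a, i) \<in> T" and ua: "\<And>a'. (a', i) \<in> T ==> a' = a"
   using bspec[OF spec[OF conjunct2[OF conjunct2[OF R]]] Suc.prems] by blast
  have "a \<in> sphere E u k" using lev[OF a] Suc.prems by simp
  from Suc.IH[OF this] obtain ys where ys: "walk T u ys a" and uy: "\<And>zs. walk T u zs a ==> zs = ys"
   by blast
  have "xs = ys @ [i]" if xs: "walk T u xs i" for xs
  proof -
   have "length xs - 1 = Suc k" using len[OF xs] Suc.prems sphere_disjoint by blast
   then obtain zs where zs: "xs = zs @ [i]" "zs \<noteq> []"
    using xs by (cases xs rule: rev_cases) (fastforce simp: walk_def)+
   with xs have "walk T u zs (last zs)" "(last zs, i) \<in> T" by (auto simp: walk_snoc)
   with ua uy zs show ?thesis by metis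
  qed
  moreover have "walk T u (ys @ [i]) i" using ys a by (rule walk_snocI)
  ultimately show ?case by blast
 qed
 show "T \<in> bfs_trees E u"
  unfolding bfs_trees_def mem_Collect_eq
 proof (intro conjI)
  show "\<forall>(a, b)\<in>T. (u, a) \<in> E\<^sup>*"
   using conjunct1[OF conjunct2[OF R]] by (auto simp: reachable_iff_sphere)
  show "T \<subseteq> E" using R by simp
  show "\<forall>i. (u, i) \<in> E\<^sup>* \<longrightarrow> (\<exists>!xs. walk T u xs i)"
   unfolding reachable_iff_sphere using uniq by (intro allI impI) (elim exE)
  show "\<forall>i xs. walk T u xs i \<longrightarrow> i \<in> sphere E u (length xs - 1)" using len by blast
 qed
qed

definition parent :: "edges => nat => nat" where
 "parent T b = (THE a. (a, b) \<in> T)"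

lemma parent:
 assumes "T \<in> bfs_trees E u" "b \<in> sphere E u (Suc k)"
 shows "(parent T b, b) \<in> T" "parent T b \<in> sphere E u k" "(parent T b, b) \<in> E"
  and "(a, b) \<in> T ==> parent T b = a"
proof -
 note T = assms(1)[unfolded bfs_trees_iff]
 have ex: "\<exists>!a. (a, b) \<in> T"
  using bspec[OF spec[OF conjunct2[OF conjunct2[OF T]]] assms(2)] .
 then show 1: "(parent T b, b) \<in> T" unfolding parent_def by (rule theI')
 show "parent T b \<in> sphere E u k" "(parent T b, b) \<in> E"
 proof -
  obtain m where m: "parent T b \<in> sphere E u m" "b \<in> sphere E u (Suc m)"
   using bspec[OF conjunct1[OF conjunct2[OF T]] 1] by auto
  have E: "(parent T b, b) \<in> E" using conjunct1[OF T] 1 by blast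
  from sphere_disjoint[OF m(2) assms(2)] m(1) have "parent T b \<in> sphere E u k" by simp
  with E show "parent T b \<in> sphere E u k" "(parent T b, b) \<in> E" by auto
 qed
 show "(a, b) \<in> T ==> parent T b = a" using 1 ex by blast
qed

lemma tree_path_walk:
 assumes "T \<in> bfs_trees E u" "i \<in> sphere E u s"
 shows "walk T u (tree_path T u i) i" "walk T u xs i ==> tree_path T u i = xs"
proof -
 have ex: "\<exists>!xs. walk T u xs i"
  using assms by (auto simp: bfs_trees_def reachable_iff_sphere)
 show 1: "walk T u (tree_path T u i) i" unfolding tree_path_def by (rule theI'[OF ex])
 show "walk T u xs i ==> tree_path T u i = xs" using 1 ex by blast
qed

lemma tree_path_Suc:
 assumes "T \<in> bfs_trees E u" "i \<in> sphere E u (Suc s)"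
 shows "tree_path T u i = tree_path T u (parent T i) @ [i]"
proof (rule tree_path_walk(2)[OF assms])
 note p = parent(1,2)[OF assms]
 show "walk T u (tree_path T u (parent T i) @ [i]) i"
  using tree_path_walk(1)[OF assms(1) p(2)] p(1) by (rule walk_snocI)
qed

lemma tree_path_0: "T \<in> bfs_trees E u ==> tree_path T u u = [u]"
 by (rule tree_path_walk(2)[where s = 0]) (auto simp: walk_def)

lemma nbr_vec_0: "T \<in> bfs_trees E u ==> nbr_vec E T A u 0 i = (if i = u then 1 else 0)"
 by (simp add: nbr_vec_def tree_path_0)

lemma zip_tl_snoc: "xs \<noteq> [] ==> zip (xs @ [b]) (tl (xs @ [b])) = zip xs (tl xs) @ [(last xs, b)]"
proof (induction xs)
 case (Cons a xs)
 then show ?case by (cases xs) auto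
qed simp

text \<open>With this recursion the path products are handled by induction over layers, without
  mentioning paths again.\<close>

lemma nbr_vec_Suc:
 assumes "T \<in> bfs_trees E u"
 shows "nbr_vec E T A u (Suc s) i =
  (if i \<in> sphere E u (Suc s) then nbr_vec E T A u s (parent T i) * A (parent T i) i else 0)"
proof (cases "i \<in> sphere E u (Suc s)")
 case True
 note p = parent(1,2,3)[OF assms True]
 have w: "walk T u (tree_path T u (parent T i)) (parent T i)"
  using tree_path_walk(1)[OF assms p(2)] .
 have "tree_path T u (parent T i) \<noteq> []" "last (tree_path T u (parent T i)) = parent T i"
  using w by (auto simp: walk_def)
 with True p(2) show ?thesis
  by (simp add: nbr_vec_def tree_path_Suc[OF assms True] zip_tl_snoc Let_def del: tl_append2)
qed (simp add: nbr_vec_def)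

lemma nbr_vec_outside: "i \<notin> sphere E u s ==> nbr_vec E T A u s i = 0"
 by (simp add: nbr_vec_def)

text \<open>Only entries on the edges enter, so the observed matrix may be replaced by the array of
  all \<open>Z\<close>.\<close>

lemma nbr_vec_cong:
 assumes T: "T \<in> bfs_trees E u" and A: "\<And>a b. (a, b) \<in> E ==> A a b = A' a b"
 shows "nbr_vec E T A u s i = nbr_vec E T A' u s i"
 by (induction s arbitrary: i) (auto simp: nbr_vec_0[OF T] nbr_vec_Suc[OF T] parent[OF T] A)

text \<open>\<open>pmf_of_set\<close> is the uniform law only on a finite nonempty set. The witness
  selects one in-neighbor from the preceding layer for each reachable vertex other than the
  root.\<close>

lemma bfs_trees_nonempty: "bfs_trees E u \<noteq> {}"
proof -
 define T where "T = {(a, b). \<exists>k. b \<in> sphere E u (Suc k) \<and> a = (SOME a. a \<in> sphere E u k \<and> (a, b) \<in> E)}"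
 have sel: "(SOME a. a \<in> sphere E u k \<and> (a, b) \<in> E) \<in> sphere E u k
   \<and> ((SOME a. a \<in> sphere E u k \<and> (a, b) \<in> E), b) \<in> E"
  if "b \<in> sphere E u (Suc k)" for b k
  using that by (intro someI_ex[of "%a. a \<in> sphere E u k \<and> (a, b) \<in> E"]) (auto simp: sphere_Suc)
 have "T \<in> bfs_trees E u"
  unfolding bfs_trees_iff
 proof (intro conjI allI ballI)
  show "T \<subseteq> E" using sel by (auto simp: T_def)
  show "case x of (a, b) \<Rightarrow> \<exists>k. a \<in> sphere E u k \<and> b \<in> sphere E u (Suc k)" if "x \<in> T" for x
   using that sel by (auto simp: T_def)
  fix k b assume b: "b \<in> sphere E u (Suc k)"
  show "\<exists>!a. (a, b) \<in> T"
  proof (rule ex1I)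
   show "(SOME a. a \<in> sphere E u k \<and> (a, b) \<in> E, b) \<in> T" using b by (auto simp: T_def)
   fix a assume "(a, b) \<in> T"
   then show "a = (SOME a. a \<in> sphere E u k \<and> (a, b) \<in> E)"
    using sphere_disjoint[OF b] by (auto simp: T_def)
  qed
 qed
 then show ?thesis by blast
qed

lemma bfs_trees_subset: "bfs_trees E u \<subseteq> Pow E"
 by (auto simp: bfs_trees_def)

section \<open>The joint law of the data\<close>

lemma UNIV_part: "UNIV = {Part1, Part2, Part3}"
 using part.exhaust by auto

instance part :: finite
 by standard (simp add: UNIV_part)

definition coin_pmf :: "real => (bool \<times> part \<times> bool) pmf" where
 "coin_pmf p = pair_pmf (bernoulli_pmf p) (pair_pmf part_pmf (bernoulli_pmf (thin_prob p)))"

definition coin_configs :: "nat => (nat \<times> nat => bool \<times> part \<times> bool) set" where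
 "coin_configs n = (PiE (pairs n) (%_. UNIV))"

definition tree_configs :: "nat => (nat => edges) set" where
 "tree_configs n = PiE {1..n} (%_. Pow (pairs n))"

definition coin_weight :: "nat => real => (nat \<times> nat => bool \<times> part \<times> bool) => real" where
 "coin_weight n p c = (\<Prod>e\<in>pairs n. pmf (coin_pmf p) (c e))"

definition tree_weight :: "edges => nat => edges => real" where
 "tree_weight E u T = pmf (pmf_of_set (bfs_trees E u)) T"

definition part_edges :: "nat => part => (nat \<times> nat => bool \<times> part \<times> bool) => edges" where
 "part_edges n k c = {e \<in> pairs n. fst (c e) \<and> fst (snd (c e)) = k}"

definition ind_edges :: "nat => (nat \<times> nat => bool \<times> part \<times> bool) => edges" where
 "ind_edges n c = {e \<in> part_edges n Part1 c. snd (snd (c e))}"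

definition joint_weight :: "nat => real => (nat \<times> nat => bool \<times> part \<times> bool) => (nat => edges) => real" where
 "joint_weight n p c \<tau> = coin_weight n p c * (\<Prod>u\<in>{1..n}. tree_weight (part_edges n Part1 c) u (\<tau> u))"

lemma finite_coin_configs [simp, intro]: "finite (coin_configs n)"
 unfolding coin_configs_def by (intro finite_PiE) auto

lemma finite_tree_configs [simp, intro]: "finite (tree_configs n)"
 unfolding tree_configs_def by (intro finite_PiE) auto

lemma part_edges_subset: "part_edges n k c \<subseteq> pairs n"
 by (auto simp: part_edges_def)

lemma finite_part_edges [simp, intro]: "finite (part_edges n k c)"
 by (rule finite_subset[OF part_edges_subset]) auto

lemma coin_weight_nonneg [simp]: "0 <= coin_weight n p c"
 by (simp add: coin_weight_def prod_nonneg)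

lemma tree_weight_nonneg [simp]: "0 <= tree_weight E u T"
 by (simp add: tree_weight_def)

lemma joint_weight_nonneg [simp]: "0 <= joint_weight n p c \<tau>"
 by (simp add: joint_weight_def prod_nonneg)

text \<open>Independence of the coins in the form behind all tail bounds: the mean of a product over
  pairs is a product of sums over the twelve values of one coin.\<close>

lemma sum_coin_weight_prod:
 "(\<Sum>c\<in>coin_configs n. coin_weight n p c * (\<Prod>e\<in>pairs n. g e (c e)))
  = (\<Prod>e\<in>pairs n. \<Sum>v\<in>UNIV. pmf (coin_pmf p) v * g e v)"
 unfolding coin_configs_def coin_weight_def
 by (subst prod_sum_PiE) (auto simp: prod.distrib)

lemma sum_pmf_UNIV [simp]: "(\<Sum>v\<in>UNIV. pmf P v) = (1::real)" for P :: "'b::finite pmf"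
 by (rule sum_pmf_eq_1) auto

lemma sum_coin_weight: "(\<Sum>c\<in>coin_configs n. coin_weight n p c) = 1"
 using sum_coin_weight_prod[where g = "%_ _. 1"] by simp

lemma sum_tree_weight_le: "finite S ==> (\<Sum>T\<in>S. tree_weight E u T) <= 1"
 unfolding tree_weight_def by (simp flip: measure_measure_pmf_finite)

text \<open>Integrates out the trees of all roots other than \<open>u\<close>. Each of these tree
  laws has mass at most 1 on the subsets of \<open>pairs n\<close>, so for nonnegative
  \<open>g\<close> an upper bound results.\<close>

lemma sum_trees_marginal:
 assumes u: "u \<in> {1..n}" and g: "\<And>T. 0 <= g T"
 shows "(\<Sum>\<tau>\<in>tree_configs n. (\<Prod>v\<in>{1..n}. tree_weight E v (\<tau> v)) * g (\<tau> u))
  <= (\<Sum>T\<in>Pow (pairs n). tree_weight E u T * g T)"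
proof -
 define h where "h v T = tree_weight E v T * (if v = u then g T else 1)" for v T
 have "(\<Sum>\<tau>\<in>tree_configs n. (\<Prod>v\<in>{1..n}. tree_weight E v (\<tau> v)) * g (\<tau> u))
   = (\<Sum>\<tau>\<in>tree_configs n. \<Prod>v\<in>{1..n}. h v (\<tau> v))"
  using u by (intro sum.cong refl) (simp add: h_def prod.distrib)
 also have "... = (\<Prod>v\<in>{1..n}. \<Sum>T\<in>Pow (pairs n). h v T)"
  unfolding tree_configs_def by (subst prod_sum_PiE) auto
 also have "... = (\<Sum>T\<in>Pow (pairs n). h u T) * (\<Prod>v\<in>{1..n}-{u}. \<Sum>T\<in>Pow (pairs n). h v T)"
  using u by (subst prod.remove[of _ u]) auto
 also have "... <= (\<Sum>T\<in>Pow (pairs n). h u T) * 1"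
  by (intro mult_left_mono prod_le_1 sum_nonneg conjI)
   (auto simp: h_def g intro!: sum_tree_weight_le sum_nonneg)
 finally show ?thesis by (simp add: h_def)
qed

lemma sum_trees_le: "(\<Sum>\<tau>\<in>tree_configs n. \<Prod>v\<in>{1..n}. tree_weight E v (\<tau> v)) <= 1"
proof -
 have "(\<Sum>\<tau>\<in>tree_configs n. \<Prod>v\<in>{1..n}. tree_weight E v (\<tau> v))
   = (\<Prod>v\<in>{1..n}. \<Sum>T\<in>Pow (pairs n). tree_weight E v T)"
  unfolding tree_configs_def by (subst prod_sum_PiE) auto
 also have "... <= 1"
  by (intro prod_le_1 conjI sum_nonneg sum_tree_weight_le) auto
 finally show ?thesis .
qed

lemma sum_joint_weight_le:
 assumes g: "\<And>c. c \<in> coin_configs n ==> 0 <= g c"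
 shows "(\<Sum>c\<in>coin_configs n. \<Sum>\<tau>\<in>tree_configs n. joint_weight n p c \<tau> * g c)
  <= (\<Sum>c\<in>coin_configs n. coin_weight n p c * g c)"
proof (rule sum_mono)
 fix c assume c: "c \<in> coin_configs n"
 have "(\<Sum>\<tau>\<in>tree_configs n. joint_weight n p c \<tau> * g c)
   = coin_weight n p c * g c *
    (\<Sum>\<tau>\<in>tree_configs n. \<Prod>v\<in>{1..n}. tree_weight (part_edges n Part1 c) v (\<tau> v))"
  by (simp add: joint_weight_def sum_distrib_left mult_ac)
 also have "... <= coin_weight n p c * g c * 1"
  using g[OF c] by (intro mult_left_mono sum_trees_le) auto
 finally show "(\<Sum>\<tau>\<in>tree_configs n. joint_weight n p c \<tau> * g c) <= coin_weight n p c * g c" by simp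
qed

lemma sum_joint_weight_le_1:
 "(\<Sum>c\<in>coin_configs n. \<Sum>\<tau>\<in>tree_configs n. joint_weight n p c \<tau>) <= 1"
 using sum_joint_weight_le[of n "%_. 1" p] by (simp add: sum_coin_weight)

lemma finite_measure_subalgebra_vimage:
 assumes "prob_space M" "D \<in> measurable M N"
 shows "finite_measure_subalgebra M (vimage_algebra (space M) D N)"
proof -
 interpret prob_space M by fact
 show ?thesis
  by unfold_locales (use assms(2) in \<open>auto simp: subalgebra_def dest: sets_image_in_sets[OF refl]\<close>)
qed

section \<open>Coins, trees and entries of one instance as random variables\<close>

locale icf_instance =
 fixes n :: nat and p :: real and f :: "real => real => real" and X :: "'a icf" and M :: "'a measure"
 assumes model: "icf_model n p f X" and M_def: "M = spc X"
  and n_pos: "n > 0" and p_pos: "0 < p" and p_le_1: "p <= 1"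
  and f_meas: "(%x. f (fst x) (snd x)) \<in> borel_measurable (borel \<Otimes>\<^sub>M borel)"
  and f01: "\<And>x y. f x y \<in> {0..1}"
begin

sublocale prob_space M
 using model by (simp add: icf_model_def M_def)

abbreviation "LZ \<equiv> latent_space n \<Otimes>\<^sub>M Z_space n"

definition TZ :: "'a => (nat => real) \<times> (nat \<times> nat => real)" where
 "TZ \<xi> = (theta_vec n X \<xi>, Z_vec n X \<xi>)"

definition trees :: "'a => nat => edges" where
 "trees \<xi> = (\<lambda>u\<in>{1..n}. tree X u \<xi>)"

abbreviation "coinsv \<equiv> coins_vec n X"

abbreviation "thetas \<equiv> theta_vec n X"

abbreviation "Zs \<equiv> Z_vec n X"

abbreviation "edges1 \<equiv> part_edges n Part1"

abbreviation "jweight \<equiv> joint_weight n p"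

abbreviation "cweight \<equiv> coin_weight n p"

lemma latent: "latent_model n f X" and sampling: "sampling_model n p X" and tree_law: "tree_model n X"
 using model by (simp_all add: icf_model_def)

lemma theta_measurable [measurable]: "u \<in> {1..n} ==> theta X u \<in> borel_measurable M"
 using latent indep_vars_def[of "%_. borel" "theta X" "{1..n}"]
 unfolding latent_model_def Let_def M_def[symmetric] by blast

lemma theta_range: "u \<in> {1..n} ==> \<xi> \<in> space M ==> theta X u \<xi> \<in> {0..1}"
 using latent unfolding latent_model_def Let_def M_def[symmetric] by blast

lemma Z_measurable [measurable]: "e \<in> pairs n ==> Zvar X e \<in> borel_measurable M"
 using latent unfolding latent_model_def Let_def M_def[symmetric] by blast

lemma Z_range: "e \<in> pairs n ==> \<xi> \<in> space M ==> Zvar X e \<xi> \<in> {0..1}"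
 using latent unfolding latent_model_def Let_def M_def[symmetric] by blast

lemma coins_measurable [measurable]: "e \<in> pairs n ==> coins X e \<in> measurable M (count_space UNIV)"
 using sampling indep_vars_def[of "%_. count_space UNIV" "coins X" "pairs n"]
 unfolding sampling_model_def Let_def M_def[symmetric] by blast

lemma tree_measurable [measurable]: "u \<in> {1..n} ==> tree X u \<in> measurable M (count_space UNIV)"
 using tree_law unfolding tree_model_def Let_def M_def[symmetric] by blast

lemma theta_vec_measurable [measurable]: "thetas \<in> measurable M (latent_space n)"
 unfolding theta_vec_def[abs_def] latent_space_def by measurable

lemma Z_vec_measurable [measurable]: "Zs \<in> measurable M (Z_space n)"
 unfolding Z_vec_def[abs_def] Z_space_def by measurable

lemma coins_vec_measurable [measurable]: "coinsv \<in> measurable M (coins_space n)"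
 unfolding coins_vec_def[abs_def] coins_space_def by measurable

lemma TZ_measurable [measurable]: "TZ \<in> measurable M LZ"
 unfolding TZ_def[abs_def] by measurable

lemma coinsv_in: "coinsv \<xi> \<in> coin_configs n"
 by (auto simp: coins_vec_def coin_configs_def)

lemma Epart_eq: "Epart n X k \<xi> = part_edges n k (coinsv \<xi>)"
 by (auto simp: Epart_def Eobs_def part_edges_def coins_vec_def coins_def)

lemma Eind_eq: "Eind n X \<xi> = ind_edges n (coinsv \<xi>)"
 by (auto simp: Eind_def Epart_eq ind_edges_def coins_vec_def coins_def part_edges_def)

lemma tree_in: "u \<in> {1..n} ==> \<xi> \<in> space M ==> tree X u \<xi> \<in> bfs_trees (edges1 (coinsv \<xi>)) u"
 using tree_law unfolding tree_model_def Let_def M_def[symmetric] Epart_eq by blast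

lemma trees_in: "\<xi> \<in> space M ==> trees \<xi> \<in> tree_configs n"
 using tree_in bfs_trees_subset part_edges_subset
 unfolding trees_def tree_configs_def by (fastforce simp: PiE_iff)

lemma singleton_coins_space: "c \<in> coin_configs n ==> {c} \<in> sets (coins_space n)"
proof -
 assume "c \<in> coin_configs n"
 then have "{c} = PiE (pairs n) (%e. {c e})"
  unfolding coin_configs_def by (intro PiE_singleton[symmetric]) (auto simp: PiE_iff)
 then show ?thesis unfolding coins_space_def by (auto intro!: sets_PiM_I_finite)
qed

lemma coins_event [measurable]: "c \<in> coin_configs n ==> {\<xi> \<in> space M. coinsv \<xi> = c} \<in> sets M"
 using measurable_sets[OF coins_vec_measurable singleton_coins_space, of c]
 by (simp add: vimage_def Int_def conj_commute)

lemma trees_event: "{\<xi> \<in> space M. trees \<xi> = \<tau>} \<in> sets M"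
proof (cases "\<tau> \<in> extensional {1..n}")
 case True
 then have "{\<xi> \<in> space M. trees \<xi> = \<tau>} = {\<xi> \<in> space M. \<forall>u\<in>{1..n}. tree X u \<xi> = \<tau> u}"
  by (auto simp: trees_def fun_eq_iff extensional_def) 
 also have "... \<in> sets M" by measurable
 finally show ?thesis .
next
 case False
 then have "{\<xi> \<in> space M. trees \<xi> = \<tau>} = {}" by (auto simp: trees_def)
 then show ?thesis by (simp only: sets.empty_sets)
qed

lemma prob_coins: "c \<in> coin_configs n ==> prob {\<xi> \<in> space M. coinsv \<xi> = c} = cweight c"
proof -
 assume c: "c \<in> coin_configs n"
 have indep: "indep_vars (%_. count_space UNIV) (coins X) (pairs n)"
  and dist: "\<And>e. e \<in> pairs n ==> distr M (count_space UNIV) (coins X e) = measure_pmf (coin_pmf p)"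
  using model by (auto simp: icf_model_def sampling_model_def Let_def M_def coin_pmf_def)
 have "{\<xi> \<in> space M. coinsv \<xi> = c} = (\<Inter>e\<in>pairs n. coins X e -` {c e} \<inter> space M)"
  using c n_pos
  by (auto simp: coins_vec_def fun_eq_iff coin_configs_def PiE_iff extensional_def) 
 also have "prob ... = (\<Prod>e\<in>pairs n. prob (coins X e -` {c e} \<inter> space M))"
  using n_pos by (intro indep_varsD[OF indep]) auto
 also have "... = (\<Prod>e\<in>pairs n. pmf (coin_pmf p) (c e))"
 proof (intro prod.cong refl)
  fix e assume e: "e \<in> pairs n"
  have "prob (coins X e -` {c e} \<inter> space M) = measure (distr M (count_space UNIV) (coins X e)) {c e}"
   using e by (subst measure_distr) auto
  then show "prob (coins X e -` {c e} \<inter> space M) = pmf (coin_pmf p) (c e)"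
   using e by (simp add: dist pmf.rep_eq)
 qed
 finally show ?thesis by (simp add: coin_weight_def)
qed

lemma indep_TZ_coins:
 assumes g [measurable]: "g \<in> borel_measurable LZ" and k [measurable]: "k \<in> borel_measurable (coins_space n)"
 shows "indep_var borel (%\<xi>. g (TZ \<xi>) :: real) borel (%\<xi>. k (coinsv \<xi>) :: real)"
proof -
 let ?A = "vimage_algebra (space M) TZ LZ" and ?B = "vimage_algebra (space M) coinsv (coins_space n)"
 have ind: "indep_set (sets ?A) (sets ?B)"
  using model by (simp add: icf_model_def sampling_model_def Let_def M_def TZ_def[abs_def])
 have TZ: "TZ \<in> space M \<rightarrow> space LZ" and C: "coinsv \<in> space M \<rightarrow> space (coins_space n)"
  using measurable_space[OF TZ_measurable] measurable_space[OF coins_vec_measurable] by auto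
 have "(%\<xi>. g (TZ \<xi>)) \<in> borel_measurable ?A" "(%\<xi>. k (coinsv \<xi>)) \<in> borel_measurable ?B"
  using measurable_compose[OF measurable_vimage_algebra1[OF TZ] g]
   measurable_compose[OF measurable_vimage_algebra1[OF C] k] by auto
 then have sub: "sigma_sets (space M) {(%\<xi>. g (TZ \<xi>)) -` A \<inter> space M |A. A \<in> sets borel} \<subseteq> sets ?A"
  "sigma_sets (space M) {(%\<xi>. k (coinsv \<xi>)) -` A \<inter> space M |A. A \<in> sets borel} \<subseteq> sets ?B"
  using sets.sigma_sets_subset[of "{(%\<xi>. g (TZ \<xi>)) -` A \<inter> space M |A. A \<in> sets borel}" ?A]
   sets.sigma_sets_subset[of "{(%\<xi>. k (coinsv \<xi>)) -` A \<inter> space M |A. A \<in> sets borel}" ?B]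
   measurable_sets[of "%\<xi>. g (TZ \<xi>)" ?A borel] measurable_sets[of "%\<xi>. k (coinsv \<xi>)" ?B borel]
  unfolding space_vimage_algebra by blast+
 have "indep_set (sigma_sets (space M) {(%\<xi>. g (TZ \<xi>)) -` A \<inter> space M |A. A \<in> sets borel})
  (sigma_sets (space M) {(%\<xi>. k (coinsv \<xi>)) -` A \<inter> space M |A. A \<in> sets borel})"
  unfolding indep_set_def
  by (rule indep_sets_mono_sets[OF ind[unfolded indep_set_def]]) (use sub in \<open>auto split: bool.splits\<close>)
 then show ?thesis unfolding indep_var_eq by simp
qed

lemma integral_TZ_coins:
 assumes h [measurable]: "h \<in> borel_measurable LZ" and hb: "\<And>x. \<bar>h x\<bar> <= (B::real)" and c: "c \<in> coin_configs n"
 shows "expectation (%\<xi>. h (TZ \<xi>) * indicat_real {c} (coinsv \<xi>))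
  = cweight c * expectation (%\<xi>. h (TZ \<xi>))"
proof -
 have [measurable]: "indicat_real {c} \<in> borel_measurable (coins_space n)"
  using singleton_coins_space[OF c] by simp
 have "indep_var borel (h \<circ> TZ) borel (indicat_real {c} \<circ> coinsv)"
  unfolding comp_def by (rule indep_TZ_coins) measurable
 then have "expectation (%\<xi>. (h \<circ> TZ) \<xi> * (indicat_real {c} \<circ> coinsv) \<xi>)
   = expectation (h \<circ> TZ) * expectation (indicat_real {c} \<circ> coinsv)"
 proof (rule indep_var_lebesgue_integral)
  show "integrable M (h \<circ> TZ)"
   by (rule integrable_const_bound[where B = B]) (auto simp: hb)
  show "integrable M (indicat_real {c} \<circ> coinsv)"
   by (rule integrable_const_bound[where B = 1]) auto
 qed
 moreover have "expectation (indicat_real {c} \<circ> coinsv) = prob {\<xi> \<in> space M. coinsv \<xi> = c}"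
 proof -
  have "expectation (indicat_real {c} \<circ> coinsv) = expectation (indicat_real {\<xi> \<in> space M. coinsv \<xi> = c})"
   by (intro Bochner_Integration.integral_cong) (auto simp: indicator_def)
  then show ?thesis using coins_event[OF c] by simp
 qed
 ultimately show ?thesis by (simp add: prob_coins[OF c] mult.commute comp_def)
qed

text \<open>The factor in front of the tree indicators is measurable with respect to the data
  algebra, so the indicators may be replaced by their conditional mean. That mean depends on the
  coins alone, and the coins are independent of the latent variables and entries; the weight then
  splits off.\<close>

lemma integral_joint:
 assumes h [measurable]: "h \<in> borel_measurable LZ" and hb: "\<And>x. \<bar>h x\<bar> <= (B::real)"
  and c: "c \<in> coin_configs n"
 shows "expectation (%\<xi>. h (TZ \<xi>) * indicat_real {c} (coinsv \<xi>) * (\<Prod>u\<in>{1..n}. indicat_real {\<tau> u} (tree X u \<xi>)))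
  = jweight c \<tau> * expectation (%\<xi>. h (TZ \<xi>))"
proof -
 define D where "D \<xi> = (thetas \<xi>, Zs \<xi>, coinsv \<xi>)" for \<xi>
 define N where "N = latent_space n \<Otimes>\<^sub>M (Z_space n \<Otimes>\<^sub>M coins_space n)"
 have D [measurable]: "D \<in> measurable M N" unfolding D_def N_def by measurable
 define F where "F = vimage_algebra (space M) D N"
 have F_eq: "F = data_algebra n X" by (simp add: F_def data_algebra_def D_def[abs_def] N_def M_def)
 interpret F: finite_measure_subalgebra M F
  unfolding F_def by (rule finite_measure_subalgebra_vimage[OF prob_space_axioms D])
 have DF [measurable]: "D \<in> measurable F N"
  unfolding F_def using measurable_space[OF D] by (intro measurable_vimage_algebra1) auto
 define H where "H \<xi> = h (TZ \<xi>) * indicat_real {c} (coinsv \<xi>)" for \<xi>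
 define I where "I \<xi> = (\<Prod>u\<in>{1..n}. indicat_real {\<tau> u} (tree X u \<xi>))" for \<xi>
 have "(%\<xi>. indicat_real {\<tau> u} (tree X u \<xi>)) \<in> borel_measurable M" if "u \<in> {1..n}" for u
  by (rule measurable_compose[OF tree_measurable[OF that]]) simp
 then have Im [measurable]: "I \<in> borel_measurable M"
  unfolding I_def by (intro borel_measurable_prod) auto
 have HF: "H \<in> borel_measurable F"
 proof -
  have [measurable]: "indicat_real {c} \<in> borel_measurable (coins_space n)"
   using singleton_coins_space[OF c] by simp
  have "(%x. h (fst x, fst (snd x)) * indicat_real {c} (snd (snd x))) \<in> borel_measurable N"
   unfolding N_def by measurable
  from measurable_compose[OF DF this] show ?thesis
   by (simp add: D_def H_def[abs_def] TZ_def)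
 qed
 have HM: "H \<in> borel_measurable M"
  using HF F.subalg by (rule measurable_from_subalg[rotated])
 have Hb: "\<bar>H \<xi>\<bar> <= B" for \<xi>
  using hb[of "TZ \<xi>"] by (auto simp: H_def indicator_def)
 have I1: "\<bar>I \<xi>\<bar> <= 1" for \<xi>
  unfolding I_def abs_prod by (intro prod_le_1) auto
 have B0: "0 <= B" using hb[of undefined] by linarith
 have int: "integrable M (%\<xi>. H \<xi> * I \<xi>)"
 proof (rule integrable_const_bound[where B = "B * 1"])
  have "\<bar>H \<xi>\<bar> * \<bar>I \<xi>\<bar> <= B * 1" for \<xi>
   by (intro mult_mono Hb I1 B0) auto
  then show "AE \<xi> in M. norm (H \<xi> * I \<xi>) <= B * 1" by (simp add: abs_mult)
 qed (use HM in measurable)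
 have "expectation (%\<xi>. H \<xi> * I \<xi>) = expectation (%\<xi>. H \<xi> * real_cond_exp M F I \<xi>)"
  by (rule F.real_cond_exp_intg(2)[symmetric, OF int HF Im])
 also have "... = expectation (%\<xi>. H \<xi> * (\<Prod>u\<in>{1..n}. tree_weight (edges1 c) u (\<tau> u)))"
 proof (rule integral_cong_AE)
  have "AE \<xi> in M. real_cond_exp M F I \<xi>
    = (\<Prod>u\<in>{1..n}. tree_weight (edges1 (coinsv \<xi>)) u (\<tau> u))"
   using model unfolding icf_model_def tree_model_def Let_def F_eq I_def[abs_def] M_def
   by (simp add: Epart_eq tree_weight_def)
  then show "AE \<xi> in M. H \<xi> * real_cond_exp M F I \<xi>
    = H \<xi> * (\<Prod>u\<in>{1..n}. tree_weight (edges1 c) u (\<tau> u))"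
   by eventually_elim (auto simp: H_def indicator_def)
 qed (use HM in measurable)
 also have "... = expectation H * (\<Prod>u\<in>{1..n}. tree_weight (edges1 c) u (\<tau> u))"
  by simp
 also have "expectation H = cweight c * expectation (%\<xi>. h (TZ \<xi>))"
  unfolding H_def by (rule integral_TZ_coins[OF h hb c])
 finally show ?thesis by (simp add: H_def I_def joint_weight_def mult_ac)
qed

text \<open>Coins and trees have finitely many values, so measurability is required only for each
  fixed value of them.\<close>

lemma joint_event [measurable]:
 assumes P: "\<And>c \<tau>. c \<in> coin_configs n ==> \<tau> \<in> tree_configs n ==> Measurable.pred LZ (P c \<tau>)"
 shows "{\<xi> \<in> space M. P (coinsv \<xi>) (trees \<xi>) (TZ \<xi>)} \<in> sets M"
proof -
 have "{\<xi> \<in> space M. P (coinsv \<xi>) (trees \<xi>) (TZ \<xi>)} =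
  (\<Union>c\<in>coin_configs n. \<Union>\<tau>\<in>tree_configs n.
    {\<xi> \<in> space M. coinsv \<xi> = c} \<inter> {\<xi> \<in> space M. trees \<xi> = \<tau>} \<inter> {\<xi> \<in> space M. P c \<tau> (TZ \<xi>)})"
  using coinsv_in trees_in by auto
 also have "... \<in> sets M"
 proof (intro sets.finite_UN sets.Int coins_event trees_event finite_coin_configs finite_tree_configs)
  fix c \<tau> assume "c \<in> coin_configs n" "\<tau> \<in> tree_configs n"
  note P[OF this, measurable]
  show "{\<xi> \<in> space M. P c \<tau> (TZ \<xi>)} \<in> sets M" by measurable
 qed
 finally show ?thesis .
qed

text \<open>Disintegration over the finitely many values of coins and trees. It is the bridge to the
  probabilistic estimates: afterwards graph and trees are constants, and only the latent variables
  and entries are random.\<close>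

lemma prob_joint:
 assumes P: "\<And>c \<tau>. c \<in> coin_configs n ==> \<tau> \<in> tree_configs n ==> Measurable.pred LZ (P c \<tau>)"
 shows "prob {\<xi> \<in> space M. P (coinsv \<xi>) (trees \<xi>) (TZ \<xi>)} =
  (\<Sum>c\<in>coin_configs n. \<Sum>\<tau>\<in>tree_configs n. jweight c \<tau> * prob {\<xi> \<in> space M. P c \<tau> (TZ \<xi>)})"
proof -
 let ?S = "%c \<tau>. {\<xi> \<in> space M. coinsv \<xi> = c \<and> trees \<xi> = \<tau> \<and> P c \<tau> (TZ \<xi>)}"
 have S: "?S c \<tau> \<in> sets M" "prob (?S c \<tau>) = jweight c \<tau> * prob {\<xi> \<in> space M. P c \<tau> (TZ \<xi>)}"
  if c: "c \<in> coin_configs n" and t: "\<tau> \<in> tree_configs n" for c \<tau>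
 proof -
  note P[OF c t, measurable]
  have ev: "{\<xi> \<in> space M. P c \<tau> (TZ \<xi>)} \<in> sets M" by measurable
  have "?S c \<tau> = {\<xi> \<in> space M. coinsv \<xi> = c} \<inter> {\<xi> \<in> space M. trees \<xi> = \<tau>} \<inter> {\<xi> \<in> space M. P c \<tau> (TZ \<xi>)}"
   by auto
  then show S: "?S c \<tau> \<in> sets M" using ev coins_event[OF c] trees_event[of \<tau>] by auto
  have \<tau>e: "trees \<xi> = \<tau> \<longleftrightarrow> (\<forall>u\<in>{1..n}. tree X u \<xi> = \<tau> u)" for \<xi>
   using t by (auto simp: trees_def tree_configs_def PiE_iff extensional_def fun_eq_iff) 
  have "prob (?S c \<tau>) = expectation (indicat_real (?S c \<tau>))" using S by simp
  also have "... = expectation (%\<xi>. indicat_real {x. P c \<tau> x} (TZ \<xi>) * indicat_real {c} (coinsv \<xi>) *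
    (\<Prod>u\<in>{1..n}. indicat_real {\<tau> u} (tree X u \<xi>)))"
  proof (intro Bochner_Integration.integral_cong refl)
   fix \<xi> assume "\<xi> \<in> space M"
   then show "indicat_real (?S c \<tau>) \<xi> = indicat_real {x. P c \<tau> x} (TZ \<xi>) * indicat_real {c} (coinsv \<xi>) *
     (\<Prod>u\<in>{1..n}. indicat_real {\<tau> u} (tree X u \<xi>))"
    by (cases "trees \<xi> = \<tau>") (auto simp: \<tau>e indicator_def)
  qed
  also have "... = jweight c \<tau> * expectation (%\<xi>. indicat_real {x. P c \<tau> x} (TZ \<xi>))"
   by (rule integral_joint[OF _ _ c, where B = 1]) (auto simp: indicator_def)
  also have "expectation (%\<xi>. indicat_real {x. P c \<tau> x} (TZ \<xi>))
    = expectation (indicat_real {\<xi> \<in> space M. P c \<tau> (TZ \<xi>)})"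
   by (intro Bochner_Integration.integral_cong) (auto simp: indicator_def)
  also have "... = prob {\<xi> \<in> space M. P c \<tau> (TZ \<xi>)}" using ev by simp
  finally show "prob (?S c \<tau>) = jweight c \<tau> * prob {\<xi> \<in> space M. P c \<tau> (TZ \<xi>)}" .
 qed
 have "{\<xi> \<in> space M. P (coinsv \<xi>) (trees \<xi>) (TZ \<xi>)} =
  (\<Union>x\<in>coin_configs n \<times> tree_configs n. ?S (fst x) (snd x))"
  using coinsv_in trees_in by auto
 also have "prob ... = (\<Sum>x\<in>coin_configs n \<times> tree_configs n. prob (?S (fst x) (snd x)))"
  by (rule finite_measure_finite_Union) (auto simp: disjoint_family_on_def S)
 also have "... = (\<Sum>x\<in>coin_configs n \<times> tree_configs n.
   jweight (fst x) (snd x) * prob {\<xi> \<in> space M. P (fst x) (snd x) (TZ \<xi>)})"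
  by (intro sum.cong) (auto simp: S)
 finally show ?thesis by (simp add: sum.cartesian_product split_def)
qed

end

section \<open>Entries given the latent variables\<close>

context icf_instance
begin

abbreviation "latent_alg \<equiv> latent_algebra n X"

lemma latent_alg_subalgebra: "finite_measure_subalgebra M latent_alg"
 unfolding latent_algebra_def M_def[symmetric]
 by (rule finite_measure_subalgebra_vimage[OF prob_space_axioms theta_vec_measurable])

lemma theta_vec_latent: "thetas \<in> measurable latent_alg (latent_space n)"
 unfolding latent_algebra_def M_def[symmetric]
 using measurable_space[OF theta_vec_measurable] by (intro measurable_vimage_algebra1) auto

lemma theta_comp: "u \<in> {1..n} ==> (%\<theta>. \<theta> u) \<in> borel_measurable (latent_space n)"
 unfolding latent_space_def by simp

lemma Z_comp: "e \<in> pairs n ==> (%z. z e) \<in> borel_measurable (Z_space n)"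
 unfolding Z_space_def by (rule measurable_component_singleton)

definition Fv :: "nat \<times> nat => (nat => real) => real" where
 "Fv e \<theta> = f (\<theta> (fst e)) (\<theta> (snd e))"

lemma Fv_range: "Fv e \<theta> \<in> {0..1}"
 using f01 by (simp add: Fv_def)

lemma Fv_bounds [simp]: "0 <= Fv e \<theta>" "Fv e \<theta> <= 1" "\<bar>Fv e \<theta>\<bar> <= 1"
 using Fv_range[of e \<theta>] by auto

lemma Fv_latent [measurable]:
 assumes "e \<in> pairs n" shows "Fv e \<in> borel_measurable (latent_space n)"
proof -
 have m: "(%\<theta>. (\<theta> (fst e), \<theta> (snd e))) \<in> measurable (latent_space n) (borel \<Otimes>\<^sub>M borel)"
  using theta_comp assms by (intro measurable_Pair) auto
 show ?thesis using measurable_compose[OF m f_meas] by (simp add: Fv_def[abs_def])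
qed

lemma Fv_theta: "e \<in> pairs n ==> Fv e (thetas \<xi>) = Fmat f X \<xi> (fst e) (snd e)"
 by (auto simp: Fv_def Fmat_def theta_vec_def)

text \<open>The model provides conditional independence for indicator events and, separately, the
  conditional mean of a single entry. To combine them, the law of \<open>Zvar X e\<close> is
  weighted once with \<open>W\<close> and once with its conditional mean \<open>C\<close>. The two
  measures agree on Borel sets, hence have the same mean, and then the conditional mean of the entry
  can be inserted.\<close>

lemma integral_cond_mean:
 assumes A: "A \<in> sets (latent_space n)" and B: "\<And>e. e \<in> pairs n ==> B e \<in> sets borel"
  and e: "e \<in> pairs n"
 defines "Y \<equiv> %\<xi>. indicat_real A (thetas \<xi>) * (\<Prod>e'\<in>pairs n - {e}. indicat_real (B e') (Zvar X e' \<xi>))"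
 shows "expectation (%\<xi>. Y \<xi> * Zvar X e \<xi>) = expectation (%\<xi>. Y \<xi> * Fv e (thetas \<xi>))"
proof -
 interpret G: finite_measure_subalgebra M latent_alg by (rule latent_alg_subalgebra)
 let ?E = "real_cond_exp M latent_alg"
 define a where "a \<xi> = indicat_real A (thetas \<xi>)" for \<xi>
 define W where "W \<xi> = (\<Prod>e'\<in>pairs n - {e}. indicat_real (B e') (Zvar X e' \<xi>))" for \<xi>
 define R where "R \<xi> = (\<Prod>e'\<in>pairs n - {e}. ?E (%\<xi>. indicat_real (B e') (Zvar X e' \<xi>)) \<xi>)" for \<xi>
 have Y: "Y \<xi> = a \<xi> * W \<xi>" for \<xi> by (simp add: Y_def a_def W_def)
 have indm: "(%\<xi>. indicat_real S (Zvar X e' \<xi>)) \<in> borel_measurable M"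
  if "e' \<in> pairs n" "S \<in> sets borel" for e' S
  using measurable_compose[OF Z_measurable[OF that(1)], of "indicat_real S" borel] that(2) by simp
 have aG: "a \<in> borel_measurable latent_alg"
  using measurable_compose[OF theta_vec_latent, of "indicat_real A" borel] A
  by (simp add: a_def[abs_def])
 have aM [measurable]: "a \<in> borel_measurable M" by (rule measurable_from_subalg[OF G.subalg aG])
 have WM [measurable]: "W \<in> borel_measurable M"
  unfolding W_def using B by (intro borel_measurable_prod indm) auto
 have W01: "0 <= W \<xi>" "W \<xi> <= 1" for \<xi>
  unfolding W_def by (auto intro!: prod_nonneg prod_le_1)
 have a01: "0 <= a \<xi>" "a \<xi> <= 1" for \<xi> by (auto simp: a_def)
 have cond: "AE \<xi> in M. ?E (%\<xi>. indicat_real S (Zvar X e \<xi>) * W \<xi>) \<xi>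
   = ?E (%\<xi>. indicat_real S (Zvar X e \<xi>)) \<xi> * R \<xi>" if S: "S \<in> sets borel" for S
 proof -
  have "AE \<xi> in M. ?E (%\<xi>. \<Prod>e'\<in>pairs n. indicat_real ((B(e := S)) e') (Zvar X e' \<xi>)) \<xi>
   = (\<Prod>e'\<in>pairs n. ?E (%\<xi>. indicat_real ((B(e := S)) e') (Zvar X e' \<xi>)) \<xi>)"
   using latent B S unfolding latent_model_def Let_def M_def[symmetric] by simp
  moreover have "(%\<xi>. \<Prod>e'\<in>pairs n. indicat_real ((B(e := S)) e') (Zvar X e' \<xi>))
    = (%\<xi>. indicat_real S (Zvar X e \<xi>) * W \<xi>)"
   using e by (subst prod.remove[of _ e]) (auto simp: W_def intro!: prod.cong)
  moreover have "(\<Prod>e'\<in>pairs n. ?E (%\<xi>. indicat_real ((B(e := S)) e') (Zvar X e' \<xi>)) \<xi>)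
    = ?E (%\<xi>. indicat_real S (Zvar X e \<xi>)) \<xi> * R \<xi>" for \<xi>
   using e by (subst prod.remove[of _ e]) (auto simp: R_def intro!: prod.cong)
  ultimately show ?thesis by simp
 qed
 have int: "integrable M g" if "g \<in> borel_measurable M" "\<And>\<xi>. \<xi> \<in> space M ==> \<bar>g \<xi>\<bar> <= 1" for g :: "'a => real"
  using that by (intro integrable_const_bound[where B = 1]) auto
 have intW: "integrable M W" using W01 by (intro int) auto
 \<comment> \<open>The choice \<open>S = UNIV\<close> identifies the product \<open>R\<close> with
   the conditional mean of \<open>W\<close>.\<close>
 have EW: "AE \<xi> in M. ?E W \<xi> = R \<xi>"
 proof -
  have "AE \<xi> in M. ?E (%_. 1) \<xi> = 1"
   by (rule G.real_cond_exp_F_meas) auto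
  moreover have "AE \<xi> in M. ?E W \<xi> = ?E (%_. 1) \<xi> * R \<xi>" using cond[of UNIV] by simp
  ultimately show ?thesis by eventually_elim simp
 qed
 define C where "C = ?E W"
 have CG [measurable]: "C \<in> borel_measurable latent_alg" unfolding C_def by simp
 have CM [measurable]: "C \<in> borel_measurable M" by (rule measurable_from_subalg[OF G.subalg CG])
 have C0: "AE \<xi> in M. 0 <= C \<xi>" unfolding C_def using W01 by (intro G.real_cond_exp_pos) auto
 have C1: "AE \<xi> in M. C \<xi> <= 1"
 proof -
  have "AE \<xi> in M. ?E W \<xi> <= ?E (%_. 1) \<xi>" by (rule G.real_cond_exp_mono) (auto simp: W01 intW)
  moreover have "AE \<xi> in M. ?E (%_. 1) \<xi> = 1" by (rule G.real_cond_exp_F_meas) auto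
  ultimately show ?thesis unfolding C_def by eventually_elim simp
 qed
 have aC: "(%\<xi>. a \<xi> * C \<xi>) \<in> borel_measurable latent_alg" using aG CG by (rule borel_measurable_times)
 have aCb: "AE \<xi> in M. \<bar>a \<xi> * C \<xi>\<bar> <= 1"
  using C0 C1 by eventually_elim (use a01 in \<open>auto simp: abs_mult intro!: mult_le_one\<close>)
 have intaC: "integrable M (%\<xi>. a \<xi> * C \<xi> * g \<xi>)"
  if "g \<in> borel_measurable M" "\<And>\<xi>. \<xi> \<in> space M ==> \<bar>g \<xi>\<bar> <= 1" for g :: "'a => real"
 proof (rule integrable_const_bound[where B = 1])
  show "AE \<xi> in M. norm (a \<xi> * C \<xi> * g \<xi>) <= 1"
   using aCb AE_space
  proof eventually_elim
   case (elim \<xi>)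
   then have "\<bar>a \<xi> * C \<xi>\<bar> * \<bar>g \<xi>\<bar> <= 1" using that(2) by (intro mult_le_one) auto
   then show ?case by (simp add: abs_mult)
  qed
 qed (use that in measurable)
 have set_eq: "expectation (%\<xi>. a \<xi> * W \<xi> * indicat_real S (Zvar X e \<xi>))
   = expectation (%\<xi>. a \<xi> * C \<xi> * indicat_real S (Zvar X e \<xi>))" if S: "S \<in> sets borel" for S
 proof -
  note [measurable] = indm[OF e S]
  have "expectation (%\<xi>. a \<xi> * W \<xi> * indicat_real S (Zvar X e \<xi>))
    = expectation (%\<xi>. a \<xi> * (indicat_real S (Zvar X e \<xi>) * W \<xi>))" by (simp add: mult_ac)
  also have "... = expectation (%\<xi>. a \<xi> * ?E (%\<xi>. indicat_real S (Zvar X e \<xi>) * W \<xi>) \<xi>)"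
   using a01 W01 by (intro G.real_cond_exp_intg(2)[symmetric] aG int) (auto simp: abs_mult intro!: mult_le_one)
  also have "... = expectation (%\<xi>. a \<xi> * C \<xi> * ?E (%\<xi>. indicat_real S (Zvar X e \<xi>)) \<xi>)"
  proof (rule integral_cong_AE)
   show "AE \<xi> in M. a \<xi> * ?E (%\<xi>. indicat_real S (Zvar X e \<xi>) * W \<xi>) \<xi>
     = a \<xi> * C \<xi> * ?E (%\<xi>. indicat_real S (Zvar X e \<xi>)) \<xi>"
    using cond[OF S] EW by eventually_elim (simp add: C_def)
  qed auto
  also have "... = expectation (%\<xi>. a \<xi> * C \<xi> * indicat_real S (Zvar X e \<xi>))"
   by (intro G.real_cond_exp_intg(2) aC intaC) auto
  finally show ?thesis .
 qed
 note [measurable] = Z_measurable[OF e]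
 define \<nu>1 where "\<nu>1 = distr (density M (%\<xi>. ennreal (a \<xi> * W \<xi>))) borel (Zvar X e)"
 define \<nu>2 where "\<nu>2 = distr (density M (%\<xi>. ennreal (a \<xi> * C \<xi>))) borel (Zvar X e)"
 have aC0: "AE \<xi> in M. 0 <= a \<xi> * C \<xi>" using C0 by eventually_elim (simp add: a01)
 have em: "emeasure (distr (density M (%\<xi>. ennreal (g \<xi>))) borel (Zvar X e)) S
   = ennreal (expectation (%\<xi>. g \<xi> * indicat_real S (Zvar X e \<xi>)))"
  if S: "S \<in> sets borel" and g [measurable]: "g \<in> borel_measurable M"
   and g0: "AE \<xi> in M. 0 <= g \<xi>" and g1: "AE \<xi> in M. \<bar>g \<xi>\<bar> <= 1" for S and g :: "'a => real"
 proof -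
  have "emeasure (distr (density M (%\<xi>. ennreal (g \<xi>))) borel (Zvar X e)) S
   = (\<integral>\<^sup>+\<xi>. ennreal (g \<xi>) * indicator (Zvar X e -` S \<inter> space M) \<xi> \<partial>M)"
   using S by (subst emeasure_distr) (auto simp: emeasure_density)
  also have "... = (\<integral>\<^sup>+\<xi>. ennreal (g \<xi> * indicat_real S (Zvar X e \<xi>)) \<partial>M)"
   by (intro nn_integral_cong) (auto simp: indicator_def)
  also have "... = ennreal (expectation (%\<xi>. g \<xi> * indicat_real S (Zvar X e \<xi>)))"
  proof (rule nn_integral_eq_integral)
   show "integrable M (%\<xi>. g \<xi> * indicat_real S (Zvar X e \<xi>))"
   proof (rule integrable_const_bound[where B = 1])
    show "AE \<xi> in M. norm (g \<xi> * indicat_real S (Zvar X e \<xi>)) <= 1"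
     using g1 by eventually_elim (auto simp: indicator_def)
   qed (use indm[OF e S] in measurable)
   show "AE \<xi> in M. 0 <= g \<xi> * indicat_real S (Zvar X e \<xi>)"
    using g0 by eventually_elim auto
  qed
  finally show ?thesis .
 qed
 have "\<nu>1 = \<nu>2"
 proof (rule measure_eqI)
  fix S assume "S \<in> sets \<nu>1"
  then have S: "S \<in> sets borel" by (simp add: \<nu>1_def)
  have "AE \<xi> in M. \<bar>a \<xi> * W \<xi>\<bar> <= 1" using a01 W01 by (auto simp: abs_mult intro!: mult_le_one)
  then show "emeasure \<nu>1 S = emeasure \<nu>2 S"
   unfolding \<nu>1_def \<nu>2_def using a01 W01 aC0 aCb S by (subst (1 2) em) (auto simp: set_eq)
 qed (simp add: \<nu>1_def \<nu>2_def)
 then have "(\<integral>x. x \<partial>\<nu>1) = (\<integral>x. x \<partial>\<nu>2)" by simp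
 moreover have "(\<integral>x. x \<partial>\<nu>1) = expectation (%\<xi>. a \<xi> * W \<xi> * Zvar X e \<xi>)"
  unfolding \<nu>1_def using a01 W01 by (subst integral_distr) (auto simp: integral_density)
 moreover have "(\<integral>x. x \<partial>\<nu>2) = expectation (%\<xi>. a \<xi> * C \<xi> * Zvar X e \<xi>)"
  unfolding \<nu>2_def using aC0 by (subst integral_distr) (auto simp: integral_density)
 ultimately have 1: "expectation (%\<xi>. a \<xi> * W \<xi> * Zvar X e \<xi>) = expectation (%\<xi>. a \<xi> * C \<xi> * Zvar X e \<xi>)"
  by simp
 have Zb: "\<xi> \<in> space M ==> \<bar>Zvar X e \<xi>\<bar> <= 1" for \<xi> using Z_range[OF e] by force
 have "expectation (%\<xi>. a \<xi> * C \<xi> * Zvar X e \<xi>) = expectation (%\<xi>. a \<xi> * C \<xi> * ?E (Zvar X e) \<xi>)"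
  using Zb by (intro G.real_cond_exp_intg(2)[symmetric] aC intaC) auto
 also have "... = expectation (%\<xi>. a \<xi> * C \<xi> * Fv e (thetas \<xi>))"
 proof (rule integral_cong_AE)
  obtain u v where uv: "e = (u, v)" "u \<in> {1..n}" "v \<in> {1..n}" using e by blast
  have "AE \<xi> in M. ?E (Zvar X e) \<xi> = Fv e (thetas \<xi>)"
   using latent uv unfolding latent_model_def Let_def M_def[symmetric] uv(1)
   by (simp add: Fv_theta)
  then show "AE \<xi> in M. a \<xi> * C \<xi> * ?E (Zvar X e) \<xi> = a \<xi> * C \<xi> * Fv e (thetas \<xi>)"
   by eventually_elim simp
 qed (use e in auto)
 also have "... = expectation (%\<xi>. (a \<xi> * Fv e (thetas \<xi>)) * ?E W \<xi>)"
  by (simp add: C_def mult_ac)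
 \<comment> \<open>\<open>Fv e\<close> is a function of the latent variables, so the conditioning of
   \<open>W\<close> can be undone.\<close>
 also have "... = expectation (%\<xi>. (a \<xi> * Fv e (thetas \<xi>)) * W \<xi>)"
 proof (rule G.real_cond_exp_intg(2))
  show "(%\<xi>. a \<xi> * Fv e (thetas \<xi>)) \<in> borel_measurable latent_alg"
   using aG measurable_compose[OF theta_vec_latent Fv_latent[OF e]] by (rule borel_measurable_times)
  show "integrable M (%\<xi>. a \<xi> * Fv e (thetas \<xi>) * W \<xi>)"
   using a01 W01 e by (intro int) (auto simp: abs_mult intro!: mult_le_one)
 qed auto
 finally show ?thesis using 1 by (simp add: Y mult_ac)
qed

text \<open>These rectangles are an intersection-stable generator, on which the two measures in
  \<open>integral_Z_mean\<close> are compared.\<close>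

lemma sets_LZ: "sets LZ = sigma_sets (space LZ)
  {A \<times> PiE (pairs n) B |A B. A \<in> sets (latent_space n) \<and> B \<in> pairs n \<rightarrow> sets borel}"
proof -
 let ?Eb = "prod_algebra (pairs n) (%_. borel :: real measure)"
 have Eb: "?Eb = {PiE (pairs n) B |B. B \<in> pairs n \<rightarrow> sets borel}"
  by (subst prod_algebra_eq_finite) auto
 have "sets LZ = sets (sigma (space (latent_space n) \<times> space (Z_space n))
   {a \<times> b |a b. a \<in> sets (latent_space n) \<and> b \<in> ?Eb})"
 proof (rule sets_pair_eq[where Ca = "{space (latent_space n)}" and Cb = "{space (Z_space n)}"])
  show "sets (latent_space n) = sigma_sets (space (latent_space n)) (sets (latent_space n))"
   by (simp add: sets.sigma_sets_eq)
  show "?Eb \<subseteq> Pow (space (Z_space n))"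
   using prod_algebra_sets_into_space unfolding Z_space_def space_PiM .
  show "sets (Z_space n) = sigma_sets (space (Z_space n)) ?Eb"
   by (simp add: Z_space_def sets_PiM space_PiM)
  show "{space (Z_space n)} \<subseteq> ?Eb" 
   unfolding Eb by (auto simp: Z_space_def space_PiM simp del: One_nat_def intro!: exI[of _ "%_. UNIV"])
 qed (auto simp: sets.space_closed dest: sets.sets_into_space)
 also have "... = sigma_sets (space LZ) {a \<times> b |a b. a \<in> sets (latent_space n) \<and> b \<in> ?Eb}"
 proof -
  have "{a \<times> b |a b. a \<in> sets (latent_space n) \<and> b \<in> ?Eb} \<subseteq> Pow (space (latent_space n) \<times> space (Z_space n))"
   using prod_algebra_sets_into_space[of "pairs n" "%_. borel :: real measure"]
   by (auto simp: Z_space_def space_PiM dest: sets.sets_into_space subsetD)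
  then show ?thesis by (simp add: space_pair_measure)
 qed
 finally show ?thesis unfolding Eb by (auto intro!: arg_cong[where f = "sigma_sets (space LZ)"])
qed

text \<open>Erasing an entry is the way to express that a function does not depend on it.\<close>

definition zero_at :: "nat \<times> nat => (nat => real) \<times> (nat \<times> nat => real) => (nat => real) \<times> (nat \<times> nat => real)" where
 "zero_at e x = (fst x, (snd x)(e := 0))"

lemma upd_measurable: "e \<in> pairs n ==> (%x. (fst x, (snd x)(e := c))) \<in> measurable LZ LZ"
 unfolding Z_space_def
 by (intro measurable_Pair measurable_fst measurable_fun_upd[where J = "pairs n"]) (auto simp: insert_absorb)

text \<open>Extension of \<open>integral_cond_mean\<close> from rectangles to bounded functions.
  Both sides are integrals of \<open>H\<close> against the law of the data with entry
  \<open>e\<close> erased, weighted by the entry or by its conditional mean, and the two weighted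
  laws agree on a generator.\<close>

theorem integral_Z_mean:
 assumes e: "e \<in> pairs n" and H [measurable]: "H \<in> borel_measurable LZ" and Hb: "\<And>x. \<bar>H x\<bar> <= (B::real)"
 shows "expectation (%\<xi>. H (zero_at e (TZ \<xi>)) * Zvar X e \<xi>)
   = expectation (%\<xi>. H (zero_at e (TZ \<xi>)) * Fv e (thetas \<xi>))"
proof -
 define Y where "Y \<xi> = zero_at e (TZ \<xi>)" for \<xi>
 have Ym [measurable]: "Y \<in> measurable M LZ"
  unfolding Y_def zero_at_def[abs_def] using measurable_compose[OF TZ_measurable upd_measurable[OF e, of 0]] .
 note [measurable] = Z_measurable[OF e] Fv_latent[OF e]
 define \<nu>1 where "\<nu>1 = distr (density M (%\<xi>. ennreal (Zvar X e \<xi>))) LZ Y"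
 define \<nu>2 where "\<nu>2 = distr (density M (%\<xi>. ennreal (Fv e (thetas \<xi>)))) LZ Y"
 have Z01: "\<xi> \<in> space M ==> 0 <= Zvar X e \<xi> \<and> Zvar X e \<xi> <= 1" for \<xi> using Z_range[OF e] by force
 have em: "emeasure (distr (density M (%\<xi>. ennreal (g \<xi>))) LZ Y) S
   = ennreal (expectation (%\<xi>. indicat_real S (Y \<xi>) * g \<xi>))"
  if S: "S \<in> sets LZ" and g [measurable]: "g \<in> borel_measurable M"
   and g01: "\<And>\<xi>. \<xi> \<in> space M ==> 0 <= g \<xi> \<and> g \<xi> <= 1" for S and g :: "'a => real"
 proof -
  have [measurable]: "indicat_real S \<in> borel_measurable LZ" using S by simp
  have "emeasure (distr (density M (%\<xi>. ennreal (g \<xi>))) LZ Y) S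
   = (\<integral>\<^sup>+\<xi>. ennreal (g \<xi>) * indicator (Y -` S \<inter> space M) \<xi> \<partial>M)"
   using S by (subst emeasure_distr) (auto simp: emeasure_density)
  also have "... = (\<integral>\<^sup>+\<xi>. ennreal (indicat_real S (Y \<xi>) * g \<xi>) \<partial>M)"
   by (intro nn_integral_cong) (auto simp: indicator_def)
  also have "... = ennreal (expectation (%\<xi>. indicat_real S (Y \<xi>) * g \<xi>))"
  proof (rule nn_integral_eq_integral)
   show "integrable M (%\<xi>. indicat_real S (Y \<xi>) * g \<xi>)"
   proof (rule integrable_const_bound[where B = 1])
    show "AE \<xi> in M. norm (indicat_real S (Y \<xi>) * g \<xi>) <= 1"
     using g01 by (auto simp: indicator_def)
   qed measurable
  qed (use g01 in auto)
  finally show ?thesis .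
 qed
 let ?Z = "%\<xi>. Zvar X e \<xi>" and ?F = "%\<xi>. Fv e (thetas \<xi>)"
 have "\<nu>1 = \<nu>2"
 proof (rule measure_eqI_generator_eq[where \<Omega> = "space LZ" and A = "%_. space LZ"
    and E = "{A \<times> PiE (pairs n) B |A B. A \<in> sets (latent_space n) \<and> B \<in> pairs n \<rightarrow> sets borel}"])
  let ?E = "{A \<times> PiE (pairs n) B |A B. A \<in> sets (latent_space n) \<and> B \<in> pairs n \<rightarrow> sets (borel :: real measure)}"
  show "Int_stable ?E"
  proof (rule Int_stableI)
   fix a b assume "a \<in> ?E" "b \<in> ?E"
   then obtain A B A' B' where ab: "a = A \<times> PiE (pairs n) B" "b = A' \<times> PiE (pairs n) B'"
    and s: "A \<in> sets (latent_space n)" "A' \<in> sets (latent_space n)"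
     "B \<in> pairs n \<rightarrow> sets borel" "B' \<in> pairs n \<rightarrow> sets borel" by blast
   have "a \<inter> b = (A \<inter> A') \<times> PiE (pairs n) (%e. B e \<inter> B' e)"
    unfolding ab by (auto simp: PiE_iff)
   moreover have "A \<inter> A' \<in> sets (latent_space n)" "(%e. B e \<inter> B' e) \<in> pairs n \<rightarrow> sets borel"
    using s by auto
   ultimately show "a \<inter> b \<in> ?E" by blast
  qed
  show "?E \<subseteq> Pow (space LZ)"
   by (auto simp: Z_space_def space_PiM space_pair_measure PiE_iff dest: sets.sets_into_space subsetD)
  have sp: "space LZ = space (latent_space n) \<times> PiE (pairs n) (%_. UNIV)"
   by (simp add: space_pair_measure Z_space_def space_PiM)
  show "range (%_. space LZ) \<subseteq> ?E"
  proof -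
   have "space (latent_space n) \<in> sets (latent_space n)" "(%_. UNIV) \<in> pairs n \<rightarrow> sets (borel :: real measure)"
    by auto
   then have "space LZ \<in> ?E" unfolding sp mem_Collect_eq by (intro exI conjI) (rule refl)
   then show ?thesis by blast
  qed
  show "emeasure \<nu>1 (space LZ) \<noteq> \<infinity>" for i :: nat
   unfolding \<nu>1_def by (subst em) (use Z01 in auto)
  show "sets \<nu>1 = sigma_sets (space LZ) ?E" "sets \<nu>2 = sigma_sets (space LZ) ?E"
   unfolding \<nu>1_def \<nu>2_def sets_distr by (fact sets_LZ)+
  fix S assume "S \<in> ?E"
  then obtain A B where S: "S = A \<times> PiE (pairs n) B"
   and A: "A \<in> sets (latent_space n)" and B: "\<And>e. e \<in> pairs n ==> B e \<in> sets borel" by blast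
  have "S \<in> sets LZ" using \<open>S \<in> ?E\<close> unfolding sets_LZ by (rule sigma_sets.Basic)
  \<comment> \<open>With the entry erased, its side of the rectangle contributes only the constant
    \<open>indicat_real (B e) 0\<close>.\<close>
  have ind: "indicat_real S (Y \<xi>) = indicat_real (B e) 0 * (indicat_real A (thetas \<xi>)
    * (\<Prod>e'\<in>pairs n - {e}. indicat_real (B e') (Zvar X e' \<xi>)))" for \<xi>
  proof -
   have "(\<Prod>e'\<in>pairs n - {e}. indicat_real (B e') (Zvar X e' \<xi>))
     = (if \<forall>e'\<in>pairs n - {e}. Zvar X e' \<xi> \<in> B e' then 1 else 0)"
    by (auto simp: indicator_def prod_zero_iff)
   moreover have "Y \<xi> \<in> S \<longleftrightarrow> thetas \<xi> \<in> A \<and> 0 \<in> B e \<and> (\<forall>e'\<in>pairs n - {e}. Zvar X e' \<xi> \<in> B e')"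
    using e by (auto simp: S Y_def zero_at_def TZ_def Z_vec_def PiE_iff extensional_def split: if_splits)
   ultimately show ?thesis by (auto simp: indicator_def)
  qed
  have "expectation (%\<xi>. indicat_real S (Y \<xi>) * ?Z \<xi>) = expectation (%\<xi>. indicat_real S (Y \<xi>) * ?F \<xi>)"
   unfolding ind mult.assoc[of "indicat_real (B e) 0"] integral_mult_right_zero
   using integral_cond_mean[OF A B e] by simp
  then show "emeasure \<nu>1 S = emeasure \<nu>2 S"
   unfolding \<nu>1_def \<nu>2_def using \<open>S \<in> sets LZ\<close> Z01
   by (subst (1 2) em) auto
 qed auto
 then have "(\<integral>x. H x \<partial>\<nu>1) = (\<integral>x. H x \<partial>\<nu>2)" by simp
 moreover have "(\<integral>x. H x \<partial>\<nu>1) = expectation (%\<xi>. H (Y \<xi>) * ?Z \<xi>)"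
  unfolding \<nu>1_def using Z01 by (subst integral_distr) (auto simp: integral_density mult.commute)
 moreover have "(\<integral>x. H x \<partial>\<nu>2) = expectation (%\<xi>. H (Y \<xi>) * ?F \<xi>)"
  unfolding \<nu>2_def by (subst integral_distr) (auto simp: integral_density mult.commute)
 ultimately show ?thesis by (simp add: Y_def)
qed

end

section \<open>Exponential moments over the latent variables and the entries\<close>

lemma exp_le_quadratic:
 fixes v :: real assumes "\<bar>v\<bar> <= 1" shows "exp v <= 1 + v + v\<^sup>2"
proof (cases "0 <= v")
 case True
 then show ?thesis using assms exp_bound by simp
next
 case False
 define w where "w = - v"
 have w: "0 < w" "w <= 1" using False assms by (auto simp: w_def)
 \<comment> \<open>The product equals \<open>1 + w ^ 3\<close>.\<close>
 have "1 <= (1 - w + w\<^sup>2) * (1 + w)" using w by (auto simp: algebra_simps power2_eq_square)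
 also have "... <= (1 - w + w\<^sup>2) * exp w"
  using w exp_ge_add_one_self[of w] by (intro mult_left_mono) auto
 finally have "1 / exp w <= 1 - w + w\<^sup>2" by (simp add: divide_simps)
 then show ?thesis by (simp add: w_def exp_minus field_simps)
qed

abbreviation "unif01 \<equiv> uniform_measure lborel {0..1::real}"

lemma prob_space_unif01: "prob_space unif01"
 by (rule prob_space_uniform_measure) auto

lemma exp_convex_segment:
 fixes a b s :: real assumes "0 <= s" "s <= 1"
 shows "exp (s * a + (1 - s) * b) <= s * exp a + (1 - s) * exp b"
 using convex_onD[OF exp_convex, of "1 - s" a b] assms by (simp add: algebra_simps)

definition overwrite :: "edges => edges => (nat \<times> nat => real) => nat \<times> nat => real" where
 "overwrite W b z = (%e. if e \<in> W then of_bool (e \<in> b) else z e)"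

lemma overwrite_empty [simp]: "overwrite {} b z = z"
 by (simp add: overwrite_def)

lemma sum_Pow_insert:
 fixes h :: "'b set => real"
 assumes "finite W" "e \<notin> W"
 shows "(\<Sum>b\<in>Pow (insert e W). h b) = (\<Sum>b\<in>Pow W. h (insert e b) + h b)"
proof -
 have inj: "inj_on (insert e) (Pow W)" using assms(2) by (auto simp: inj_on_def)
 have "(\<Sum>b\<in>Pow (insert e W). h b) = (\<Sum>b\<in>Pow W. h b) + (\<Sum>b\<in>insert e ` Pow W. h b)"
  unfolding Pow_insert using assms by (subst sum.union_disjoint) auto
 also have "(\<Sum>b\<in>insert e ` Pow W. h b) = (\<Sum>b\<in>Pow W. h (insert e b))"
  using inj by (simp add: sum.reindex)
 finally show ?thesis by (simp add: sum.distrib add.commute)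
qed

context icf_instance
begin

text \<open>Contains all values of \<open>TZ\<close>. Bounds are available only here, whereas
  measurability is stated on the whole of \<open>LZ\<close>.\<close>

definition Dom :: "((nat => real) \<times> (nat \<times> nat => real)) set" where
 "Dom = {x \<in> space LZ. (\<forall>u\<in>{1..n}. fst x u \<in> {0..1}) \<and> (\<forall>e\<in>pairs n. snd x e \<in> {0..1})}"

lemma TZ_Dom: "\<xi> \<in> space M ==> TZ \<xi> \<in> Dom"
 using measurable_space[OF TZ_measurable] theta_range Z_range
 by (auto simp: Dom_def TZ_def theta_vec_def Z_vec_def)

definition put :: "nat \<times> nat => real => (nat => real) \<times> (nat \<times> nat => real) => (nat => real) \<times> (nat \<times> nat => real)" where
 "put e c x = (fst x, (snd x)(e := c))"

lemma put_measurable [measurable]: "e \<in> pairs n ==> put e c \<in> measurable LZ LZ"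
 unfolding put_def[abs_def] by (rule upd_measurable)

lemma put_Dom: "e \<in> pairs n ==> x \<in> Dom ==> c \<in> {0..1} ==> put e c x \<in> Dom"
 using measurable_space[OF put_measurable, of e x c] by (auto simp: Dom_def put_def)

lemma put_put [simp]: "put e c (put e d x) = put e c x"
 by (simp add: put_def)

lemma put_commute: "e \<noteq> e' ==> put e c (put e' d x) = put e' d (put e c x)"
 by (simp add: put_def fun_upd_twist)

lemma fst_put [simp]: "fst (put e c x) = fst x"
 by (simp add: put_def)

lemma snd_put [simp]: "snd (put e c x) e' = (if e' = e then c else snd x e')"
 by (simp add: put_def)

lemma fst_TZ [simp]: "fst (TZ \<xi>) = thetas \<xi>"
 by (simp add: TZ_def)

lemma snd_TZ: "e \<in> pairs n ==> snd (TZ \<xi>) e = Zvar X e \<xi>"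
 by (auto simp: TZ_def Z_vec_def)

lemma Fv_fst [measurable]: "e \<in> pairs n ==> (%x. Fv e (fst x)) \<in> borel_measurable LZ"
 by measurable

lemma snd_comp [measurable]: "e \<in> pairs n ==> (%x. snd x e) \<in> borel_measurable LZ"
 using Z_comp by (rule measurable_compose[OF measurable_snd])

lemma fst_comp [measurable]: "u \<in> {1..n} ==> (%x. fst x u) \<in> borel_measurable LZ"
 using theta_comp by (rule measurable_compose[OF measurable_fst])

lemma integrable_TZ:
 assumes "H \<in> borel_measurable LZ" and Hb: "\<And>x. x \<in> Dom ==> \<bar>H x\<bar> <= (B::real)"
 shows "integrable M (%\<xi>. H (TZ \<xi>))"
 using assms TZ_Dom by (intro integrable_const_bound[where B = B]) auto

lemma integral_Z_mean':
 assumes e: "e \<in> pairs n" and H [measurable]: "H \<in> borel_measurable LZ"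
  and Hb: "\<And>x. x \<in> Dom ==> \<bar>H x\<bar> <= (B::real)"
  and H0: "\<And>x c. H (put e c x) = H x"
 shows "expectation (%\<xi>. H (TZ \<xi>) * snd (TZ \<xi>) e) = expectation (%\<xi>. H (TZ \<xi>) * Fv e (fst (TZ \<xi>)))"
proof -
 \<comment> \<open>Truncation gives a bound at every point and changes nothing on
   \<open>Dom\<close>.\<close>
 define G where "G x = max (- B) (min B (H x))" for x
 have G0: "G (put e c x) = G x" for c x by (simp add: G_def H0)
 have GH: "G (TZ \<xi>) = H (TZ \<xi>)" if "\<xi> \<in> space M" for \<xi>
  using Hb[OF TZ_Dom[OF that]] by (auto simp: G_def)
 have Gb: "\<bar>G x\<bar> <= \<bar>B\<bar>" for x by (auto simp: G_def)
 have [measurable]: "G \<in> borel_measurable LZ" unfolding G_def[abs_def] by measurable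
 have "expectation (%\<xi>. G (zero_at e (TZ \<xi>)) * Zvar X e \<xi>)
   = expectation (%\<xi>. G (zero_at e (TZ \<xi>)) * Fv e (thetas \<xi>))"
  by (rule integral_Z_mean[OF e _ Gb]) measurable
 moreover have "zero_at e x = put e 0 x" for x by (simp add: zero_at_def put_def)
 ultimately have eq: "expectation (%\<xi>. G (TZ \<xi>) * Zvar X e \<xi>) = expectation (%\<xi>. G (TZ \<xi>) * Fv e (thetas \<xi>))"
  by (simp add: G0)
 have "expectation (%\<xi>. H (TZ \<xi>) * snd (TZ \<xi>) e) = expectation (%\<xi>. G (TZ \<xi>) * Zvar X e \<xi>)"
  using e by (intro Bochner_Integration.integral_cong refl) (simp add: GH snd_TZ)
 also note eq
 also have "expectation (%\<xi>. G (TZ \<xi>) * Fv e (thetas \<xi>)) = expectation (%\<xi>. H (TZ \<xi>) * Fv e (fst (TZ \<xi>)))"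
  by (intro Bochner_Integration.integral_cong refl) (simp add: GH)
 finally show ?thesis .
qed

text \<open>The mean of the function after entry \<open>e\<close> has been resampled as 1 or 0 with
  its given conditional mean.\<close>

definition avg :: "nat \<times> nat => ((nat => real) \<times> (nat \<times> nat => real) => real) => (nat => real) \<times> (nat \<times> nat => real) => real" where
 "avg e \<Psi> x = Fv e (fst x) * \<Psi> (put e 1 x) + (1 - Fv e (fst x)) * \<Psi> (put e 0 x)"

definition convex_at :: "nat \<times> nat => ((nat => real) \<times> (nat \<times> nat => real) => real) => bool" where
 "convex_at e \<Psi> \<longleftrightarrow> (\<forall>x\<in>Dom. \<Psi> x <= snd x e * \<Psi> (put e 1 x) + (1 - snd x e) * \<Psi> (put e 0 x))"

lemma put_compose [measurable]:
 "e \<in> pairs n ==> \<Psi> \<in> borel_measurable LZ ==> (%x. \<Psi> (put e c x)) \<in> borel_measurable LZ"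
 by (rule measurable_compose[OF put_measurable])

lemma avg_measurable [measurable]: "e \<in> pairs n ==> \<Psi> \<in> borel_measurable LZ ==> avg e \<Psi> \<in> borel_measurable LZ"
 unfolding avg_def[abs_def] using put_compose[of e \<Psi> 1] put_compose[of e \<Psi> 0] Fv_fst[of e]
 by (intro borel_measurable_add borel_measurable_times borel_measurable_diff borel_measurable_const)

lemma avg_bound:
 assumes "e \<in> pairs n" "\<And>x. x \<in> Dom ==> \<bar>\<Psi> x\<bar> <= B" "x \<in> Dom"
 shows "\<bar>avg e \<Psi> x\<bar> <= B"
proof -
 have "\<bar>avg e \<Psi> x\<bar> <= \<bar>Fv e (fst x) * \<Psi> (put e 1 x)\<bar> + \<bar>(1 - Fv e (fst x)) * \<Psi> (put e 0 x)\<bar>"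
  unfolding avg_def by (rule abs_triangle_ineq)
 also have "... <= Fv e (fst x) * B + (1 - Fv e (fst x)) * B"
  using assms(2)[OF put_Dom[OF assms(1,3), of 1]] assms(2)[OF put_Dom[OF assms(1,3), of 0]]
  by (intro add_mono) (simp_all add: abs_mult mult_left_mono)
 finally show ?thesis by (simp add: algebra_simps)
qed

text \<open>Only the conditional means of the entries are known, so a function that is convex in an entry
 is compared with the two-point distribution on 0 and 1 that has the same mean.\<close>

lemma expectation_le_avg:
 assumes e: "e \<in> pairs n" and m [measurable]: "\<Psi> \<in> borel_measurable LZ"
  and b: "\<And>x. x \<in> Dom ==> \<bar>\<Psi> x\<bar> <= (B::real)" and c: "convex_at e \<Psi>"
 shows "expectation (%\<xi>. \<Psi> (TZ \<xi>)) <= expectation (%\<xi>. avg e \<Psi> (TZ \<xi>))"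
proof -
 define H where "H x = \<Psi> (put e 1 x) - \<Psi> (put e 0 x)" for x
 have Hm [measurable]: "H \<in> borel_measurable LZ" unfolding H_def[abs_def] using e by measurable
 have Hb: "\<bar>H x\<bar> <= 2 * B" if "x \<in> Dom" for x
  using b[OF put_Dom[OF e that, of 1]] b[OF put_Dom[OF e that, of 0]] by (auto simp: H_def)
 have P0m [measurable]: "(%x. \<Psi> (put e 0 x)) \<in> borel_measurable LZ" using e by measurable
 have P0b: "\<bar>\<Psi> (put e 0 x)\<bar> <= B" if "x \<in> Dom" for x using b[OF put_Dom[OF e that]] by simp
 have i0: "integrable M (%\<xi>. \<Psi> (put e 0 (TZ \<xi>)))" by (rule integrable_TZ[OF P0m P0b])
 have z01: "x \<in> Dom ==> \<bar>snd x e\<bar> <= 1" for x using e by (force simp: Dom_def)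
 have Hb2: "\<bar>H x * s\<bar> <= 2 * B" if "x \<in> Dom" "\<bar>s\<bar> <= 1" for x s
  using mult_mono[OF Hb[OF that(1)] that(2)] order_trans[OF abs_ge_zero Hb[OF that(1)]]
  by (simp add: abs_mult)
 have i1: "integrable M (%\<xi>. H (TZ \<xi>) * snd (TZ \<xi>) e)"
  by (rule integrable_TZ[OF _ Hb2[OF _ z01]]) (use e in measurable)
 have i2: "integrable M (%\<xi>. H (TZ \<xi>) * Fv e (fst (TZ \<xi>)))"
  by (rule integrable_TZ[OF _ Hb2]) (use e in measurable)
 have "expectation (%\<xi>. \<Psi> (TZ \<xi>)) <= expectation (%\<xi>. H (TZ \<xi>) * snd (TZ \<xi>) e + \<Psi> (put e 0 (TZ \<xi>)))"
 proof (rule integral_mono)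
  show "integrable M (%\<xi>. \<Psi> (TZ \<xi>))" by (rule integrable_TZ[OF m b])
  show "integrable M (%\<xi>. H (TZ \<xi>) * snd (TZ \<xi>) e + \<Psi> (put e 0 (TZ \<xi>)))"
   using i0 i1 by simp
  fix \<xi> assume "\<xi> \<in> space M"
  then show "\<Psi> (TZ \<xi>) <= H (TZ \<xi>) * snd (TZ \<xi>) e + \<Psi> (put e 0 (TZ \<xi>))"
   using c TZ_Dom[of \<xi>] by (auto simp: convex_at_def H_def algebra_simps)
 qed
 also have "... = expectation (%\<xi>. H (TZ \<xi>) * Fv e (fst (TZ \<xi>)) + \<Psi> (put e 0 (TZ \<xi>)))"
  using i0 i1 i2 integral_Z_mean'[OF e Hm Hb] by (simp add: H_def)
 also have "... = expectation (%\<xi>. avg e \<Psi> (TZ \<xi>))"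
  by (intro Bochner_Integration.integral_cong refl) (simp add: avg_def H_def algebra_simps)
 finally show ?thesis .
qed

text \<open>The law of independent 0-1 entries on \<open>W\<close> with means \<open>Fv\<close>; the
  set \<open>b\<close> records the ones.\<close>

definition two_point_weight :: "edges => edges => (nat => real) => real" where
 "two_point_weight W b \<theta> = (\<Prod>e\<in>b. Fv e \<theta>) * (\<Prod>e\<in>W - b. 1 - Fv e \<theta>)"

lemma two_point_weight_nonneg [simp]: "0 <= two_point_weight W b \<theta>"
 unfolding two_point_weight_def by (intro mult_nonneg_nonneg prod_nonneg) auto

lemma sum_two_point_weight: "finite W ==> (\<Sum>b\<in>Pow W. two_point_weight W b \<theta>) = 1"
 unfolding two_point_weight_def by (subst prod_add[symmetric]) auto

lemma two_point_weight_le_1: "finite W ==> b \<subseteq> W ==> two_point_weight W b \<theta> <= 1"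
 unfolding sum_two_point_weight[of W \<theta>, symmetric] by (rule member_le_sum) auto

lemma two_point_weight_measurable [measurable]:
 assumes "W \<subseteq> pairs n" "b \<subseteq> W"
 shows "two_point_weight W b \<in> borel_measurable (latent_space n)"
 unfolding two_point_weight_def[abs_def] using assms
 by (intro borel_measurable_times borel_measurable_prod borel_measurable_diff) auto

definition two_point_avg :: "edges => ((nat => real) \<times> (nat \<times> nat => real) => real) => (nat => real) \<times> (nat \<times> nat => real) => real" where
 "two_point_avg W \<Psi> x = (\<Sum>b\<in>Pow W. two_point_weight W b (fst x) * \<Psi> (fst x, overwrite W b (snd x)))"

lemma two_point_avg_insert:
 assumes "finite W" "e \<notin> W"
 shows "two_point_avg (insert e W) \<Psi> x = two_point_avg W (avg e \<Psi>) x"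
proof -
 have 1: "two_point_weight (insert e W) (insert e b) \<theta> = Fv e \<theta> * two_point_weight W b \<theta>"
  "two_point_weight (insert e W) b \<theta> = (1 - Fv e \<theta>) * two_point_weight W b \<theta>" if "b \<subseteq> W" for b \<theta>
 proof -
  have "finite b" "e \<notin> b" "insert e W - insert e b = W - b" "insert e W - b = insert e (W - b)"
   using that assms by (auto intro: finite_subset)
  then show "two_point_weight (insert e W) (insert e b) \<theta> = Fv e \<theta> * two_point_weight W b \<theta>"
   "two_point_weight (insert e W) b \<theta> = (1 - Fv e \<theta>) * two_point_weight W b \<theta>"
   using assms by (auto simp: two_point_weight_def mult_ac)
 qed
 have 2: "overwrite (insert e W) (insert e b) z = (overwrite W b z)(e := 1)"
  "overwrite (insert e W) b z = (overwrite W b z)(e := 0)" if "b \<subseteq> W" for b z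
  using that assms by (auto simp: overwrite_def fun_eq_iff)
 show ?thesis
  unfolding two_point_avg_def sum_Pow_insert[OF assms]
  by (intro sum.cong refl) (auto simp: 1 2 avg_def put_def algebra_simps)
qed

lemma convex_at_avg:
 assumes e: "e \<in> pairs n" "e' \<in> pairs n" "e \<noteq> e'" and c: "convex_at e \<Psi>"
 shows "convex_at e (avg e' \<Psi>)"
 unfolding convex_at_def
proof
 fix x assume x: "x \<in> Dom"
 let ?s = "snd x e" and ?F = "Fv e' (fst x)"
 have *: "\<Psi> (put e' c x) <= ?s * \<Psi> (put e' c (put e 1 x)) + (1 - ?s) * \<Psi> (put e' c (put e 0 x))"
  if "c \<in> {0..1}" for c
  using c put_Dom[OF e(2) x that] e(3) by (auto simp: convex_at_def put_commute)
 have "avg e' \<Psi> x <= ?F * (?s * \<Psi> (put e' 1 (put e 1 x)) + (1 - ?s) * \<Psi> (put e' 1 (put e 0 x)))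
  + (1 - ?F) * (?s * \<Psi> (put e' 0 (put e 1 x)) + (1 - ?s) * \<Psi> (put e' 0 (put e 0 x)))"
  unfolding avg_def by (intro add_mono mult_left_mono *) auto
 also have "... = ?s * avg e' \<Psi> (put e 1 x) + (1 - ?s) * avg e' \<Psi> (put e 0 x)"
  by (simp add: avg_def algebra_simps)
 finally show "avg e' \<Psi> x <= ?s * avg e' \<Psi> (put e 1 x) + (1 - ?s) * avg e' \<Psi> (put e 0 x)" .
qed

text \<open>Entries are resampled one after the other. The claims are proved together because the
  comparison for the next entry requires measurability, a bound and convexity, and convexity in one
  entry survives the resampling of another.\<close>

lemma two_point_avg_props:
 assumes "finite W" "W \<subseteq> pairs n" "\<Psi> \<in> borel_measurable LZ" "\<And>x. x \<in> Dom ==> \<bar>\<Psi> x\<bar> <= (B::real)"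
 shows "two_point_avg W \<Psi> \<in> borel_measurable LZ"
  and "x \<in> Dom ==> \<bar>two_point_avg W \<Psi> x\<bar> <= B"
  and "e \<in> pairs n ==> e \<notin> W ==> convex_at e \<Psi> ==> convex_at e (two_point_avg W \<Psi>)"
  and "(\<And>e. e \<in> W ==> convex_at e \<Psi>) ==>
   expectation (%\<xi>. \<Psi> (TZ \<xi>)) <= expectation (%\<xi>. two_point_avg W \<Psi> (TZ \<xi>))"
 using assms
proof (induction W arbitrary: \<Psi> rule: finite_induct)
 case empty
 have [simp]: "two_point_avg {} = (%\<Psi>. \<Psi>)" by (auto simp: two_point_avg_def two_point_weight_def fun_eq_iff)
 {
  case 1 then show ?case by simp
 next
  case 2 then show ?case by simp
 next
  case 3 then show ?case by simp
 next
  case 4 then show ?case by simp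
 }
next
 case (insert e0 W)
 have ins: "two_point_avg (insert e0 W) \<Psi> = two_point_avg W (avg e0 \<Psi>)" for \<Psi>
  using two_point_avg_insert[OF insert.hyps(1,2)] by (auto simp: fun_eq_iff)
 have prep: "avg e0 \<Psi> \<in> borel_measurable LZ" "x \<in> Dom ==> \<bar>avg e0 \<Psi> x\<bar> <= B"
  if sub: "insert e0 W \<subseteq> pairs n" and m: "\<Psi> \<in> borel_measurable LZ"
   and bd: "\<And>x. x \<in> Dom ==> \<bar>\<Psi> x\<bar> <= B" for \<Psi> x
 proof -
  have e0: "e0 \<in> pairs n" using sub by blast
  show "avg e0 \<Psi> \<in> borel_measurable LZ" using e0 m by (rule avg_measurable)
  show "x \<in> Dom ==> \<bar>avg e0 \<Psi> x\<bar> <= B" using avg_bound[OF e0 bd] .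
 qed
 {
  case 1
  then have "W \<subseteq> pairs n" by blast
  from insert.IH(1)[OF this prep[OF 1]] show ?case unfolding ins .
 next
  case 2
  then have "W \<subseteq> pairs n" by blast
  from insert.IH(2)[OF 2(1) this prep[OF 2(2-4)]] show ?case unfolding ins .
 next
  case 3
  then have W: "W \<subseteq> pairs n" and e: "e0 \<in> pairs n" "e \<noteq> e0" "e \<notin> W" by blast+
  from insert.IH(3)[OF 3(1) e(3) convex_at_avg[OF 3(1) e(1,2) 3(3)] W prep[OF 3(4-6)]]
  show ?case unfolding ins .
 next
  case 4
  then have e0: "e0 \<in> pairs n" and W: "W \<subseteq> pairs n" by blast+
  have "expectation (%\<xi>. \<Psi> (TZ \<xi>)) <= expectation (%\<xi>. avg e0 \<Psi> (TZ \<xi>))"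
   by (rule expectation_le_avg[OF e0 4(3,4) 4(1)]) auto
  also have "... <= expectation (%\<xi>. two_point_avg W (avg e0 \<Psi>) (TZ \<xi>))"
  proof (rule insert.IH(4)[OF _ W prep[OF 4(2-4)]])
   fix e assume e: "e \<in> W"
   then have "e \<in> pairs n" "e \<noteq> e0" using W insert.hyps(2) by blast+
   then show "convex_at e (avg e0 \<Psi>)" using e0 4(1) e by (intro convex_at_avg) auto
  qed
  finally show ?case unfolding ins .
 }
qed

lemma distr_theta: "distr M (latent_space n) (thetas) = PiM {1..n} (%_. unif01)"
proof -
 have "indep_vars (%_. borel) (theta X) {1..n}"
  using latent unfolding latent_model_def Let_def M_def[symmetric] by blast
 then have "distr M (PiM {1..n} (%_. borel)) (%\<xi>. \<lambda>u\<in>{1..n}. theta X u \<xi>)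
   = PiM {1..n} (%u. distr M borel (theta X u))"
  using n_pos by (subst (asm) indep_vars_iff_distr_eq_PiM') auto
 also have "... = PiM {1..n} (%_. unif01)"
  using latent unfolding latent_model_def Let_def M_def[symmetric] by (intro PiM_cong) auto
 finally show ?thesis by (simp add: latent_space_def theta_vec_def[abs_def])
qed

lemma expectation_theta:
 "g \<in> borel_measurable (latent_space n) ==>
  expectation (%\<xi>. g (thetas \<xi>)) = (\<integral>\<theta>. g \<theta> \<partial>PiM {1..n} (%_. unif01) :: real)"
 by (subst distr_theta[symmetric], subst integral_distr) auto

text \<open>Fubini for a single latent coordinate. The inner integral no longer depends on that
  coordinate, so integrating over it once more changes nothing.\<close>

lemma expectation_theta_integrate:
 assumes j: "j \<in> {1..n}" and g [measurable]: "g \<in> borel_measurable (latent_space n)"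
  and gb: "\<And>\<theta>. \<bar>g \<theta>\<bar> <= (B::real)"
 shows "(%\<theta>. \<integral>y. g (\<theta>(j := y)) \<partial>unif01) \<in> borel_measurable (latent_space n)" (is "?G \<in> _")
  and "expectation (%\<xi>. g (thetas \<xi>)) = expectation (%\<xi>. \<integral>y. g ((thetas \<xi>)(j := y)) \<partial>unif01)" (is ?eq)
proof -
 interpret U: prob_space unif01 by (rule prob_space_unif01)
 interpret P: product_prob_space "%_::nat. unif01" by unfold_locales
 let ?I = "{1..n} - {j}"
 interpret Pn: prob_space "PiM {1..n} (%_. unif01)" by (rule prob_space_PiM) (rule prob_space_unif01)
 have I: "{1..n} = insert j ?I" using j by auto
 have sets: "sets (PiM {1..n} (%_. unif01)) = sets (latent_space n)"
  unfolding latent_space_def by (rule sets_PiM_cong) auto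
 have meas: "borel_measurable (PiM {1..n} (%_. unif01)) = borel_measurable (latent_space n)"
  by (rule measurable_cong_sets[OF sets refl])
 note [simp del] = One_nat_def
 have upd: "(%x. (fst x)(j := snd x)) \<in> measurable (latent_space n \<Otimes>\<^sub>M unif01) (latent_space n)"
  unfolding latent_space_def using j
  by (intro measurable_fun_upd[where J = "{1..n}"]) (auto simp: insert_absorb)
 have int: "integrable (PiM {1..n} (%_. unif01)) h"
  if "h \<in> borel_measurable (latent_space n)" "\<And>\<theta>. \<bar>h \<theta>\<bar> <= B" for h
  using that by (intro Pn.integrable_const_bound[where B = B]) (auto simp: meas)
 define G where "G \<theta> = (\<integral>y. g (\<theta>(j := y)) \<partial>unif01)" for \<theta>
 have Gm: "G \<in> borel_measurable (latent_space n)"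
  unfolding G_def using measurable_compose[OF upd g]
  by (intro U.borel_measurable_lebesgue_integral) (simp add: split_def)
 have Gb: "\<bar>G \<theta>\<bar> <= B" for \<theta>
 proof (cases "integrable unif01 (%y. g (\<theta>(j := y)))")
  case True
  have "norm (G \<theta>) <= (\<integral>y. norm (g (\<theta>(j := y))) \<partial>unif01)"
   unfolding G_def by (rule integral_norm_bound)
  also have "... <= B"
   using gb True by (intro U.integral_le_const) auto
  finally show ?thesis by simp
 qed (use order_trans[OF abs_ge_zero gb] in \<open>simp add: G_def not_integrable_integral_eq\<close>)
 have split: "(\<integral>\<theta>. h \<theta> \<partial>PiM {1..n} (%_. unif01)) = (\<integral>\<theta>. (\<integral>y. h (\<theta>(j := y)) \<partial>unif01) \<partial>PiM ?I (%_. unif01))"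
  if "h \<in> borel_measurable (latent_space n)" "\<And>\<theta>. \<bar>h \<theta>\<bar> <= B" for h
  using int[OF that] by (subst I, subst P.product_integral_insert) (auto simp: insert_absorb[OF j])
 have "(\<integral>\<theta>. G \<theta> \<partial>PiM {1..n} (%_. unif01)) = (\<integral>\<theta>. (\<integral>y. G (\<theta>(j := y)) \<partial>unif01) \<partial>PiM ?I (%_. unif01))"
  by (rule split[OF Gm Gb])
 also have "... = (\<integral>\<theta>. (\<integral>y. g (\<theta>(j := y)) \<partial>unif01) \<partial>PiM ?I (%_. unif01))"
  by (simp add: G_def U.prob_space)
 also have "... = (\<integral>\<theta>. g \<theta> \<partial>PiM {1..n} (%_. unif01))" by (rule split[OF g gb, symmetric])
 finally show ?eq using expectation_theta[OF g] expectation_theta[OF Gm] by (simp add: G_def)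
 show "?G \<in> borel_measurable (latent_space n)" using Gm unfolding G_def[abs_def] .
qed

end

section \<open>Exponential moments for fixed graph and trees\<close>

context icf_instance
begin

lemma Dom_snd: "pt \<in> Dom ==> e \<in> pairs n ==> 0 <= snd pt e \<and> snd pt e <= 1"
 unfolding Dom_def atLeastAtMost_iff by blast

lemma f_section: "f a \<in> borel_measurable borel"
proof -
 have "(%y. (a, y)) \<in> measurable borel (borel \<Otimes>\<^sub>M borel)" by measurable
 from measurable_compose[OF this f_meas] show ?thesis by simp
qed

text \<open>The exponential moment of one layer of a tree: \<open>EJ\<close> are the tree edges into the layer, \<open>V0\<close> the
 earlier vertices, and \<open>N a\<close> is the product of the entries on the tree path to \<open>a\<close>.\<close>

lemma layer_exp_moment:
 fixes N :: "nat => (nat \<times> nat => real) => real" and h :: "real => real"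
 assumes EJ: "EJ \<subseteq> pairs n" "fst ` EJ \<subseteq> V0" "snd ` EJ \<inter> V0 = {}" "inj_on snd EJ"
  and W0: "W0 \<subseteq> pairs n" "W0 \<subseteq> V0 \<times> V0"
  and Nm: "\<And>a. N a \<in> borel_measurable (Z_space n)"
  and Ndep: "\<And>a z z'. (\<And>e. e \<in> W0 ==> z e = z' e) ==> N a z = N a z'"
  and N01: "\<And>a z. (\<And>e. e \<in> W0 ==> z e \<in> {0..1}) ==> N a z \<in> {0..1}"
  and Naff: "\<And>a z e. e \<in> W0 ==> N a z = z e * N a (z(e := 1)) + (1 - z e) * N a (z(e := 0))"
  and h [measurable]: "h \<in> borel_measurable borel" and hB: "\<And>y. \<bar>h y\<bar> <= B" and B: "1 <= B"
  and eig: "\<And>a. (\<integral>y. h y * f a y \<partial>unif01) = l * h a"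
  and x: "\<bar>x\<bar> <= 1 / (2 * B)"
 defines "Q \<equiv> %pt. \<Sum>e\<in>EJ. h (fst pt (snd e)) * N (fst e) (snd pt) * snd pt e - l * h (fst pt (fst e)) * N (fst e) (snd pt)"
 shows "Q \<in> borel_measurable LZ" 
  and "expectation (%\<xi>. exp (x * Q (TZ \<xi>))) <= exp (4 * B\<^sup>2 * x\<^sup>2 * real (card EJ))"
proof -
 interpret U: prob_space unif01 by (rule prob_space_unif01)
 have fin: "finite EJ" "finite W0" using EJ(1) W0(1) by (auto intro: finite_subset[OF _ finite_SigmaI])
 have disj: "EJ \<inter> W0 = {}" using EJ(3) W0(2) by (auto simp: subset_iff)
 have EJmem: "fst e \<in> {1..n}" "snd e \<in> {1..n}" "e \<in> pairs n" if "e \<in> EJ" for e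
  using subsetD[OF EJ(1) that] by (auto simp: mem_Times_iff)
 have hf_int: "integrable unif01 (%y. h y * f a y)" for a
 proof (rule U.integrable_const_bound[where B = "B * 1"])
  have "\<bar>h y\<bar> * \<bar>f a y\<bar> <= B * 1" for y using f01[of a y] hB[of y] B by (intro mult_mono) auto
  then show "AE y in unif01. norm (h y * f a y) <= B * 1" by (simp add: abs_mult)
 qed (use f_section[of a] in measurable)
 \<comment> \<open>The eigenvalue equation writes \<open>l * h a\<close> as a mean of
   \<open>h\<close> with weights in [0, 1], so it inherits the bound of \<open>h\<close>.\<close>
 have lh: "\<bar>l * h a\<bar> <= B" for a
 proof -
  have "norm (\<integral>y. h y * f a y \<partial>unif01) <= (\<integral>y. norm (h y * f a y) \<partial>unif01)" by (rule integral_norm_bound)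
  also have "... <= B"
  proof (rule U.integral_le_const)
   have "\<bar>h y\<bar> * \<bar>f a y\<bar> <= B * 1" for y using f01[of a y] hB[of y] B by (intro mult_mono) auto
   then show "AE y in unif01. norm (h y * f a y) <= B" by (simp add: abs_mult)
  qed (use hf_int in simp)
  finally show ?thesis by (simp add: eig)
 qed
 define T where "T e pt = h (fst pt (snd e)) * N (fst e) (snd pt) * snd pt e - l * h (fst pt (fst e)) * N (fst e) (snd pt)" for e pt
 have Nm' [measurable]: "(%pt. N a (snd pt)) \<in> borel_measurable LZ" for a
  by (rule measurable_compose[OF measurable_snd Nm])
 have Tm: "T e \<in> borel_measurable LZ" if "e \<in> EJ" for e
 proof -
  note [measurable] = fst_comp[OF EJmem(1)[OF that]] fst_comp[OF EJmem(2)[OF that]] snd_comp[OF EJmem(3)[OF that]]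
  show ?thesis unfolding T_def[abs_def] by measurable
 qed
 have Q: "Q pt = (\<Sum>e\<in>EJ. T e pt)" for pt by (simp add: Q_def T_def)
 show Qm: "Q \<in> borel_measurable LZ" unfolding Q[abs_def] using Tm by (intro borel_measurable_sum) auto
 have ND: "N a (snd pt) \<in> {0..1}" if "pt \<in> Dom" for a pt
  using Dom_snd[OF that] W0(1) by (intro N01) auto
 have Tb: "\<bar>T e pt\<bar> <= 2 * B" if e: "e \<in> EJ" and pt: "pt \<in> Dom" for e pt
 proof -
  have z: "snd pt e \<in> {0..1}" using Dom_snd[OF pt EJmem(3)[OF e]] by simp
  have "\<bar>h (fst pt (snd e)) * N (fst e) (snd pt) * snd pt e\<bar> <= B * 1 * 1"
   unfolding abs_mult using z ND[OF pt] hB B by (intro mult_mono) auto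
  moreover have "\<bar>l * h (fst pt (fst e)) * N (fst e) (snd pt)\<bar> <= B * 1"
   unfolding abs_mult[of _ "N (fst e) (snd pt)"] using ND[OF pt] lh B by (intro mult_mono) auto
  ultimately show ?thesis unfolding T_def by linarith
 qed
 define \<Psi> where "\<Psi> pt = exp (x * Q pt)" for pt
 have \<Psi>m: "\<Psi> \<in> borel_measurable LZ" unfolding \<Psi>_def[abs_def] using Qm by measurable
 define C where "C = exp (\<bar>x\<bar> * (real (card EJ) * (2 * B)))"
 have \<Psi>b: "\<bar>\<Psi> pt\<bar> <= C" if "pt \<in> Dom" for pt
 proof -
  have "\<bar>Q pt\<bar> <= (\<Sum>e\<in>EJ. \<bar>T e pt\<bar>)" unfolding Q by (rule sum_abs)
  also have "... <= real (card EJ) * (2 * B)" using Tb[OF _ that] by (intro sum_bounded_above) auto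
  finally have "\<bar>x * Q pt\<bar> <= \<bar>x\<bar> * (real (card EJ) * (2 * B))"
   unfolding abs_mult by (intro mult_left_mono) auto
  then show ?thesis unfolding \<Psi>_def C_def by simp
 qed
 \<comment> \<open>\<open>Q\<close> is affine in each single entry, whether of the new layer or of
   an earlier one, so its exponential is convex in that entry.\<close>
 have affine: "Q pt = snd pt e * Q (put e 1 pt) + (1 - snd pt e) * Q (put e 0 pt)" if e: "e \<in> EJ \<union> W0" for e pt
 proof -
  let ?s = "snd pt e"
  have "T e' pt = ?s * T e' (put e 1 pt) + (1 - ?s) * T e' (put e 0 pt)" if e': "e' \<in> EJ" for e'
  proof (cases "e \<in> W0")
   case True
   then have ne: "e' \<noteq> e" using e' disj by blast
   have N: "N (fst e') (snd (put e c pt)) = N (fst e') ((snd pt)(e := c))" for c by (simp add: put_def)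
   show ?thesis
    unfolding T_def N fst_put snd_put Naff[OF True, of "fst e'" "snd pt"] using ne
    by (simp add: algebra_simps)
  next
   case False
   then have "N (fst e') (snd (put e c pt)) = N (fst e') (snd pt)" for c by (intro Ndep) auto
   then show ?thesis by (cases "e' = e") (auto simp: T_def algebra_simps)
  qed
  then show ?thesis unfolding Q by (simp add: sum.distrib sum_distrib_left)
 qed
 have conv: "convex_at e \<Psi>" if e: "e \<in> EJ \<union> W0" for e
  unfolding convex_at_def
 proof
  fix pt assume pt: "pt \<in> Dom"
  have "e \<in> pairs n" using e EJ(1) W0(1) by blast
  then have s: "0 <= snd pt e" "snd pt e <= 1" using Dom_snd[OF pt] by auto
  have "x * Q pt = snd pt e * (x * Q (put e 1 pt)) + (1 - snd pt e) * (x * Q (put e 0 pt))"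
   by (subst affine[OF e]) (simp add: algebra_simps)
  then show "\<Psi> pt <= snd pt e * \<Psi> (put e 1 pt) + (1 - snd pt e) * \<Psi> (put e 0 pt)"
   unfolding \<Psi>_def using exp_convex_segment[OF s] by simp
 qed
 \<comment> \<open>The entries of the new layer are resampled first; convexity in the earlier
   entries survives this, so they can follow.\<close>
 define \<Phi> where "\<Phi> = two_point_avg EJ \<Psi>"
 note props1 = two_point_avg_props[OF fin(1) EJ(1) \<Psi>m \<Psi>b, folded \<Phi>_def]
 have 1: "expectation (%\<xi>. \<Psi> (TZ \<xi>)) <= expectation (%\<xi>. \<Phi> (TZ \<xi>))"
  by (rule props1(4)) (use conv in auto)
 have convP: "convex_at e \<Phi>" if "e \<in> W0" for e
  using that disj W0(1) conv by (intro props1(3)) auto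
 have 2: "expectation (%\<xi>. \<Phi> (TZ \<xi>)) <= expectation (%\<xi>. two_point_avg W0 \<Phi> (TZ \<xi>))"
  by (rule two_point_avg_props(4)[OF fin(2) W0(1) props1(1,2) convP])
 \<comment> \<open>Once the earlier entries form the 0-1 pattern \<open>b\<close>, the path products
   are the constants \<open>c b e\<close>.\<close>
 define c where "c b e = N (fst e) (overwrite W0 b (%_. 0))" for b and e :: "nat \<times> nat"
 have c01: "c b e \<in> {0..1}" for b e unfolding c_def by (intro N01) (auto simp: overwrite_def)
 define g where "g b e \<theta> = Fv e \<theta> * exp (x * (h (\<theta> (snd e)) * c b e - l * h (\<theta> (fst e)) * c b e))
   + (1 - Fv e \<theta>) * exp (x * (- (l * h (\<theta> (fst e)) * c b e)))" for b e \<theta>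
 have \<Phi>_eq: "\<Phi> (\<theta>, overwrite W0 b z) = (\<Prod>e\<in>EJ. g b e \<theta>)" for \<theta> b z
 proof -
  have Nc: "N (fst e) (overwrite EJ b1 (overwrite W0 b z)) = c b e" for e b1
   unfolding c_def using disj by (intro Ndep) (auto simp: overwrite_def)
  have ovE: "overwrite EJ b1 z' e = of_bool (e \<in> b1)" if "e \<in> EJ" for e b1 z'
   using that by (simp add: overwrite_def)
  have "\<Phi> (\<theta>, overwrite W0 b z) = (\<Sum>b1\<in>Pow EJ. two_point_weight EJ b1 \<theta> *
    exp (x * (\<Sum>e\<in>EJ. h (\<theta> (snd e)) * c b e * of_bool (e \<in> b1) - l * h (\<theta> (fst e)) * c b e)))"
   unfolding \<Phi>_def two_point_avg_def \<Psi>_def Q T_def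
   unfolding fst_conv snd_conv Nc
   by (intro sum.cong refl arg_cong2[where f = "(*)"] arg_cong[where f = exp] arg_cong2[where f = "(-)"])
    (simp_all add: ovE)
  also have "... = (\<Sum>b1\<in>Pow EJ.
    (\<Prod>e\<in>b1. Fv e \<theta> * exp (x * (h (\<theta> (snd e)) * c b e - l * h (\<theta> (fst e)) * c b e))) *
    (\<Prod>e\<in>EJ - b1. (1 - Fv e \<theta>) * exp (x * (- (l * h (\<theta> (fst e)) * c b e)))))"
  proof (intro sum.cong refl)
   fix b1 assume "b1 \<in> Pow EJ"
   then have b1: "b1 \<subseteq> EJ" by simp
   let ?t = "%e. h (\<theta> (snd e)) * c b e * of_bool (e \<in> b1) - l * h (\<theta> (fst e)) * c b e"
   have "exp (x * (\<Sum>e\<in>EJ. ?t e)) = (\<Prod>e\<in>EJ. exp (x * ?t e))"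
    using fin by (simp add: sum_distrib_left exp_sum)
   also have "... = (\<Prod>e\<in>EJ - b1. exp (x * ?t e)) * (\<Prod>e\<in>b1. exp (x * ?t e))"
    by (rule prod.subset_diff[OF b1 fin(1)])
   also have "(\<Prod>e\<in>EJ - b1. exp (x * ?t e)) = (\<Prod>e\<in>EJ - b1. exp (x * (- (l * h (\<theta> (fst e)) * c b e))))"
    by (intro prod.cong) auto
   also have "(\<Prod>e\<in>b1. exp (x * ?t e)) = (\<Prod>e\<in>b1. exp (x * (h (\<theta> (snd e)) * c b e - l * h (\<theta> (fst e)) * c b e)))"
    by (intro prod.cong) auto
   finally show "two_point_weight EJ b1 \<theta> * exp (x * (\<Sum>e\<in>EJ. ?t e)) = 
    (\<Prod>e\<in>b1. Fv e \<theta> * exp (x * (h (\<theta> (snd e)) * c b e - l * h (\<theta> (fst e)) * c b e))) *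
    (\<Prod>e\<in>EJ - b1. (1 - Fv e \<theta>) * exp (x * (- (l * h (\<theta> (fst e)) * c b e))))"
    unfolding two_point_weight_def prod.distrib by (simp only: mult_ac)
  qed
  also have "... = (\<Prod>e\<in>EJ. g b e \<theta>)"
   unfolding g_def by (rule prod_add[OF fin(1), symmetric])
  finally show ?thesis .
 qed
 have 3: "expectation (%\<xi>. two_point_avg W0 \<Phi> (TZ \<xi>))
   = expectation (%\<xi>. \<Sum>b\<in>Pow W0. two_point_weight W0 b (thetas \<xi>) * (\<Prod>e\<in>EJ. g b e (thetas \<xi>)))"
  unfolding two_point_avg_def by (simp add: \<Phi>_eq)
 have v1: "\<bar>x * (h y * c b e - l * h a * c b e)\<bar> <= 1" "\<bar>x * (- (l * h a * c b e))\<bar> <= 1"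
  and v2: "(x * (h y * c b e - l * h a * c b e))\<^sup>2 <= 4 * B\<^sup>2 * x\<^sup>2" "(x * (- (l * h a * c b e)))\<^sup>2 <= 4 * B\<^sup>2 * x\<^sup>2"
  for y b e a
 proof -
  have c: "0 <= c b e" "c b e <= 1" using c01[of b e] by auto
  have "\<bar>h y * c b e\<bar> <= B * 1" unfolding abs_mult using c hB B by (intro mult_mono) auto
  moreover have "\<bar>l * h a * c b e\<bar> <= B * 1" unfolding abs_mult[of _ "c b e"] using c lh B by (intro mult_mono) auto
  ultimately have a: "\<bar>h y * c b e - l * h a * c b e\<bar> <= 2 * B" "\<bar>- (l * h a * c b e)\<bar> <= 2 * B"
   using B by linarith+
  have *: "\<bar>x * t\<bar> <= 1 \<and> (x * t)\<^sup>2 <= 4 * B\<^sup>2 * x\<^sup>2" if t: "\<bar>t\<bar> <= 2 * B" for t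
  proof
   have "\<bar>x * t\<bar> <= (1 / (2 * B)) * (2 * B)"
    unfolding abs_mult using x t B by (intro mult_mono) auto
   then show "\<bar>x * t\<bar> <= 1" using B by simp
   have "t\<^sup>2 <= (2 * B)\<^sup>2" using t by (metis abs_ge_zero power2_abs power_mono)
   then have "x\<^sup>2 * t\<^sup>2 <= x\<^sup>2 * (2 * B)\<^sup>2" by (rule mult_left_mono) simp
   then show "(x * t)\<^sup>2 <= 4 * B\<^sup>2 * x\<^sup>2" by (simp add: power_mult_distrib mult_ac)
  qed
  show "\<bar>x * (h y * c b e - l * h a * c b e)\<bar> <= 1" "\<bar>x * (- (l * h a * c b e))\<bar> <= 1"
   "(x * (h y * c b e - l * h a * c b e))\<^sup>2 <= 4 * B\<^sup>2 * x\<^sup>2" "(x * (- (l * h a * c b e)))\<^sup>2 <= 4 * B\<^sup>2 * x\<^sup>2"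
   using *[OF a(1)] *[OF a(2)] by auto
 qed
 define K where "K = exp (4 * B\<^sup>2 * x\<^sup>2)"
 have g0: "0 <= g b e \<theta>" for b e \<theta> unfolding g_def by (intro add_nonneg_nonneg mult_nonneg_nonneg) auto
 have gle: "g b e \<theta> <= exp 1" for b e \<theta>
 proof -
  have "g b e \<theta> <= Fv e \<theta> * exp 1 + (1 - Fv e \<theta>) * exp 1"
   unfolding g_def using v1 by (intro add_mono mult_left_mono) (auto simp: abs_le_iff)
  then show ?thesis by (simp add: algebra_simps)
 qed
 have gm: "g b e \<in> borel_measurable (latent_space n)" if "e \<in> EJ" for b e
 proof -
  note [measurable] = theta_comp[OF EJmem(1)[OF that]] theta_comp[OF EJmem(2)[OF that]] Fv_latent[OF EJmem(3)[OF that]]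
  show ?thesis unfolding g_def[abs_def] by measurable
 qed
 \<comment> \<open>Averaging over the new vertex: the linear terms cancel by the eigenvalue equation
   and only the quadratic remainder is left.\<close>
 have gint: "(\<integral>y. g b e (\<theta>(snd e := y)) \<partial>unif01) <= K" if e: "e \<in> EJ" for b e \<theta>
 proof -
  have ne: "fst e \<noteq> snd e" using e EJ(2,3) by force
  let ?a = "\<theta> (fst e)" and ?c = "c b e"
  have "(\<integral>y. g b e (\<theta>(snd e := y)) \<partial>unif01)
    <= (\<integral>y. (1 - x * (l * h ?a * ?c) + 4 * B\<^sup>2 * x\<^sup>2) + (x * ?c) * (h y * f ?a y) \<partial>unif01)"
  proof (rule integral_mono)
   have "(%y. g b e (\<theta>(snd e := y))) \<in> borel_measurable borel"
    unfolding g_def Fv_def using ne f_section[of ?a] by simp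
   then show "integrable unif01 (%y. g b e (\<theta>(snd e := y)))"
    using gle g0 by (intro U.integrable_const_bound[where B = "exp 1"]) auto
   show "integrable unif01 (%y. (1 - x * (l * h ?a * ?c) + 4 * B\<^sup>2 * x\<^sup>2) + (x * ?c) * (h y * f ?a y))"
    using hf_int by simp
   fix y
   let ?f = "f ?a y"
   have f: "0 <= ?f" "?f <= 1" using f01[of ?a y] by auto
   have "g b e (\<theta>(snd e := y)) = ?f * exp (x * (h y * ?c - l * h ?a * ?c)) + (1 - ?f) * exp (x * (- (l * h ?a * ?c)))"
    unfolding g_def Fv_def using ne by simp
   also have "... <= ?f * (1 + x * (h y * ?c - l * h ?a * ?c) + 4 * B\<^sup>2 * x\<^sup>2)
     + (1 - ?f) * (1 + x * (- (l * h ?a * ?c)) + 4 * B\<^sup>2 * x\<^sup>2)"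
    using exp_le_quadratic[OF v1(1), of y b e ?a] exp_le_quadratic[OF v1(2), of ?a b e] v2(1)[of y b e ?a] v2(2)[of ?a b e] f
    by (intro add_mono mult_left_mono) auto
   also have "... = (1 - x * (l * h ?a * ?c) + 4 * B\<^sup>2 * x\<^sup>2) + (x * ?c) * (h y * ?f)"
    by (simp add: algebra_simps)
   finally show "g b e (\<theta>(snd e := y)) <= (1 - x * (l * h ?a * ?c) + 4 * B\<^sup>2 * x\<^sup>2) + (x * ?c) * (h y * f ?a y)" .
  qed
  also have "... = (1 - x * (l * h ?a * ?c) + 4 * B\<^sup>2 * x\<^sup>2) + (x * ?c) * (l * h ?a)"
   using hf_int by (simp add: eig U.prob_space)
  also have "... = 1 + 4 * B\<^sup>2 * x\<^sup>2" by (simp add: algebra_simps)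
  also have "... <= K" unfolding K_def by (rule exp_ge_add_one_self)
  finally show ?thesis .
 qed
 have wint: "integrable M (%\<xi>. two_point_weight W0 b (thetas \<xi>) * (\<Prod>e\<in>E'. g b e (thetas \<xi>)))"
  and wm: "(%\<theta>. two_point_weight W0 b \<theta> * (\<Prod>e\<in>E'. g b e \<theta>)) \<in> borel_measurable (latent_space n)"
  and wb: "\<bar>two_point_weight W0 b \<theta> * (\<Prod>e\<in>E'. g b e \<theta>)\<bar> <= exp 1 ^ card E'"
  if b: "b \<subseteq> W0" and E': "E' \<subseteq> EJ" for b E' \<theta>
 proof -
  show m: "(%\<theta>. two_point_weight W0 b \<theta> * (\<Prod>e\<in>E'. g b e \<theta>)) \<in> borel_measurable (latent_space n)"
   using two_point_weight_measurable[OF W0(1) b] E' gm by (intro borel_measurable_times borel_measurable_prod) auto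
  have *: "\<bar>two_point_weight W0 b \<theta> * (\<Prod>e\<in>E'. g b e \<theta>)\<bar> <= exp 1 ^ card E'" for \<theta>
  proof -
   have "(\<Prod>e\<in>E'. g b e \<theta>) <= (\<Prod>e\<in>E'. exp 1)" using g0 gle by (intro prod_mono) auto
   then have "two_point_weight W0 b \<theta> * (\<Prod>e\<in>E'. g b e \<theta>) <= 1 * exp 1 ^ card E'"
    using two_point_weight_le_1[OF fin(2) b] g0 by (intro mult_mono) (auto intro!: prod_nonneg)
   then show ?thesis using g0 by (simp add: prod_nonneg)
  qed
  then show "\<bar>two_point_weight W0 b \<theta> * (\<Prod>e\<in>E'. g b e \<theta>)\<bar> <= exp 1 ^ card E'" .
  show "integrable M (%\<xi>. two_point_weight W0 b (thetas \<xi>) * (\<Prod>e\<in>E'. g b e (thetas \<xi>)))"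
   using * measurable_compose[OF theta_vec_measurable m]
   by (intro integrable_const_bound[where B = "exp 1 ^ card E'"]) auto
 qed
 \<comment> \<open>Each new vertex is the end of exactly one edge of the layer and does not occur in
   \<open>W0\<close>, so it can be integrated out while all other factors stay fixed.\<close>
 have 4: "expectation (%\<xi>. two_point_weight W0 b (thetas \<xi>) * (\<Prod>e\<in>E'. g b e (thetas \<xi>)))
   <= K ^ card E' * expectation (%\<xi>. two_point_weight W0 b (thetas \<xi>))"
  if b: "b \<subseteq> W0" and "finite E'" "E' \<subseteq> EJ" for b E'
  using that(2,3)
 proof (induction E' rule: finite_induct)
  case (insert e E')
  let ?G = "%E' \<theta>. two_point_weight W0 b \<theta> * (\<Prod>e\<in>E'. g b e \<theta>)"
  have e: "e \<in> EJ" and E': "E' \<subseteq> EJ" using insert.prems by auto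
  have upd: "?G (insert e E') (\<theta>(snd e := y)) = ?G E' \<theta> * g b e (\<theta>(snd e := y))" for \<theta> y
  proof -
   have nV: "snd e \<notin> V0" using e EJ(3) by blast
   have F0: "Fv e' (\<theta>(snd e := y)) = Fv e' \<theta>" if "e' \<in> W0" for e'
   proof -
    have "fst e' \<noteq> snd e" "snd e' \<noteq> snd e" using subsetD[OF W0(2) that] nV by (auto simp: mem_Times_iff)
    then show ?thesis by (simp add: Fv_def)
   qed
   have "two_point_weight W0 b (\<theta>(snd e := y)) = two_point_weight W0 b \<theta>"
    unfolding two_point_weight_def using b F0 by (intro arg_cong2[where f = "(*)"] prod.cong) auto
   moreover have "g b e' (\<theta>(snd e := y)) = g b e' \<theta>" if "e' \<in> E'" for e'
   proof -
    have "e' \<in> EJ" "e' \<noteq> e" using that E' insert.hyps by auto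
    then have "snd e' \<noteq> snd e" using EJ(4) e by (auto dest: inj_onD)
    moreover have "fst e' \<noteq> snd e" using \<open>e' \<in> EJ\<close> EJ(2) nV by auto
    ultimately show ?thesis by (simp add: g_def Fv_def)
   qed
   ultimately show ?thesis using insert.hyps by (simp add: mult_ac)
  qed
  have sub: "insert e E' \<subseteq> EJ" using e E' by blast
  note tstep = expectation_theta_integrate[OF EJmem(2)[OF e] wm[OF b sub] wb[OF b sub]]
  have "expectation (%\<xi>. ?G (insert e E') (thetas \<xi>))
    = expectation (%\<xi>. \<integral>y. ?G (insert e E') ((thetas \<xi>)(snd e := y)) \<partial>unif01)"
   by (rule tstep(2))
  also have "... <= expectation (%\<xi>. K * ?G E' (thetas \<xi>))"
  proof (rule integral_mono)
   have G0: "0 <= ?G E' \<theta>" for \<theta> using g0 by (simp add: prod_nonneg)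
   have le: "(\<integral>y. ?G (insert e E') (\<theta>(snd e := y)) \<partial>unif01) <= K * ?G E' \<theta>"
    and ge: "0 <= (\<integral>y. ?G (insert e E') (\<theta>(snd e := y)) \<partial>unif01)" for \<theta>
   proof -
    have eq: "(\<integral>y. ?G (insert e E') (\<theta>(snd e := y)) \<partial>unif01) = ?G E' \<theta> * (\<integral>y. g b e (\<theta>(snd e := y)) \<partial>unif01)"
     unfolding upd by simp
    have "?G E' \<theta> * (\<integral>y. g b e (\<theta>(snd e := y)) \<partial>unif01) <= ?G E' \<theta> * K"
     using gint[OF e] G0 by (rule mult_left_mono)
    then show "(\<integral>y. ?G (insert e E') (\<theta>(snd e := y)) \<partial>unif01) <= K * ?G E' \<theta>" unfolding eq by (simp add: mult.commute)
    show "0 <= (\<integral>y. ?G (insert e E') (\<theta>(snd e := y)) \<partial>unif01)"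
     unfolding eq by (rule mult_nonneg_nonneg[OF G0 Bochner_Integration.integral_nonneg[OF g0]])
   qed
   show "(\<integral>y. ?G (insert e E') ((thetas \<xi>)(snd e := y)) \<partial>unif01) <= K * ?G E' (thetas \<xi>)" for \<xi>
    by (rule le)
   show i: "integrable M (%\<xi>. K * ?G E' (thetas \<xi>))" using wint[OF b E'] by simp
   show "integrable M (%\<xi>. \<integral>y. ?G (insert e E') ((thetas \<xi>)(snd e := y)) \<partial>unif01)"
    using i measurable_compose[OF theta_vec_measurable tstep(1)]
   proof (rule Bochner_Integration.integrable_bound)
    show "AE \<xi> in M. norm (\<integral>y. ?G (insert e E') ((thetas \<xi>)(snd e := y)) \<partial>unif01) <= norm (K * ?G E' (thetas \<xi>))"
    proof (intro AE_I2)
     fix \<xi>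
     show "norm (\<integral>y. ?G (insert e E') ((thetas \<xi>)(snd e := y)) \<partial>unif01) <= norm (K * ?G E' (thetas \<xi>))"
      using le[of "thetas \<xi>"] ge[of "thetas \<xi>"] unfolding real_norm_def by linarith
    qed
   qed
  qed
  also have "... = K * expectation (%\<xi>. ?G E' (thetas \<xi>))" by simp
  also have "... <= K * (K ^ card E' * expectation (%\<xi>. two_point_weight W0 b (thetas \<xi>)))"
   using insert.IH[OF E'] by (intro mult_left_mono) (auto simp: K_def)
  finally show ?case using insert.hyps by (simp add: mult_ac)
 qed simp
 have "expectation (%\<xi>. \<Psi> (TZ \<xi>))
   <= (\<Sum>b\<in>Pow W0. expectation (%\<xi>. two_point_weight W0 b (thetas \<xi>) * (\<Prod>e\<in>EJ. g b e (thetas \<xi>))))"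
  using 1 2 unfolding 3 using wint by (subst (asm) Bochner_Integration.integral_sum) auto
 also have "... <= (\<Sum>b\<in>Pow W0. K ^ card EJ * expectation (%\<xi>. two_point_weight W0 b (thetas \<xi>)))"
  using 4 fin by (intro sum_mono) auto
 also have "... = K ^ card EJ * expectation (%\<xi>. \<Sum>b\<in>Pow W0. two_point_weight W0 b (thetas \<xi>))"
  using wint[OF _ empty_subsetI] by (simp add: sum_distrib_left)
 also have "... = K ^ card EJ" by (simp add: sum_two_point_weight fin prob_space)
 also have "... = exp (4 * B\<^sup>2 * x\<^sup>2 * real (card EJ))"
  unfolding K_def by (simp add: exp_of_nat_mult[symmetric] mult_ac)
 finally show "expectation (%\<xi>. exp (x * Q (TZ \<xi>))) <= exp (4 * B\<^sup>2 * x\<^sup>2 * real (card EJ))"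
  by (simp add: \<Psi>_def)
qed

text \<open>Here \<open>\<pi>\<close> is the chance that an entry is observed, already averaged out,
  and the last exponential compensates drift and variance. The coefficients may depend on entries
  outside \<open>W\<close> but not on those of \<open>W\<close>, so factors can be added one by one
  without raising the mean above 1.\<close>

lemma entries_exp_moment:
 fixes \<gamma> :: "nat \<times> nat => (nat \<times> nat => real) => real" and \<pi> :: real
 assumes W: "W \<subseteq> pairs n"
  and \<gamma>m: "\<And>e. e \<in> W ==> \<gamma> e \<in> borel_measurable (Z_space n)"
  and \<gamma>dep: "\<And>e e' z c. e \<in> W ==> e' \<in> W ==> \<gamma> e (z(e' := c)) = \<gamma> e z"
  and \<gamma>1: "\<And>e z. e \<in> W ==> (\<And>e. e \<in> pairs n ==> z e \<in> {0..1}) ==> \<bar>\<gamma> e z\<bar> <= 1"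
  and \<pi>: "0 <= \<pi>" "\<pi> <= 1"
 defines "t \<equiv> %e pt. (1 - \<pi> + \<pi> * exp (\<gamma> e (snd pt) * snd pt e)) * exp (- \<pi> * \<gamma> e (snd pt) * Fv e (fst pt) - \<pi> * (\<gamma> e (snd pt))\<^sup>2)"
 shows "(%pt. \<Prod>e\<in>W. t e pt) \<in> borel_measurable LZ"
  and "integrable M (%\<xi>. \<Prod>e\<in>W. t e (TZ \<xi>))"
  and "expectation (%\<xi>. \<Prod>e\<in>W. t e (TZ \<xi>)) <= 1"
proof -
 have fin: "finite W" using W by (rule finite_subset) auto
 have gm [measurable]: "(%pt. \<gamma> e (snd pt)) \<in> borel_measurable LZ" if "e \<in> W" for e
  by (rule measurable_compose[OF measurable_snd \<gamma>m[OF that]])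
 have tm: "t e \<in> borel_measurable LZ" if "e \<in> W" for e
 proof -
  have e: "e \<in> pairs n" using that W by blast
  note [measurable] = gm[OF that] Fv_fst[OF e] snd_comp[OF e]
  show ?thesis unfolding t_def by measurable
 qed
 have Wn: "e \<in> W ==> e \<in> pairs n" for e using W by blast
 have t0: "0 <= t e pt" for e pt
  unfolding t_def using \<pi> by (intro mult_nonneg_nonneg add_nonneg_nonneg) auto
 have g1: "\<bar>\<gamma> e (snd pt)\<bar> <= 1" if "e \<in> W" "pt \<in> Dom" for e pt
  using Dom_snd[OF that(2)] by (intro \<gamma>1 that(1)) auto
 have tb: "t e pt <= exp 2" if e: "e \<in> W" and pt: "pt \<in> Dom" for e pt
 proof -
  have g: "\<bar>\<gamma> e (snd pt)\<bar> <= 1" and z: "snd pt e \<in> {0..1}"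
   using g1[OF e pt] Dom_snd[OF pt Wn[OF e]] by auto
  have "\<bar>\<gamma> e (snd pt)\<bar> * \<bar>snd pt e\<bar> <= 1" using g z by (intro mult_le_one) auto
  then have "\<bar>\<gamma> e (snd pt) * snd pt e\<bar> <= 1" by (simp add: abs_mult)
  then have "exp (\<gamma> e (snd pt) * snd pt e) <= exp 1" by simp
  then have "\<pi> * exp (\<gamma> e (snd pt) * snd pt e) <= \<pi> * exp 1" using \<pi>(1) by (rule mult_left_mono)
  moreover have "(1 - \<pi>) * 1 <= (1 - \<pi>) * exp 1" using \<pi> by (intro mult_left_mono) auto
  ultimately have 1: "1 - \<pi> + \<pi> * exp (\<gamma> e (snd pt) * snd pt e) <= exp 1" by (simp add: algebra_simps)
  have "\<pi> * \<bar>\<gamma> e (snd pt)\<bar> * Fv e (fst pt) <= 1" using g \<pi> by (intro mult_le_one) auto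
  moreover have "- (\<pi> * \<gamma> e (snd pt) * Fv e (fst pt)) <= \<pi> * \<bar>\<gamma> e (snd pt)\<bar> * Fv e (fst pt)"
  proof -
   have "\<pi> * (- \<gamma> e (snd pt)) * Fv e (fst pt) <= \<pi> * \<bar>\<gamma> e (snd pt)\<bar> * Fv e (fst pt)"
    using \<pi> by (intro mult_right_mono mult_left_mono) auto
   then show ?thesis by simp
  qed
  moreover have "0 <= \<pi> * (\<gamma> e (snd pt))\<^sup>2" using \<pi> by simp
  ultimately have "- \<pi> * \<gamma> e (snd pt) * Fv e (fst pt) - \<pi> * (\<gamma> e (snd pt))\<^sup>2 <= 1" by simp
  then have "exp (- \<pi> * \<gamma> e (snd pt) * Fv e (fst pt) - \<pi> * (\<gamma> e (snd pt))\<^sup>2) <= exp 1" by simp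
  then have "t e pt <= exp 1 * exp 1" unfolding t_def using 1 \<pi> by (intro mult_mono) auto
  then show ?thesis by (simp flip: exp_add)
 qed
 have Rm: "(%pt. \<Prod>e\<in>W'. t e pt) \<in> borel_measurable LZ" if "W' \<subseteq> W" for W'
  using tm that by (intro borel_measurable_prod) auto
 have R0: "0 <= (\<Prod>e\<in>W'. t e pt)" for W' pt using t0 by (intro prod_nonneg) auto
 have Rb: "\<bar>\<Prod>e\<in>W'. t e pt\<bar> <= exp 2 ^ card W'" if "W' \<subseteq> W" "pt \<in> Dom" for W' pt
 proof -
  have "(\<Prod>e\<in>W'. t e pt) <= (\<Prod>e\<in>W'. exp 2)"
   using subsetD[OF that(1)] t0 tb[OF _ that(2)] by (intro prod_mono conjI) blast+
  then show ?thesis using prod_nonneg[of W' "%e. t e pt"] t0 by simp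
 qed
 show "(%pt. \<Prod>e\<in>W. t e pt) \<in> borel_measurable LZ" by (rule Rm) simp
 show "integrable M (%\<xi>. \<Prod>e\<in>W. t e (TZ \<xi>))"
  by (rule integrable_TZ[OF Rm Rb]) auto
 have "expectation (%\<xi>. \<Prod>e\<in>W'. t e (TZ \<xi>)) <= 1" if "finite W'" "W' \<subseteq> W" for W'
  using that
 proof (induction W' rule: finite_induct)
  case empty
  then show ?case by (simp add: prob_space)
 next
  case (insert e W')
  have e: "e \<in> W" and W': "W' \<subseteq> W" using insert.prems by auto
  have en: "e \<in> pairs n" using e W by blast
  note [measurable] = gm[OF e] Fv_fst[OF en] snd_comp[OF en] Rm[OF W']
  define R where "R pt = (\<Prod>e\<in>W'. t e pt)" for pt
  define u where "u pt = exp (- \<pi> * \<gamma> e (snd pt) * Fv e (fst pt) - \<pi> * (\<gamma> e (snd pt))\<^sup>2)" for pt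
  \<comment> \<open>Collects what multiplies the entry \<open>e\<close> after the chord bound. It
    does not depend on that entry, so the entry may be replaced by \<open>Fv e\<close>.\<close>
  define H where "H pt = R pt * u pt * (\<pi> * (exp (\<gamma> e (snd pt)) - 1))" for pt
  have Rm' [measurable]: "R \<in> borel_measurable LZ" unfolding R_def[abs_def] using Rm[OF W'] by simp
  have um [measurable]: "u \<in> borel_measurable LZ" unfolding u_def[abs_def] by measurable
  have Hm [measurable]: "H \<in> borel_measurable LZ" unfolding H_def[abs_def] by measurable
  have gput: "\<gamma> e' (snd (put e c pt)) = \<gamma> e' (snd pt)" if "e' \<in> W" for e' c pt
   unfolding put_def snd_conv using \<gamma>dep[OF that e] .
  have Rput: "R (put e c pt) = R pt" for c pt
   unfolding R_def
  proof (intro prod.cong refl)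
   fix e' assume "e' \<in> W'"
   then have "e' \<in> W" "e' \<noteq> e" using W' insert.hyps by auto
   then show "t e' (put e c pt) = t e' pt" by (simp add: t_def gput)
  qed
  have Hput: "H (put e c pt) = H pt" for c pt
   unfolding H_def Rput by (simp add: u_def gput e)
  have R0': "0 <= R pt" for pt unfolding R_def by (rule R0)
  have ub: "u pt <= exp 1" if "pt \<in> Dom" for pt
  proof -
   have "\<pi> * (- \<gamma> e (snd pt)) * Fv e (fst pt) <= \<pi> * \<bar>\<gamma> e (snd pt)\<bar> * Fv e (fst pt)"
    using \<pi> by (intro mult_right_mono mult_left_mono) auto
   moreover have "\<pi> * \<bar>\<gamma> e (snd pt)\<bar> * Fv e (fst pt) <= 1"
    using g1[OF e that] \<pi> by (intro mult_le_one) auto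
   moreover have "0 <= \<pi> * (\<gamma> e (snd pt))\<^sup>2" using \<pi> by simp
   ultimately show ?thesis unfolding u_def by simp
  qed
  define D where "D = exp 2 ^ card W' * exp 1 * exp (1::real)"
  have Hb: "\<bar>H pt\<bar> <= D" if "pt \<in> Dom" for pt
  proof -
   have "exp (\<gamma> e (snd pt)) <= exp 1" using g1[OF e that] by simp
   then have "\<bar>exp (\<gamma> e (snd pt)) - 1\<bar> <= exp 1" using exp_gt_zero[of "\<gamma> e (snd pt)"] exp_ge_add_one_self[of 1] by linarith
   then have "\<bar>\<pi>\<bar> * \<bar>exp (\<gamma> e (snd pt)) - 1\<bar> <= 1 * exp 1" using \<pi> by (intro mult_mono) auto
   moreover have "\<bar>R pt\<bar> * \<bar>u pt\<bar> <= exp 2 ^ card W' * exp 1"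
    using Rb[OF W' that] ub[OF that] unfolding R_def by (intro mult_mono) (auto simp: u_def)
   ultimately have "(\<bar>R pt\<bar> * \<bar>u pt\<bar>) * (\<bar>\<pi>\<bar> * \<bar>exp (\<gamma> e (snd pt)) - 1\<bar>) <= (exp 2 ^ card W' * exp 1) * (1 * exp 1)"
    using mult_mono[of "\<bar>R pt\<bar> * \<bar>u pt\<bar>" "exp 2 ^ card W' * exp 1"] by simp
   then show ?thesis unfolding H_def D_def abs_mult by (simp add: mult.assoc)
  qed
  have Rub: "\<bar>R pt * u pt\<bar> <= exp 2 ^ card W' * exp 1" if "pt \<in> Dom" for pt
   unfolding abs_mult using Rb[OF W' that] ub[OF that] unfolding R_def by (intro mult_mono) (auto simp: u_def)
  have HZb: "\<bar>H pt * s\<bar> <= D" if "pt \<in> Dom" "s \<in> {0..1}" for pt s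
  proof -
   have "\<bar>H pt\<bar> * \<bar>s\<bar> <= D * 1" using Hb[OF that(1)] that(2) by (intro mult_mono) (auto simp: D_def)
   then show ?thesis by (simp add: abs_mult)
  qed
  have i1: "integrable M (%\<xi>. R (TZ \<xi>) * u (TZ \<xi>))" by (rule integrable_TZ[OF _ Rub]) measurable
  have i2: "integrable M (%\<xi>. H (TZ \<xi>) * snd (TZ \<xi>) e)"
   by (rule integrable_TZ[OF _ HZb]) (use en Dom_snd in auto)
  have i3: "integrable M (%\<xi>. H (TZ \<xi>) * Fv e (fst (TZ \<xi>)))"
   by (rule integrable_TZ[OF _ HZb]) (use Fv_range in auto)
  have i4: "integrable M (%\<xi>. R (TZ \<xi>))"
   by (rule integrable_TZ[OF Rm' Rb[OF W', folded R_def]])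
  have i5: "integrable M (%\<xi>. \<Prod>e\<in>insert e W'. t e (TZ \<xi>))"
   by (rule integrable_TZ[OF Rm Rb]) (use insert.prems in auto)
  have "expectation (%\<xi>. \<Prod>e\<in>insert e W'. t e (TZ \<xi>))
    <= expectation (%\<xi>. R (TZ \<xi>) * u (TZ \<xi>) + H (TZ \<xi>) * snd (TZ \<xi>) e)"
  proof (rule integral_mono[OF i5])
   show "integrable M (%\<xi>. R (TZ \<xi>) * u (TZ \<xi>) + H (TZ \<xi>) * snd (TZ \<xi>) e)" using i1 i2 by simp
   fix \<xi> assume "\<xi> \<in> space M"
   then have pt: "TZ \<xi> \<in> Dom" by (rule TZ_Dom)
   let ?g = "\<gamma> e (snd (TZ \<xi>))" and ?s = "snd (TZ \<xi>) e"
   have s: "0 <= ?s" "?s <= 1" using Dom_snd[OF pt en] by auto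
   have "exp (?g * ?s) <= 1 + ?s * (exp ?g - 1)"
    using exp_convex_segment[OF s, of ?g 0] by (simp add: algebra_simps)
   then have "\<pi> * exp (?g * ?s) <= \<pi> * (1 + ?s * (exp ?g - 1))" using \<pi>(1) by (rule mult_left_mono)
   then have "1 - \<pi> + \<pi> * exp (?g * ?s) <= 1 + \<pi> * (exp ?g - 1) * ?s" by (simp add: algebra_simps)
   then have "R (TZ \<xi>) * u (TZ \<xi>) * (1 - \<pi> + \<pi> * exp (?g * ?s)) <= R (TZ \<xi>) * u (TZ \<xi>) * (1 + \<pi> * (exp ?g - 1) * ?s)"
    using R0'[of "TZ \<xi>"] by (intro mult_left_mono) (auto simp: u_def)
   moreover have "(\<Prod>e\<in>insert e W'. t e (TZ \<xi>)) = R (TZ \<xi>) * u (TZ \<xi>) * (1 - \<pi> + \<pi> * exp (?g * ?s))"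
    using insert.hyps by (simp add: R_def t_def u_def)
   ultimately show "(\<Prod>e\<in>insert e W'. t e (TZ \<xi>)) <= R (TZ \<xi>) * u (TZ \<xi>) + H (TZ \<xi>) * snd (TZ \<xi>) e"
    by (simp add: H_def algebra_simps)
  qed
  also have "... = expectation (%\<xi>. R (TZ \<xi>) * u (TZ \<xi>) + H (TZ \<xi>) * Fv e (fst (TZ \<xi>)))"
   using i1 i2 i3 integral_Z_mean'[OF en Hm Hb Hput] by simp
  also have "... <= expectation (%\<xi>. R (TZ \<xi>))"
  proof (rule integral_mono[OF _ i4])
   show "integrable M (%\<xi>. R (TZ \<xi>) * u (TZ \<xi>) + H (TZ \<xi>) * Fv e (fst (TZ \<xi>)))" using i1 i3 by simp
   fix \<xi> assume "\<xi> \<in> space M"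
   then have pt: "TZ \<xi> \<in> Dom" by (rule TZ_Dom)
   let ?g = "\<gamma> e (snd (TZ \<xi>))" and ?F = "Fv e (fst (TZ \<xi>))"
   \<comment> \<open>The linear and the quadratic term are exactly those compensated by
     \<open>u\<close>.\<close>
   have "exp ?g - 1 <= ?g + ?g\<^sup>2" using exp_le_quadratic[OF g1[OF e pt]] by simp
   then have "\<pi> * ?F * (exp ?g - 1) <= \<pi> * ?F * (?g + ?g\<^sup>2)" using \<pi> by (intro mult_left_mono) auto
   also have "... <= \<pi> * ?g * ?F + \<pi> * ?g\<^sup>2"
   proof -
    have "?F * (\<pi> * ?g\<^sup>2) <= 1 * (\<pi> * ?g\<^sup>2)" using \<pi> by (intro mult_right_mono) auto
    then show ?thesis by (simp add: algebra_simps)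
   qed
   finally have "1 + \<pi> * ?F * (exp ?g - 1) <= exp (\<pi> * ?g * ?F + \<pi> * ?g\<^sup>2)"
    using exp_ge_add_one_self[of "\<pi> * ?g * ?F + \<pi> * ?g\<^sup>2"] by linarith
   then have "u (TZ \<xi>) * (1 + \<pi> * ?F * (exp ?g - 1)) <= u (TZ \<xi>) * exp (\<pi> * ?g * ?F + \<pi> * ?g\<^sup>2)"
    by (intro mult_left_mono) (auto simp: u_def)
   also have "... = 1" unfolding u_def by (simp flip: exp_add)
   finally have "R (TZ \<xi>) * (u (TZ \<xi>) * (1 + \<pi> * ?F * (exp ?g - 1))) <= R (TZ \<xi>) * 1"
    using R0' by (rule mult_left_mono)
   then show "R (TZ \<xi>) * u (TZ \<xi>) + H (TZ \<xi>) * Fv e (fst (TZ \<xi>)) <= R (TZ \<xi>)"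
    by (simp add: H_def algebra_simps)
  qed
  also have "... <= 1" using insert.IH[OF W'] by (simp add: R_def)
  finally show ?case .
 qed
 from this[OF fin order_refl] show "expectation (%\<xi>. \<Prod>e\<in>W. t e (TZ \<xi>)) <= 1" .
qed

end

section \<open>Uniformity of the parents in a random breadth-first tree\<close>

text \<open>Each \<open>j\<close> has a permutation of its own for its in-edges from
  \<open>A\<close>. Independent choices for different \<open>j\<close> are what later makes the
  parents independent.\<close>

definition twist :: "nat set => nat set => (nat => nat => nat) => edges => edges" where
 "twist A A' \<tau> E = {(a, j). if a \<in> A \<and> j \<in> A' then (\<tau> j a, j) \<in> E else (a, j) \<in> E}"

lemma twist_iff: "(a, j) \<in> twist A A' \<tau> E \<longleftrightarrow> (if a \<in> A \<and> j \<in> A' then (\<tau> j a, j) \<in> E else (a, j) \<in> E)"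
 by (simp add: twist_def)

lemma twist_iff' [simp]:
 "a \<in> A ==> j \<in> A' ==> (a, j) \<in> twist A A' \<tau> E \<longleftrightarrow> (\<tau> j a, j) \<in> E"
 "a \<notin> A ==> (a, j) \<in> twist A A' \<tau> E \<longleftrightarrow> (a, j) \<in> E"
 "j \<notin> A' ==> (a, j) \<in> twist A A' \<tau> E \<longleftrightarrow> (a, j) \<in> E"
 by (simp_all add: twist_def)

lemma finite_sphere: "finite E ==> finite (sphere E u s)"
proof (cases s)
 case (Suc k)
 assume "finite E"
 moreover have "sphere E u s \<subseteq> snd ` E" unfolding Suc sphere_Suc by force
 ultimately show ?thesis by (auto intro: finite_subset)
qed simp

context
 fixes A A' :: "nat set" and \<tau> :: "nat => nat => nat"
 assumes bij: "\<And>j. j \<in> A' ==> bij_betw (\<tau> j) A A"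
begin

lemma tau_in: "j \<in> A' ==> a \<in> A ==> \<tau> j a \<in> A"
 using bij bij_betwE by blast

lemma tau_surj: "j \<in> A' ==> a \<in> A ==> \<exists>b\<in>A. \<tau> j b = a"
 using bij[of j] bij_betw_apply bij_betw_imp_surj_on[of "\<tau> j" A A] by (metis imageE)

lemma tau_inj: "j \<in> A' ==> a \<in> A ==> b \<in> A ==> \<tau> j a = \<tau> j b ==> a = b"
 using bij[of j] unfolding bij_betw_def inj_on_def by auto

text \<open>The law of the random graph depends on the number of edges only, so this amounts to its
  invariance.\<close>

lemma card_twist: "card (twist A A' \<tau> E) = card E"
proof -
 define \<phi> where "\<phi> = (%(a, j). if a \<in> A \<and> j \<in> A' then (\<tau> j a, j) else (a, j))"
 have "bij_betw \<phi> (twist A A' \<tau> E) E"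
  unfolding bij_betw_def
 proof
  show "inj_on \<phi> (twist A A' \<tau> E)"
  proof (rule inj_onI)
   fix e e' assume eq: "\<phi> e = \<phi> e'"
   obtain a j a' j' where e: "e = (a, j)" "e' = (a', j')" by force
   have "snd (\<phi> e) = j" "snd (\<phi> e') = j'" by (auto simp: \<phi>_def e)
   with eq have j: "j' = j" by simp
   show "e = e'"
   proof (cases "j \<in> A'")
    case True
    then have "a \<in> A \<longleftrightarrow> fst (\<phi> e) \<in> A" "a' \<in> A \<longleftrightarrow> fst (\<phi> e') \<in> A"
     using tau_in[OF True] by (auto simp: \<phi>_def e j)
    then have "a \<in> A \<longleftrightarrow> a' \<in> A" using eq by simp
    then show ?thesis using eq tau_inj[OF True, of a a'] True by (cases "a \<in> A") (auto simp: \<phi>_def e j)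
   qed (use eq in \<open>simp add: \<phi>_def e j\<close>)
  qed
  show "\<phi> ` twist A A' \<tau> E = E"
  proof (intro equalityI subsetI)
   fix e assume "e \<in> \<phi> ` twist A A' \<tau> E"
   then show "e \<in> E" by (auto simp: \<phi>_def twist_iff split: if_splits)
  next
   fix e assume e: "e \<in> E"
   obtain a j where aj: "e = (a, j)" by force
   show "e \<in> \<phi> ` twist A A' \<tau> E"
   proof (cases "a \<in> A \<and> j \<in> A'")
    case True
    then obtain b where "b \<in> A" "\<tau> j b = a" using tau_surj by blast
    with True e show ?thesis by (intro image_eqI[of _ _ "(b, j)"]) (auto simp: \<phi>_def aj)
   next
    case False
    with e show ?thesis by (intro image_eqI[of _ _ "(a, j)"]) (auto simp: \<phi>_def aj twist_iff)
   qed
  qed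
 qed
 then show ?thesis by (rule bij_betw_same_card)
qed

lemma inj_twist: "twist A A' \<tau> E = twist A A' \<tau> E2 ==> E = E2"
proof -
 assume eq: "twist A A' \<tau> E = twist A A' \<tau> E2"
 have "(a, j) \<in> E \<longleftrightarrow> (a, j) \<in> E2" for a j
 proof (cases "a \<in> A \<and> j \<in> A'")
  case True
  then obtain b where "b \<in> A" "\<tau> j b = a" using tau_surj by blast
  then show ?thesis using True eq twist_iff'(1)[of b A j A' \<tau>] by metis
 next
  case False
  then show ?thesis using eq twist_iff[of a j A A' \<tau>] by metis
 qed
 then show ?thesis by auto
qed

lemma twist_subset: "A \<subseteq> V ==> E \<subseteq> V \<times> V' ==> twist A A' \<tau> E \<subseteq> V \<times> V'"
 by (auto simp: twist_iff split: if_splits)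

context
 fixes E u s assumes A: "A = sphere E u s" and A': "A' = sphere E u (Suc s)"
begin

text \<open>Only edges from layer \<open>s\<close> to layer \<open>s + 1\<close> move, and every
  vertex of the later layer keeps an in-neighbor in the earlier one.\<close>

lemma sphere_twist: "sphere (twist A A' \<tau> E) u k = sphere E u k"
proof (induction k rule: less_induct)
 case (less k)
 show ?case
 proof (cases k)
  case (Suc m)
  have IH: "i <= m ==> sphere (twist A A' \<tau> E) u i = sphere E u i" for i
   using less Suc by simp
  have "(\<exists>a\<in>sphere E u m. (a, i) \<in> twist A A' \<tau> E) \<longleftrightarrow> (\<exists>a\<in>sphere E u m. (a, i) \<in> E)" for i
  proof (cases "m = s \<and> i \<in> A'")
   case True
   then have i: "i \<in> A'" and m: "sphere E u m = A" using A by auto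
   show ?thesis unfolding m using i tau_in tau_surj[OF i] by (metis twist_iff'(1))
  next
   case False
   then have "(a, i) \<in> twist A A' \<tau> E \<longleftrightarrow> (a, i) \<in> E" if "a \<in> sphere E u m" for a
    using that A sphere_disjoint by (auto simp: twist_iff)
   then show ?thesis by auto
  qed
  then show ?thesis unfolding Suc sphere_Suc using IH by simp
 qed simp
qed

text \<open>Graph and tree are rewired by the same permutations. A vertex of \<open>A'\<close> again
  has exactly one parent, namely the preimage of the old one.\<close>

lemma twist_bfs: "T \<in> bfs_trees E u ==> twist A A' \<tau> T \<in> bfs_trees (twist A A' \<tau> E) u"
proof -
 assume T: "T \<in> bfs_trees E u"
 note R = T[unfolded bfs_trees_iff]
 show ?thesis
  unfolding bfs_trees_iff sphere_twist
 proof (intro conjI allI ballI)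
  show "twist A A' \<tau> T \<subseteq> twist A A' \<tau> E" using subsetD[OF conjunct1[OF R]] by (auto simp: twist_iff)
  show "case x of (a, b) \<Rightarrow> \<exists>k. a \<in> sphere E u k \<and> b \<in> sphere E u (Suc k)" if x: "x \<in> twist A A' \<tau> T" for x
  proof -
   obtain a b where ab: "x = (a, b)" by force
   show ?thesis
   proof (cases "a \<in> A \<and> b \<in> A'")
    case True then show ?thesis unfolding ab using A A' by auto
   next
    case False
    then have "(a, b) \<in> T" using x ab by (auto simp: twist_iff)
    then show ?thesis unfolding ab using bspec[OF conjunct1[OF conjunct2[OF R]], of "(a, b)"] by simp
   qed
  qed
  fix k b assume b: "b \<in> sphere E u (Suc k)"
  then have ex: "\<exists>!a. (a, b) \<in> T" using R by blast
  show "\<exists>!a. (a, b) \<in> twist A A' \<tau> T"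
  proof (cases "b \<in> A'")
   case False
   then show ?thesis using ex by simp
  next
   case True
   then have k: "k = s" using b A' sphere_disjoint by blast
   have Tb: "a \<in> A" if "(a, b) \<in> T" for a
    using parent(2,4)[OF T b] that k A by auto
   from ex obtain a0 where a0: "(a0, b) \<in> T" by blast
   then obtain a where a: "a \<in> A" "\<tau> b a = a0" using tau_surj[OF True Tb[OF a0]] by blast
   show ?thesis
   proof (rule ex1I[of _ a])
    show "(a, b) \<in> twist A A' \<tau> T" using a a0 True by simp
    fix c assume c: "(c, b) \<in> twist A A' \<tau> T"
    have "c \<in> A" using c Tb by (cases "c \<in> A") auto
    then have "\<tau> b c = \<tau> b a" using c True ex a0 a(2) by auto
    then show "c = a" using tau_inj[OF True \<open>c \<in> A\<close> a(1)] by blast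
   qed
  qed
 qed
qed

lemma parent_twist:
 assumes T: "T \<in> bfs_trees E u" and j: "j \<in> A'"
 shows "parent (twist A A' \<tau> T) j \<in> A" "\<tau> j (parent (twist A A' \<tau> T) j) = parent T j"
proof -
 have j': "j \<in> sphere (twist A A' \<tau> E) u (Suc s)" unfolding sphere_twist using j A' by simp
 note p = parent[OF twist_bfs[OF T] j']
 show 1: "parent (twist A A' \<tau> T) j \<in> A" using p(2) A unfolding sphere_twist by simp
 have "(\<tau> j (parent (twist A A' \<tau> T) j), j) \<in> T" using p(1) 1 j by simp
 then show "\<tau> j (parent (twist A A' \<tau> T) j) = parent T j"
  using parent(4)[OF T] j A' by metis
qed

text \<open>The tree paths to the layers up to \<open>s\<close> end before the rewired
  edges.\<close>

lemma nbr_vec_twist: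
 assumes T: "T \<in> bfs_trees E u" and k: "k <= s"
 shows "nbr_vec (twist A A' \<tau> E) (twist A A' \<tau> T) M u k i = nbr_vec E T M u k i"
 using k
proof (induction k arbitrary: i)
 case 0
 then show ?case by (simp add: nbr_vec_0[OF T] nbr_vec_0[OF twist_bfs[OF T]])
next
 case (Suc k)
 have "parent (twist A A' \<tau> T) i = parent T i" if i: "i \<in> sphere E u (Suc k)"
 proof -
  have "i \<notin> A'" using i Suc.prems A' sphere_disjoint by fastforce
  then have "(a, i) \<in> twist A A' \<tau> T \<longleftrightarrow> (a, i) \<in> T" for a by simp
  then show ?thesis unfolding parent_def by simp
 qed
 then show ?case using Suc by (simp add: nbr_vec_Suc[OF T] nbr_vec_Suc[OF twist_bfs[OF T]] sphere_twist)
qed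

end

end

text \<open>The inverse permutations undo the rewiring, so it maps the trees of one graph onto those
  of the other, and the uniform laws correspond.\<close>

lemma bfs_trees_twist:
 assumes bij: "\<And>j. j \<in> A' ==> bij_betw (\<tau> j) A A" and A: "A = sphere E u s" and A': "A' = sphere E u (Suc s)"
 shows "bfs_trees (twist A A' \<tau> E) u = twist A A' \<tau> ` bfs_trees E u"
proof (intro equalityI subsetI)
 fix T assume T: "T \<in> bfs_trees (twist A A' \<tau> E) u"
 define \<tau>' where "\<tau>' j = inv_into A (\<tau> j)" for j
 have bij': "bij_betw (\<tau>' j) A A" if "j \<in> A'" for j
  unfolding \<tau>'_def using bij_betw_inv_into[OF bij[OF that]] .
 have undo: "twist A A' \<tau>' (twist A A' \<tau> F) = F" "twist A A' \<tau> (twist A A' \<tau>' F) = F" for F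
 proof -
  have "(a, j) \<in> twist A A' \<tau>' (twist A A' \<tau> F) \<longleftrightarrow> (a, j) \<in> F"
   "(a, j) \<in> twist A A' \<tau> (twist A A' \<tau>' F) \<longleftrightarrow> (a, j) \<in> F" for a j
  proof -
   have "\<tau> j (\<tau>' j a) = a" "\<tau>' j (\<tau> j a) = a" "\<tau>' j a \<in> A" "\<tau> j a \<in> A" if "a \<in> A" "j \<in> A'"
    using that bij[of j] bij'[of j] unfolding \<tau>'_def
    by (auto simp: bij_betw_def f_inv_into_f)
   then show "(a, j) \<in> twist A A' \<tau>' (twist A A' \<tau> F) \<longleftrightarrow> (a, j) \<in> F"
    "(a, j) \<in> twist A A' \<tau> (twist A A' \<tau>' F) \<longleftrightarrow> (a, j) \<in> F"
    by (cases "a \<in> A \<and> j \<in> A'"; auto simp: twist_iff)+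
  qed
  then show "twist A A' \<tau>' (twist A A' \<tau> F) = F" "twist A A' \<tau> (twist A A' \<tau>' F) = F" by auto
 qed
 have "twist A A' \<tau>' T \<in> bfs_trees (twist A A' \<tau>' (twist A A' \<tau> E)) u"
  using sphere_twist[OF bij A A'] A A' T by (intro twist_bfs[OF bij']) auto
 then have "twist A A' \<tau>' T \<in> bfs_trees E u" unfolding undo .
 then show "T \<in> twist A A' \<tau> ` bfs_trees E u" using undo(2)[of T] by (metis image_eqI)
qed (use twist_bfs[OF bij A A'] in auto)

lemma tree_weight_twist:
 assumes bij: "\<And>j. j \<in> A' ==> bij_betw (\<tau> j) A A" and A: "A = sphere E u s" and A': "A' = sphere E u (Suc s)" and "finite E" "T \<in> bfs_trees E u"
 shows "tree_weight (twist A A' \<tau> E) u (twist A A' \<tau> T) = tree_weight E u T"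
proof -
 have inj: "inj_on (twist A A' \<tau>) S" for S using inj_twist[OF bij] by (auto simp: inj_on_def)
 have "finite (bfs_trees E u)" using finite_subset[OF bfs_trees_subset] \<open>finite E\<close> by blast
 moreover have "bfs_trees (twist A A' \<tau> E) u = twist A A' \<tau> ` bfs_trees E u"
  by (rule bfs_trees_twist[OF _ A A']) (rule bij)
 ultimately show ?thesis
  unfolding tree_weight_def using \<open>T \<in> bfs_trees E u\<close> bfs_trees_nonempty inj
  by (simp add: card_image indicator_def)
qed

text \<open>Cyclic shifts can stand in for the full symmetric group: exactly one of them moves
  \<open>a\<close> to \<open>b\<close>, and this is all that a uniform parent requires.\<close>

lemma cyclic_shifts:
 assumes "finite A"
 obtains \<sigma> :: "nat => nat => nat" where
  "\<And>i. i < card A ==> bij_betw (\<sigma> i) A A" "\<And>a b. a \<in> A ==> b \<in> A ==> \<exists>!i. i < card A \<and> \<sigma> i a = b"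
proof -
 let ?m = "card A"
 obtain g where g: "bij_betw g {0..<?m} A" using ex_bij_betw_nat_finite[OF assms] by blast
 define g' where "g' = inv_into {0..<?m} g"
 have g': "bij_betw g' A {0..<?m}" unfolding g'_def using g by (rule bij_betw_inv_into)
 have gg: "g (g' a) = a" "g' a < ?m" if "a \<in> A" for a
  using that g bij_betwE[OF g'] unfolding g'_def by (auto simp: bij_betw_inv_into_right)
 have gg': "g' (g k) = k" "g k \<in> A" if "k < ?m" for k
  using that g bij_betwE[OF g] unfolding g'_def by (auto simp: bij_betw_inv_into_left)
 define \<sigma> where "\<sigma> i a = g ((g' a + i) mod ?m)" for i a
 have u: "\<exists>!i. i < m \<and> (k + i) mod m = l" if "k < m" "l < m" for k l m :: nat
 proof (rule ex1I[of _ "(l + (m - k)) mod m"])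
  have "(k + (l + (m - k)) mod m) mod m = (k + (l + (m - k))) mod m" by (simp add: mod_add_right_eq)
  also have "k + (l + (m - k)) = l + m" using that by simp
  finally show "(l + (m - k)) mod m < m \<and> (k + (l + (m - k)) mod m) mod m = l" using that by simp
  fix i assume i: "i < m \<and> (k + i) mod m = l"
  have "(l + (m - k)) mod m = ((k + i) mod m + (m - k)) mod m" using i by simp
  also have "... = ((k + i) + (m - k)) mod m" by (simp add: mod_add_left_eq)
  also have "(k + i) + (m - k) = i + m" using that by simp
  finally show "i = (l + (m - k)) mod m" using i by simp
 qed
 show thesis
 proof
  fix a b assume ab: "a \<in> A" "b \<in> A"
  have "\<sigma> i a = b \<longleftrightarrow> (g' a + i) mod ?m = g' b" if "i < ?m" for i
   using gg[OF ab(1)] gg[OF ab(2)] gg'[of "(g' a + i) mod ?m"] that unfolding \<sigma>_def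
   by (metis mod_less_divisor less_nat_zero_code neq0_conv)
  then show "\<exists>!i. i < ?m \<and> \<sigma> i a = b" using u[OF gg(2)[OF ab(1)] gg(2)[OF ab(2)]] by (metis (no_types, lifting))
 next
  fix i assume i: "i < ?m"
  have "inj_on (\<sigma> i) A"
  proof (rule inj_onI)
   fix a b assume ab: "a \<in> A" "b \<in> A" "\<sigma> i a = \<sigma> i b"
   have "(g' a + i) mod ?m = (g' b + i) mod ?m"
    using ab(3) gg'(1)[of "(g' a + i) mod ?m"] gg'(1)[of "(g' b + i) mod ?m"] i unfolding \<sigma>_def
    by (metis mod_less_divisor less_nat_zero_code neq0_conv)
   moreover have "\<exists>!k. k < ?m \<and> (i + k) mod ?m = (g' a + i) mod ?m" using i by (intro u) auto
   ultimately have "g' a = g' b" using gg(2)[OF ab(1)] gg(2)[OF ab(2)] by (metis add.commute)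
   then show "a = b" using gg(1)[OF ab(1)] gg(1)[OF ab(2)] by metis
  qed
  moreover have "\<sigma> i ` A \<subseteq> A" using gg'(2) i unfolding \<sigma>_def by auto
  ultimately show "bij_betw (\<sigma> i) A A"
   using assms by (simp add: bij_betw_def endo_inj_surj)
 qed
qed

definition edge_weight :: "nat => real => edges => real" where
 "edge_weight n r E = r ^ card E * (1 - r) ^ (n * n - card E)"

text \<open>With both layers fixed, every vertex \<open>j\<close> of the later one receives a shift
  \<open>h j\<close> of its own. Graph law, tree law and the values \<open>W\<close> are invariant,
  so the sum may be averaged over \<open>h\<close>. This makes the parents independent and uniform
  on the earlier layer, and the centered moment factorizes over the later layer.\<close>

theorem parents_exp_moment:
 fixes W :: "edges => edges => nat => real"
 assumes u: "u \<in> {1..n}" and r: "0 <= r" "r <= 1"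
  and WB: "\<And>E T a. \<bar>W E T a\<bar> <= B" and B: "1 <= B" and x: "\<bar>x\<bar> <= 1 / (2 * B)"
  and Winv: "\<And>E T \<tau> a. T \<in> bfs_trees E u ==> a \<in> sphere E u s ==>
   (\<And>j. j \<in> sphere E u (Suc s) ==> bij_betw (\<tau> j) (sphere E u s) (sphere E u s)) ==>
   W (twist (sphere E u s) (sphere E u (Suc s)) \<tau> E) (twist (sphere E u s) (sphere E u (Suc s)) \<tau> T) a = W E T a"
 defines "Y \<equiv> %E T. exp (x * ((\<Sum>j\<in>sphere E u (Suc s). W E T (parent T j))
   - real (card (sphere E u (Suc s))) * ((\<Sum>a\<in>sphere E u s. W E T a) / real (card (sphere E u s))))
   - 4 * B\<^sup>2 * x\<^sup>2 * real (card (sphere E u (Suc s))))"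
 shows "(\<Sum>E\<in>Pow (pairs n). \<Sum>T\<in>Pow (pairs n). edge_weight n r E * tree_weight E u T * Y E T)
  <= (\<Sum>E\<in>Pow (pairs n). \<Sum>T\<in>Pow (pairs n). edge_weight n r E * tree_weight E u T)"
proof -
 define S where "S = {(E, T). E \<subseteq> pairs n \<and> T \<in> bfs_trees E u}"
 define wt where "wt = (%(E, T). edge_weight n r E * tree_weight E u T)"
 define Y' where "Y' = (%(E, T). Y E T)"
 define S2 where "S2 A A' = {(E, T) \<in> S. sphere E u s = A \<and> sphere E u (Suc s) = A'}" for A A'
 have finP: "finite (Pow (pairs n) \<times> Pow (pairs n))" by simp
 have Ssub: "S \<subseteq> Pow (pairs n) \<times> Pow (pairs n)"
  using bfs_trees_subset by (fastforce simp: S_def)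
 have finS: "finite S" by (rule finite_subset[OF Ssub finP])
 have tw0: "tree_weight E u T = 0" if "E \<subseteq> pairs n" "T \<notin> bfs_trees E u" for E T
 proof -
  have "finite E" using that(1) by (rule finite_subset) auto
  then have "finite (bfs_trees E u)" using finite_subset[OF bfs_trees_subset] by auto
  then show ?thesis using that bfs_trees_nonempty by (simp add: tree_weight_def)
 qed
 have wt0: "0 <= wt x" for x
  using r by (cases x) (simp add: wt_def edge_weight_def)
 have reduce: "(\<Sum>E\<in>Pow (pairs n). \<Sum>T\<in>Pow (pairs n). edge_weight n r E * tree_weight E u T * G E T)
   = (\<Sum>x\<in>S. wt x * G (fst x) (snd x))" for G
 proof -
  have "(\<Sum>E\<in>Pow (pairs n). \<Sum>T\<in>Pow (pairs n). edge_weight n r E * tree_weight E u T * G E T)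
    = (\<Sum>x\<in>Pow (pairs n) \<times> Pow (pairs n). wt x * G (fst x) (snd x))"
   unfolding wt_def by (simp add: sum.cartesian_product split_def)
  also have "... = (\<Sum>x\<in>S. wt x * G (fst x) (snd x))"
  proof (rule sum.mono_neutral_right[OF finP Ssub], rule ballI)
   fix y assume y: "y \<in> Pow (pairs n) \<times> Pow (pairs n) - S"
   obtain E T where ET: "y = (E, T)" by force
   then have "E \<subseteq> pairs n" "T \<notin> bfs_trees E u" using y unfolding S_def by blast+
   from tw0[OF this] show "wt y * G (fst y) (snd y) = 0" by (simp add: ET wt_def)
  qed
  finally show ?thesis .
 qed
 have key: "(\<Sum>x\<in>S2 A A'. wt x * Y' x) <= (\<Sum>x\<in>S2 A A'. wt x)" for A A'
 proof (cases "S2 A A' = {}")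
  case False
  then obtain E0 T0 where E0: "(E0, T0) \<in> S2 A A'" by auto
  then have E0': "E0 \<subseteq> pairs n" "A = sphere E0 u s" "A' = sphere E0 u (Suc s)"
   by (auto simp: S2_def S_def)
  have An: "A \<subseteq> {1..n}" "A' \<subseteq> {1..n}" using E0' u sphere_subset by auto
  have finA: "finite A" "finite A'" using An by (auto intro: finite_subset)
  have Ane: "A \<noteq> {}" if "A' \<noteq> {}" using that E0' by (auto simp: sphere_Suc)
  let ?m = "card A"
  obtain \<sigma> where \<sigma>: "\<And>i. i < ?m ==> bij_betw (\<sigma> i) A A"
   "\<And>a b. a \<in> A ==> b \<in> A ==> \<exists>!i. i < ?m \<and> \<sigma> i a = b"
   using cyclic_shifts[OF finA(1)] by metis
  define H where "H = PiE A' (%_. {..<?m})"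
  have finH: "finite H" unfolding H_def using finA by (intro finite_PiE) auto
  have cardH: "card H = ?m ^ card A'" unfolding H_def using finA by (simp add: card_PiE)
  define \<tau> where "\<tau> h j = \<sigma> (h j)" for h :: "nat => nat" and j
  have bij: "bij_betw (\<tau> h j) A A" if "h \<in> H" "j \<in> A'" for h j
   using that \<sigma>(1) unfolding \<tau>_def H_def by auto
  define tw where "tw h = (%(E, T). (twist A A' (\<tau> h) E, twist A A' (\<tau> h) T))" for h
  have tw: "bij_betw (tw h) (S2 A A') (S2 A A')" "\<And>x. x \<in> S2 A A' ==> wt (tw h x) = wt x" if h: "h \<in> H" for h
  proof -
   note b = bij[OF h]
   have sub: "tw h ` S2 A A' \<subseteq> S2 A A'"
   proof
    fix y assume "y \<in> tw h ` S2 A A'"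
    then obtain E T where ET: "(E, T) \<in> S2 A A'" "y = (twist A A' (\<tau> h) E, twist A A' (\<tau> h) T)"
     by (auto simp: tw_def)
    then have E: "E \<subseteq> pairs n" "T \<in> bfs_trees E u" "A = sphere E u s" "A' = sphere E u (Suc s)"
     by (auto simp: S2_def S_def)
    have "twist A A' (\<tau> h) E \<subseteq> pairs n" by (rule twist_subset[OF b An(1) E(1)])
    moreover have "twist A A' (\<tau> h) T \<in> bfs_trees (twist A A' (\<tau> h) E) u"
     using twist_bfs[OF b E(3,4) E(2)] .
    ultimately show "y \<in> S2 A A'"
     unfolding ET(2) S2_def S_def using sphere_twist[OF b E(3,4)] E(3,4) by simp
   qed
   have inj: "inj_on (tw h) (S2 A A')"
   proof (rule inj_onI)
    fix y y' assume "tw h y = tw h y'"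
    then have "twist A A' (\<tau> h) (fst y) = twist A A' (\<tau> h) (fst y')"
     "twist A A' (\<tau> h) (snd y) = twist A A' (\<tau> h) (snd y')" by (simp_all add: tw_def split_def)
    then have "fst y = fst y'" "snd y = snd y'"
     using inj_twist[of A' "\<tau> h" A, OF b] by metis+
    then show "y = y'" by (rule prod_eqI)
   qed
   have "finite (S2 A A')" using finS by (rule rev_finite_subset) (auto simp: S2_def)
   then show "bij_betw (tw h) (S2 A A') (S2 A A')"
    using inj sub by (simp add: bij_betw_def endo_inj_surj)
   fix x assume x: "x \<in> S2 A A'"
   obtain E T where ET: "x = (E, T)" by force
   have E: "E \<subseteq> pairs n" "T \<in> bfs_trees E u" "A = sphere E u s" "A' = sphere E u (Suc s)"
    using x by (auto simp: ET S2_def S_def)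
   have "finite E" using E(1) by (rule finite_subset) auto
   then show "wt (tw h x) = wt x"
    unfolding ET tw_def wt_def
    using tree_weight_twist[OF b E(3,4) _ E(2)] card_twist[OF b] by (simp add: edge_weight_def)
  qed
  have avg: "(\<Sum>h\<in>H. Y' (tw h xx)) <= real (card H)" if xS: "xx \<in> S2 A A'" for xx
  proof -
   obtain E T where ET: "xx = (E, T)" by force
   have E: "E \<subseteq> pairs n" "T \<in> bfs_trees E u" "A = sphere E u s" "A' = sphere E u (Suc s)"
    using xS by (auto simp: ET S2_def S_def)
   let ?W = "W E T"
   define \<mu> where "\<mu> = (\<Sum>a\<in>A. ?W a) / real ?m"
   \<comment> \<open>The new parent is the preimage of the old one under the shift.\<close>
   define par where "par i b = (THE a. a \<in> A \<and> \<sigma> i a = b)" for i b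
   have par: "par i b \<in> A" "\<sigma> i (par i b) = b" "\<And>a. a \<in> A ==> \<sigma> i a = b ==> par i b = a"
    if "i < ?m" "b \<in> A" for i b
   proof -
    have "\<exists>!a. a \<in> A \<and> \<sigma> i a = b"
     using \<sigma>(1)[OF that(1)] that(2) unfolding bij_betw_iff_bijections by metis
    from theI'[OF this] this show "par i b \<in> A" "\<sigma> i (par i b) = b"
     "\<And>a. a \<in> A ==> \<sigma> i a = b ==> par i b = a"
     unfolding par_def by (auto intro: the1_equality)
   qed
   have b_in: "parent T j \<in> A" if "j \<in> A'" for j
    using parent(2)[OF E(2)] that E(3,4) by simp
   define F where "F j i = exp (x * (?W (par i (parent T j)) - \<mu>) - 4 * B\<^sup>2 * x\<^sup>2)" for j i
   have Yh: "Y' (tw h xx) = (\<Prod>j\<in>A'. F j (h j))" if h: "h \<in> H" for h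
   proof -
    note b = bij[OF h]
    have sph: "sphere (twist A A' (\<tau> h) E) u s = A" "sphere (twist A A' (\<tau> h) E) u (Suc s) = A'"
     using sphere_twist[of A' "\<tau> h" A, OF b E(3,4)] E(3,4) by simp_all
    have hj: "h j < ?m" if "j \<in> A'" for j using h that by (auto simp: H_def)
    have Wt: "W (twist A A' (\<tau> h) E) (twist A A' (\<tau> h) T) a = ?W a" if "a \<in> A" for a
     using Winv[OF E(2), of a "\<tau> h"] that b E(3,4) by simp
    have pt: "parent (twist A A' (\<tau> h) T) j = par (h j) (parent T j)" if j: "j \<in> A'" for j
     using parent_twist[of A' "\<tau> h" A, OF b E(3,4) E(2) j] par(3)[OF hj[OF j] b_in[OF j]] by (simp add: \<tau>_def)
    have "Y' (tw h xx) = exp (x * ((\<Sum>j\<in>A'. ?W (par (h j) (parent T j))) - real (card A') * \<mu>) - 4 * B\<^sup>2 * x\<^sup>2 * real (card A'))"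
     unfolding Y'_def Y_def tw_def ET prod.case sph \<mu>_def
     using par(1)[OF hj b_in] by (simp add: pt Wt)
    also have "... = exp (\<Sum>j\<in>A'. x * (?W (par (h j) (parent T j)) - \<mu>) - 4 * B\<^sup>2 * x\<^sup>2)"
     by (simp add: sum_subtractf sum_distrib_left[symmetric] right_diff_distrib mult_ac)
    also have "... = (\<Prod>j\<in>A'. F j (h j))" unfolding F_def using finA by (simp add: exp_sum)
    finally show ?thesis .
   qed
   have W_le: "\<bar>?W a - \<mu>\<bar> <= 2 * B" if a: "a \<in> A" for a
   proof -
    have m0: "0 < real ?m" using a finA by (auto simp: card_gt_0_iff)
    have "\<bar>\<Sum>a\<in>A. ?W a\<bar> <= (\<Sum>a\<in>A. \<bar>?W a\<bar>)" by (rule sum_abs)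
    also have "... <= real ?m * B" using WB by (intro sum_bounded_above)
    finally have "\<bar>\<mu>\<bar> <= B" unfolding \<mu>_def using m0 by (simp add: abs_divide divide_le_eq mult.commute)
    with WB[of E T a] show ?thesis by linarith
   qed
   have Fsum: "(\<Sum>i<?m. F j i) <= real ?m" if j: "j \<in> A'" for j
   proof -
    let ?b = "parent T j"
    have bA: "?b \<in> A" by (rule b_in[OF j])
    then have m0: "0 < real ?m" using finA by (auto simp: card_gt_0_iff)
    \<comment> \<open>As the shift varies, the parent runs through the earlier layer exactly once,
      so the sum over shifts is a sum over this layer and the linear term vanishes.\<close>
    have bb: "bij_betw (%i. par i ?b) {..<?m} A"
    proof (rule bij_betw_imageI)
     show "inj_on (%i. par i ?b) {..<?m}"
     proof (rule inj_onI)
      fix i i' assume i: "i \<in> {..<?m}" "i' \<in> {..<?m}" "par i ?b = par i' ?b"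
      then have "\<sigma> i (par i ?b) = ?b" "\<sigma> i' (par i ?b) = ?b" "par i ?b \<in> A"
       using par(1,2)[OF _ bA, of i] par(1,2)[OF _ bA, of i'] i by auto
      then show "i = i'" using \<sigma>(2)[OF _ bA] i by blast
     qed
     show "(%i. par i ?b) ` {..<?m} = A"
     proof (intro equalityI subsetI)
      fix a assume a: "a \<in> A"
      then obtain i where "i < ?m" "\<sigma> i a = ?b" using \<sigma>(2)[OF a bA] by blast
      then show "a \<in> (%i. par i ?b) ` {..<?m}" using par(3)[OF _ bA a] by blast
     qed (use par(1)[OF _ bA] in auto)
    qed
    have "(\<Sum>i<?m. F j i) = (\<Sum>i<?m. exp (x * (?W (par i ?b) - \<mu>))) * exp (- (4 * B\<^sup>2 * x\<^sup>2))"
     unfolding F_def sum_distrib_right by (simp flip: exp_add)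
    also have "(\<Sum>i<?m. exp (x * (?W (par i ?b) - \<mu>))) = (\<Sum>a\<in>A. exp (x * (?W a - \<mu>)))"
     by (rule sum.reindex_bij_betw[OF bb])
    also have "... <= (\<Sum>a\<in>A. 1 + x * (?W a - \<mu>) + 4 * B\<^sup>2 * x\<^sup>2)"
    proof (rule sum_mono)
     fix a assume a: "a \<in> A"
     let ?t = "?W a - \<mu>"
     have "\<bar>x * ?t\<bar> <= (1 / (2 * B)) * (2 * B)"
      unfolding abs_mult using x W_le[OF a] B by (intro mult_mono) auto
     then have 1: "\<bar>x * ?t\<bar> <= 1" using B by simp
     have "?t\<^sup>2 <= (2 * B)\<^sup>2" using W_le[OF a] by (metis abs_ge_zero power2_abs power_mono)
     then have "x\<^sup>2 * ?t\<^sup>2 <= x\<^sup>2 * (2 * B)\<^sup>2" by (rule mult_left_mono) simp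
     then have "(x * ?t)\<^sup>2 <= 4 * B\<^sup>2 * x\<^sup>2" by (simp add: power_mult_distrib mult_ac)
     with exp_le_quadratic[OF 1] show "exp (x * ?t) <= 1 + x * ?t + 4 * B\<^sup>2 * x\<^sup>2" by linarith
    qed
    also have "... = real ?m * (1 + 4 * B\<^sup>2 * x\<^sup>2)"
    proof -
     have "(\<Sum>a\<in>A. ?W a - \<mu>) = 0" unfolding sum_subtractf \<mu>_def using m0 by simp
     then have "(\<Sum>a\<in>A. x * (?W a - \<mu>)) = 0" by (simp flip: sum_distrib_left)
     then show ?thesis by (simp add: sum.distrib distrib_left)
    qed
    also have "... <= real ?m * exp (4 * B\<^sup>2 * x\<^sup>2)"
     by (intro mult_left_mono exp_ge_add_one_self) auto
    finally have "(\<Sum>i<?m. F j i) <= real ?m * exp (4 * B\<^sup>2 * x\<^sup>2) * exp (- (4 * B\<^sup>2 * x\<^sup>2))"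
     by (simp add: mult_right_mono)
    then show ?thesis by (simp add: mult.assoc flip: exp_add)
   qed
   have "(\<Sum>h\<in>H. Y' (tw h xx)) = (\<Sum>h\<in>H. \<Prod>j\<in>A'. F j (h j))" using Yh by simp
   also have "... = (\<Prod>j\<in>A'. \<Sum>i<?m. F j i)" unfolding H_def using finA by (subst prod_sum_PiE) auto
   also have "... <= (\<Prod>j\<in>A'. real ?m)" using Fsum by (intro prod_mono) (auto simp: F_def sum_nonneg)
   finally show ?thesis by (simp add: cardH)
  qed
  have H0: "0 < real (card H)" using Ane finA by (auto simp: cardH card_gt_0_iff)
  have "real (card H) * (\<Sum>y\<in>S2 A A'. wt y * Y' y) = (\<Sum>h\<in>H. \<Sum>y\<in>S2 A A'. wt y * Y' y)" by simp
  also have "... = (\<Sum>h\<in>H. \<Sum>y\<in>S2 A A'. wt y * Y' (tw h y))"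
  proof (rule sum.cong[OF refl])
   fix h assume h: "h \<in> H"
   have "(\<Sum>y\<in>S2 A A'. wt y * Y' y) = (\<Sum>y\<in>S2 A A'. wt (tw h y) * Y' (tw h y))"
    by (rule sum.reindex_bij_betw[OF tw(1)[OF h], symmetric])
   then show "(\<Sum>y\<in>S2 A A'. wt y * Y' y) = (\<Sum>y\<in>S2 A A'. wt y * Y' (tw h y))" using tw(2)[OF h] by simp
  qed
  also have "... = (\<Sum>y\<in>S2 A A'. wt y * (\<Sum>h\<in>H. Y' (tw h y)))"
   by (subst sum.swap) (simp add: sum_distrib_left)
  also have "... <= (\<Sum>y\<in>S2 A A'. wt y * real (card H))"
   using avg wt0 by (intro sum_mono mult_left_mono) auto
  finally have "real (card H) * (\<Sum>y\<in>S2 A A'. wt y * Y' y) <= real (card H) * (\<Sum>y\<in>S2 A A'. wt y)"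
   by (simp add: sum_distrib_left mult.commute)
  then show ?thesis using H0 by simp
 qed simp
 \<comment> \<open>Configurations are grouped by their pair of layers, because the shifts act within
   each group.\<close>
 define g where "g = (%(E, T :: edges). (sphere E u s, sphere E u (Suc s)))"
 have grp: "(\<Sum>y\<in>S. G y) = (\<Sum>AA\<in>g ` S. \<Sum>y\<in>S2 (fst AA) (snd AA). G y)" for G :: "edges \<times> edges => real"
 proof -
  have "S2 (fst AA) (snd AA) = {y \<in> S. g y = AA}" for AA
   by (auto simp: S2_def g_def prod_eq_iff)
  then show ?thesis using sum.group[OF finS finite_imageI[OF finS] order_refl, of G g] by simp
 qed
 have "(\<Sum>y\<in>S. wt y * Y' y) <= (\<Sum>y\<in>S. wt y)"
  unfolding grp by (intro sum_mono key)
 then show ?thesis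
  using reduce[of Y] reduce[of "%_ _. 1"] by (simp add: Y'_def split_def)
qed

section \<open>The random edge sets\<close>

lemma pmf_part: "pmf part_pmf Part1 = 1/4" "pmf part_pmf Part2 = 1/4" "pmf part_pmf Part3 = 1/2"
proof -
 have "pmf_of_list_wf [(Part1, 1/4), (Part2, 1/4), (Part3, 1/2 :: real)]"
  by (auto simp: pmf_of_list_wf_def)
 then show "pmf part_pmf Part1 = 1/4" "pmf part_pmf Part2 = 1/4" "pmf part_pmf Part3 = 1/2"
  by (simp_all add: part_pmf_def pmf_pmf_of_list)
qed

lemma thin_prob_bounds: "0 < p ==> p <= 1 ==> 0 < thin_prob p \<and> thin_prob p <= 1 \<and> thin_prob p <= p \<and> p / 4 <= thin_prob p"
 unfolding thin_prob_def by (auto simp: field_simps)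

lemma sum_coin_pmf:
 assumes "0 < p" "p <= 1"
 shows "(\<Sum>v\<in>UNIV. pmf (coin_pmf p) v * g v) =
  p * (1/4 * (thin_prob p * g (True, Part1, True) + (1 - thin_prob p) * g (True, Part1, False))
   + 1/4 * (thin_prob p * g (True, Part2, True) + (1 - thin_prob p) * g (True, Part2, False))
   + 1/2 * (thin_prob p * g (True, Part3, True) + (1 - thin_prob p) * g (True, Part3, False)))
  + (1 - p) * (1/4 * (thin_prob p * g (False, Part1, True) + (1 - thin_prob p) * g (False, Part1, False))
   + 1/4 * (thin_prob p * g (False, Part2, True) + (1 - thin_prob p) * g (False, Part2, False))
   + 1/2 * (thin_prob p * g (False, Part3, True) + (1 - thin_prob p) * g (False, Part3, False)))"
proof -
 have t: "0 <= thin_prob p" "thin_prob p <= 1" using thin_prob_bounds[OF assms] by auto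
 have U: "(UNIV :: (bool \<times> part \<times> bool) set) = UNIV \<times> UNIV \<times> UNIV" by simp
 show ?thesis
  unfolding U sum.cartesian_product' using t assms
  by (simp add: UNIV_bool UNIV_part coin_pmf_def pmf_pair pmf_part algebra_simps)
qed

section \<open>Markov and Chernoff bounds for coins and edge sets\<close>

context icf_instance
begin

lemma thin_bounds: "0 < thin_prob p" "thin_prob p <= 1" "thin_prob p <= p" "p / 4 <= thin_prob p"
 using thin_prob_bounds[OF p_pos p_le_1] by auto

lemma sum_coin_weight_parts:
 assumes "\<And>e v. e \<in> pairs n ==> g e v = (if fst v then G e (fst (snd v)) else G0 e)"
 shows "(\<Sum>c\<in>coin_configs n. cweight c * (\<Prod>e\<in>pairs n. g e (c e)))
  = (\<Prod>e\<in>pairs n. p * (G e Part1 / 4 + G e Part2 / 4 + G e Part3 / 2) + (1 - p) * (G0 e :: real))"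
 unfolding sum_coin_weight_prod
 by (intro prod.cong refl, subst sum_coin_pmf[OF p_pos p_le_1]) (simp add: assms field_simps)

text \<open>Markov's inequality for a test function that may depend on coins and trees. The
  conditions concern configurations of positive weight only, since there the trees are genuine
  breadth-first trees.\<close>

lemma prob_le_joint:
 assumes P: "\<And>c \<tau>. c \<in> coin_configs n ==> \<tau> \<in> tree_configs n ==> Measurable.pred LZ (P c \<tau>)"
  and hm: "\<And>c \<tau>. c \<in> coin_configs n ==> \<tau> \<in> tree_configs n ==> 0 < jweight c \<tau> ==> integrable M (%\<xi>. h c \<tau> (TZ \<xi>))"
  and h0: "\<And>c \<tau> x. c \<in> coin_configs n ==> \<tau> \<in> tree_configs n ==> 0 < jweight c \<tau> ==> x \<in> Dom ==> (0::real) <= h c \<tau> x"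
  and h1: "\<And>c \<tau> x. c \<in> coin_configs n ==> \<tau> \<in> tree_configs n ==> 0 < jweight c \<tau> ==> x \<in> Dom ==> P c \<tau> x ==> 1 <= h c \<tau> x"
 shows "prob {\<xi> \<in> space M. P (coinsv \<xi>) (trees \<xi>) (TZ \<xi>)}
  <= (\<Sum>c\<in>coin_configs n. \<Sum>\<tau>\<in>tree_configs n. jweight c \<tau> * expectation (%\<xi>. h c \<tau> (TZ \<xi>)))"
proof -
 have eq: "prob {\<xi> \<in> space M. P (coinsv \<xi>) (trees \<xi>) (TZ \<xi>)} =
  (\<Sum>c\<in>coin_configs n. \<Sum>\<tau>\<in>tree_configs n. jweight c \<tau> * prob {\<xi> \<in> space M. P c \<tau> (TZ \<xi>)})"
  by (rule prob_joint) (rule P)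
 show ?thesis unfolding eq
proof (intro sum_mono)
 fix c \<tau> assume c: "c \<in> coin_configs n" and t: "\<tau> \<in> tree_configs n"
 show "jweight c \<tau> * prob {\<xi> \<in> space M. P c \<tau> (TZ \<xi>)} <= jweight c \<tau> * expectation (%\<xi>. h c \<tau> (TZ \<xi>))"
 proof (cases "jweight c \<tau> = 0")
  case False
  then have w: "0 < jweight c \<tau>" using joint_weight_nonneg[of n p c \<tau>] by linarith
  note P[OF c t, measurable]
  have ev: "{\<xi> \<in> space M. P c \<tau> (TZ \<xi>)} \<in> sets M" by measurable
  then have "prob {\<xi> \<in> space M. P c \<tau> (TZ \<xi>)} = expectation (indicat_real {\<xi> \<in> space M. P c \<tau> (TZ \<xi>)})" by simp
  also have "... <= expectation (%\<xi>. h c \<tau> (TZ \<xi>))"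
  proof (rule integral_mono[OF _ hm[OF c t w]])
   show "integrable M (indicat_real {\<xi> \<in> space M. P c \<tau> (TZ \<xi>)})"
    using ev by (intro integrable_const_bound[where B = 1]) auto
  qed (auto simp: indicator_def TZ_Dom intro!: h0[OF c t w] h1[OF c t w])
  finally show ?thesis by (intro mult_left_mono) auto
 qed simp
qed
qed

lemma prob_le_uniform:
 assumes P: "\<And>c \<tau>. c \<in> coin_configs n ==> \<tau> \<in> tree_configs n ==> Measurable.pred LZ (P c \<tau>)"
  and b: "\<And>c \<tau>. c \<in> coin_configs n ==> \<tau> \<in> tree_configs n ==> 0 < jweight c \<tau> ==>
   prob {\<xi> \<in> space M. P c \<tau> (TZ \<xi>)} <= b" and b0: "0 <= b"
 shows "prob {\<xi> \<in> space M. P (coinsv \<xi>) (trees \<xi>) (TZ \<xi>)} <= b"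
proof -
 have eq: "prob {\<xi> \<in> space M. P (coinsv \<xi>) (trees \<xi>) (TZ \<xi>)} =
  (\<Sum>c\<in>coin_configs n. \<Sum>\<tau>\<in>tree_configs n. jweight c \<tau> * prob {\<xi> \<in> space M. P c \<tau> (TZ \<xi>)})"
  by (rule prob_joint) (rule P)
 have "prob {\<xi> \<in> space M. P (coinsv \<xi>) (trees \<xi>) (TZ \<xi>)}
   <= (\<Sum>c\<in>coin_configs n. \<Sum>\<tau>\<in>tree_configs n. jweight c \<tau> * b)"
  unfolding eq
 proof (intro sum_mono)
  fix c \<tau> assume c: "c \<in> coin_configs n" "\<tau> \<in> tree_configs n"
  show "jweight c \<tau> * prob {\<xi> \<in> space M. P c \<tau> (TZ \<xi>)} <= jweight c \<tau> * b"
   using b[OF c] joint_weight_nonneg[of n p c \<tau>]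
   by (cases "jweight c \<tau> = 0") (auto intro!: mult_left_mono)
 qed
 also have "... = b * (\<Sum>c\<in>coin_configs n. \<Sum>\<tau>\<in>tree_configs n. jweight c \<tau>)"
  by (simp add: sum_distrib_left mult.commute)
 also have "... <= b" using mult_left_mono[OF sum_joint_weight_le_1[of n p] b0] by simp
 finally show ?thesis .
qed

lemma prob_coins_event:
 assumes h0: "\<And>c. c \<in> coin_configs n ==> (0::real) <= h c" and h1: "\<And>c. c \<in> coin_configs n ==> P c ==> 1 <= h c"
 shows "{\<xi> \<in> space M. P (coinsv \<xi>)} \<in> sets M"
  and "prob {\<xi> \<in> space M. P (coinsv \<xi>)} <= (\<Sum>c\<in>coin_configs n. cweight c * h c)"
proof -
 show "{\<xi> \<in> space M. P (coinsv \<xi>)} \<in> sets M"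
  using joint_event[of "%c \<tau> x. P c"] by simp
 have "prob {\<xi> \<in> space M. P (coinsv \<xi>)} <= (\<Sum>c\<in>coin_configs n. \<Sum>\<tau>\<in>tree_configs n. jweight c \<tau> * expectation (%\<xi>. h c))"
  by (rule prob_le_joint[where P = "%c \<tau> x. P c" and h = "%c \<tau> x. h c"]) (auto simp: h0 h1)
 also have "... <= (\<Sum>c\<in>coin_configs n. cweight c * h c)"
  using sum_joint_weight_le[of n h p] h0 by (simp add: prob_space)
 finally show "prob {\<xi> \<in> space M. P (coinsv \<xi>)} <= (\<Sum>c\<in>coin_configs n. cweight c * h c)" .
qed

lemma coin_sum_exp_part:
 assumes R: "R \<subseteq> pairs n"
 shows "(\<Sum>c\<in>coin_configs n. cweight c * exp (y * real (card (part_edges n k c \<inter> R))))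
  = (1 + p * (if k = Part3 then 1/2 else 1/4) * (exp y - 1)) ^ card R"
proof -
 have fin: "finite R" using R by (rule finite_subset) auto
 define g where "g e v = (if e \<in> R \<and> fst v \<and> fst (snd v) = k then exp y else (1::real))" for e and v :: "bool \<times> part \<times> bool"
 define G where "G e k' = (if e \<in> R \<and> k' = k then exp y else (1::real))" for e k'
 have "exp (y * real (card (part_edges n k c \<inter> R))) = (\<Prod>e\<in>pairs n. g e (c e))" for c
 proof -
  have "(\<Prod>e\<in>pairs n. g e (c e)) = (\<Prod>e\<in>part_edges n k c \<inter> R. exp y)"
   using R by (intro prod.mono_neutral_cong_right) (auto simp: g_def part_edges_def)
  then show ?thesis by (simp add: exp_of_nat2_mult mult.commute)
 qed
 then have "(\<Sum>c\<in>coin_configs n. cweight c * exp (y * real (card (part_edges n k c \<inter> R))))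
   = (\<Sum>c\<in>coin_configs n. cweight c * (\<Prod>e\<in>pairs n. g e (c e)))" by simp
 also have "... = (\<Prod>e\<in>pairs n. p * (G e Part1 / 4 + G e Part2 / 4 + G e Part3 / 2) + (1 - p) * 1)"
  by (rule sum_coin_weight_parts) (simp add: g_def G_def)
 also have "... = (\<Prod>e\<in>pairs n. if e \<in> R then 1 + p * (if k = Part3 then 1/2 else 1/4) * (exp y - 1) else 1)"
  by (intro prod.cong refl) (cases k; auto simp: G_def field_simps)
 also have "... = (1 + p * (if k = Part3 then 1/2 else 1/4) * (exp y - 1)) ^ card R"
  using R by (subst prod.inter_restrict[symmetric]) (auto simp: Int_absorb1)
 finally show ?thesis .
qed

lemma power_le_exp: "0 <= 1 + a ==> (1 + a) ^ m <= exp (real m * (a::real))"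
proof -
 assume "0 <= 1 + a"
 then have "(1 + a) ^ m <= exp a ^ m" by (intro power_mono exp_ge_add_one_self)
 then show ?thesis by (simp add: exp_of_nat_mult)
qed

lemma exp_m1_bounds: "exp (- 1 :: real) <= 1 / 2"
proof -
 have "(2::real) <= exp 1" using exp_ge_add_one_self[of 1] by simp
 then show ?thesis by (simp add: exp_minus field_simps)
qed

text \<open>A pair is in the third part with probability p/2, so the threshold is a quarter of the
  mean. The parameter -1 together with \<open>exp (- 1) <= 1 / 2\<close> gives the exponent
  \<open>p / 8 - p / 4\<close> per pair.\<close>

lemma coin_sum_lower_tail:
 assumes R: "R \<subseteq> pairs n"
 shows "(\<Sum>c\<in>coin_configs n. cweight c * of_bool (real (card (part_edges n Part3 c \<inter> R)) < p * real (card R) / 8))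
  <= exp (- p * real (card R) / 8)"
proof -
 have "(\<Sum>c\<in>coin_configs n. cweight c * of_bool (real (card (part_edges n Part3 c \<inter> R)) < p * real (card R) / 8))
   <= (\<Sum>c\<in>coin_configs n. cweight c * (exp (p * real (card R) / 8) * exp ((- 1) * real (card (part_edges n Part3 c \<inter> R)))))"
  by (intro sum_mono mult_left_mono) (auto simp flip: exp_add)
 also have "... = exp (p * real (card R) / 8) * (1 + p * (1/2) * (exp (- 1) - 1)) ^ card R"
  unfolding mult.left_commute[of "cweight _"] sum_distrib_left[symmetric]
  by (subst coin_sum_exp_part[OF R]) simp
 also have "(1 + p * (1/2) * (exp (- 1) - 1)) ^ card R <= exp (real (card R) * (p * (1/2) * (exp (- 1) - 1)))"
 proof (rule power_le_exp)
  have "p * (1 - exp (- 1)) <= 1 * 1" using p_pos p_le_1 by (intro mult_mono) auto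
  moreover have "p * (1/2) * (exp (- 1) - 1) = - (p * (1 - exp (- 1)) / 2)" by (simp add: field_simps)
  ultimately show "0 <= 1 + p * (1/2) * (exp (- 1) - 1)" by linarith
 qed
 also have "real (card R) * (p * (1/2) * (exp (- 1) - 1)) <= real (card R) * (p * (1/2) * (- 1/2))"
  using exp_m1_bounds p_pos by (intro mult_left_mono) auto
 finally show ?thesis by (simp add: algebra_simps flip: exp_add)
qed

text \<open>The mean degree in the first part is np/4, and 0.275 is ten percent above 1/4. With
  parameter 0.05 the exponent is 0.0525/4 - 0.05 * 0.275 = -0.000625 per unit of np, which is below
  -1/2000.\<close>

lemma outdegree_event:
 "prob {\<xi> \<in> space M. \<exists>i\<in>{1..n}. real (card {j. (i, j) \<in> edges1 (coinsv \<xi>)}) > 0.275 * real n * p}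
  <= real n * exp (- real n * p / 2000)"
proof -
 let ?d = "%c i. real (card (edges1 c \<inter> {i} \<times> {1..n}))"
 have d: "card {j. (i, j) \<in> edges1 c} = card (edges1 c \<inter> {i} \<times> {1..n})" for i c
  by (rule bij_betw_same_card[of "%j. (i, j)"]) (auto simp: bij_betw_def inj_on_def part_edges_def)
 define h where "h c = (\<Sum>i\<in>{1..n}. exp (- (0.05 * (0.275 * real n * p))) * exp (0.05 * ?d c i))" for c
 have "prob {\<xi> \<in> space M. \<exists>i\<in>{1..n}. real (card {j. (i, j) \<in> edges1 (coinsv \<xi>)}) > 0.275 * real n * p}
   <= (\<Sum>c\<in>coin_configs n. cweight c * h c)"
 proof (rule prob_coins_event(2))
  show "0 <= h c" for c unfolding h_def by (intro sum_nonneg) auto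
  fix c assume "\<exists>i\<in>{1..n}. real (card {j. (i, j) \<in> edges1 c}) > 0.275 * real n * p"
  then obtain i where i: "i \<in> {1..n}" "?d c i > 0.275 * real n * p" unfolding d by blast
  have "1 <= exp (0.05 * (?d c i - 0.275 * real n * p))" using i(2) by simp
  also have "... = exp (- (0.05 * (0.275 * real n * p))) * exp (0.05 * ?d c i)"
   by (simp only: exp_add[symmetric]) (simp add: algebra_simps)
  finally have "1 <= exp (- (0.05 * (0.275 * real n * p))) * exp (0.05 * ?d c i)" .
  also have "... <= h c" unfolding h_def using i(1) by (intro member_le_sum) auto
  finally show "1 <= h c" .
 qed
 also have "... = (\<Sum>i\<in>{1..n}. exp (- (0.05 * (0.275 * real n * p))) *
   (\<Sum>c\<in>coin_configs n. cweight c * exp (0.05 * ?d c i)))"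
  unfolding h_def sum_distrib_left by (subst sum.swap) (simp add: mult_ac)
 also have "... <= (\<Sum>i\<in>{1..n}. exp (- real n * p / 2000))"
 proof (rule sum_mono)
  fix i assume i: "i \<in> {1..n}"
  have e: "exp 0.05 - 1 <= (0.0525 :: real)" using exp_le_quadratic[of "0.05"] by (simp add: power2_eq_square)
  have "(\<Sum>c\<in>coin_configs n. cweight c * exp (0.05 * ?d c i)) = (1 + p * (1/4) * (exp 0.05 - 1)) ^ n"
   using i by (subst coin_sum_exp_part) (auto simp: card_cartesian_product)
  also have "... <= exp (real n * (p * (1/4) * (exp 0.05 - 1)))" using p_pos by (intro power_le_exp) simp
  also have "... <= exp (real n * (p * (1/4) * 0.0525))"
   unfolding exp_le_cancel_iff using e p_pos by (intro mult_left_mono) auto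
  finally have "exp (- (0.05 * (0.275 * real n * p))) * (\<Sum>c\<in>coin_configs n. cweight c * exp (0.05 * ?d c i))
    <= exp (- (0.05 * (0.275 * real n * p))) * exp (real n * (p * (1/4) * 0.0525))" by simp
  also have "... <= exp (- real n * p / 2000)" using p_pos by (simp add: field_simps flip: exp_add)
  finally show "exp (- (0.05 * (0.275 * real n * p))) * (\<Sum>c\<in>coin_configs n. cweight c * exp (0.05 * ?d c i))
    <= exp (- real n * p / 2000)" .
 qed
 finally show ?thesis by simp
qed

definition out_nbrs :: "edges => nat set => nat set" where
 "out_nbrs E A = {j \<in> {1..n}. \<exists>a\<in>A. (a, j) \<in> E}"

text \<open>Different target vertices are missed independently, each with probability
  \<open>(1 - p / 4) ^ card A\<close>; hence an \<open>n\<close>-th power.\<close>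

lemma coin_sum_exp_out_nbrs:
 assumes A: "A \<subseteq> {1..n}"
 shows "(\<Sum>c\<in>coin_configs n. cweight c * exp (- real (card (out_nbrs (edges1 c) A))))
  = (exp (- 1) + (1 - exp (- 1)) * (1 - p / 4) ^ card A) ^ n"
proof -
 let ?b = "1 - exp (- 1 :: real)"
 have fA: "finite A" using A by (rule finite_subset) auto
 have e: "exp (- real (card (out_nbrs (edges1 c) A)))
   = (\<Sum>J\<in>Pow {1..n}. (exp (- 1)) ^ (n - card J) * ?b ^ card J * (\<Prod>e\<in>pairs n. of_bool (e \<in> A \<times> J \<longrightarrow> e \<notin> edges1 c)))" for c
 proof -
  let ?N = "out_nbrs (edges1 c) A"
  have N: "?N \<subseteq> {1..n}" by (auto simp: out_nbrs_def)
  have "exp (- real (card ?N)) = (\<Prod>j\<in>?N. exp (- 1))" by (simp flip: exp_of_nat_mult)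
  also have "... = (\<Prod>j\<in>{1..n}. if j \<in> ?N then exp (- 1) else 1)"
   using N by (intro prod.mono_neutral_cong_left) auto
  \<comment> \<open>Each factor is affine in the indicator of being missed, so the product expands
    over sets \<open>J\<close> of missed targets.\<close>
  also have "... = (\<Prod>j\<in>{1..n}. ?b * of_bool (j \<notin> ?N) + exp (- 1))" by (intro prod.cong) auto
  also have "... = (\<Sum>J\<in>Pow {1..n}. (\<Prod>j\<in>J. ?b * of_bool (j \<notin> ?N)) * (\<Prod>j\<in>{1..n} - J. exp (- 1)))"
   by (rule prod_add) simp
  also have "... = (\<Sum>J\<in>Pow {1..n}. (exp (- 1)) ^ (n - card J) * ?b ^ card J * (\<Prod>e\<in>pairs n. of_bool (e \<in> A \<times> J \<longrightarrow> e \<notin> edges1 c)))"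
  proof (intro sum.cong refl)
   fix J assume "J \<in> Pow {1..n}"
   then have J: "J \<subseteq> {1..n}" "finite J" by (auto intro: finite_subset)
   have of_bool_prod: "(\<Prod>x\<in>S. of_bool (Q x)) = (of_bool (\<forall>x\<in>S. Q x) :: real)" if "finite S" for S :: "'b set" and Q
    using that by (induction S rule: finite_induct) auto
   have "(\<forall>j\<in>J. j \<notin> ?N) \<longleftrightarrow> (\<forall>e\<in>pairs n. e \<in> A \<times> J \<longrightarrow> e \<notin> edges1 c)"
    using J A part_edges_subset[of n Part1 c] unfolding out_nbrs_def by blast
   then have "(\<Prod>j\<in>J. of_bool (j \<notin> ?N)) = (\<Prod>e\<in>pairs n. of_bool (e \<in> A \<times> J \<longrightarrow> e \<notin> edges1 c) :: real)"
    using of_bool_prod[OF J(2), of "%j. j \<notin> ?N"]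
     of_bool_prod[of "pairs n" "%e. e \<in> A \<times> J \<longrightarrow> e \<notin> edges1 c"] by simp
   then show "(\<Prod>j\<in>J. ?b * of_bool (j \<notin> ?N)) * (\<Prod>j\<in>{1..n} - J. exp (- 1))
     = (exp (- 1)) ^ (n - card J) * ?b ^ card J * (\<Prod>e\<in>pairs n. of_bool (e \<in> A \<times> J \<longrightarrow> e \<notin> edges1 c))"
    using J by (simp add: prod.distrib card_Diff_subset)
  qed
  finally show ?thesis .
 qed
 have col: "(\<Sum>c\<in>coin_configs n. cweight c * (\<Prod>e\<in>pairs n. of_bool (e \<in> A \<times> J \<longrightarrow> e \<notin> edges1 c)))
   = ((1 - p / 4) ^ card A) ^ card J" if J: "J \<subseteq> {1..n}" for J
 proof -
  define g where "g e v = (of_bool (e \<in> A \<times> J \<longrightarrow> \<not> (fst v \<and> fst (snd v) = Part1)) :: real)" for e and v :: "bool \<times> part \<times> bool"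
  define G where "G e k = (of_bool (e \<in> A \<times> J \<longrightarrow> k \<noteq> Part1) :: real)" for e k
  have "(\<Prod>e\<in>pairs n. of_bool (e \<in> A \<times> J \<longrightarrow> e \<notin> edges1 c)) = (\<Prod>e\<in>pairs n. g e (c e))" for c
   by (intro prod.cong refl) (simp add: g_def part_edges_def)
  then have "(\<Sum>c\<in>coin_configs n. cweight c * (\<Prod>e\<in>pairs n. of_bool (e \<in> A \<times> J \<longrightarrow> e \<notin> edges1 c)))
    = (\<Sum>c\<in>coin_configs n. cweight c * (\<Prod>e\<in>pairs n. g e (c e)))" by (simp only:)
  also have "... = (\<Prod>e\<in>pairs n. p * (G e Part1 / 4 + G e Part2 / 4 + G e Part3 / 2) + (1 - p) * 1)"
   by (rule sum_coin_weight_parts) (simp add: g_def G_def)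
  also have "... = (\<Prod>e\<in>pairs n. if e \<in> A \<times> J then 1 - p / 4 else 1)"
   by (intro prod.cong refl) (auto simp: G_def algebra_simps)
  also have "... = (1 - p / 4) ^ card (A \<times> J)"
  proof -
   have "pairs n \<inter> A \<times> J = A \<times> J" using A J by auto
   then show ?thesis by (subst prod.inter_restrict[symmetric]) auto
  qed
  finally show ?thesis by (simp add: card_cartesian_product power_mult)
 qed
 have "(\<Sum>c\<in>coin_configs n. cweight c * exp (- real (card (out_nbrs (edges1 c) A))))
  = (\<Sum>J\<in>Pow {1..n}. (exp (- 1)) ^ (n - card J) * ?b ^ card J *
    (\<Sum>c\<in>coin_configs n. cweight c * (\<Prod>e\<in>pairs n. of_bool (e \<in> A \<times> J \<longrightarrow> e \<notin> edges1 c))))"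
  unfolding e sum_distrib_left by (subst sum.swap) (simp add: mult_ac)
 also have "... = (\<Sum>J\<in>Pow {1..n}. (\<Prod>j\<in>J. ?b * (1 - p / 4) ^ card A) * (\<Prod>j\<in>{1..n} - J. exp (- 1)))"
 proof (intro sum.cong refl)
  fix J assume "J \<in> Pow {1..n}"
  then have J: "J \<subseteq> {1..n}" "finite J" by (auto intro: finite_subset)
  show "(exp (- 1)) ^ (n - card J) * ?b ^ card J *
    (\<Sum>c\<in>coin_configs n. cweight c * (\<Prod>e\<in>pairs n. of_bool (e \<in> A \<times> J \<longrightarrow> e \<notin> edges1 c)))
   = (\<Prod>j\<in>J. ?b * (1 - p / 4) ^ card A) * (\<Prod>j\<in>{1..n} - J. exp (- 1))"
   unfolding col[OF J(1)] using J by (simp add: card_Diff_subset power_mult_distrib)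
 qed
 also have "... = (\<Prod>j\<in>{1..n}. ?b * (1 - p / 4) ^ card A + exp (- 1))"
  by (rule prod_add[symmetric]) simp
 finally show ?thesis by (simp add: add.commute)
qed

text \<open>The union bound over all vertex sets is affordable because \<open>A\<close> fails with
  probability at most \<open>q ^ card A\<close>, where \<open>q = exp (- real n * p / 50)\<close>;
  over all nonempty sets these sum to at most \<open>(1 + q) ^ n - 1\<close>.\<close>

lemma expansion_event:
 "prob {\<xi> \<in> space M. \<exists>A\<subseteq>{1..n}. A \<noteq> {} \<and> p * real (card A) <= 0.08 \<and>
   real (card (out_nbrs (edges1 (coinsv \<xi>)) A)) < real n * p * real (card A) / 10}
  <= (1 + exp (- real n * p / 50)) ^ n - 1"
proof -
 let ?\<A> = "{A. A \<subseteq> {1..n} \<and> A \<noteq> {} \<and> p * real (card A) <= 0.08}"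
 let ?N = "%c A. real (card (out_nbrs (edges1 c) A))"
 define h where "h c = (\<Sum>A\<in>?\<A>. exp (real n * p * real (card A) / 10) * exp (- ?N c A))" for c
 have fin: "finite ?\<A>" by (rule finite_subset[of _ "Pow {1..n}"]) auto
 have "prob {\<xi> \<in> space M. \<exists>A\<subseteq>{1..n}. A \<noteq> {} \<and> p * real (card A) <= 0.08 \<and>
   ?N (coinsv \<xi>) A < real n * p * real (card A) / 10} <= (\<Sum>c\<in>coin_configs n. cweight c * h c)"
 proof (rule prob_coins_event(2))
  show "0 <= h c" for c unfolding h_def by (intro sum_nonneg) auto
  fix c assume "\<exists>A\<subseteq>{1..n}. A \<noteq> {} \<and> p * real (card A) <= 0.08 \<and> ?N c A < real n * p * real (card A) / 10"
  then obtain A where A: "A \<in> ?\<A>" "?N c A < real n * p * real (card A) / 10" by blast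
  have "1 <= exp (real n * p * real (card A) / 10) * exp (- ?N c A)"
   using A(2) by (simp flip: exp_add)
  also have "... <= h c" unfolding h_def using A(1) fin by (intro member_le_sum) auto
  finally show "1 <= h c" .
 qed
 also have "... = (\<Sum>A\<in>?\<A>. exp (real n * p * real (card A) / 10) *
   (\<Sum>c\<in>coin_configs n. cweight c * exp (- ?N c A)))"
  unfolding h_def sum_distrib_left by (subst sum.swap) (simp add: mult_ac)
 also have "... <= (\<Sum>A\<in>?\<A>. exp (- real n * p / 50) ^ card A)"
 proof (rule sum_mono)
  fix A assume A: "A \<in> ?\<A>"
  then have A': "A \<subseteq> {1..n}" by simp
  \<comment> \<open>Smallness of the set gives \<open>y <= 0.02\<close>, so a target is hit with
    probability at least \<open>0.98 * y\<close>. The factor \<open>1 - exp (- 1)\<close> keeps at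
    least half of it, that is 0.1225 np per vertex of \<open>A\<close>; the threshold consumes 0.1
    and 0.0225 remains.\<close>
  define y where "y = p * real (card A) / 4"
  have y: "0 <= y" "y <= 0.02" using A p_pos by (auto simp: y_def)
  have "(1 + (- (p / 4))) ^ card A <= exp (real (card A) * (- (p / 4)))"
   using p_le_1 by (intro power_le_exp) simp
  also have "real (card A) * (- (p / 4)) = - y" by (simp add: y_def)
  also have "exp (- y) <= 1 + (- y) + (- y)\<^sup>2" using y by (intro exp_le_quadratic) simp
  also have "... <= 1 - y + 0.02 * y" using mult_right_mono[OF y(2,1)] by (simp add: power2_eq_square)
  finally have pw: "(1 - p / 4) ^ card A <= 1 - 0.98 * y" by simp
  let ?b = "1 - exp (- 1 :: real)"
  have "exp (- 1) + ?b * (1 - p / 4) ^ card A <= exp (- 1) + ?b * (1 - 0.98 * y)"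
   using pw by (intro add_left_mono mult_left_mono) auto
  also have "... = 1 + (- (?b * (0.98 * y)))" by (simp add: algebra_simps)
  also have "... <= 1 + (- (1/2 * (0.98 * y)))"
  proof -
   have "1/2 <= ?b" using exp_m1_bounds by simp
   from mult_right_mono[OF this, of "0.98 * y"] y show ?thesis by simp
  qed
  finally have le: "exp (- 1) + ?b * (1 - p / 4) ^ card A <= 1 + (- (1/2 * (0.98 * y)))" .
  have "0 <= exp (- 1) + ?b * (1 - p / 4) ^ card A"
   using p_le_1 by (intro add_nonneg_nonneg mult_nonneg_nonneg zero_le_power) auto
  then have "(\<Sum>c\<in>coin_configs n. cweight c * exp (- ?N c A)) <= (1 + (- (1/2 * (0.98 * y)))) ^ n"
   unfolding coin_sum_exp_out_nbrs[OF A'] using le by (intro power_mono)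
  also have "... <= exp (real n * (- (1/2 * (0.98 * y))))" using y by (intro power_le_exp) simp
  finally have "exp (real n * p * real (card A) / 10) * (\<Sum>c\<in>coin_configs n. cweight c * exp (- ?N c A))
   <= exp (real n * p * real (card A) / 10) * exp (real n * (- (1/2 * (0.98 * y))))" by simp
  also have "... = exp (real (card A) * (- real n * p * 0.0225))"
   unfolding y_def by (simp add: algebra_simps flip: exp_add)
  also have "... <= exp (real (card A) * (- real n * p / 50))"
   using p_pos by (auto intro!: mult_left_mono)
  finally show "exp (real n * p * real (card A) / 10) * (\<Sum>c\<in>coin_configs n. cweight c * exp (- ?N c A))
    <= exp (- real n * p / 50) ^ card A" by (simp only: exp_of_nat_mult)
 qed
 also have "... <= (\<Sum>A\<in>Pow {1..n} - {{}}. exp (- real n * p / 50) ^ card A)"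
  by (intro sum_mono2) auto
 also have "... = (\<Sum>A\<in>Pow {1..n}. exp (- real n * p / 50) ^ card A) - 1"
  by (subst sum_diff1) auto
 also have "(\<Sum>A\<in>Pow {1..n}. exp (- real n * p / 50) ^ card A) = (\<Prod>j\<in>{1..n}. exp (- real n * p / 50) + 1)"
  by (subst prod_add) simp_all
 finally show ?thesis by (simp add: add.commute)
qed

text \<open>A first moment is enough: a pair is retained with probability
  \<open>p / 4 * thin_prob p\<close>, at most \<open>p\<^sup>2\<close>, and later \<open>K\<close>
  exceeds the mean by a power of n up to logarithms.\<close>

lemma ind_edges_event:
 assumes K: "0 < K"
 shows "prob {\<xi> \<in> space M. real (card (ind_edges n (coinsv \<xi>))) > K} <= (real n)\<^sup>2 * p\<^sup>2 / K"
proof -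
 have "prob {\<xi> \<in> space M. real (card (ind_edges n (coinsv \<xi>))) > K}
   <= (\<Sum>c\<in>coin_configs n. cweight c * (real (card (ind_edges n c)) / K))"
  using K by (intro prob_coins_event(2)) (auto simp: field_simps)
 also have "... = (\<Sum>e\<in>pairs n. \<Sum>c\<in>coin_configs n. cweight c * of_bool (e \<in> ind_edges n c)) / K"
 proof -
  have "real (card (ind_edges n c)) = (\<Sum>e\<in>pairs n. of_bool (e \<in> ind_edges n c))" for c
  proof -
   have "pairs n \<inter> {e. e \<in> ind_edges n c} = ind_edges n c" by (auto simp: ind_edges_def part_edges_def)
   then show ?thesis by (simp add: sum_of_bool_eq)
  qed
  then have "(\<Sum>c\<in>coin_configs n. cweight c * (real (card (ind_edges n c)) / K))
    = (\<Sum>c\<in>coin_configs n. \<Sum>e\<in>pairs n. cweight c * of_bool (e \<in> ind_edges n c)) / K"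
   unfolding sum_divide_distrib by (simp only: sum_distrib_left sum_divide_distrib times_divide_eq_right)
  then show ?thesis by (subst sum.swap) simp
 qed
 also have "(\<Sum>e\<in>pairs n. \<Sum>c\<in>coin_configs n. cweight c * of_bool (e \<in> ind_edges n c)) <= (\<Sum>e\<in>pairs n. p\<^sup>2)"
 proof (rule sum_mono)
  fix e assume e: "e \<in> pairs n"
  define g where "g e' v = (if e' = e then of_bool (fst v \<and> fst (snd v) = Part1 \<and> snd (snd v)) else (1::real))" for e' and v :: "bool \<times> part \<times> bool"
  have "(of_bool (e \<in> ind_edges n c) :: real) = (\<Prod>e'\<in>pairs n. g e' (c e'))" for c
   unfolding g_def using e by (subst prod.delta) (auto simp: ind_edges_def part_edges_def)
  then have "(\<Sum>c\<in>coin_configs n. cweight c * of_bool (e \<in> ind_edges n c))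
    = (\<Prod>e'\<in>pairs n. \<Sum>v\<in>UNIV. pmf (coin_pmf p) v * g e' v)"
   by (simp only: sum_coin_weight_prod)
  also have "... = (\<Prod>e'\<in>pairs n. if e' = e then p * (1/4 * thin_prob p) else 1)"
   by (intro prod.cong refl, subst sum_coin_pmf[OF p_pos p_le_1]) (auto simp: g_def algebra_simps)
  also have "... = p * (1/4 * thin_prob p)" using e by (subst prod.delta) auto
  also have "... <= p * p" using thin_bounds p_pos by (intro mult_left_mono) auto
  finally show "(\<Sum>c\<in>coin_configs n. cweight c * of_bool (e \<in> ind_edges n c)) <= p\<^sup>2"
   by (simp add: power2_eq_square)
 qed
 finally show ?thesis using K by (simp add: divide_right_mono power2_eq_square)
qed

text \<open>Presents the first part as a random graph with edge probability p/4, the form in which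
  the symmetrization of parents is stated.\<close>

lemma coin_sum_Part1:
 "(\<Sum>c\<in>coin_configs n. cweight c * G (edges1 c))
  = (\<Sum>E\<in>Pow (pairs n). edge_weight n (p / 4) E * G E)"
proof -
 have w: "(\<Sum>c | c \<in> coin_configs n \<and> edges1 c = E. cweight c) = edge_weight n (p / 4) E"
  if E: "E \<subseteq> pairs n" for E
 proof -
  define g where "g e v = (of_bool ((fst v \<and> fst (snd v) = Part1) = (e \<in> E)) :: real)" for e and v :: "bool \<times> part \<times> bool"
  define G where "G e k = (of_bool ((k = Part1) = (e \<in> E)) :: real)" for e k
  have fE: "finite E" using E by (rule finite_subset) auto
  have "(\<Prod>e\<in>pairs n. g e (c e)) = of_bool (edges1 c = E)" for c
  proof (cases "edges1 c = E")
   case True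
   then show ?thesis by (auto intro!: prod.neutral simp: g_def part_edges_def)
  next
   case False
   then obtain e where "e \<in> pairs n" "(fst (c e) \<and> fst (snd (c e)) = Part1) \<noteq> (e \<in> E)"
    using E unfolding part_edges_def by blast
   then have "g e (c e) = 0" "e \<in> pairs n" by (auto simp: g_def)
   then have "(\<Prod>e\<in>pairs n. g e (c e)) = 0" by (intro prod_zero) auto
   with False show ?thesis by simp
  qed
  then have "(\<Sum>c | c \<in> coin_configs n \<and> edges1 c = E. cweight c)
    = (\<Sum>c\<in>coin_configs n. cweight c * (\<Prod>e\<in>pairs n. g e (c e)))"
   by (intro sum.mono_neutral_cong_left) auto
  also have "... = (\<Prod>e\<in>pairs n. p * (G e Part1 / 4 + G e Part2 / 4 + G e Part3 / 2) + (1 - p) * of_bool (e \<notin> E))"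
   by (rule sum_coin_weight_parts) (simp add: g_def G_def)
  also have "... = (\<Prod>e\<in>pairs n. if e \<in> E then p / 4 else 1 - p / 4)"
   by (intro prod.cong refl) (auto simp: G_def algebra_simps)
  also have "... = (p / 4) ^ card E * (1 - p / 4) ^ card (pairs n - E)"
  proof -
   have "pairs n \<inter> {e. e \<in> E} = E" "pairs n \<inter> - {e. e \<in> E} = pairs n - E" using E by auto
   then show ?thesis by (subst prod.If_cases) auto
  qed
  finally show ?thesis using E fE by (simp add: edge_weight_def card_Diff_subset card_cartesian_product)
 qed
 have "(\<Sum>c\<in>coin_configs n. cweight c * G (edges1 c))
   = (\<Sum>E\<in>Pow (pairs n). \<Sum>c | c \<in> coin_configs n \<and> edges1 c = E. cweight c * G (edges1 c))"
  using part_edges_subset by (intro sum.group[symmetric]) auto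
 also have "... = (\<Sum>E\<in>Pow (pairs n). (\<Sum>c | c \<in> coin_configs n \<and> edges1 c = E. cweight c) * G E)"
  unfolding sum_distrib_right by (intro sum.cong) auto
 also have "... = (\<Sum>E\<in>Pow (pairs n). edge_weight n (p / 4) E * G E)"
  using w by (intro sum.cong) auto
 finally show ?thesis .
qed

end

section \<open>Concentration of the neighborhood vectors\<close>

definition path_value :: "edges => edges => nat => nat => (nat \<times> nat => real) => nat => real" where
 "path_value E T u s z i = nbr_vec E T (%a b. z (a, b)) u s i"

definition layer_avg :: "(real => real) => edges => edges => nat => nat => (nat => real) => (nat \<times> nat => real) => real" where
 "layer_avg h E T u s \<theta> z = (\<Sum>i\<in>sphere E u s. h (\<theta> i) * path_value E T u s z i) / real (card (sphere E u s))"

context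
 fixes E T u assumes T: "T \<in> bfs_trees E u"
begin

lemma path_value_0: "path_value E T u 0 z i = (if i = u then 1 else 0)"
 unfolding path_value_def by (rule nbr_vec_0[OF T])

lemma path_value_Suc: "path_value E T u (Suc s) z i =
  (if i \<in> sphere E u (Suc s) then path_value E T u s z (parent T i) * z (parent T i, i) else 0)"
 unfolding path_value_def by (rule nbr_vec_Suc[OF T])

lemma path_value_cong:
 "(\<And>e. e \<in> T ==> (\<exists>l\<le>s. snd e \<in> sphere E u l) ==> z e = z' e) ==> path_value E T u s z i = path_value E T u s z' i"
proof (induction s arbitrary: i)
 case (Suc s)
 have "path_value E T u s z j = path_value E T u s z' j" for j
  by (rule Suc.IH, rule Suc.prems) (use le_SucI in blast)+
 moreover have "z (parent T i, i) = z' (parent T i, i)" if "i \<in> sphere E u (Suc s)"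
  using that parent(1)[OF T that] by (intro Suc.prems) auto
 ultimately show ?case by (simp add: path_value_Suc)
qed (simp add: path_value_0)

text \<open>A tree path enters each layer once, so every entry occurs in the product at most
  once.\<close>

lemma path_value_affine:
 "path_value E T u s z i = z e * path_value E T u s (z(e := 1)) i + (1 - z e) * path_value E T u s (z(e := 0)) i"
proof (induction s arbitrary: i)
 case (Suc s)
 show ?case
 proof (cases "i \<in> sphere E u (Suc s)")
  case True
  show ?thesis
  proof (cases "e = (parent T i, i)")
   case e: True
   \<comment> \<open>Paths to layer \<open>s\<close> cannot use the edge into \<open>i\<close>,
     which lies one layer further.\<close>
   have "path_value E T u s (z(e := c)) j = path_value E T u s z j" for c j
   proof (rule path_value_cong)
    fix e' :: "nat \<times> nat" assume "\<exists>l\<le>s. snd e' \<in> sphere E u l"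
    then have "e' \<noteq> e" using e sphere_disjoint[OF True] by fastforce
    then show "(z(e := c)) e' = z e'" by simp
   qed
   then show ?thesis using True by (simp add: path_value_Suc e fun_upd_same del: fun_upd_apply)
  next
   case False
   then have "z (parent T i, i) = (z(e := c)) (parent T i, i)" for c by simp
   then show ?thesis using True by (simp add: path_value_Suc Suc.IH[of "parent T i"] algebra_simps)
  qed
 qed (simp add: path_value_Suc)
qed (simp add: path_value_0)

lemma path_value_range:
 "(\<And>e. e \<in> T ==> (\<exists>l\<le>s. snd e \<in> sphere E u l) ==> z e \<in> {0..1}) ==> path_value E T u s z i \<in> {0..1}"
proof (induction s arbitrary: i)
 case (Suc s)
 have 1: "path_value E T u s z j \<in> {0..1}" for j
  by (rule Suc.IH, rule Suc.prems) (use le_SucI in blast)+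
 have 2: "z (parent T i, i) \<in> {0..1}" if "i \<in> sphere E u (Suc s)"
  using that parent(1)[OF T that] by (intro Suc.prems) auto
 show ?case using 1[of "parent T i"] 2 by (auto simp: path_value_Suc mult_le_one)
qed (simp add: path_value_0)

lemma path_value_measurable:
 assumes "E \<subseteq> pairs n"
 shows "(%z. path_value E T u s z i) \<in> borel_measurable (Z_space n)"
proof (induction s arbitrary: i)
 case (Suc s)
 show ?case
 proof (cases "i \<in> sphere E u (Suc s)")
  case True
  have "(parent T i, i) \<in> pairs n" using parent(3)[OF T True] assms by blast
  then have [measurable]: "(%z. z (parent T i, i)) \<in> borel_measurable (Z_space n)"
   unfolding Z_space_def by (rule measurable_component_singleton)
  note [measurable] = Suc.IH[of "parent T i"]
  show ?thesis using True by (simp add: path_value_Suc)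
 qed (simp add: path_value_Suc)
qed (simp add: path_value_0)

end

lemma finite_sphere': "E \<subseteq> pairs n ==> finite (sphere E u s)"
 by (rule finite_sphere) (rule finite_subset, auto)

text \<open>One step of the recursion has two errors. The first compares new vertices and entries
  with their mean given the parents; the second compares the parents with the whole earlier layer
  and is multiplied by the eigenvalue.\<close>

lemma layer_avg_Suc:
 assumes T: "T \<in> bfs_trees E u" and E: "E \<subseteq> pairs n" and S: "0 < card (sphere E u (Suc s))"
  and 1: "\<bar>\<Sum>j\<in>sphere E u (Suc s). h (\<theta> j) * path_value E T u s z (parent T j) * z (parent T j, j)
    - l * h (\<theta> (parent T j)) * path_value E T u s z (parent T j)\<bar> <= \<epsilon> * real (card (sphere E u (Suc s)))"
  and 2: "\<bar>(\<Sum>j\<in>sphere E u (Suc s). h (\<theta> (parent T j)) * path_value E T u s z (parent T j))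
    - real (card (sphere E u (Suc s))) * layer_avg h E T u s \<theta> z\<bar> <= \<epsilon> * real (card (sphere E u (Suc s)))"
 shows "\<bar>layer_avg h E T u (Suc s) \<theta> z - l * layer_avg h E T u s \<theta> z\<bar> <= \<epsilon> * (1 + \<bar>l\<bar>)"
proof -
 let ?S = "sphere E u (Suc s)" and ?c = "real (card (sphere E u (Suc s)))"
 let ?A = "\<Sum>j\<in>?S. h (\<theta> j) * path_value E T u s z (parent T j) * z (parent T j, j)"
 let ?B = "\<Sum>j\<in>?S. h (\<theta> (parent T j)) * path_value E T u s z (parent T j)"
 have A: "?c * layer_avg h E T u (Suc s) \<theta> z = ?A"
  using S unfolding layer_avg_def by (simp add: path_value_Suc[OF T] mult.assoc)
 have "?c * (layer_avg h E T u (Suc s) \<theta> z - l * layer_avg h E T u s \<theta> z)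
   = (?A - l * ?B) + l * (?B - ?c * layer_avg h E T u s \<theta> z)"
  using A by (simp add: algebra_simps)
 moreover have "\<bar>?A - l * ?B\<bar> <= \<epsilon> * ?c"
  using 1 by (simp add: sum_subtractf sum_distrib_left mult.assoc)
 moreover have "\<bar>l * (?B - ?c * layer_avg h E T u s \<theta> z)\<bar> <= \<bar>l\<bar> * (\<epsilon> * ?c)"
  unfolding abs_mult using 2 by (intro mult_left_mono) auto
 ultimately have "\<bar>?c * (layer_avg h E T u (Suc s) \<theta> z - l * layer_avg h E T u s \<theta> z)\<bar> <= \<epsilon> * ?c + \<bar>l\<bar> * (\<epsilon> * ?c)"
  by linarith
 then have "?c * \<bar>layer_avg h E T u (Suc s) \<theta> z - l * layer_avg h E T u s \<theta> z\<bar> <= ?c * (\<epsilon> * (1 + \<bar>l\<bar>))"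
  unfolding abs_mult abs_of_nat by (simp add: algebra_simps)
 then show ?thesis using S by simp
qed

lemma abs_le_exp_sum:
 fixes R x :: real assumes "0 <= x" "a <= \<bar>R\<bar>" shows "exp (x * a) <= exp (x * R) + exp (- x * R)"
proof -
 have "x * a <= x * \<bar>R\<bar>" using assms by (intro mult_left_mono) auto
 then have "exp (x * a) <= exp (x * \<bar>R\<bar>)" by simp
 also have "... <= exp (x * R) + exp (- x * R)" by (cases "0 <= R") auto
 finally show ?thesis .
qed

section \<open>From one layer to the next with high probability\<close>

context icf_instance
begin

lemma joint_weight_pos:
 assumes "0 < jweight c \<tau>" "u \<in> {1..n}"
 shows "\<tau> u \<in> bfs_trees (edges1 c) u"
proof -
 have "tree_weight (edges1 c) u (\<tau> u) \<noteq> 0"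
 proof
  assume "tree_weight (edges1 c) u (\<tau> u) = 0"
  then have "(\<Prod>u\<in>{1..n}. tree_weight (edges1 c) u (\<tau> u)) = 0"
   using assms(2) by (intro prod_zero) auto
  then have "jweight c \<tau> = 0" by (simp only: joint_weight_def mult_zero_right)
  then show False using assms(1) by simp
 qed
 moreover have "finite (bfs_trees (edges1 c) u)"
  by (rule finite_subset[OF bfs_trees_subset]) auto
 ultimately show ?thesis using bfs_trees_nonempty unfolding tree_weight_def
  by (auto simp: indicator_def split: if_splits)
qed

lemma path_value_Dom:
 assumes "T \<in> bfs_trees E u" "E \<subseteq> pairs n" "x \<in> Dom"
 shows "path_value E T u s (snd x) i \<in> {0..1}"
proof (rule path_value_range[OF assms(1)])
 fix e assume "e \<in> T"
 then have "e \<in> pairs n" using assms(1,2) bfs_trees_subset by blast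
 then show "snd x e \<in> {0..1}" using Dom_snd[OF assms(3)] by auto
qed

lemma path_value_LZ [measurable]:
 "T \<in> bfs_trees E u ==> E \<subseteq> pairs n ==> (%x. path_value E T u s (snd x) i) \<in> borel_measurable LZ"
 by (rule measurable_compose[OF measurable_snd path_value_measurable])

lemma sum_edge_weight_le:
 "(\<Sum>E\<in>Pow (pairs n). \<Sum>T\<in>Pow (pairs n). edge_weight n (p / 4) E * tree_weight E u T) <= 1"
proof -
 have "(\<Sum>E\<in>Pow (pairs n). \<Sum>T\<in>Pow (pairs n). edge_weight n (p / 4) E * tree_weight E u T)
   = (\<Sum>c\<in>coin_configs n. cweight c * (\<Sum>T\<in>Pow (pairs n). tree_weight (edges1 c) u T))"
  unfolding coin_sum_Part1[where G = "%E. \<Sum>T\<in>Pow (pairs n). tree_weight E u T"] by (simp add: sum_distrib_left)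
 also have "... <= (\<Sum>c\<in>coin_configs n. cweight c * 1)"
  by (intro sum_mono mult_left_mono sum_tree_weight_le) auto
 finally show ?thesis by (simp add: sum_coin_weight)
qed

definition entry_dev :: "(real => real) => real => edges => edges => nat => nat => (nat => real) \<times> (nat \<times> nat => real) => real" where
 "entry_dev h l E T u s x = (\<Sum>j\<in>sphere E u (Suc s). h (fst x j) * path_value E T u s (snd x) (parent T j) * snd x (parent T j, j)
    - l * h (fst x (parent T j)) * path_value E T u s (snd x) (parent T j))"

definition parent_dev :: "(real => real) => edges => edges => nat => nat => (nat => real) \<times> (nat \<times> nat => real) => real" where
 "parent_dev h E T u s x = (\<Sum>j\<in>sphere E u (Suc s). h (fst x (parent T j)) * path_value E T u s (snd x) (parent T j))
    - real (card (sphere E u (Suc s))) * layer_avg h E T u s (fst x) (snd x)"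

context
 fixes h :: "real => real" and l B :: real
 assumes h [measurable]: "h \<in> borel_measurable borel" and hB: "\<And>y. \<bar>h y\<bar> <= B" and B: "1 <= B"
  and eig: "\<And>a. (\<integral>y. h y * f a y \<partial>unif01) = l * h a"
begin

lemma layer_avg_measurable:
 assumes T: "T \<in> bfs_trees E u" and E: "E \<subseteq> pairs n" and u: "u \<in> {1..n}"
 shows "(%x. layer_avg h E T u s (fst x) (snd x)) \<in> borel_measurable LZ"
 unfolding layer_avg_def
proof (intro borel_measurable_divide borel_measurable_sum borel_measurable_times path_value_LZ[OF T E])
 fix i assume "i \<in> sphere E u s"
 then have "i \<in> {1..n}" using sphere_subset[OF E u] by blast
 then show "(%x. h (fst x i)) \<in> borel_measurable LZ" using fst_comp by measurable
qed simp

lemma parent_dev_measurable: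
 assumes T: "T \<in> bfs_trees E u" and E: "E \<subseteq> pairs n" and u: "u \<in> {1..n}"
 shows "parent_dev h E T u s \<in> borel_measurable LZ"
 unfolding parent_dev_def[abs_def]
proof (intro borel_measurable_diff borel_measurable_sum borel_measurable_times path_value_LZ[OF T E] layer_avg_measurable[OF assms])
 fix j assume "j \<in> sphere E u (Suc s)"
 then have "parent T j \<in> {1..n}" using parent(2)[OF T] sphere_subset[OF E u] by blast
 then show "(%x. h (fst x (parent T j))) \<in> borel_measurable LZ" using fst_comp by measurable
qed simp

text \<open>Instance of \<open>layer_exp_moment\<close> for a fixed tree: the tree edges into the
  new layer form \<open>EJ\<close>, and the tree edges into layers up to \<open>s\<close> form
  \<open>W0\<close>.\<close>

lemma entry_dev_event:
 assumes T: "T \<in> bfs_trees E u" and E: "E \<subseteq> pairs n" and u: "u \<in> {1..n}"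
  and \<epsilon>: "0 < \<epsilon>" "\<epsilon> <= 4 * B"
 shows "entry_dev h l E T u s \<in> borel_measurable LZ"
  and "prob {\<xi> \<in> space M. \<bar>entry_dev h l E T u s (TZ \<xi>)\<bar> > \<epsilon> * real (card (sphere E u (Suc s)))}
   <= 2 * exp (- \<epsilon>\<^sup>2 * real (card (sphere E u (Suc s))) / (16 * B\<^sup>2))"
proof -
 let ?S = "sphere E u (Suc s)"
 define EJ where "EJ = (%j. (parent T j, j)) ` ?S"
 define V0 where "V0 = (\<Union>k\<le>s. sphere E u k)"
 define W0 where "W0 = {e \<in> T. snd e \<in> V0}"
 define N where "N a z = path_value E T u s z a" for a z
 have Sf: "finite ?S" by (rule finite_sphere'[OF E])
 have inj: "inj_on (%j. (parent T j, j)) ?S" by (auto simp: inj_on_def)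
 have cEJ: "card EJ = card ?S" unfolding EJ_def by (rule card_image[OF inj])
 have TE: "T \<subseteq> E" using T bfs_trees_subset by blast
 have EJp: "EJ \<subseteq> pairs n" using parent(3)[OF T] E unfolding EJ_def by blast
 have EJV: "fst ` EJ \<subseteq> V0" using parent(2)[OF T] unfolding EJ_def V0_def by auto
 have EJd: "snd ` EJ \<inter> V0 = {}"
 proof -
  have "j \<notin> sphere E u k" if "j \<in> ?S" "k <= s" for j k using sphere_disjoint[OF that(1), of k] that(2) by auto
  then show ?thesis unfolding EJ_def V0_def by auto
 qed
 have EJi: "inj_on snd EJ" unfolding EJ_def by (auto simp: inj_on_def)
 have W0p: "W0 \<subseteq> pairs n" using TE E by (auto simp: W0_def)
 have W0V: "W0 \<subseteq> V0 \<times> V0"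
 proof
  fix e assume "e \<in> W0"
  then obtain a b k where e: "e = (a, b)" "(a, b) \<in> T" "k <= s" "b \<in> sphere E u k"
   by (cases e) (auto simp: W0_def V0_def)
  obtain m where m: "a \<in> sphere E u m" "b \<in> sphere E u (Suc m)"
   using T[unfolded bfs_trees_iff] e(2) by blast
  then have "m <= s" using sphere_disjoint[OF e(4) m(2)] e(3) by simp
  then show "e \<in> V0 \<times> V0" using m e by (auto simp: V0_def)
 qed
 have Nm: "N a \<in> borel_measurable (Z_space n)" for a
  unfolding N_def by (rule path_value_measurable[OF T E])
 have Ndep: "N a z = N a z'" if "\<And>e. e \<in> W0 ==> z e = z' e" for a z z'
  unfolding N_def using that by (intro path_value_cong[OF T]) (auto simp: W0_def V0_def)
 have N01: "N a z \<in> {0..1}" if "\<And>e. e \<in> W0 ==> z e \<in> {0..1}" for a z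
  unfolding N_def using that by (intro path_value_range[OF T]) (auto simp: W0_def V0_def)
 have Naff: "N a z = z e * N a (z(e := 1)) + (1 - z e) * N a (z(e := 0))" if "e \<in> W0" for a z e
  unfolding N_def by (rule path_value_affine[OF T])
 define Q where "Q pt = (\<Sum>e\<in>EJ. h (fst pt (snd e)) * N (fst e) (snd pt) * snd pt e - l * h (fst pt (fst e)) * N (fst e) (snd pt))" for pt
 have Q: "entry_dev h l E T u s = Q"
  unfolding Q_def[abs_def] EJ_def entry_dev_def[abs_def] by (subst sum.reindex[OF inj]) (simp add: N_def)
 \<comment> \<open>Minimizes \<open>4 * B\<^sup>2 * x\<^sup>2 - \<epsilon> * x\<close>; the
   hypothesis \<open>\<epsilon> <= 4 * B\<close> keeps it in the admissible range of the moment
   bound.\<close>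
 define x where "x = \<epsilon> / (8 * B\<^sup>2)"
 have x: "0 < x" "\<bar>x\<bar> <= 1 / (2 * B)" "\<bar>- x\<bar> <= 1 / (2 * B)"
  using \<epsilon> B by (auto simp: x_def power2_eq_square field_simps)
 note lm = layer_exp_moment[where N = N, OF EJp EJV EJd EJi W0p W0V Nm _ _ _ h hB B eig]
 have Qm: "Q \<in> borel_measurable LZ"
  unfolding Q_def[abs_def] by (rule lm(1)[OF Ndep N01 Naff x(2)])
 then show "entry_dev h l E T u s \<in> borel_measurable LZ" unfolding Q .
 have mom: "expectation (%\<xi>. exp (y * Q (TZ \<xi>))) <= exp (4 * B\<^sup>2 * x\<^sup>2 * real (card ?S))" if "y = x \<or> y = - x" for y
 proof -
  have y: "y\<^sup>2 = x\<^sup>2" "\<bar>y\<bar> <= 1 / (2 * B)" using that x by auto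
  have "expectation (%\<xi>. exp (y * Q (TZ \<xi>))) <= exp (4 * B\<^sup>2 * y\<^sup>2 * real (card EJ))"
   unfolding Q_def by (rule lm(2)[OF Ndep N01 Naff y(2)])
  then show ?thesis by (simp add: cEJ y)
 qed
 have Qb: "\<bar>Q pt\<bar> <= real (card ?S) * (B + \<bar>l\<bar> * B)" if pt: "pt \<in> Dom" for pt
 proof -
  have "\<bar>Q pt\<bar> <= (\<Sum>e\<in>EJ. \<bar>h (fst pt (snd e)) * N (fst e) (snd pt) * snd pt e - l * h (fst pt (fst e)) * N (fst e) (snd pt)\<bar>)"
   unfolding Q_def by (rule sum_abs)
  also have "... <= real (card EJ) * (B + \<bar>l\<bar> * B)"
  proof (rule sum_bounded_above)
   fix e assume e: "e \<in> EJ"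
   have z: "0 <= snd pt e \<and> snd pt e <= 1" using Dom_snd[OF pt] e EJp by blast
   have N: "N (fst e) (snd pt) \<in> {0..1}" unfolding N_def by (rule path_value_Dom[OF T E pt])
   have "\<bar>h (fst pt (snd e)) * N (fst e) (snd pt) * snd pt e\<bar> <= B * 1 * 1"
    unfolding abs_mult using z N hB B by (intro mult_mono) auto
   moreover have "\<bar>l * h (fst pt (fst e)) * N (fst e) (snd pt)\<bar> <= \<bar>l\<bar> * B * 1"
    unfolding abs_mult using N hB B by (intro mult_mono) auto
   ultimately show "\<bar>h (fst pt (snd e)) * N (fst e) (snd pt) * snd pt e - l * h (fst pt (fst e)) * N (fst e) (snd pt)\<bar> <= B + \<bar>l\<bar> * B"
    by linarith
  qed
  finally show ?thesis by (simp add: cEJ)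
 qed
 have int: "integrable M (%\<xi>. exp (y * Q (TZ \<xi>)))" for y
 proof (rule integrable_TZ[where H = "%pt. exp (y * Q pt)" and B = "exp (\<bar>y\<bar> * (real (card ?S) * (B + \<bar>l\<bar> * B)))"])
  show "(%pt. exp (y * Q pt)) \<in> borel_measurable LZ" using Qm by measurable
  fix pt assume "pt \<in> Dom"
  then have "\<bar>y * Q pt\<bar> <= \<bar>y\<bar> * (real (card ?S) * (B + \<bar>l\<bar> * B))"
   unfolding abs_mult using Qb by (intro mult_left_mono) auto
  then show "\<bar>exp (y * Q pt)\<bar> <= exp (\<bar>y\<bar> * (real (card ?S) * (B + \<bar>l\<bar> * B)))" by simp
 qed
 let ?A = "{\<xi> \<in> space M. \<bar>Q (TZ \<xi>)\<bar> > \<epsilon> * real (card ?S)}" and ?c = "real (card ?S)"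
 have A: "?A \<in> sets M" using Qm by measurable
 have "prob ?A = expectation (indicat_real ?A)" using A by simp
 also have "... <= expectation (%\<xi>. exp (- (x * (\<epsilon> * ?c))) * (exp (x * Q (TZ \<xi>)) + exp (- x * Q (TZ \<xi>))))"
 proof (rule integral_mono)
  show "integrable M (indicat_real ?A)" using A by (intro integrable_const_bound[where B = 1]) auto
  show "integrable M (%\<xi>. exp (- (x * (\<epsilon> * ?c))) * (exp (x * Q (TZ \<xi>)) + exp (- x * Q (TZ \<xi>))))"
   using int[of x] int[of "- x"] by simp
  fix \<xi>
  have "1 <= exp (- (x * (\<epsilon> * ?c))) * (exp (x * Q (TZ \<xi>)) + exp (- x * Q (TZ \<xi>)))" if "\<xi> \<in> ?A"
   using abs_le_exp_sum[of x "\<epsilon> * ?c" "Q (TZ \<xi>)"] that x by (simp add: exp_minus field_simps)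
  then show "indicat_real ?A \<xi> <= exp (- (x * (\<epsilon> * ?c))) * (exp (x * Q (TZ \<xi>)) + exp (- x * Q (TZ \<xi>)))"
   by (cases "\<xi> \<in> ?A") (auto simp: indicator_def intro!: mult_nonneg_nonneg add_nonneg_nonneg)
 qed
 also have "... = exp (- (x * (\<epsilon> * ?c))) * (expectation (%\<xi>. exp (x * Q (TZ \<xi>))) + expectation (%\<xi>. exp (- x * Q (TZ \<xi>))))"
  using int[of x] int[of "- x"] by simp
 also have "... <= exp (- (x * (\<epsilon> * ?c))) * (exp (4 * B\<^sup>2 * x\<^sup>2 * ?c) + exp (4 * B\<^sup>2 * x\<^sup>2 * ?c))"
  using mom[of x] mom[of "- x"] by (intro mult_left_mono add_mono) simp_all
 also have "... = 2 * exp (4 * B\<^sup>2 * x\<^sup>2 * ?c - x * (\<epsilon> * ?c))" by (simp add: exp_diff exp_minus field_simps)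
 also have "4 * B\<^sup>2 * x\<^sup>2 * ?c - x * (\<epsilon> * ?c) = - \<epsilon>\<^sup>2 * ?c / (16 * B\<^sup>2)"
  using B by (simp add: x_def power2_eq_square field_simps)
 finally show "prob {\<xi> \<in> space M. \<bar>entry_dev h l E T u s (TZ \<xi>)\<bar> > \<epsilon> * ?c} <= 2 * exp (- \<epsilon>\<^sup>2 * ?c / (16 * B\<^sup>2))"
  unfolding Q .
qed

text \<open>Latent variables and entries are frozen, and only graph and trees are averaged. The size
  of the new layer is random, so it stays in the compensator and is compared with \<open>m\<close>
  only on the event.\<close>

lemma parent_dev_event:
 assumes u: "u \<in> {1..n}" and \<epsilon>: "0 < \<epsilon>" "\<epsilon> <= 4 * B"
 shows "prob {\<xi> \<in> space M. m <= real (card (sphere (edges1 (coinsv \<xi>)) u (Suc s))) \<and>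
   trees \<xi> u \<in> bfs_trees (edges1 (coinsv \<xi>)) u \<and>
   \<bar>parent_dev h (edges1 (coinsv \<xi>)) (trees \<xi> u) u s (TZ \<xi>)\<bar>
    > \<epsilon> * real (card (sphere (edges1 (coinsv \<xi>)) u (Suc s)))}
  <= 2 * exp (- \<epsilon>\<^sup>2 * m / (16 * B\<^sup>2))"
proof -
 define x where "x = \<epsilon> / (8 * B\<^sup>2)"
 have x: "0 < x" "\<bar>x\<bar> <= 1 / (2 * B)" "\<bar>- x\<bar> <= 1 / (2 * B)"
  using \<epsilon> B by (auto simp: x_def power2_eq_square field_simps)
 define k where "k E = real (card (sphere E u (Suc s)))" for E
 define Y where "Y y E T pt = exp (y * parent_dev h E T u s pt - 4 * B\<^sup>2 * y\<^sup>2 * k E)" for y E T pt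
 define K where "K = exp (- \<epsilon>\<^sup>2 * m / (16 * B\<^sup>2))"
 let ?E = "%c. edges1 c"
 let ?h = "%c \<tau> pt. K * (Y x (?E c) (\<tau> u) pt + Y (- x) (?E c) (\<tau> u) pt)"
 let ?P = "%c (\<tau> :: nat => edges) pt. m <= k (?E c) \<and> \<tau> u \<in> bfs_trees (?E c) u \<and> \<bar>parent_dev h (?E c) (\<tau> u) u s pt\<bar> > \<epsilon> * k (?E c)"
 note pm = parent_dev_measurable[OF _ part_edges_subset u]
 have Ym: "Y y (?E c) T \<in> borel_measurable LZ" if "T \<in> bfs_trees (?E c) u" for y c T
  unfolding Y_def[abs_def] using pm[OF that] by measurable
 have pb: "\<bar>parent_dev h E T u s pt\<bar> <= 2 * B * k E" if T: "T \<in> bfs_trees E u" and E: "E \<subseteq> pairs n" and pt: "pt \<in> Dom" for E T pt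
 proof -
  have hp: "\<bar>h a * path_value E T u s (snd pt) b\<bar> <= B" for a b
  proof -
   have "\<bar>h a\<bar> * \<bar>path_value E T u s (snd pt) b\<bar> <= B * 1"
    using path_value_Dom[OF T E pt, of s b] hB B by (intro mult_mono) auto
   then show ?thesis by (simp add: abs_mult)
  qed
  have "\<bar>\<Sum>j\<in>sphere E u (Suc s). h (fst pt (parent T j)) * path_value E T u s (snd pt) (parent T j)\<bar> <= k E * B"
   unfolding k_def by (rule order_trans[OF sum_abs]) (rule sum_bounded_above[OF hp])
  moreover have "\<bar>layer_avg h E T u s (fst pt) (snd pt)\<bar> <= B"
  proof -
   have "\<bar>\<Sum>i\<in>sphere E u s. h (fst pt i) * path_value E T u s (snd pt) i\<bar> <= real (card (sphere E u s)) * B"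
    by (rule order_trans[OF sum_abs]) (rule sum_bounded_above[OF hp])
   then show ?thesis unfolding layer_avg_def using B
    by (cases "card (sphere E u s) = 0") (auto simp: abs_divide divide_le_eq mult.commute)
  qed
  then have "\<bar>k E * layer_avg h E T u s (fst pt) (snd pt)\<bar> <= k E * B"
   unfolding abs_mult by (intro mult_mono) (auto simp: k_def)
  moreover have "2 * B * k E = k E * B + k E * B" by simp
  ultimately show ?thesis unfolding parent_dev_def k_def[symmetric] abs_le_iff by linarith
 qed
 have Yint: "integrable M (%\<xi>. Y y (?E c) T (TZ \<xi>))" if T: "T \<in> bfs_trees (?E c) u" for y c T
 proof (rule integrable_TZ[OF Ym[OF T], where B = "exp (\<bar>y\<bar> * (2 * B * k (?E c)))"])
  fix pt assume pt: "pt \<in> Dom"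
  have "\<bar>y * parent_dev h (?E c) T u s pt\<bar> <= \<bar>y\<bar> * (2 * B * k (?E c))"
   unfolding abs_mult using pb[OF T part_edges_subset pt] by (intro mult_left_mono) auto
  moreover have "0 <= 4 * B\<^sup>2 * y\<^sup>2 * k (?E c)" by (simp add: k_def)
  ultimately show "\<bar>Y y (?E c) T pt\<bar> <= exp (\<bar>y\<bar> * (2 * B * k (?E c)))"
   unfolding Y_def by (simp add: abs_le_iff)
 qed
 have "prob {\<xi> \<in> space M. ?P (coinsv \<xi>) (trees \<xi>) (TZ \<xi>)}
  <= (\<Sum>c\<in>coin_configs n. \<Sum>\<tau>\<in>tree_configs n. jweight c \<tau> * expectation (%\<xi>. ?h c \<tau> (TZ \<xi>)))"
 proof (rule prob_le_joint)
  show "Measurable.pred LZ (?P c \<tau>)" for c and \<tau> :: "nat => edges"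
  proof (cases "\<tau> u \<in> bfs_trees (?E c) u")
   case True
   note [measurable] = pm[OF True]
   show ?thesis by measurable
  qed simp
  fix c \<tau> assume w: "0 < jweight c \<tau>"
  note T = joint_weight_pos[OF w u]
  show "integrable M (%\<xi>. ?h c \<tau> (TZ \<xi>))" using Yint[OF T] by simp
  show "0 <= ?h c \<tau> pt" for pt unfolding K_def Y_def by (intro mult_nonneg_nonneg add_nonneg_nonneg) auto
  fix pt assume P: "?P c \<tau> pt"
  let ?k = "k (?E c)" and ?R = "parent_dev h (?E c) (\<tau> u) u s pt"
  have "exp (\<epsilon>\<^sup>2 * m / (16 * B\<^sup>2)) <= exp (\<epsilon>\<^sup>2 * ?k / (16 * B\<^sup>2))"
   using P B by (auto intro!: divide_right_mono mult_left_mono)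
  also have "\<epsilon>\<^sup>2 * ?k / (16 * B\<^sup>2) = x * (\<epsilon> * ?k) - 4 * B\<^sup>2 * x\<^sup>2 * ?k"
   using B by (simp add: x_def power2_eq_square field_simps)
  also have "exp (x * (\<epsilon> * ?k) - 4 * B\<^sup>2 * x\<^sup>2 * ?k) <= (exp (x * ?R) + exp (- x * ?R)) * exp (- (4 * B\<^sup>2 * x\<^sup>2 * ?k))"
  proof -
   have "exp (x * (\<epsilon> * ?k)) <= exp (x * ?R) + exp (- x * ?R)"
    using P x by (intro abs_le_exp_sum) auto
   then have "exp (x * (\<epsilon> * ?k)) * exp (- (4 * B\<^sup>2 * x\<^sup>2 * ?k)) <= (exp (x * ?R) + exp (- x * ?R)) * exp (- (4 * B\<^sup>2 * x\<^sup>2 * ?k))"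
    by (rule mult_right_mono) simp
   then show ?thesis by (simp only: diff_conv_add_uminus exp_add)
  qed
  also have "... = Y x (?E c) (\<tau> u) pt + Y (- x) (?E c) (\<tau> u) pt"
   unfolding Y_def by (simp add: exp_diff exp_minus field_simps)
  finally show "1 <= ?h c \<tau> pt"
   unfolding K_def by (simp add: exp_minus field_simps)
 qed
 also have "... = K * ((\<Sum>c\<in>coin_configs n. \<Sum>\<tau>\<in>tree_configs n. jweight c \<tau> * expectation (%\<xi>. Y x (?E c) (\<tau> u) (TZ \<xi>)))
  + (\<Sum>c\<in>coin_configs n. \<Sum>\<tau>\<in>tree_configs n. jweight c \<tau> * expectation (%\<xi>. Y (- x) (?E c) (\<tau> u) (TZ \<xi>))))"
 proof -
  have "jweight c \<tau> * expectation (%\<xi>. ?h c \<tau> (TZ \<xi>)) = K * (jweight c \<tau> * expectation (%\<xi>. Y x (?E c) (\<tau> u) (TZ \<xi>))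
   + jweight c \<tau> * expectation (%\<xi>. Y (- x) (?E c) (\<tau> u) (TZ \<xi>)))" for c \<tau>
  proof (cases "jweight c \<tau> = 0")
   case False
   then have w: "0 < jweight c \<tau>" using joint_weight_nonneg[of n p c \<tau>] by linarith
   show ?thesis using Yint[OF joint_weight_pos[OF w u]] by (simp add: algebra_simps)
  qed simp
  note eq = this
  show ?thesis unfolding eq by (simp only: distrib_left sum.distrib sum_distrib_left)
 qed
 also have "... <= K * (1 + 1)"
 proof (intro mult_left_mono add_mono)
  have main: "(\<Sum>c\<in>coin_configs n. \<Sum>\<tau>\<in>tree_configs n. jweight c \<tau> * expectation (%\<xi>. Y y (?E c) (\<tau> u) (TZ \<xi>))) <= 1"
   if y: "\<bar>y\<bar> <= 1 / (2 * B)" for y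
  proof -
   have ji: "integrable M (%\<xi>. jweight c \<tau> * Y y (?E c) (\<tau> u) (TZ \<xi>))" for c \<tau>
   proof (cases "jweight c \<tau> = 0")
    case False
    then have w: "0 < jweight c \<tau>" using joint_weight_nonneg[of n p c \<tau>] by linarith
    show ?thesis using Yint[OF joint_weight_pos[OF w u]] by simp
   qed simp
   have "(\<Sum>c\<in>coin_configs n. \<Sum>\<tau>\<in>tree_configs n. jweight c \<tau> * expectation (%\<xi>. Y y (?E c) (\<tau> u) (TZ \<xi>)))
     = expectation (%\<xi>. \<Sum>c\<in>coin_configs n. \<Sum>\<tau>\<in>tree_configs n. jweight c \<tau> * Y y (?E c) (\<tau> u) (TZ \<xi>))"
    using ji by (subst Bochner_Integration.integral_sum) (auto intro!: sum.cong simp: Bochner_Integration.integral_sum)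
   also have "... <= expectation (%\<xi>. 1)"
   proof (rule integral_mono)
    show "integrable M (%\<xi>. \<Sum>c\<in>coin_configs n. \<Sum>\<tau>\<in>tree_configs n. jweight c \<tau> * Y y (?E c) (\<tau> u) (TZ \<xi>))"
     using ji by (intro Bochner_Integration.integrable_sum) auto
    fix \<xi> assume \<xi>: "\<xi> \<in> space M"
    let ?pt = "TZ \<xi>"
    note pt = TZ_Dom[OF \<xi>]
    \<comment> \<open>Clamping makes the bound hold for arbitrary edge sets in place of a tree; for
      genuine trees it changes nothing.\<close>
    define W where "W E T a = h (fst ?pt a) * max 0 (min 1 (path_value E T u s (snd ?pt) a))" for E T a
    have Wp: "W E T a = h (fst ?pt a) * path_value E T u s (snd ?pt) a" if "T \<in> bfs_trees E u" "E \<subseteq> pairs n" for E T a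
     using path_value_Dom[OF that pt, of s a] by (simp add: W_def)
    have WB: "\<bar>W E T a\<bar> <= B" for E T a
    proof -
     have "\<bar>h (fst ?pt a)\<bar> * \<bar>max 0 (min 1 (path_value E T u s (snd ?pt) a))\<bar> <= B * 1"
      using hB B by (intro mult_mono) auto
     then show ?thesis by (simp add: W_def abs_mult)
    qed
    define Y' where "Y' E T = exp (y * ((\<Sum>j\<in>sphere E u (Suc s). W E T (parent T j))
      - real (card (sphere E u (Suc s))) * ((\<Sum>a\<in>sphere E u s. W E T a) / real (card (sphere E u s))))
      - 4 * B\<^sup>2 * y\<^sup>2 * real (card (sphere E u (Suc s))))" for E T
    have YY: "Y y E T ?pt = Y' E T" if "T \<in> bfs_trees E u" "E \<subseteq> pairs n" for E T
     unfolding Y_def Y'_def parent_dev_def layer_avg_def k_def using Wp[OF that] by simp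
    have "(\<Sum>c\<in>coin_configs n. \<Sum>\<tau>\<in>tree_configs n. jweight c \<tau> * Y y (?E c) (\<tau> u) ?pt)
      = (\<Sum>c\<in>coin_configs n. cweight c * (\<Sum>\<tau>\<in>tree_configs n. (\<Prod>v\<in>{1..n}. tree_weight (?E c) v (\<tau> v)) * Y' (?E c) (\<tau> u)))"
    proof (intro sum.cong refl)
     fix c
     have "jweight c \<tau> * Y y (?E c) (\<tau> u) ?pt = jweight c \<tau> * Y' (?E c) (\<tau> u)" for \<tau>
     proof (cases "jweight c \<tau> = 0")
      case False
      then have w: "0 < jweight c \<tau>" using joint_weight_nonneg[of n p c \<tau>] by linarith
      show ?thesis using YY[OF joint_weight_pos[OF w u] part_edges_subset] by simp
     qed simp
     note eq = this
     show "(\<Sum>\<tau>\<in>tree_configs n. jweight c \<tau> * Y y (?E c) (\<tau> u) ?pt)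
       = cweight c * (\<Sum>\<tau>\<in>tree_configs n. (\<Prod>v\<in>{1..n}. tree_weight (?E c) v (\<tau> v)) * Y' (?E c) (\<tau> u))"
      unfolding eq by (simp only: joint_weight_def sum_distrib_left mult.assoc)
    qed
    also have "... <= (\<Sum>c\<in>coin_configs n. cweight c * (\<Sum>T\<in>Pow (pairs n). tree_weight (?E c) u T * Y' (?E c) T))"
     by (intro sum_mono mult_left_mono sum_trees_marginal[OF u]) (auto simp: Y'_def)
    also have "... = (\<Sum>E\<in>Pow (pairs n). \<Sum>T\<in>Pow (pairs n). edge_weight n (p / 4) E * tree_weight E u T * Y' E T)"
     unfolding coin_sum_Part1[where G = "%E. \<Sum>T\<in>Pow (pairs n). tree_weight E u T * Y' E T"]
     by (simp add: sum_distrib_left mult.assoc)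
    also have "... <= (\<Sum>E\<in>Pow (pairs n). \<Sum>T\<in>Pow (pairs n). edge_weight n (p / 4) E * tree_weight E u T)"
     unfolding Y'_def
    proof (rule parents_exp_moment[OF u _ _ WB B y])
     fix E T \<tau> a assume T: "T \<in> bfs_trees E u"
      and b: "\<And>j. j \<in> sphere E u (Suc s) ==> bij_betw (\<tau> j) (sphere E u s) (sphere E u s)"
     have "path_value (twist (sphere E u s) (sphere E u (Suc s)) \<tau> E) (twist (sphere E u s) (sphere E u (Suc s)) \<tau> T) u s (snd ?pt) a
      = path_value E T u s (snd ?pt) a"
      unfolding path_value_def by (rule nbr_vec_twist[OF b refl refl T order_refl])
     then show "W (twist (sphere E u s) (sphere E u (Suc s)) \<tau> E) (twist (sphere E u s) (sphere E u (Suc s)) \<tau> T) a = W E T a"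
      unfolding W_def by simp
    qed (use p_pos p_le_1 in auto)
    also have "... <= 1" by (rule sum_edge_weight_le)
    finally show "(\<Sum>c\<in>coin_configs n. \<Sum>\<tau>\<in>tree_configs n. jweight c \<tau> * Y y (?E c) (\<tau> u) ?pt) <= 1" .
   qed simp
   finally show ?thesis by (simp add: prob_space)
  qed
  show "(\<Sum>c\<in>coin_configs n. \<Sum>\<tau>\<in>tree_configs n. jweight c \<tau> * expectation (%\<xi>. Y x (?E c) (\<tau> u) (TZ \<xi>))) <= 1"
   "(\<Sum>c\<in>coin_configs n. \<Sum>\<tau>\<in>tree_configs n. jweight c \<tau> * expectation (%\<xi>. Y (- x) (?E c) (\<tau> u) (TZ \<xi>))) <= 1"
   using main[of x] main[of "- x"] x by auto
 qed (simp add: K_def)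
 finally show ?thesis by (simp add: K_def k_def mult.commute)
qed

text \<open>The two errors of a step are treated with opposite roles: one with the graph fixed and
  the data random, the other with the data fixed and the graph random. Each contributes half of the
  bound.\<close>

lemma layer_event:
 assumes u: "u \<in> {1..n}" and \<epsilon>: "0 < \<epsilon>" "\<epsilon> <= 4 * B" and m: "0 < m"
 defines "E \<equiv> %\<xi>. edges1 (coinsv \<xi>)"
 shows "{\<xi> \<in> space M. m <= real (card (sphere (E \<xi>) u (Suc s))) \<and>
   \<bar>layer_avg h (E \<xi>) (tree X u \<xi>) u (Suc s) (thetas \<xi>) (Zs \<xi>)
    - l * layer_avg h (E \<xi>) (tree X u \<xi>) u s (thetas \<xi>) (Zs \<xi>)\<bar> > \<epsilon> * (1 + \<bar>l\<bar>)} \<in> sets M" (is "?S \<in> _")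
  and "prob {\<xi> \<in> space M. m <= real (card (sphere (E \<xi>) u (Suc s))) \<and>
   \<bar>layer_avg h (E \<xi>) (tree X u \<xi>) u (Suc s) (thetas \<xi>) (Zs \<xi>)
    - l * layer_avg h (E \<xi>) (tree X u \<xi>) u s (thetas \<xi>) (Zs \<xi>)\<bar> > \<epsilon> * (1 + \<bar>l\<bar>)}
   <= 4 * exp (- \<epsilon>\<^sup>2 * m / (16 * B\<^sup>2))"
proof -
 have tr: "trees \<xi> u = tree X u \<xi>" for \<xi> using u by (simp add: trees_def)
 let ?E = "%c. edges1 c"
 let ?k = "%c. real (card (sphere (?E c) u (Suc s)))"
 let ?P0 = "%c (\<tau> :: nat => edges) pt. m <= ?k c \<and> \<tau> u \<in> bfs_trees (?E c) u \<and>
  \<bar>layer_avg h (?E c) (\<tau> u) u (Suc s) (fst pt) (snd pt) - l * layer_avg h (?E c) (\<tau> u) u s (fst pt) (snd pt)\<bar> > \<epsilon> * (1 + \<bar>l\<bar>)"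
 let ?P1 = "%c (\<tau> :: nat => edges) pt. m <= ?k c \<and> \<tau> u \<in> bfs_trees (?E c) u \<and> \<bar>entry_dev h l (?E c) (\<tau> u) u s pt\<bar> > \<epsilon> * ?k c"
 let ?P2 = "%c (\<tau> :: nat => edges) pt. m <= ?k c \<and> \<tau> u \<in> bfs_trees (?E c) u \<and> \<bar>parent_dev h (?E c) (\<tau> u) u s pt\<bar> > \<epsilon> * ?k c"
 have m0: "Measurable.pred LZ (?P0 c \<tau>)" for c \<tau>
 proof (cases "\<tau> u \<in> bfs_trees (?E c) u")
  case True
  note [measurable] = layer_avg_measurable[OF True part_edges_subset u]
  show ?thesis by measurable
 qed simp
 have m1: "Measurable.pred LZ (?P1 c \<tau>)" for c \<tau>
 proof (cases "\<tau> u \<in> bfs_trees (?E c) u")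
  case True
  note [measurable] = entry_dev_event(1)[OF True part_edges_subset u \<epsilon>]
  show ?thesis by measurable
 qed simp
 have m2: "Measurable.pred LZ (?P2 c \<tau>)" for c \<tau>
 proof (cases "\<tau> u \<in> bfs_trees (?E c) u")
  case True
  note [measurable] = parent_dev_measurable[OF True part_edges_subset u]
  show ?thesis by measurable
 qed simp
 have S: "?S = {\<xi> \<in> space M. ?P0 (coinsv \<xi>) (trees \<xi>) (TZ \<xi>)}"
 proof (intro Collect_cong)
  fix \<xi>
  show "(\<xi> \<in> space M \<and> m <= real (card (sphere (E \<xi>) u (Suc s))) \<and>
   \<bar>layer_avg h (E \<xi>) (tree X u \<xi>) u (Suc s) (thetas \<xi>) (Zs \<xi>)
    - l * layer_avg h (E \<xi>) (tree X u \<xi>) u s (thetas \<xi>) (Zs \<xi>)\<bar> > \<epsilon> * (1 + \<bar>l\<bar>))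
   \<longleftrightarrow> (\<xi> \<in> space M \<and> ?P0 (coinsv \<xi>) (trees \<xi>) (TZ \<xi>))"
   unfolding E_def tr TZ_def fst_conv snd_conv using tree_in[OF u, of \<xi>]
   by (cases "\<xi> \<in> space M") (simp_all only: simp_thms)
 qed
 show "?S \<in> sets M" unfolding S by (rule joint_event) (rule m0)
 have e1: "{\<xi> \<in> space M. ?P1 (coinsv \<xi>) (trees \<xi>) (TZ \<xi>)} \<in> sets M" by (rule joint_event) (rule m1)
 have e2: "{\<xi> \<in> space M. ?P2 (coinsv \<xi>) (trees \<xi>) (TZ \<xi>)} \<in> sets M" by (rule joint_event) (rule m2)
 have sub: "?S \<subseteq> {\<xi> \<in> space M. ?P1 (coinsv \<xi>) (trees \<xi>) (TZ \<xi>)} \<union> {\<xi> \<in> space M. ?P2 (coinsv \<xi>) (trees \<xi>) (TZ \<xi>)}"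
 proof
  fix \<xi> assume "\<xi> \<in> ?S"
  then have \<xi>: "\<xi> \<in> space M" and P0: "?P0 (coinsv \<xi>) (trees \<xi>) (TZ \<xi>)" unfolding S by auto
  show "\<xi> \<in> {\<xi> \<in> space M. ?P1 (coinsv \<xi>) (trees \<xi>) (TZ \<xi>)} \<union> {\<xi> \<in> space M. ?P2 (coinsv \<xi>) (trees \<xi>) (TZ \<xi>)}"
  proof (rule ccontr)
   assume "\<xi> \<notin> {\<xi> \<in> space M. ?P1 (coinsv \<xi>) (trees \<xi>) (TZ \<xi>)} \<union> {\<xi> \<in> space M. ?P2 (coinsv \<xi>) (trees \<xi>) (TZ \<xi>)}"
   then have "\<bar>entry_dev h l (?E (coinsv \<xi>)) (trees \<xi> u) u s (TZ \<xi>)\<bar> <= \<epsilon> * ?k (coinsv \<xi>)"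
    "\<bar>parent_dev h (?E (coinsv \<xi>)) (trees \<xi> u) u s (TZ \<xi>)\<bar> <= \<epsilon> * ?k (coinsv \<xi>)"
    using P0 \<xi> by auto
   note dev = this[unfolded entry_dev_def parent_dev_def]
   have "trees \<xi> u \<in> bfs_trees (?E (coinsv \<xi>)) u" "0 < card (sphere (?E (coinsv \<xi>)) u (Suc s))"
    using P0 m by (auto intro!: gr0I)
   from layer_avg_Suc[OF this(1) part_edges_subset this(2) dev] P0
   show False by linarith
  qed
 qed
 have "prob ?S <= prob ({\<xi> \<in> space M. ?P1 (coinsv \<xi>) (trees \<xi>) (TZ \<xi>)} \<union> {\<xi> \<in> space M. ?P2 (coinsv \<xi>) (trees \<xi>) (TZ \<xi>)})"
  by (rule finite_measure_mono[OF sub sets.Un[OF e1 e2]])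
 also have "... <= prob {\<xi> \<in> space M. ?P1 (coinsv \<xi>) (trees \<xi>) (TZ \<xi>)} + prob {\<xi> \<in> space M. ?P2 (coinsv \<xi>) (trees \<xi>) (TZ \<xi>)}"
  using e1 e2 by (rule measure_Un_le)
 also have "... <= 2 * exp (- \<epsilon>\<^sup>2 * m / (16 * B\<^sup>2)) + 2 * exp (- \<epsilon>\<^sup>2 * m / (16 * B\<^sup>2))"
 proof (rule add_mono)
  show "prob {\<xi> \<in> space M. ?P1 (coinsv \<xi>) (trees \<xi>) (TZ \<xi>)} <= 2 * exp (- \<epsilon>\<^sup>2 * m / (16 * B\<^sup>2))"
  proof (rule prob_le_uniform)
   fix c \<tau> assume w: "0 < jweight c \<tau>"
   note T = joint_weight_pos[OF w u]
   show "prob {\<xi> \<in> space M. ?P1 c \<tau> (TZ \<xi>)} <= 2 * exp (- \<epsilon>\<^sup>2 * m / (16 * B\<^sup>2))"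
   proof (cases "m <= ?k c")
    case True
    have "prob {\<xi> \<in> space M. ?P1 c \<tau> (TZ \<xi>)} = prob {\<xi> \<in> space M. \<bar>entry_dev h l (?E c) (\<tau> u) u s (TZ \<xi>)\<bar> > \<epsilon> * ?k c}"
     using True T by simp
    also have "... <= 2 * exp (- \<epsilon>\<^sup>2 * ?k c / (16 * B\<^sup>2))"
     by (rule entry_dev_event(2)[OF T part_edges_subset u \<epsilon>])
    also have "... <= 2 * exp (- \<epsilon>\<^sup>2 * m / (16 * B\<^sup>2))"
     using True B by (auto intro!: divide_right_mono mult_left_mono)
    finally show ?thesis .
   qed simp
  next
   show "Measurable.pred LZ (?P1 c \<tau>)" for c \<tau> by (rule m1)
  qed simp
  show "prob {\<xi> \<in> space M. ?P2 (coinsv \<xi>) (trees \<xi>) (TZ \<xi>)} <= 2 * exp (- \<epsilon>\<^sup>2 * m / (16 * B\<^sup>2))"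
   by (rule parent_dev_event[OF u \<epsilon>])
 qed
 finally show "prob ?S <= 4 * exp (- \<epsilon>\<^sup>2 * m / (16 * B\<^sup>2))" by simp
qed

end

end

section \<open>Concentration of the bilinear form and of the averages\<close>

definition norm_value :: "edges => edges => nat => nat => (nat \<times> nat => real) => nat => real" where
 "norm_value E T u s z i = path_value E T u s z i / real (card (sphere E u s))"

definition diff_value :: "edges => (nat => edges) => nat => nat => nat => (nat \<times> nat => real) => nat => real" where
 "diff_value E \<tau> u v s z i = norm_value E (\<tau> u) u s z i - norm_value E (\<tau> v) v s z i"

text \<open>Entries off the first part do not enter the neighborhood vectors; this is what leaves
  them fresh for the bilinear form.\<close>

lemma diff_value_cong:
 assumes "\<tau> u \<in> bfs_trees E u" "\<tau> v \<in> bfs_trees E v" "\<And>e. e \<in> E ==> z e = z' e"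
 shows "diff_value E \<tau> u v s z i = diff_value E \<tau> u v s z' i"
proof -
 have "path_value E (\<tau> w) w s z i = path_value E (\<tau> w) w s z' i" if "\<tau> w \<in> bfs_trees E w" for w
  using that assms(3) bfs_trees_subset[of E w] by (intro path_value_cong) auto
 then show ?thesis using assms(1,2) by (simp add: diff_value_def norm_value_def)
qed

lemma one_le_exp_mult: "exp a <= b ==> 1 <= exp (- a) * (b :: real)"
 by (simp add: exp_minus field_simps)

context icf_instance
begin

text \<open>Measurability and bounds of the neighborhood vectors are available for genuine trees.
  Every outcome and every configuration of positive weight has them.\<close>

definition valid_trees :: "(nat \<times> nat => bool \<times> part \<times> bool) => (nat => edges) => bool" where
 "valid_trees c \<tau> \<longleftrightarrow> (\<forall>u\<in>{1..n}. \<tau> u \<in> bfs_trees (edges1 c) u)"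

lemma valid_trees_pos: "0 < jweight c \<tau> ==> valid_trees c \<tau>"
 unfolding valid_trees_def using joint_weight_pos by blast

lemma valid_trees_data: "\<xi> \<in> space M ==> valid_trees (coinsv \<xi>) (trees \<xi>)"
 unfolding valid_trees_def using tree_in by (simp add: trees_def)

text \<open>Given the first part, the remaining pairs are in the second part independently with
  probability \<open>(p / 4) / (1 - p / 4)\<close>, which equals \<open>thin_prob p\<close>.\<close>

lemma coin_sum_Part1_Part2:
 assumes E: "E \<subseteq> pairs n"
 shows "(\<Sum>c | c \<in> coin_configs n \<and> edges1 c = E. cweight c *
   (\<Prod>e\<in>pairs n - E. if e \<in> part_edges n Part2 c then a e else 1))
  = edge_weight n (p / 4) E * (\<Prod>e\<in>pairs n - E. 1 - thin_prob p + thin_prob p * a e)"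
proof -
 define g where "g e v = (if (fst v \<and> fst (snd v) = Part1) = (e \<in> E)
   then (if e \<notin> E \<and> fst v \<and> fst (snd v) = Part2 then a e else 1) else (0::real))" for e and v :: "bool \<times> part \<times> bool"
 define G where "G e k = (if (k = Part1) = (e \<in> E) then (if e \<notin> E \<and> k = Part2 then a e else 1) else (0::real))" for e k
 have fE: "finite E" using E by (rule finite_subset) auto
 define Gp where "Gp c = (\<Prod>e\<in>pairs n. g e (c e))" for c
 have g: "Gp c = (if edges1 c = E
   then (\<Prod>e\<in>pairs n - E. if e \<in> part_edges n Part2 c then a e else 1) else 0)" for c
 proof (cases "edges1 c = E")
  case True
  have "g e (c e) = (if e \<notin> E \<and> e \<in> part_edges n Part2 c then a e else 1)" if "e \<in> pairs n" for e
  proof -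
   have "(fst (c e) \<and> fst (snd (c e)) = Part1) = (e \<in> E)" using True that unfolding part_edges_def by blast
   moreover have "(fst (c e) \<and> fst (snd (c e)) = Part2) = (e \<in> part_edges n Part2 c)"
    using that unfolding part_edges_def by blast
   ultimately show ?thesis unfolding g_def by simp
  qed
  then have "(\<Prod>e\<in>pairs n. g e (c e)) = (\<Prod>e\<in>pairs n. if e \<notin> E \<and> e \<in> part_edges n Part2 c then a e else 1)"
   by (intro prod.cong) auto
  also have "... = (\<Prod>e\<in>pairs n - E. if e \<in> part_edges n Part2 c then a e else 1)"
   by (intro prod.mono_neutral_cong_right) auto
  finally show ?thesis using True by (simp add: Gp_def)
 next
  case False
  then obtain e where "e \<in> pairs n" "(fst (c e) \<and> fst (snd (c e)) = Part1) \<noteq> (e \<in> E)"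
   using E unfolding part_edges_def by blast
  then have "g e (c e) = 0" "e \<in> pairs n" by (auto simp: g_def)
  then have "Gp c = 0" unfolding Gp_def by (intro prod_zero) auto
  with False show ?thesis by simp
 qed
 have "(\<Sum>c | c \<in> coin_configs n \<and> edges1 c = E. cweight c *
   (\<Prod>e\<in>pairs n - E. if e \<in> part_edges n Part2 c then a e else 1))
   = (\<Sum>c\<in>coin_configs n. cweight c * Gp c)"
  by (intro sum.mono_neutral_cong_left) (auto simp: g)
 also have "... = (\<Prod>e\<in>pairs n. p * (G e Part1 / 4 + G e Part2 / 4 + G e Part3 / 2) + (1 - p) * of_bool (e \<notin> E))"
  unfolding Gp_def by (rule sum_coin_weight_parts) (simp add: g_def G_def)
 also have "... = (\<Prod>e\<in>pairs n. if e \<in> E then p / 4 else (1 - p / 4) * (1 - thin_prob p + thin_prob p * a e))"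
 proof (intro prod.cong refl)
  fix e
  have t: "(1 - p / 4) * thin_prob p = p / 4" using p_le_1 by (simp add: thin_prob_def field_simps)
  have "(1 - p / 4) * (1 - thin_prob p + thin_prob p * a e) = (1 - p / 4) - p / 4 + p / 4 * a e"
  proof -
   have "(1 - p / 4) * (1 - thin_prob p + thin_prob p * a e)
     = (1 - p / 4) - (1 - p / 4) * thin_prob p + (1 - p / 4) * thin_prob p * a e"
    by (simp only: distrib_left right_diff_distrib mult.assoc mult_1_right)
   then show ?thesis unfolding t .
  qed
  then show "p * (G e Part1 / 4 + G e Part2 / 4 + G e Part3 / 2) + (1 - p) * of_bool (e \<notin> E)
    = (if e \<in> E then p / 4 else (1 - p / 4) * (1 - thin_prob p + thin_prob p * a e))"
   by (cases "e \<in> E") (simp_all add: G_def algebra_simps)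
 qed
 also have "... = (p / 4) ^ card E * (\<Prod>e\<in>pairs n - E. (1 - p / 4) * (1 - thin_prob p + thin_prob p * a e))"
 proof -
  have "pairs n \<inter> {e. e \<in> E} = E" "pairs n \<inter> - {e. e \<in> E} = pairs n - E" using E by auto
  then show ?thesis by (subst prod.If_cases) auto
 qed
 finally show ?thesis
  using E fE by (simp add: prod.distrib edge_weight_def card_Diff_subset card_cartesian_product)
qed

lemma diff_value_measurable:
 assumes "valid_trees c \<tau>" "u \<in> {1..n}" "v \<in> {1..n}"
 shows "diff_value (edges1 c) \<tau> u v s z' \<in> borel_measurable (count_space UNIV)"
  and "(%z. diff_value (edges1 c) \<tau> u v s z i) \<in> borel_measurable (Z_space n)"
proof -
 have "(%z. path_value (edges1 c) (\<tau> w) w s z i) \<in> borel_measurable (Z_space n)" if "w \<in> {1..n}" for w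
  using assms(1) that by (intro path_value_measurable part_edges_subset) (simp add: valid_trees_def)
 then show "(%z. diff_value (edges1 c) \<tau> u v s z i) \<in> borel_measurable (Z_space n)"
  unfolding diff_value_def norm_value_def using assms(2,3) by simp
qed simp

lemma diff_value_bound:
 assumes "valid_trees c \<tau>" "u \<in> {1..n}" "v \<in> {1..n}" and x: "\<And>e. e \<in> pairs n ==> z e \<in> {0..1}"
  and m: "0 < m" "m <= real (card (sphere (edges1 c) u s))" "m <= real (card (sphere (edges1 c) v s))"
 shows "\<bar>diff_value (edges1 c) \<tau> u v s z i\<bar> <= 1 / m"
proof -
 have "norm_value (edges1 c) (\<tau> w) w s z i \<in> {0..1 / m}"
  if w: "w \<in> {1..n}" and mw: "m <= real (card (sphere (edges1 c) w s))" for w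
 proof -
  have T: "\<tau> w \<in> bfs_trees (edges1 c) w" using assms(1) w by (simp add: valid_trees_def)
  have "path_value (edges1 c) (\<tau> w) w s z i \<in> {0..1}"
  proof (rule path_value_range[OF T])
   fix e assume "e \<in> \<tau> w"
   then have "e \<in> pairs n" using T bfs_trees_subset part_edges_subset by blast
   then show "z e \<in> {0..1}" by (rule x)
  qed
  then show ?thesis unfolding norm_value_def using mw m(1)
   by (auto intro!: frac_le divide_nonneg_nonneg)
 qed
 from this[OF assms(2) m(2)] this[OF assms(3) m(3)] show ?thesis
  unfolding diff_value_def by (auto simp: abs_le_iff)
qed

text \<open>Pairs of the first part are left out, since the vectors depend on them. On all other
  pairs coins and entries are fresh, and subtracting \<open>thin_prob p * Fv e\<close> centers the
  sum.\<close>

definition bilinear_dev where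
 "bilinear_dev c \<tau> u v s1 s2 x = (\<Sum>e\<in>pairs n - edges1 c.
  diff_value (edges1 c) \<tau> u v s1 (snd x) (fst e) * diff_value (edges1 c) \<tau> u v s2 (snd x) (snd e) *
  (of_bool (e \<in> part_edges n Part2 c) * snd x e - thin_prob p * Fv e (fst x)))"

definition big_layers where
 "big_layers m E u v s1 s2 \<longleftrightarrow> m <= real (card (sphere E u s1)) \<and> m <= real (card (sphere E v s1)) \<and>
  m <= real (card (sphere E u s2)) \<and> m <= real (card (sphere E v s2))"

lemma bilinear_dev_measurable:
 assumes V: "valid_trees c \<tau>" and u: "u \<in> {1..n}" and v: "v \<in> {1..n}"
 shows "bilinear_dev c \<tau> u v s1 s2 \<in> borel_measurable LZ"
 unfolding bilinear_dev_def[abs_def]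
proof (intro borel_measurable_sum borel_measurable_times borel_measurable_diff borel_measurable_const)
 fix e assume "e \<in> pairs n - edges1 c"
 then have e: "e \<in> pairs n" by simp
 show "(%x. diff_value (edges1 c) \<tau> u v s1 (snd x) (fst e)) \<in> borel_measurable LZ"
  "(%x. diff_value (edges1 c) \<tau> u v s2 (snd x) (snd e)) \<in> borel_measurable LZ"
  by (rule measurable_compose[OF measurable_snd diff_value_measurable(2)[OF V u v]])+
 show "(%x. snd x e) \<in> borel_measurable LZ" "(%x. Fv e (fst x)) \<in> borel_measurable LZ"
  using snd_comp[OF e] Fv_fst[OF e] by auto
qed

text \<open>For a fixed first part and fixed trees the coefficients depend only on entries of the
  first part. The coins of the second part are averaged explicitly, and the entries are left to
  \<open>entries_exp_moment\<close>. Each coefficient is at most \<open>1 / m\<^sup>2\<close>, so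
  the variance term over all pairs is at most
  \<open>thin_prob p * s\<^sup>2 * (real n)\<^sup>2 / m ^ 4\<close>.\<close>

theorem bilinear_event:
 assumes u: "u \<in> {1..n}" and v: "v \<in> {1..n}" and m: "0 < m" and s: "0 < s" "s <= m\<^sup>2"
 shows "{\<xi> \<in> space M. big_layers m (edges1 (coinsv \<xi>)) u v s1 s2 \<and>
   \<bar>bilinear_dev (coinsv \<xi>) (trees \<xi>) u v s1 s2 (TZ \<xi>)\<bar> > t0} \<in> sets M" (is "?S \<in> _")
  and "prob {\<xi> \<in> space M. big_layers m (edges1 (coinsv \<xi>)) u v s1 s2 \<and>
   \<bar>bilinear_dev (coinsv \<xi>) (trees \<xi>) u v s1 s2 (TZ \<xi>)\<bar> > t0}
   <= 2 * exp (thin_prob p * s\<^sup>2 * (real n)\<^sup>2 / m ^ 4 - s * t0)"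
proof -
 let ?E = "%c. edges1 c" and ?b = "%c \<tau>. bilinear_dev c \<tau> u v s1 s2"
 let ?P = "%c \<tau> pt. big_layers m (?E c) u v s1 s2 \<and> valid_trees c \<tau> \<and> \<bar>?b c \<tau> pt\<bar> > t0"
 define h where "h y c \<tau> pt = (if big_layers m (?E c) u v s1 s2 then exp (y * ?b c \<tau> pt) else 0)" for y c \<tau> pt
 define K where "K = exp (thin_prob p * s\<^sup>2 * (real n)\<^sup>2 / m ^ 4)"
 define \<gamma> where "\<gamma> E \<tau> e z = diff_value E \<tau> u v s1 z (fst e) * diff_value E \<tau> u v s2 z (snd e)" for E \<tau> e z
 have S: "?S = {\<xi> \<in> space M. ?P (coinsv \<xi>) (trees \<xi>) (TZ \<xi>)}"
  using valid_trees_data by blast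
 have Pm: "Measurable.pred LZ (?P c \<tau>)" for c \<tau>
 proof (cases "valid_trees c \<tau>")
  case True
  note [measurable] = bilinear_dev_measurable[OF True u v]
  show ?thesis by measurable
 qed simp
 show "?S \<in> sets M" unfolding S by (rule joint_event) (rule Pm)
 have \<gamma>b: "\<bar>\<gamma> (?E c) \<tau> e z\<bar> <= 1 / m\<^sup>2"
  if "valid_trees c \<tau>" "big_layers m (?E c) u v s1 s2" "\<And>e. e \<in> pairs n ==> z e \<in> {0..1}" for c \<tau> e z
 proof -
  have "\<bar>diff_value (?E c) \<tau> u v s1 z (fst e)\<bar> <= 1 / m" "\<bar>diff_value (?E c) \<tau> u v s2 z (snd e)\<bar> <= 1 / m"
   using that m by (auto intro!: diff_value_bound[OF that(1) u v that(3)] simp: big_layers_def)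
  then have "\<bar>diff_value (?E c) \<tau> u v s1 z (fst e)\<bar> * \<bar>diff_value (?E c) \<tau> u v s2 z (snd e)\<bar> <= (1 / m) * (1 / m)"
   using m by (intro mult_mono) auto
  then show ?thesis by (simp add: \<gamma>_def abs_mult power2_eq_square)
 qed
 have Dz: "z e \<in> {0..1}" if "x \<in> Dom" "z = snd x" "e \<in> pairs n" for x z e
  using Dom_snd[OF that(1,3)] that(2) by simp
 have bb: "\<bar>?b c \<tau> pt\<bar> <= real (card (pairs n - ?E c)) * (1 / m\<^sup>2 * 2)"
  if V: "valid_trees c \<tau>" and L: "big_layers m (?E c) u v s1 s2" and pt: "pt \<in> Dom" for c \<tau> pt
  unfolding bilinear_dev_def
 proof (rule order_trans[OF sum_abs], rule sum_bounded_above)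
  fix e assume "e \<in> pairs n - ?E c"
  then have z: "0 <= snd pt e \<and> snd pt e <= 1" using Dom_snd[OF pt] by simp
  have "\<bar>of_bool (e \<in> part_edges n Part2 c) * snd pt e\<bar> <= 1" using z by simp
  moreover have "\<bar>thin_prob p * Fv e (fst pt)\<bar> <= 1" unfolding abs_mult using thin_bounds by (intro mult_le_one) auto
  ultimately have "\<bar>of_bool (e \<in> part_edges n Part2 c) * snd pt e - thin_prob p * Fv e (fst pt)\<bar> <= 2" by linarith
  moreover have "\<bar>\<gamma> (?E c) \<tau> e (snd pt)\<bar> <= 1 / m\<^sup>2" using \<gamma>b[OF V L] Dz[OF pt refl] by blast
  ultimately have "\<bar>\<gamma> (?E c) \<tau> e (snd pt)\<bar> * \<bar>of_bool (e \<in> part_edges n Part2 c) * snd pt e - thin_prob p * Fv e (fst pt)\<bar> <= 1 / m\<^sup>2 * 2"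
   by (intro mult_mono) auto
  then show "\<bar>diff_value (?E c) \<tau> u v s1 (snd pt) (fst e) * diff_value (?E c) \<tau> u v s2 (snd pt) (snd e) *
    (of_bool (e \<in> part_edges n Part2 c) * snd pt e - thin_prob p * Fv e (fst pt))\<bar> <= 1 / m\<^sup>2 * 2"
   by (simp add: \<gamma>_def abs_mult)
 qed
 have hint: "integrable M (%\<xi>. h y c \<tau> (TZ \<xi>))" if V: "valid_trees c \<tau>" for y c \<tau>
 proof (cases "big_layers m (?E c) u v s1 s2")
  case True
  show ?thesis
  proof (rule integrable_TZ)
   show "h y c \<tau> \<in> borel_measurable LZ"
    unfolding h_def[abs_def] using True bilinear_dev_measurable[OF V u v, of s1 s2] by simp
   fix pt assume pt: "pt \<in> Dom"
   have "\<bar>y * ?b c \<tau> pt\<bar> <= \<bar>y\<bar> * (real (card (pairs n - ?E c)) * (1 / m\<^sup>2 * 2))"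
    unfolding abs_mult using bb[OF V True pt] by (intro mult_left_mono) auto
   then show "\<bar>h y c \<tau> pt\<bar> <= exp (\<bar>y\<bar> * (real (card (pairs n - ?E c)) * (1 / m\<^sup>2 * 2)))"
    unfolding h_def using True by (simp add: abs_le_iff)
  qed
 qed (simp add: h_def)
 have main: "(\<Sum>c\<in>coin_configs n. \<Sum>\<tau>\<in>tree_configs n. jweight c \<tau> * expectation (%\<xi>. h y c \<tau> (TZ \<xi>))) <= K"
  if y: "\<bar>y\<bar> = s" for y
 proof -
  let ?tw = "%E \<tau>. \<Prod>w\<in>{1..n}. tree_weight E w (\<tau> w)"
  let ?C = "%E. {c. c \<in> coin_configs n \<and> ?E c = E}"
  have tw0: "0 <= ?tw E \<tau>" for E \<tau> by (intro prod_nonneg) simp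
  have inner: "(\<Sum>c\<in>?C E. cweight c * expectation (%\<xi>. h y c \<tau> (TZ \<xi>))) <= edge_weight n (p / 4) E * K"
   if E: "E \<subseteq> pairs n" and V: "\<forall>w\<in>{1..n}. \<tau> w \<in> bfs_trees E w" for E \<tau>
  proof (cases "big_layers m E u v s1 s2")
   case L: True
   let ?W = "pairs n - E"
   have fin: "finite ?W" by simp
   have ew: "0 <= edge_weight n (p / 4) E" unfolding edge_weight_def using p_pos p_le_1 by simp
   have V': "valid_trees c \<tau>" if "c \<in> ?C E" for c using V that by (auto simp: valid_trees_def)
   define t where "t e pt = (1 - thin_prob p + thin_prob p * exp (y * \<gamma> E \<tau> e (snd pt) * snd pt e)) *
     exp (- thin_prob p * (y * \<gamma> E \<tau> e (snd pt)) * Fv e (fst pt) - thin_prob p * (y * \<gamma> E \<tau> e (snd pt))\<^sup>2)" for e pt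
   have y\<gamma>: "\<bar>y * \<gamma> E \<tau> e z\<bar> <= s / m\<^sup>2" if z01: "\<And>e. e \<in> pairs n ==> z e \<in> {0..1}" and ne: "?C E \<noteq> {}" for e z
   proof -
    obtain c where c: "c \<in> ?C E" using ne by blast
    have "\<bar>\<gamma> (?E c) \<tau> e z\<bar> <= 1 / m\<^sup>2"
     by (rule \<gamma>b[OF V'[OF c]]) (use c L z01 in auto)
    then have "\<bar>\<gamma> E \<tau> e z\<bar> <= 1 / m\<^sup>2" using c by simp
    then have "\<bar>y\<bar> * \<bar>\<gamma> E \<tau> e z\<bar> <= s * (1 / m\<^sup>2)" using y s by (intro mult_mono) auto
    then show ?thesis by (simp add: abs_mult)
   qed
   show ?thesis
   proof (cases "?C E = {}")
    case False
    then obtain c0 where c0: "c0 \<in> ?C E" by blast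
    have sm: "s / m\<^sup>2 <= 1" using s m by simp
    have ent: "integrable M (%\<xi>. \<Prod>e\<in>?W. t e (TZ \<xi>))" "expectation (%\<xi>. \<Prod>e\<in>?W. t e (TZ \<xi>)) <= 1"
    proof -
     have g1: "(%z. y * \<gamma> E \<tau> e z) \<in> borel_measurable (Z_space n)" if "e \<in> ?W" for e
      unfolding \<gamma>_def using diff_value_measurable(2)[OF V'[OF c0] u v] c0
      by (intro borel_measurable_times borel_measurable_const) auto
     have g2: "y * \<gamma> E \<tau> e (z(e' := b)) = y * \<gamma> E \<tau> e z" if "e \<in> ?W" "e' \<in> ?W" for e e' z b
     proof -
      have "(z(e' := b)) e'' = z e''" if "e'' \<in> E" for e'' using \<open>e' \<in> ?W\<close> that by auto
      then have "diff_value E \<tau> u v s' (z(e' := b)) i = diff_value E \<tau> u v s' z i" for s' i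
       using V u v by (intro diff_value_cong) auto
      then show ?thesis unfolding \<gamma>_def by simp
     qed
     have g3: "\<bar>y * \<gamma> E \<tau> e z\<bar> <= 1" if "e \<in> ?W" "\<And>e. e \<in> pairs n ==> z e \<in> {0..1}" for e z
      by (rule order_trans[OF y\<gamma>[OF that(2) False] sm])
     note em = entries_exp_moment[where \<gamma> = "%e z. y * \<gamma> E \<tau> e z" and \<pi> = "thin_prob p" and W = ?W, OF Diff_subset g1 g2 g3 less_imp_le[OF thin_bounds(1)] thin_bounds(2)]
     show "integrable M (%\<xi>. \<Prod>e\<in>?W. t e (TZ \<xi>))" unfolding t_def by (rule em(2))
     show "expectation (%\<xi>. \<Prod>e\<in>?W. t e (TZ \<xi>)) <= 1" unfolding t_def by (rule em(3))
    qed
    \<comment> \<open>For fixed data, summing over the coins with first part \<open>E\<close> turns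
      the exponential into the product treated by \<open>entries_exp_moment\<close>, up to the
      variance factor \<open>K\<close>.\<close>
    have pw: "(\<Sum>c\<in>?C E. cweight c * h y c \<tau> pt) <= edge_weight n (p / 4) E * K * (\<Prod>e\<in>?W. t e pt)"
     if pt: "pt \<in> Dom" for pt
    proof -
     let ?g = "%e. y * \<gamma> E \<tau> e (snd pt)" and ?z = "snd pt"
     have "h y c \<tau> pt = (\<Prod>e\<in>?W. exp (- thin_prob p * ?g e * Fv e (fst pt))) * (\<Prod>e\<in>?W. if e \<in> part_edges n Part2 c then exp (?g e * ?z e) else 1)"
      if c: "c \<in> ?C E" for c
     proof -
      have "h y c \<tau> pt = exp (\<Sum>e\<in>?W. ?g e * (of_bool (e \<in> part_edges n Part2 c) * ?z e - thin_prob p * Fv e (fst pt)))"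
       using c L unfolding h_def bilinear_dev_def by (simp add: sum_distrib_left \<gamma>_def mult.assoc)
      also have "... = (\<Prod>e\<in>?W. exp (- thin_prob p * ?g e * Fv e (fst pt)) * (if e \<in> part_edges n Part2 c then exp (?g e * ?z e) else 1))"
       unfolding exp_sum[OF fin] by (intro prod.cong refl) (auto simp: algebra_simps simp flip: exp_add)
      finally show ?thesis by (simp add: prod.distrib)
     qed
     then have "(\<Sum>c\<in>?C E. cweight c * h y c \<tau> pt)
       = (\<Prod>e\<in>?W. exp (- thin_prob p * ?g e * Fv e (fst pt))) *
        (\<Sum>c\<in>?C E. cweight c * (\<Prod>e\<in>?W. if e \<in> part_edges n Part2 c then exp (?g e * ?z e) else 1))"
      unfolding sum_distrib_left by (intro sum.cong refl) (simp add: mult_ac)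
     also have "... = edge_weight n (p / 4) E * (\<Prod>e\<in>?W. (1 - thin_prob p + thin_prob p * exp (?g e * ?z e)) * exp (- thin_prob p * ?g e * Fv e (fst pt)))"
      unfolding coin_sum_Part1_Part2[OF E] prod.distrib by (simp only: mult_ac)
     also have "(\<Prod>e\<in>?W. (1 - thin_prob p + thin_prob p * exp (?g e * ?z e)) * exp (- thin_prob p * ?g e * Fv e (fst pt)))
       = (\<Prod>e\<in>?W. t e pt * exp (thin_prob p * (?g e)\<^sup>2))"
      unfolding t_def by (intro prod.cong refl) (simp add: exp_diff mult.assoc)
     also have "... = (\<Prod>e\<in>?W. t e pt) * exp (\<Sum>e\<in>?W. thin_prob p * (?g e)\<^sup>2)"
      by (simp add: prod.distrib exp_sum)
     also have "... <= (\<Prod>e\<in>?W. t e pt) * K"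
     proof (rule mult_left_mono)
      have "(\<Sum>e\<in>?W. thin_prob p * (?g e)\<^sup>2) <= real (card ?W) * (thin_prob p * (s / m\<^sup>2)\<^sup>2)"
      proof (rule sum_bounded_above)
       fix e
       have "\<bar>?g e\<bar> <= s / m\<^sup>2" by (rule y\<gamma>[OF Dz[OF pt refl] False])
       then have "(?g e)\<^sup>2 <= (s / m\<^sup>2)\<^sup>2" by (metis abs_ge_zero power2_abs power_mono)
       then show "thin_prob p * (?g e)\<^sup>2 <= thin_prob p * (s / m\<^sup>2)\<^sup>2"
        using thin_bounds(1) by (intro mult_left_mono) auto
      qed
      also have "... <= real (n * n) * (thin_prob p * (s / m\<^sup>2)\<^sup>2)"
      proof (rule mult_right_mono)
       have "card ?W <= card (pairs n)" by (rule card_mono) auto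
       then have "card ?W <= n * n" by (simp add: card_cartesian_product)
       then show "real (card ?W) <= real (n * n)" by (rule of_nat_mono)
      qed (use thin_bounds(1) in simp)
      also have "... = thin_prob p * s\<^sup>2 * (real n)\<^sup>2 / m ^ 4"
       by (simp add: power2_eq_square power4_eq_xxxx mult_ac)
      finally show "exp (\<Sum>e\<in>?W. thin_prob p * (?g e)\<^sup>2) <= K" by (simp add: K_def)
      show "0 <= (\<Prod>e\<in>?W. t e pt)"
       unfolding t_def using thin_bounds by (intro prod_nonneg mult_nonneg_nonneg add_nonneg_nonneg) auto
     qed
     finally show ?thesis using ew by (simp add: mult_ac mult_left_mono mult_right_mono)
    qed
    have "(\<Sum>c\<in>?C E. cweight c * expectation (%\<xi>. h y c \<tau> (TZ \<xi>)))
      = expectation (%\<xi>. \<Sum>c\<in>?C E. cweight c * h y c \<tau> (TZ \<xi>))"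
     using hint[OF V'] by (subst Bochner_Integration.integral_sum) auto
    also have "... <= expectation (%\<xi>. edge_weight n (p / 4) E * K * (\<Prod>e\<in>?W. t e (TZ \<xi>)))"
    proof (rule integral_mono)
     show "integrable M (%\<xi>. \<Sum>c\<in>?C E. cweight c * h y c \<tau> (TZ \<xi>))"
      using hint[OF V'] by (intro Bochner_Integration.integrable_sum integrable_mult_right) auto
     show "integrable M (%\<xi>. edge_weight n (p / 4) E * K * (\<Prod>e\<in>?W. t e (TZ \<xi>)))"
      using ent(1) by (rule integrable_mult_right)
    qed (rule pw[OF TZ_Dom])
    also have "... = edge_weight n (p / 4) E * K * expectation (%\<xi>. \<Prod>e\<in>?W. t e (TZ \<xi>))" by simp
    also have "... <= edge_weight n (p / 4) E * K * 1"
     using ent(2) ew by (intro mult_left_mono) (auto simp: K_def)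
    finally show ?thesis by simp
   next
    case True
    show ?thesis unfolding True using ew by (simp add: K_def)
   qed
  next
   case False
   have "0 <= edge_weight n (p / 4) E" unfolding edge_weight_def using p_pos p_le_1 by simp
   moreover have "(\<Sum>c\<in>?C E. cweight c * expectation (%\<xi>. h y c \<tau> (TZ \<xi>))) = 0"
    using False by (intro sum.neutral) (auto simp: h_def)
   ultimately show ?thesis by (simp add: K_def)
  qed
  \<comment> \<open>The sum is regrouped by the first part, because the tree weights depend on the
    coins only through it.\<close>
  have "(\<Sum>c\<in>coin_configs n. \<Sum>\<tau>\<in>tree_configs n. jweight c \<tau> * expectation (%\<xi>. h y c \<tau> (TZ \<xi>)))
   = (\<Sum>E\<in>Pow (pairs n). \<Sum>c\<in>?C E. \<Sum>\<tau>\<in>tree_configs n. jweight c \<tau> * expectation (%\<xi>. h y c \<tau> (TZ \<xi>)))"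
   using part_edges_subset by (intro sum.group[symmetric]) auto
  also have "... = (\<Sum>E\<in>Pow (pairs n). \<Sum>\<tau>\<in>tree_configs n. ?tw E \<tau> * (\<Sum>c\<in>?C E. cweight c * expectation (%\<xi>. h y c \<tau> (TZ \<xi>))))"
   unfolding sum_distrib_left
   by (intro sum.cong refl, subst sum.swap, intro sum.cong refl) (auto simp: joint_weight_def)
  also have "... <= (\<Sum>E\<in>Pow (pairs n). \<Sum>\<tau>\<in>tree_configs n. ?tw E \<tau> * (edge_weight n (p / 4) E * K))"
  proof (intro sum_mono)
   fix E \<tau> assume E: "E \<in> Pow (pairs n)"
   show "?tw E \<tau> * (\<Sum>c\<in>?C E. cweight c * expectation (%\<xi>. h y c \<tau> (TZ \<xi>))) <= ?tw E \<tau> * (edge_weight n (p / 4) E * K)"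
   proof (cases "\<forall>w\<in>{1..n}. \<tau> w \<in> bfs_trees E w")
    case True
    then show ?thesis using E tw0 by (intro mult_left_mono inner) auto
   next
    case False
    then obtain w where w: "w \<in> {1..n}" "\<tau> w \<notin> bfs_trees E w" by blast
    have "finite E" using E by (auto intro: finite_subset)
    then have "finite (bfs_trees E w)" using finite_subset[OF bfs_trees_subset] by blast
    then have "tree_weight E w (\<tau> w) = 0" using w bfs_trees_nonempty by (simp add: tree_weight_def)
    then have "?tw E \<tau> = 0" using w(1) by (intro prod_zero) auto
    then show ?thesis by (simp only: mult_zero_left)
   qed
  qed
  also have "... = (\<Sum>E\<in>Pow (pairs n). edge_weight n (p / 4) E * K * (\<Sum>\<tau>\<in>tree_configs n. ?tw E \<tau>))"
   unfolding sum_distrib_left by (simp only: mult_ac)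
  also have "... <= (\<Sum>E\<in>Pow (pairs n). edge_weight n (p / 4) E * K * 1)"
   using p_pos p_le_1 by (intro sum_mono mult_left_mono sum_trees_le) (auto simp: K_def edge_weight_def)
  also have "... = K * (\<Sum>E\<in>Pow (pairs n). edge_weight n (p / 4) E * 1)"
   unfolding sum_distrib_left by (simp only: mult_ac)
  also have "... = K"
   unfolding coin_sum_Part1[where G = "%_. 1", symmetric] by (simp add: sum_coin_weight)
  finally show ?thesis .
 qed
 have "prob {\<xi> \<in> space M. ?P (coinsv \<xi>) (trees \<xi>) (TZ \<xi>)}
  <= (\<Sum>c\<in>coin_configs n. \<Sum>\<tau>\<in>tree_configs n. jweight c \<tau> *
     expectation (%\<xi>. exp (- (s * t0)) * (h s c \<tau> (TZ \<xi>) + h (- s) c \<tau> (TZ \<xi>))))"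
 proof (rule prob_le_joint)
  show "Measurable.pred LZ (?P c \<tau>)" for c \<tau> by (rule Pm)
  fix c \<tau> assume w: "0 < jweight c \<tau>"
  note V = valid_trees_pos[OF w]
  show "integrable M (%\<xi>. exp (- (s * t0)) * (h s c \<tau> (TZ \<xi>) + h (- s) c \<tau> (TZ \<xi>)))"
   using hint[OF V] by simp
  show "0 <= exp (- (s * t0)) * (h s c \<tau> pt + h (- s) c \<tau> pt)" for pt by (simp add: h_def)
  fix pt assume P: "?P c \<tau> pt"
  have "exp (s * t0) <= exp (s * ?b c \<tau> pt) + exp (- s * ?b c \<tau> pt)"
   using P s by (intro abs_le_exp_sum) auto
  then show "1 <= exp (- (s * t0)) * (h s c \<tau> pt + h (- s) c \<tau> pt)"
   using P unfolding h_def by (simp add: exp_minus[of "s * t0"] field_simps)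
 qed
 also have "... = exp (- (s * t0)) * ((\<Sum>c\<in>coin_configs n. \<Sum>\<tau>\<in>tree_configs n. jweight c \<tau> * expectation (%\<xi>. h s c \<tau> (TZ \<xi>)))
  + (\<Sum>c\<in>coin_configs n. \<Sum>\<tau>\<in>tree_configs n. jweight c \<tau> * expectation (%\<xi>. h (- s) c \<tau> (TZ \<xi>))))"
 proof -
  have eq: "jweight c \<tau> * expectation (%\<xi>. exp (- (s * t0)) * (h s c \<tau> (TZ \<xi>) + h (- s) c \<tau> (TZ \<xi>)))
   = exp (- (s * t0)) * (jweight c \<tau> * expectation (%\<xi>. h s c \<tau> (TZ \<xi>))
   + jweight c \<tau> * expectation (%\<xi>. h (- s) c \<tau> (TZ \<xi>)))" for c \<tau>
  proof (cases "jweight c \<tau> = 0")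
   case False
   then have w: "0 < jweight c \<tau>" using joint_weight_nonneg[of n p c \<tau>] by linarith
   show ?thesis using hint[OF valid_trees_pos[OF w]] by (simp add: algebra_simps)
  qed simp
  show ?thesis unfolding eq by (simp only: distrib_left sum.distrib sum_distrib_left)
 qed
 also have "... <= exp (- (s * t0)) * (K + K)"
  using main[of s] main[of "- s"] s by (intro mult_left_mono add_mono) auto
 also have "... = 2 * exp (thin_prob p * s\<^sup>2 * (real n)\<^sup>2 / m ^ 4 - s * t0)"
  by (simp add: K_def exp_diff exp_minus field_simps)
 finally show "prob ?S <= 2 * exp (thin_prob p * s\<^sup>2 * (real n)\<^sup>2 / m ^ 4 - s * t0)" unfolding S .
qed

text \<open>The set \<open>S\<close> may depend on everything except the entries of the third part,
  so these are fresh and \<open>entries_exp_moment\<close> applies with observation probability 1.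
  As the size of \<open>S\<close> is random, it enters through the compensator and the deviation is
  measured relative to it.\<close>

theorem noise_event:
 fixes S :: "(nat \<times> nat => bool \<times> part \<times> bool) => (nat => edges) => (nat \<times> nat => real) => edges"
 assumes sub: "\<And>c \<tau> z. S c \<tau> z \<subseteq> part_edges n Part3 c"
  and Sm: "\<And>c \<tau> e. valid_trees c \<tau> ==> Measurable.pred (Z_space n) (%z. e \<in> S c \<tau> z)"
  and dep: "\<And>c \<tau> e z b. valid_trees c \<tau> ==> e \<in> part_edges n Part3 c ==> S c \<tau> (z(e := b)) = S c \<tau> z"
  and x: "0 < x" "x <= 1"
 shows "{\<xi> \<in> space M. N0 <= real (card (S (coinsv \<xi>) (trees \<xi>) (Zs \<xi>))) \<and>
   \<bar>\<Sum>e\<in>S (coinsv \<xi>) (trees \<xi>) (Zs \<xi>). Zs \<xi> e - Fv e (thetas \<xi>)\<bar>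
    > 2 * x * real (card (S (coinsv \<xi>) (trees \<xi>) (Zs \<xi>)))} \<in> sets M" (is "?S \<in> _")
  and "prob {\<xi> \<in> space M. N0 <= real (card (S (coinsv \<xi>) (trees \<xi>) (Zs \<xi>))) \<and>
   \<bar>\<Sum>e\<in>S (coinsv \<xi>) (trees \<xi>) (Zs \<xi>). Zs \<xi> e - Fv e (thetas \<xi>)\<bar>
    > 2 * x * real (card (S (coinsv \<xi>) (trees \<xi>) (Zs \<xi>)))} <= 2 * exp (- x\<^sup>2 * N0)"
proof -
 let ?k = "%c \<tau> pt. real (card (S c \<tau> (snd pt)))"
 let ?R = "%c \<tau> pt. \<Sum>e\<in>S c \<tau> (snd pt). snd pt e - Fv e (fst pt)"
 let ?P = "%c \<tau> pt. valid_trees c \<tau> \<and> N0 <= ?k c \<tau> pt \<and> \<bar>?R c \<tau> pt\<bar> > 2 * x * ?k c \<tau> pt"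
 have sumS: "(\<Sum>e\<in>S c \<tau> (snd pt). g e) = (\<Sum>e\<in>part_edges n Part3 c. of_bool (e \<in> S c \<tau> (snd pt)) * g e)" for c \<tau> pt and g :: "nat \<times> nat => real"
  using sub[of c \<tau> "snd pt"] by (intro sum.mono_neutral_cong_left) auto
 have kS: "?k c \<tau> pt = (\<Sum>e\<in>part_edges n Part3 c. of_bool (e \<in> S c \<tau> (snd pt)))" for c \<tau> pt
  using sumS[of "%_. 1" c \<tau> pt] by simp
 have obm: "(%pt. of_bool (e \<in> S c \<tau> (snd pt)) :: real) \<in> borel_measurable LZ" if V: "valid_trees c \<tau>" for e c \<tau>
 proof -
  have "(%z. of_bool (e \<in> S c \<tau> z) :: real) \<in> borel_measurable (Z_space n)"
   using Sm[OF V, of e] by measurable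
  from measurable_compose[OF measurable_snd this] show ?thesis .
 qed
 have km: "?k c \<tau> \<in> borel_measurable LZ" if V: "valid_trees c \<tau>" for c \<tau>
  unfolding kS using obm[OF V] by (intro borel_measurable_sum)
 have Rm: "?R c \<tau> \<in> borel_measurable LZ" if V: "valid_trees c \<tau>" for c \<tau>
  unfolding sumS
 proof (intro borel_measurable_sum borel_measurable_times borel_measurable_diff obm[OF V])
  fix e assume "e \<in> part_edges n Part3 c"
  then have e: "e \<in> pairs n" using part_edges_subset by blast
  show "(%x. snd x e) \<in> borel_measurable LZ" "(%x. Fv e (fst x)) \<in> borel_measurable LZ"
   using snd_comp[OF e] Fv_fst[OF e] by auto
 qed
 have Pm: "Measurable.pred LZ (?P c \<tau>)" for c \<tau>
 proof (cases "valid_trees c \<tau>")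
  case True
  note [measurable] = km[OF True] Rm[OF True]
  show ?thesis using True by simp measurable
 qed simp
 have Seq: "?S = {\<xi> \<in> space M. ?P (coinsv \<xi>) (trees \<xi>) (TZ \<xi>)}"
  unfolding TZ_def fst_conv snd_conv using valid_trees_data by blast
 show "?S \<in> sets M" unfolding Seq by (rule joint_event) (rule Pm)
 show "prob ?S <= 2 * exp (- x\<^sup>2 * N0)"
  unfolding Seq
 proof (rule prob_le_uniform)
  show "Measurable.pred LZ (?P c \<tau>)" for c \<tau> by (rule Pm)
  show "0 <= 2 * exp (- x\<^sup>2 * N0)" by simp
  fix c \<tau> assume w: "0 < jweight c \<tau>"
  note V = valid_trees_pos[OF w]
  define Y where "Y y pt = exp (y * ?R c \<tau> pt - x\<^sup>2 * ?k c \<tau> pt)" for y pt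
  have Y: "integrable M (%\<xi>. Y y (TZ \<xi>))" "expectation (%\<xi>. Y y (TZ \<xi>)) <= 1" if y: "\<bar>y\<bar> = x" for y
  proof -
   define \<gamma> where "\<gamma> e z = y * of_bool (e \<in> S c \<tau> z)" for e z
   have g1: "\<gamma> e \<in> borel_measurable (Z_space n)" for e
    unfolding \<gamma>_def[abs_def] using Sm[OF V, of e] by measurable
   have g2: "\<gamma> e (z(e' := b)) = \<gamma> e z" if "e' \<in> part_edges n Part3 c" for e e' z b
    unfolding \<gamma>_def using dep[OF V that] by simp
   have g3: "\<bar>\<gamma> e z\<bar> <= 1" for e z using x y by (simp add: \<gamma>_def)
   have y2: "y\<^sup>2 = x\<^sup>2" using y by (metis power2_abs)
   note em = entries_exp_moment[where \<gamma> = \<gamma> and \<pi> = 1 and W = "part_edges n Part3 c", OF part_edges_subset g1 g2 g3]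
   have eq: "(\<Prod>e\<in>part_edges n Part3 c. (1 - 1 + 1 * exp (\<gamma> e (snd pt) * snd pt e)) * exp (- 1 * \<gamma> e (snd pt) * Fv e (fst pt) - 1 * (\<gamma> e (snd pt))\<^sup>2)) = Y y pt" for pt
   proof -
    have "(\<Prod>e\<in>part_edges n Part3 c. (1 - 1 + 1 * exp (\<gamma> e (snd pt) * snd pt e)) * exp (- 1 * \<gamma> e (snd pt) * Fv e (fst pt) - 1 * (\<gamma> e (snd pt))\<^sup>2))
      = (\<Prod>e\<in>part_edges n Part3 c. exp (y * (of_bool (e \<in> S c \<tau> (snd pt)) * (snd pt e - Fv e (fst pt))) - x\<^sup>2 * of_bool (e \<in> S c \<tau> (snd pt))))"
     by (intro prod.cong refl) (auto simp: \<gamma>_def y2 algebra_simps simp flip: exp_add)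
    also have "... = Y y pt"
     unfolding Y_def sumS kS sum_distrib_left sum_subtractf[symmetric]
     by (rule exp_sum[symmetric]) simp
    finally show ?thesis .
   qed
   show "integrable M (%\<xi>. Y y (TZ \<xi>))" "expectation (%\<xi>. Y y (TZ \<xi>)) <= 1"
    using em(2,3) unfolding eq by auto
  qed
  define Q where "Q = {\<xi> \<in> space M. ?P c \<tau> (TZ \<xi>)}"
  have ev: "Q \<in> sets M"
  proof -
   have "Measurable.pred M (%\<xi>. ?P c \<tau> (TZ \<xi>))" by (rule measurable_compose[OF TZ_measurable Pm])
   then show ?thesis unfolding Q_def by (rule predE)
  qed
  have "prob Q = expectation (indicat_real Q)" using ev by simp
  also have "... <= expectation (%\<xi>. exp (- x\<^sup>2 * N0) * (Y x (TZ \<xi>) + Y (- x) (TZ \<xi>)))"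
  proof (rule integral_mono)
   show "integrable M (indicat_real Q)"
    using ev by (intro integrable_const_bound[where B = 1]) auto
   show "integrable M (%\<xi>. exp (- x\<^sup>2 * N0) * (Y x (TZ \<xi>) + Y (- x) (TZ \<xi>)))"
    using Y(1)[of x] Y(1)[of "- x"] x by simp
   fix \<xi>
   have "1 <= exp (- x\<^sup>2 * N0) * (Y x (TZ \<xi>) + Y (- x) (TZ \<xi>))" if P: "?P c \<tau> (TZ \<xi>)"
   proof -
    let ?kk = "?k c \<tau> (TZ \<xi>)" and ?RR = "?R c \<tau> (TZ \<xi>)"
    have "exp (x\<^sup>2 * N0) <= exp (x\<^sup>2 * ?kk)" using P by (auto intro!: mult_left_mono)
    also have "x\<^sup>2 * ?kk = x * (2 * x * ?kk) + - (x\<^sup>2 * ?kk)" by (simp add: power2_eq_square)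
    also have "exp (x * (2 * x * ?kk) + - (x\<^sup>2 * ?kk)) <= (exp (x * ?RR) + exp (- x * ?RR)) * exp (- (x\<^sup>2 * ?kk))"
     unfolding exp_add using P x by (intro mult_right_mono abs_le_exp_sum) auto
    also have "... = Y x (TZ \<xi>) + Y (- x) (TZ \<xi>)"
     unfolding Y_def diff_conv_add_uminus exp_add by (simp only: distrib_right)
    finally have "1 <= exp (- (x\<^sup>2 * N0)) * (Y x (TZ \<xi>) + Y (- x) (TZ \<xi>))" by (rule one_le_exp_mult)
    then show ?thesis by simp
   qed
   moreover have "0 <= exp (- x\<^sup>2 * N0) * (Y x (TZ \<xi>) + Y (- x) (TZ \<xi>))" by (simp add: Y_def)
   ultimately show "indicat_real Q \<xi> <= exp (- x\<^sup>2 * N0) * (Y x (TZ \<xi>) + Y (- x) (TZ \<xi>))"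
    unfolding Q_def indicator_def by simp
  qed
  also have "... = exp (- x\<^sup>2 * N0) * (expectation (%\<xi>. Y x (TZ \<xi>)) + expectation (%\<xi>. Y (- x) (TZ \<xi>)))"
   using Y(1)[of x] Y(1)[of "- x"] x by simp
  also have "... <= exp (- x\<^sup>2 * N0) * (1 + 1)"
   using Y(2)[of x] Y(2)[of "- x"] x by (intro mult_left_mono add_mono) auto
  finally show "prob {\<xi> \<in> space M. ?P c \<tau> (TZ \<xi>)} <= 2 * exp (- x\<^sup>2 * N0)" by (simp add: Q_def)
 qed
qed

text \<open>Each interval has probability 1/K, so its count has mean n/K. With parameter -1 the
  moment is at most \<open>exp (- real n / (2 * real K))\<close>, and the threshold n/(4K) consumes
  half of that exponent.\<close>

theorem coverage_event:
 assumes K: "0 < K"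
 shows "{\<xi> \<in> space M. \<exists>i<K. real (card {u \<in> {1..n}. theta X u \<xi> \<in> {real i / real K..real (Suc i) / real K}}) < real n / (4 * real K)} \<in> sets M" (is "?S \<in> _")
  and "prob {\<xi> \<in> space M. \<exists>i<K. real (card {u \<in> {1..n}. theta X u \<xi> \<in> {real i / real K..real (Suc i) / real K}}) < real n / (4 * real K)}
   <= real K * exp (- real n / (4 * real K))"
proof -
 interpret U: prob_space unif01 by (rule prob_space_unif01)
 interpret P: product_prob_space "%_::nat. unif01" by unfold_locales
 let ?I = "%i. {real i / real K..real (Suc i) / real K}"
 define N where "N i \<xi> = (\<Sum>u\<in>{1..n}. indicat_real (?I i) (theta X u \<xi>))" for i \<xi>
 have Nc: "real (card {u \<in> {1..n}. theta X u \<xi> \<in> ?I i}) = N i \<xi>" for i \<xi>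
  unfolding N_def indicator_def by (simp add: sum.If_cases Int_def)
 have Nm [measurable]: "N i \<in> borel_measurable M" for i
  unfolding N_def by (intro borel_measurable_sum measurable_compose[OF theta_measurable]) auto
 have S: "?S = {\<xi> \<in> space M. \<exists>i<K. N i \<xi> < real n / (4 * real K)}" unfolding Nc ..
 show "?S \<in> sets M" unfolding S by measurable
 have N0: "0 <= N i \<xi>" for i \<xi> unfolding N_def by (intro sum_nonneg) auto
 have int: "integrable M (%\<xi>. exp (- N i \<xi>))" for i
  using N0 by (intro integrable_const_bound[where B = 1]) auto
 have mom: "expectation (%\<xi>. exp (- N i \<xi>)) <= exp (- real n / (2 * real K))" if i: "i < K" for i
 proof -
  define g where "g y = exp (- indicat_real (?I i) y)" for y :: real
  have gm [measurable]: "g \<in> borel_measurable borel" unfolding g_def by measurable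
  have "exp (- N i \<xi>) = (\<Prod>u\<in>{1..n}. g (thetas \<xi> u))" for \<xi>
   unfolding N_def g_def by (simp add: exp_sum[symmetric] sum_negf theta_vec_def)
  then have "expectation (%\<xi>. exp (- N i \<xi>)) = expectation (%\<xi>. \<Prod>u\<in>{1..n}. g (thetas \<xi> u))" by simp
  also have "... = (\<integral>\<theta>. (\<Prod>u\<in>{1..n}. g (\<theta> u)) \<partial>PiM {1..n} (%_. unif01))"
  proof (rule expectation_theta)
   show "(%\<theta>. \<Prod>u\<in>{1..n}. g (\<theta> u)) \<in> borel_measurable (latent_space n)"
    by (intro borel_measurable_prod measurable_compose[OF theta_comp gm])
  qed
  also have "... = (\<Prod>u\<in>{1..n}. \<integral>y. g y \<partial>unif01)"
   by (intro P.product_integral_prod) (auto intro!: U.integrable_const_bound[where B = 1] simp: g_def)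
  also have "(\<integral>y. g y \<partial>unif01) = 1 + (exp (- 1) - 1) / real K"
  proof -
   have "g y = 1 + (exp (- 1) - 1) * indicat_real (?I i) y" for y by (simp add: g_def indicator_def)
   then have "(\<integral>y. g y \<partial>unif01) = (\<integral>y. 1 + (exp (- 1) - 1) * indicat_real (?I i) y \<partial>unif01)" by simp
   also have "... = 1 + (exp (- 1) - 1) * measure unif01 (?I i)"
    by (subst Bochner_Integration.integral_add) (auto simp: U.prob_space intro!: U.integrable_const_bound[where B = 1])
   also have "measure unif01 (?I i) = 1 / real K"
   proof -
    have sub: "?I i \<subseteq> {0..1}" using i K by (auto simp: field_simps intro: order_trans)
    have "real i / real K <= real (Suc i) / real K" by (intro divide_right_mono) auto
    then have "measure lborel (?I i) = 1 / real K" by (simp add: field_simps diff_divide_distrib[symmetric])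
    then show ?thesis using sub by (subst measure_uniform_measure) (auto simp: Int_absorb1)
   qed
   finally show ?thesis by simp
  qed
  also have "(\<Prod>u\<in>{1..n}. 1 + (exp (- 1) - 1) / real K) = (1 + (exp (- 1) - 1) / real K) ^ n" by simp
  also have "... <= exp (real n * ((exp (- 1) - 1) / real K))"
  proof (rule power_le_exp)
   have "(1 - exp (- 1)) / real K <= 1" using K by (simp add: divide_le_eq) (smt (verit) exp_gt_zero of_nat_0_less_iff Suc_leI K of_nat_1 of_nat_mono One_nat_def)
   moreover have "(exp (- 1) - 1) / real K = - ((1 - exp (- 1)) / real K)" by (simp add: diff_divide_distrib)
   ultimately show "0 <= 1 + (exp (- 1) - 1) / real K" by linarith
  qed
  also have "... <= exp (real n * (- (1 / 2) / real K))"
   unfolding exp_le_cancel_iff using exp_m1_bounds K by (intro mult_left_mono divide_right_mono) auto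
  finally show ?thesis by simp
 qed
 have "prob ?S <= expectation (%\<xi>. \<Sum>i<K. exp (real n / (4 * real K)) * exp (- N i \<xi>))"
 proof -
  have ev: "{\<xi> \<in> space M. \<exists>i<K. N i \<xi> < real n / (4 * real K)} \<in> sets M" by measurable
  have "prob ?S = expectation (indicat_real {\<xi> \<in> space M. \<exists>i<K. N i \<xi> < real n / (4 * real K)})"
   unfolding S using ev by simp
  also have "... <= expectation (%\<xi>. \<Sum>i<K. exp (real n / (4 * real K)) * exp (- N i \<xi>))"
  proof (rule integral_mono)
   show "integrable M (indicat_real {\<xi> \<in> space M. \<exists>i<K. N i \<xi> < real n / (4 * real K)})"
    using ev by (intro integrable_const_bound[where B = 1]) auto
   show "integrable M (%\<xi>. \<Sum>i<K. exp (real n / (4 * real K)) * exp (- N i \<xi>))"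
    using int by (intro Bochner_Integration.integrable_sum integrable_mult_right)
   fix \<xi>
   show "indicat_real {\<xi> \<in> space M. \<exists>i<K. N i \<xi> < real n / (4 * real K)} \<xi>
     <= (\<Sum>i<K. exp (real n / (4 * real K)) * exp (- N i \<xi>))"
   proof (cases "\<exists>i<K. N i \<xi> < real n / (4 * real K)")
    case True
    then obtain i where i: "i < K" "N i \<xi> < real n / (4 * real K)" by blast
    have "1 <= exp (real n / (4 * real K)) * exp (- N i \<xi>)" using i(2) by (simp flip: exp_add)
    also have "... <= (\<Sum>i<K. exp (real n / (4 * real K)) * exp (- N i \<xi>))"
     using i(1) by (intro member_le_sum) auto
    finally show ?thesis by (auto simp: indicator_def)
   qed (auto simp: indicator_def intro!: sum_nonneg)
  qed
  finally show ?thesis .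
 qed
 also have "... = (\<Sum>i<K. exp (real n / (4 * real K)) * expectation (%\<xi>. exp (- N i \<xi>)))"
  using int by (subst Bochner_Integration.integral_sum) auto
 also have "... <= (\<Sum>i<K. exp (real n / (4 * real K)) * exp (- real n / (2 * real K)))"
  using mom by (intro sum_mono mult_left_mono) auto
 also have "exp (real n / (4 * real K)) * exp (- real n / (2 * real K)) = exp (- real n / (4 * real K))"
  using K by (simp add: field_simps flip: exp_add)
 finally show "prob ?S <= real K * exp (- real n / (4 * real K))" by simp
qed

text \<open>The set \<open>R\<close> depends on the latent variables alone and hence is independent
  of the coins; the binomial lower tail applies to each fixed value of it.\<close>

theorem sample_event:
 fixes R :: "(nat => real) => edges"
 assumes R: "\<And>\<theta>. R \<theta> \<subseteq> pairs n" and Rm: "\<And>e. Measurable.pred (latent_space n) (%\<theta>. e \<in> R \<theta>)"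
 shows "{\<xi> \<in> space M. r0 <= real (card (R (thetas \<xi>))) \<and>
   real (card (part_edges n Part3 (coinsv \<xi>) \<inter> R (thetas \<xi>))) < p * real (card (R (thetas \<xi>))) / 8} \<in> sets M" (is "?S \<in> _")
  and "prob {\<xi> \<in> space M. r0 <= real (card (R (thetas \<xi>))) \<and>
   real (card (part_edges n Part3 (coinsv \<xi>) \<inter> R (thetas \<xi>))) < p * real (card (R (thetas \<xi>))) / 8}
   <= exp (- p * r0 / 8)"
proof -
 let ?P = "%c (\<tau> :: nat => edges) pt. r0 <= real (card (R (fst pt))) \<and>
   real (card (part_edges n Part3 c \<inter> R (fst pt))) < p * real (card (R (fst pt))) / 8"
 have card: "real (card (V \<inter> R \<theta>)) = (\<Sum>e\<in>pairs n. of_bool (e \<in> V) * of_bool (e \<in> R \<theta>))" for V \<theta>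
 proof -
  have "(\<Sum>e\<in>pairs n. of_bool (e \<in> V) * of_bool (e \<in> R \<theta>)) = (\<Sum>e\<in>pairs n. of_bool (e \<in> V \<inter> R \<theta>) :: real)"
   by (intro sum.cong) auto
  moreover have "pairs n \<inter> {e. e \<in> V \<inter> R \<theta>} = V \<inter> R \<theta>" using R[of \<theta>] by blast
  ultimately show ?thesis by (simp add: sum_of_bool_eq)
 qed
 have cm: "(%\<theta>. real (card (V \<inter> R \<theta>))) \<in> borel_measurable (latent_space n)" for V
  unfolding card using Rm by measurable
 have cm1 [measurable]: "(%pt. real (card (V \<inter> R (fst pt)))) \<in> borel_measurable LZ" for V
  by (rule measurable_compose[OF measurable_fst cm])
 have cm2 [measurable]: "(%pt. real (card (R (fst pt)))) \<in> borel_measurable LZ"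
  using cm1[of UNIV] by simp
 have Pm: "Measurable.pred LZ (?P c \<tau>)" for c \<tau> by measurable
 have S: "?S = {\<xi> \<in> space M. ?P (coinsv \<xi>) (trees \<xi>) (TZ \<xi>)}" by (simp add: TZ_def)
 show "?S \<in> sets M" unfolding S by (rule joint_event) (rule Pm)
 let ?h = "%c pt. of_bool (r0 <= real (card (R (fst pt)))) *
  of_bool (real (card (part_edges n Part3 c \<inter> R (fst pt))) < p * real (card (R (fst pt))) / 8) :: real"
 have hm: "?h c \<in> borel_measurable LZ" for c by measurable
 have hint: "integrable M (%\<xi>. ?h c (TZ \<xi>))" for c
  by (rule integrable_TZ[OF hm, where B = 1]) auto
 have "prob ?S <= (\<Sum>c\<in>coin_configs n. \<Sum>\<tau>\<in>tree_configs n. jweight c \<tau> * expectation (%\<xi>. ?h c (TZ \<xi>)))"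
  unfolding S by (rule prob_le_joint[where P = ?P and h = "%c \<tau>. ?h c"]) (use Pm hint in auto)
 also have "... <= (\<Sum>c\<in>coin_configs n. cweight c * expectation (%\<xi>. ?h c (TZ \<xi>)))"
  by (rule sum_joint_weight_le) (rule Bochner_Integration.integral_nonneg, simp)
 also have "... = expectation (%\<xi>. \<Sum>c\<in>coin_configs n. cweight c * ?h c (TZ \<xi>))"
  using hint by (subst Bochner_Integration.integral_sum) auto
 also have "... <= expectation (%\<xi>. exp (- p * r0 / 8))"
 proof (rule integral_mono)
  show "integrable M (%\<xi>. \<Sum>c\<in>coin_configs n. cweight c * ?h c (TZ \<xi>))"
   using hint by (intro Bochner_Integration.integrable_sum integrable_mult_right)
  fix \<xi>
  let ?R = "R (fst (TZ \<xi>))"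
  have "(\<Sum>c\<in>coin_configs n. cweight c * ?h c (TZ \<xi>)) = of_bool (r0 <= real (card ?R)) *
    (\<Sum>c\<in>coin_configs n. cweight c * of_bool (real (card (part_edges n Part3 c \<inter> ?R)) < p * real (card ?R) / 8))"
   unfolding sum_distrib_left by (simp only: mult_ac)
  also have "... <= of_bool (r0 <= real (card ?R)) * exp (- p * real (card ?R) / 8)"
   by (intro mult_left_mono coin_sum_lower_tail[OF R]) auto
  also have "... <= exp (- p * r0 / 8)" using p_pos by (cases "r0 <= real (card ?R)") auto
  finally show "(\<Sum>c\<in>coin_configs n. cweight c * ?h c (TZ \<xi>)) <= exp (- p * r0 / 8)" .
 qed simp
 finally show "prob ?S <= exp (- p * r0 / 8)" by (simp add: prob_space)
qed

end

section \<open>Deterministic error bounds\<close>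

text \<open>The sharper bound with \<open>\<rho> ^ Suc s0 - \<rho> ^ Suc s\<close> carries the
  induction. A ratio of at most 1/2 makes the geometric sum at most twice its first term.\<close>

lemma geometric_chain:
 fixes b :: "nat => real"
 assumes step: "\<And>s. s < N ==> \<bar>b (Suc s) - b s\<bar> <= e * \<rho> ^ Suc s" and \<rho>: "0 <= \<rho>" "\<rho> <= 1 / 2" and e: "0 <= e"
  and s: "s0 <= s" "s <= N"
 shows "\<bar>b s - b s0\<bar> <= 2 * e * \<rho> ^ Suc s0"
proof -
 have "\<bar>b s - b s0\<bar> <= 2 * e * (\<rho> ^ Suc s0 - \<rho> ^ Suc s)"
  using s
 proof (induction s rule: dec_induct)
  case (step s)
  have "\<rho> * \<rho> ^ Suc s <= (1 / 2) * \<rho> ^ Suc s" using \<rho> by (intro mult_right_mono) auto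
  then have "e * (\<rho> * \<rho> ^ Suc s) <= e * ((1 / 2) * \<rho> ^ Suc s)" using e by (rule mult_left_mono)
  moreover have "\<bar>b (Suc s) - b s0\<bar> <= \<bar>b (Suc s) - b s\<bar> + \<bar>b s - b s0\<bar>" by linarith
  moreover have "\<bar>b s - b s0\<bar> <= 2 * e * (\<rho> ^ Suc s0 - \<rho> ^ Suc s)" using step by simp
  moreover have "\<bar>b (Suc s) - b s\<bar> <= e * \<rho> ^ Suc s" using step by (intro assms(1)) auto
  ultimately show ?case by (simp add: algebra_simps)
 qed simp
 also have "... <= 2 * e * \<rho> ^ Suc s0" using e \<rho> by (intro mult_left_mono) auto
 finally show ?thesis .
qed

text \<open>After division by powers of the eigenvalues, the system says that the polynomial with
  coefficients \<open>z\<close> takes the value \<open>1 / v ^ (2 * t)\<close> at every distinct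
  eigenvalue \<open>v\<close>. Lagrange interpolation expresses it in a basis that does not depend
  on \<open>t\<close>, whence a constant uniform in \<open>t\<close>.\<close>

lemma weights_bound:
 assumes lam: "\<And>k. k \<in> {1..r} ==> lam k \<noteq> 0"
 shows "\<exists>C\<ge>0. \<forall>\<mu> t z. 0 < \<mu> \<longrightarrow> (\<forall>k\<in>{1..r}. \<mu> <= \<bar>lam k\<bar>) \<longrightarrow> solves_weights r lam t z \<longrightarrow>
  (\<forall>b\<in>{1..num_distinct r lam}. \<bar>z b\<bar> <= C * (1 / \<mu>) ^ (2 * t))"
proof -
 define V where "V = lam ` {1..r}"
 define m where "m = card V"
 have finV: "finite V" by (simp add: V_def)
 have m: "num_distinct r lam = m" by (simp add: num_distinct_def m_def V_def)
 have V0: "v \<noteq> 0" if "v \<in> V" for v using that lam by (auto simp: V_def)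
 \<comment> \<open>The Lagrange basis polynomial of the node \<open>v\<close>.\<close>
 define l where "l v = (\<Prod>w\<in>V - {v}. smult (1 / (v - w)) [:- w, 1:])" for v
 have lval: "poly (l v) w = (if w = v then 1 else 0)" if "v \<in> V" "w \<in> V" for v w
 proof (cases "w = v")
  case True
  then show ?thesis unfolding l_def poly_prod by (auto intro!: prod.neutral simp: diff_divide_distrib[symmetric])
 next
  case False
  then show ?thesis unfolding l_def poly_prod using that finV by (auto intro!: prod_zero bexI[of _ w])
 qed
 have ldeg: "degree (l v) <= m - 1" if "v \<in> V" for v
 proof -
  have "degree (l v) <= (\<Sum>w\<in>V - {v}. degree (smult (1 / (v - w)) [:- w, 1:]))"
   using degree_prod_sum_le[of "V - {v}" "%w. smult (1 / (v - w)) [:- w, 1:]"] finV unfolding l_def o_def by blast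
  also have "... <= (\<Sum>w\<in>V - {v}. 1)" by (intro sum_mono) simp
  also have "... = m - 1" using that finV by (simp add: m_def)
  finally show ?thesis .
 qed
 define C where "C = (\<Sum>v\<in>V. \<Sum>b<m. \<bar>coeff (l v) b\<bar>)"
 show ?thesis
 proof (intro exI[of _ C] conjI allI impI ballI)
  show "0 <= C" unfolding C_def by (intro sum_nonneg) auto
  fix \<mu> t z b assume \<mu>: "0 < \<mu>" "\<forall>k\<in>{1..r}. \<mu> <= \<bar>lam k\<bar>" and z: "solves_weights r lam t z"
   and b: "b \<in> {1..num_distinct r lam}"
  have m0: "0 < m" using b by (simp add: m)
  define P where "P = (\<Sum>b<m. monom (z (Suc b)) b)"
  define Q where "Q = (\<Sum>v\<in>V. smult (1 / v ^ (2 * t)) (l v))"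
  \<comment> \<open>Both polynomials agree at all nodes, and their degrees are below the number of
    nodes.\<close>
  have "P = Q"
  proof (rule poly_eqI_degree[where A = V])
   fix v assume v: "v \<in> V"
   then obtain k where k: "k \<in> {1..r}" "v = lam k" by (auto simp: V_def)
   have "poly P v = (\<Sum>b<m. v ^ b * z (Suc b))" unfolding P_def poly_sum by (simp add: poly_monom mult.commute)
   also have "... = (\<Sum>b=1..m. v ^ (b - 1) * z b)"
    by (rule sum.reindex_bij_witness[of _ "%b. b - 1" Suc]) auto
   finally have "v ^ (2 * t + 2) * poly P v = v ^ 2"
    using z k unfolding solves_weights_def m by auto
   then have "v ^ (2 * t) * poly P v = 1" using V0[OF v] by (simp add: power_add power2_eq_square mult_ac)
   then have "poly P v = 1 / v ^ (2 * t)" using V0[OF v] by (simp add: field_simps)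
   moreover have "poly Q v = 1 / v ^ (2 * t)"
    unfolding Q_def poly_sum using v finV by (simp add: lval if_distrib cong: if_cong)
   ultimately show "poly P v = poly Q v" by simp
  next
   have "degree P <= m - 1" unfolding P_def by (intro degree_sum_le) (auto intro: order_trans[OF degree_monom_le])
   then show "degree P < card V" using m0 by (simp add: m_def)
   have "degree Q <= m - 1" unfolding Q_def
    by (intro degree_sum_le finV) (rule order_trans[OF degree_smult_le ldeg])
   then show "degree Q < card V" using m0 by (simp add: m_def)
  qed
  obtain b' where b': "b = Suc b'" "b' < m" using b m by (cases b) auto
  have "z b = coeff P b'" unfolding P_def coeff_sum using b' by (simp add: coeff_monom)
  also have "... = (\<Sum>v\<in>V. 1 / v ^ (2 * t) * coeff (l v) b')"
   unfolding \<open>P = Q\<close> Q_def coeff_sum by simp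
  finally have zb: "z b = (\<Sum>v\<in>V. 1 / v ^ (2 * t) * coeff (l v) b')" .
  have "\<bar>z b\<bar> <= (\<Sum>v\<in>V. \<bar>1 / v ^ (2 * t) * coeff (l v) b'\<bar>)" unfolding zb by (rule sum_abs)
  also have "... <= (\<Sum>v\<in>V. (1 / \<mu>) ^ (2 * t) * (\<Sum>b<m. \<bar>coeff (l v) b\<bar>))"
  proof (rule sum_mono)
   fix v assume v: "v \<in> V"
   have "1 / \<bar>v\<bar> <= 1 / \<mu>" using v \<mu> by (intro divide_left_mono) (auto simp: V_def V0)
   then have "(1 / \<bar>v\<bar>) ^ (2 * t) <= (1 / \<mu>) ^ (2 * t)" by (intro power_mono) auto
   moreover have "\<bar>1 / v ^ (2 * t)\<bar> = (1 / \<bar>v\<bar>) ^ (2 * t)" by (simp add: abs_divide power_abs power_one_over)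
   moreover have "\<bar>coeff (l v) b'\<bar> <= (\<Sum>b<m. \<bar>coeff (l v) b\<bar>)" using b' by (intro member_le_sum) auto
   ultimately show "\<bar>1 / v ^ (2 * t) * coeff (l v) b'\<bar> <= (1 / \<mu>) ^ (2 * t) * (\<Sum>b<m. \<bar>coeff (l v) b\<bar>)"
    unfolding abs_mult using \<mu> by (intro mult_mono) auto
  qed
  finally show "\<bar>z b\<bar> <= C * (1 / \<mu>) ^ (2 * t)" by (simp add: C_def sum_distrib_left mult.commute)
 qed
qed

context icf_instance
begin

text \<open>The degree bound keeps the layers up to \<open>N\<close> below 0.08/p, where expansion
  is available; hence growth up to layer \<open>N + 1\<close>. The 2 subtracted in \<open>g\<close>
  accounts for out-neighbors in layers already present: the induction also shows that these have
  together at most twice the size of the last one.\<close>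

lemma sphere_growth:
 assumes E: "E \<subseteq> pairs n" and u: "u \<in> {1..n}"
  and deg: "\<And>i. i \<in> {1..n} ==> real (card {j. (i, j) \<in> E}) <= D"
  and ex: "\<And>A. A \<subseteq> {1..n} ==> A \<noteq> {} ==> p * real (card A) <= 0.08 ==>
   real n * p * real (card A) / 10 <= real (card (out_nbrs E A))"
  and D: "1 <= D" "p * D ^ N <= 0.08" and g: "g = real n * p / 10 - 2" "2 <= g"
  and s: "s <= Suc N"
 shows "g ^ s <= real (card (sphere E u s))"
proof -
 let ?S = "sphere E u"
 have fin: "finite (?S k)" for k by (rule finite_sphere'[OF E])
 have sub: "?S k \<subseteq> {1..n}" for k by (rule sphere_subset[OF E u])
 have up: "real (card (?S k)) <= D ^ k" for k
 proof (induction k)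
  case (Suc k)
  have finE: "finite {j. (i, j) \<in> E}" for i
   by (rule finite_subset[of _ "{1..n}"]) (use E in auto)
  have "card (?S (Suc k)) <= card (\<Union>a\<in>?S k. {j. (a, j) \<in> E})"
   by (rule card_mono) (use fin finE in \<open>auto simp: sphere_Suc\<close>)
  also have "... <= (\<Sum>a\<in>?S k. card {j. (a, j) \<in> E})" by (rule card_UN_le[OF fin])
  finally have "real (card (?S (Suc k))) <= (\<Sum>a\<in>?S k. real (card {j. (a, j) \<in> E}))"
   by (metis of_nat_mono of_nat_sum)
  also have "... <= real (card (?S k)) * D" using sub deg by (intro sum_bounded_above) blast
  also have "... <= D ^ k * D" using Suc D by (intro mult_right_mono) auto
  finally show ?case by (simp add: mult.commute)
 qed simp
 have "g ^ s <= real (card (?S s)) \<and> (\<Sum>k\<le>s. real (card (?S k))) <= 2 * real (card (?S s))"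
  using s
 proof (induction s)
  case (Suc s)
  then have IH: "g ^ s <= real (card (?S s))" "(\<Sum>k\<le>s. real (card (?S k))) <= 2 * real (card (?S s))" by auto
  have g0: "0 < g ^ s" using g by simp
  have ne: "?S s \<noteq> {}" using IH(1) g0 by (metis card.empty of_nat_0 not_le)
  have "p * real (card (?S s)) <= p * D ^ s" using up p_pos by (intro mult_left_mono) auto
  also have "... <= p * D ^ N" using Suc.prems D p_pos by (intro mult_left_mono power_increasing) auto
  finally have small: "p * real (card (?S s)) <= 0.08" using D by simp
  have "out_nbrs E (?S s) \<subseteq> ?S (Suc s) \<union> (\<Union>k\<le>s. ?S k)"
   unfolding out_nbrs_def sphere_Suc by blast
  then have "card (out_nbrs E (?S s)) <= card (?S (Suc s) \<union> (\<Union>k\<le>s. ?S k))"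
   using fin by (intro card_mono) auto
  also have "... <= card (?S (Suc s)) + card (\<Union>k\<le>s. ?S k)" by (rule card_Un_le)
  also have "card (\<Union>k\<le>s. ?S k) <= (\<Sum>k\<le>s. card (?S k))" by (rule card_UN_le) simp
  finally have "real (card (out_nbrs E (?S s))) <= real (card (?S (Suc s)) + (\<Sum>k\<le>s. card (?S k)))"
   by (intro of_nat_mono) simp
  then have "real (card (out_nbrs E (?S s))) <= real (card (?S (Suc s))) + (\<Sum>k\<le>s. real (card (?S k)))" by simp
  with ex[OF sub ne small] IH(2) have
   "real n * p * real (card (?S s)) / 10 - 2 * real (card (?S s)) <= real (card (?S (Suc s)))" by linarith
  then have growth: "g * real (card (?S s)) <= real (card (?S (Suc s)))" unfolding g(1) by (simp add: algebra_simps)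
  have "g * g ^ s <= g * real (card (?S s))" using IH(1) g by (intro mult_left_mono) auto
  with growth have 1: "g ^ Suc s <= real (card (?S (Suc s)))" by simp
  have "2 * real (card (?S s)) <= g * real (card (?S s))" using g by (intro mult_right_mono) auto
  with growth IH(2) have "(\<Sum>k\<le>Suc s. real (card (?S k))) <= 2 * real (card (?S (Suc s)))" by simp
  with 1 show ?case by simp
 qed simp
 then show ?thesis by simp
qed

definition pair_form where
 "pair_form c \<tau> u v s1 s2 z = (\<Sum>e\<in>pairs n. diff_value (edges1 c) \<tau> u v s1 z (fst e) *
  (of_bool (e \<in> part_edges n Part2 c) * z e + of_bool (e \<in> ind_edges n c) * z e) *
  diff_value (edges1 c) \<tau> u v s2 z (snd e))"

text \<open>The distance estimate as a function of coins, trees and entries, so that it can be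
  studied for fixed discrete data.\<close>

definition dist_est where
 "dist_est r' w t c \<tau> z u v = 1 / thin_prob p * (\<Sum>l=1..r'. w l * pair_form c \<tau> u v t (t + l) z)"

lemma Nvec_eq:
 assumes u: "u \<in> {1..n}" and \<xi>: "\<xi> \<in> space M"
 shows "Nvec n X \<xi> u s i = norm_value (edges1 (coinsv \<xi>)) (trees \<xi> u) u s (Zs \<xi>) i"
proof -
 let ?E = "edges1 (coinsv \<xi>)"
 have T: "tree X u \<xi> \<in> bfs_trees ?E u" by (rule tree_in[OF u \<xi>])
 have "mat_on ?E (Mmat n X \<xi>) a b = Zs \<xi> (a, b)" if ab: "(a, b) \<in> ?E" for a b
 proof -
  have "(a, b) \<in> Eobs n X \<xi>" using ab unfolding Epart_eq[symmetric] by (simp add: Epart_def)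
  moreover have "(a, b) \<in> pairs n" using ab part_edges_subset by blast
  ultimately show ?thesis using ab unfolding mat_on_def Mmat_def Z_vec_def by simp
 qed
 then have "nbr_vec ?E (tree X u \<xi>) (mat_on ?E (Mmat n X \<xi>)) u s i
   = nbr_vec ?E (tree X u \<xi>) (%a b. Zs \<xi> (a, b)) u s i"
  by (rule nbr_vec_cong[OF T])
 then show ?thesis using u
  by (simp add: Nvec_def nbr_vec_normalized_def Epart_eq norm_value_def path_value_def trees_def)
qed

lemma mat_on_eq:
 assumes "k = Part2 \<or> k = Part3" "(i, j) \<in> pairs n"
 shows "mat_on (Epart n X k \<xi>) (Mmat n X \<xi>) i j = of_bool ((i, j) \<in> part_edges n k (coinsv \<xi>)) * Zs \<xi> (i, j)"
 using assms unfolding mat_on_def Mmat_def Z_vec_def Epart_eq[symmetric] by (auto simp: Epart_def)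

lemma mat_on_ind_eq:
 assumes "(i, j) \<in> pairs n"
 shows "mat_on (Eind n X \<xi>) (Mmat n X \<xi>) i j = of_bool ((i, j) \<in> ind_edges n (coinsv \<xi>)) * Zs \<xi> (i, j)"
 using assms unfolding mat_on_def Mmat_def Z_vec_def Eind_eq[symmetric] by (auto simp: Epart_def Eind_def)

lemma d_hat_eq:
 assumes u: "u \<in> {1..n}" and v: "v \<in> {1..n}" and \<xi>: "\<xi> \<in> space M"
 shows "d_hat n p X r' w t \<xi> u v = dist_est r' w t (coinsv \<xi>) (trees \<xi>) (Zs \<xi>) u v"
proof -
 have "(\<Sum>i=1..n. \<Sum>j=1..n. (Nvec n X \<xi> u t i - Nvec n X \<xi> v t i) *
    (mat_on (Epart n X Part2 \<xi>) (Mmat n X \<xi>) i j + mat_on (Eind n X \<xi>) (Mmat n X \<xi>) i j) *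
    (Nvec n X \<xi> u (t + l) j - Nvec n X \<xi> v (t + l) j))
   = pair_form (coinsv \<xi>) (trees \<xi>) u v t (t + l) (Zs \<xi>)" for l
  unfolding pair_form_def sum.cartesian_product' fst_conv snd_conv diff_value_def
  using mat_on_eq[of Part2] mat_on_ind_eq
  by (intro sum.cong refl) (simp add: Nvec_eq[OF u \<xi>] Nvec_eq[OF v \<xi>])
 then show ?thesis unfolding d_hat_def dist_est_def by simp
qed

end

text \<open>The conditions on \<open>f\<close> and \<open>q\<close> are imposed on the whole line,
  so no side conditions on arguments arise. The constants are parameters because they must be the
  same for all \<open>n\<close>.\<close>

locale rank_instance = icf_instance n p f X M
 for n p f and X :: "'a icf" and M +
 fixes r :: nat and lam :: "nat => real" and q :: "nat => real => real" and B L \<mu> \<Lambda> :: real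
 assumes B: "1 <= B" and L: "0 <= L"
  and f_rank: "\<And>x y. f x y = (\<Sum>k=1..r. lam k * q k x * q k y)"
  and qm: "\<And>k. k \<in> {1..r} ==> q k \<in> borel_measurable borel"
  and qB: "\<And>k y. k \<in> {1..r} ==> \<bar>q k y\<bar> <= B"
  and eig: "\<And>k a. k \<in> {1..r} ==> (\<integral>y. q k y * f a y \<partial>unif01) = lam k * q k a"
  and lip: "\<And>x x' y. \<bar>f x y - f x' y\<bar> <= L * \<bar>x - x'\<bar>"
  and \<mu>: "0 < \<mu>" "\<And>k. k \<in> {1..r} ==> \<mu> <= \<bar>lam k\<bar>"
  and \<Lambda>: "1 <= \<Lambda>" "\<And>k. k \<in> {1..r} ==> \<bar>lam k\<bar> <= \<Lambda>"
begin

text \<open>The target of the distance estimate. For orthonormal \<open>q\<close> it is the squared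
  L^2 distance between the sections of \<open>f\<close> at \<open>x\<close> and at
  \<open>x'\<close>.\<close>

definition ldist :: "real => real => real" where
 "ldist x x' = (\<Sum>k=1..r. (lam k)\<^sup>2 * (q k x - q k x')\<^sup>2)"

lemma f_sym: "f x y = f y x"
 unfolding f_rank by (intro sum.cong refl) simp

text \<open>\<open>lam k * q k\<close> is the integral of \<open>q k\<close> against
  \<open>f\<close>, so it inherits the Lipschitz bound of \<open>f\<close>.\<close>

lemma lam_q_lipschitz:
 assumes k: "k \<in> {1..r}" shows "\<bar>lam k * (q k x - q k x')\<bar> <= B * L * \<bar>x - x'\<bar>"
proof -
 interpret U: prob_space unif01 by (rule prob_space_unif01)
 have int: "integrable unif01 (%y. q k y * f a y)" for a
 proof (rule U.integrable_const_bound[where B = "B * 1"])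
  have "\<bar>q k y\<bar> * \<bar>f a y\<bar> <= B * 1" for y using f01[of a y] qB[OF k, of y] B by (intro mult_mono) auto
  then show "AE y in unif01. norm (q k y * f a y) <= B * 1" by (simp add: abs_mult)
 qed (use f_section[of a] qm[OF k] in measurable)
 have "lam k * (q k x - q k x') = (\<integral>y. q k y * f x y - q k y * f x' y \<partial>unif01)"
  using int by (simp add: eig[OF k] right_diff_distrib)
 also have "\<bar>...\<bar> <= (\<integral>y. \<bar>q k y * f x y - q k y * f x' y\<bar> \<partial>unif01)"
  using integral_norm_bound[of unif01 "%y. q k y * f x y - q k y * f x' y"] by simp
 also have "... <= B * L * \<bar>x - x'\<bar>"
 proof (rule U.integral_le_const)
  have "\<bar>q k y\<bar> * \<bar>f x y - f x' y\<bar> <= B * (L * \<bar>x - x'\<bar>)" for y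
   using qB[OF k] lip B by (intro mult_mono) auto
  then show "AE y in unif01. \<bar>q k y * f x y - q k y * f x' y\<bar> <= B * L * \<bar>x - x'\<bar>"
   by (simp add: abs_mult right_diff_distrib[symmetric] mult.assoc)
 qed (use int in auto)
 finally show ?thesis .
qed

lemma ldist_le: "ldist x x' <= real r * (B * L)\<^sup>2 * \<bar>x - x'\<bar>\<^sup>2"
proof -
 have "ldist x x' <= real (card {1..r}) * ((B * L)\<^sup>2 * \<bar>x - x'\<bar>\<^sup>2)"
  unfolding ldist_def
 proof (rule sum_bounded_above)
  fix k assume k: "k \<in> {1..r}"
  have "\<bar>lam k * (q k x - q k x')\<bar>\<^sup>2 <= (B * L * \<bar>x - x'\<bar>)\<^sup>2"
   by (rule power_mono[OF lam_q_lipschitz[OF k]]) simp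
  then show "(lam k)\<^sup>2 * (q k x - q k x')\<^sup>2 <= (B * L)\<^sup>2 * \<bar>x - x'\<bar>\<^sup>2"
   by (simp add: power_mult_distrib)
 qed
 then show ?thesis by (simp add: mult.assoc)
qed

text \<open>Counterpart of \<open>ldist_le\<close>: a small distance forces nearly equal rows of
  \<open>f\<close>, however far apart the latent positions are.\<close>

lemma f_diff_le_ldist: "\<bar>f x y - f x' y\<bar> <= real r * B * sqrt (ldist x x')"
proof -
 have "\<bar>f x y - f x' y\<bar> = \<bar>\<Sum>k=1..r. lam k * (q k x - q k x') * q k y\<bar>"
  unfolding f_rank by (simp add: sum_subtractf[symmetric] algebra_simps)
 also have "... <= (\<Sum>k=1..r. \<bar>lam k * (q k x - q k x') * q k y\<bar>)" by (rule sum_abs)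
 also have "... <= real (card {1..r}) * (sqrt (ldist x x') * B)"
 proof (rule sum_bounded_above)
  fix k assume k: "k \<in> {1..r}"
  have "(lam k * (q k x - q k x'))\<^sup>2 <= ldist x x'"
   unfolding ldist_def power_mult_distrib using k by (intro member_le_sum) auto
  then have "\<bar>lam k * (q k x - q k x')\<bar> <= sqrt (ldist x x')"
   by (metis real_sqrt_abs real_sqrt_le_mono)
  moreover have "0 <= ldist x x'" unfolding ldist_def by (intro sum_nonneg) auto
  ultimately show "\<bar>lam k * (q k x - q k x') * q k y\<bar> <= sqrt (ldist x x') * B"
   unfolding abs_mult[of _ "q k y"] using qB[OF k] by (intro mult_mono) auto
 qed
 finally show ?thesis by (simp add: mult_ac)
qed

text \<open>There are three errors: passing from layer \<open>t\<close> to the root costs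
  \<open>d1\<close>, passing from layer \<open>t + l\<close> to layer \<open>t\<close> costs
  \<open>d2\<close>, and the bilinear form differs from its mean. The weights cancel exactly only if
  all layers \<open>t + l\<close> agree with layer \<open>t\<close>, so the comparison between
  layers is the one that they multiply; it is much finer than the comparison with the root.\<close>

lemma dist_est_error:
 fixes \<xi> t r' w e \<rho> \<beta> Zb m t0 K3 D
 defines "c \<equiv> coinsv \<xi>" and "\<tau> \<equiv> trees \<xi>" and "\<theta> \<equiv> thetas \<xi>" and "z \<equiv> Zs \<xi>"
 defines "a \<equiv> %u k s. layer_avg (q k) (edges1 c) (\<tau> u) u s \<theta> z"
 defines "d1 \<equiv> 2 * e * \<rho>" and "d2 \<equiv> 2 * e * \<rho> ^ Suc t"
 assumes \<xi>: "\<xi> \<in> space M" and u: "u \<in> {1..n}" and v: "v \<in> {1..n}"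
  and step: "\<And>u k s. u \<in> {1..n} ==> k \<in> {1..r} ==> s < t + r' ==> \<bar>a u k (Suc s) - lam k * a u k s\<bar> <= e * (\<mu> * \<rho>) ^ Suc s"
  and \<rho>: "0 <= \<rho>" "\<rho> <= 1 / 2" and e: "0 <= e"
  and w: "solves_weights r lam t w" "r' = num_distinct r lam" and Zb: "\<And>l. l \<in> {1..r'} ==> \<bar>w l\<bar> <= Zb" "0 <= Zb"
  and m: "0 < m" and big: "\<And>l. l <= r' ==> m <= real (card (sphere (edges1 c) u (t + l)))"
   "\<And>l. l <= r' ==> m <= real (card (sphere (edges1 c) v (t + l)))"
  and bil: "\<And>l. l \<in> {1..r'} ==> \<bar>bilinear_dev c \<tau> u v t (t + l) (TZ \<xi>)\<bar> <= t0"
  and K3: "real (card (ind_edges n c)) <= K3"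
  and deg: "\<And>i. i \<in> {1..n} ==> real (card {j. (i, j) \<in> edges1 c}) <= D"
 shows "\<bar>dist_est r' w t c \<tau> z u v - ldist (\<theta> u) (\<theta> v)\<bar> \<le>
  real r * \<Lambda>\<^sup>2 * (2 * d1 * (4 * B + 2 * d1))
  + real r' * Zb * (real r * (\<Lambda> ^ (2 * t + r' + 1) * ((2 * B + 2 * d1) * (2 * d2))))
  + real r' * Zb * (t0 / thin_prob p + real n * D / m\<^sup>2 + K3 / (thin_prob p * m\<^sup>2))"
proof -
 let ?E = "edges1 c"
 have pt: "(\<theta>, z) \<in> Dom" using TZ_Dom[OF \<xi>] by (simp add: TZ_def \<theta>_def z_def)
 have TZeq: "TZ \<xi> = (\<theta>, z)" by (simp add: TZ_def \<theta>_def z_def)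
 have V: "valid_trees c \<tau>" unfolding c_def \<tau>_def by (rule valid_trees_data[OF \<xi>])
 have T: "\<tau> x \<in> bfs_trees ?E x" if "x \<in> {1..n}" for x using V that by (simp add: valid_trees_def)
 have lam0: "lam k \<noteq> 0" "\<mu> <= \<bar>lam k\<bar>" "\<bar>lam k\<bar> <= \<Lambda>" if "k \<in> {1..r}" for k
  using \<mu>(1) \<mu>(2)[OF that] \<Lambda>(2)[OF that] by auto
 \<comment> \<open>Dividing by the power of the eigenvalue turns the approximate recursion into a
   nearly constant sequence.\<close>
 define b where "b x k s = a x k s / lam k ^ s" for x k s
 have bstep: "\<bar>b x k (Suc s) - b x k s\<bar> <= e * \<rho> ^ Suc s" if x: "x \<in> {1..n}" and k: "k \<in> {1..r}" and s: "s < t + r'" for x k s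
 proof -
  have l: "0 < \<bar>lam k\<bar>" using lam0[OF k] by simp
  have "b x k (Suc s) - b x k s = (a x k (Suc s) - lam k * a x k s) / lam k ^ Suc s"
   using lam0(1)[OF k] by (simp add: b_def field_simps)
  then have "\<bar>b x k (Suc s) - b x k s\<bar> = \<bar>a x k (Suc s) - lam k * a x k s\<bar> / \<bar>lam k\<bar> ^ Suc s"
   by (simp add: abs_divide power_abs abs_mult)
  also have "... <= (e * (\<mu> * \<rho>) ^ Suc s) / \<mu> ^ Suc s"
   using step[OF x k s] \<mu>(1) lam0[OF k] e \<rho> by (intro frac_le power_mono) auto
  also have "... = e * \<rho> ^ Suc s" using \<mu>(1) by (simp add: power_mult_distrib)
  finally show ?thesis .
 qed
 have a0: "b x k 0 = q k (\<theta> x)" if x: "x \<in> {1..n}" for x k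
  unfolding b_def a_def layer_avg_def by (simp add: path_value_0[OF T[OF x]])
 have d0: "0 <= d1" "0 <= d2" using e \<rho> by (auto simp: d1_def d2_def)
 have bt: "\<bar>b x k t - q k (\<theta> x)\<bar> <= d1" if x: "x \<in> {1..n}" and k: "k \<in> {1..r}" for x k
  using geometric_chain[of "t + r'" "b x k" e \<rho> 0 t, OF bstep[OF x k] \<rho> e] a0[OF x, of k] by (simp add: d1_def)
 have btl: "\<bar>b x k (t + l) - b x k t\<bar> <= d2" if x: "x \<in> {1..n}" and k: "k \<in> {1..r}" and l: "l <= r'" for x k l
  using geometric_chain[of "t + r'" "b x k" e \<rho> t "t + l", OF bstep[OF x k] \<rho> e] l by (simp add: d2_def)
 define A where "A k = b u k t - b v k t" for k
 define A' where "A' k l = b u k (t + l) - b v k (t + l)" for k l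
 define \<Delta> where "\<Delta> k = q k (\<theta> u) - q k (\<theta> v)" for k
 have A\<Delta>: "\<bar>A k - \<Delta> k\<bar> <= 2 * d1" if "k \<in> {1..r}" for k
  using bt[OF u that] bt[OF v that] unfolding A_def \<Delta>_def by linarith
 have \<Delta>B: "\<bar>\<Delta> k\<bar> <= 2 * B" if "k \<in> {1..r}" for k
  using qB[OF that, of "\<theta> u"] qB[OF that, of "\<theta> v"] unfolding \<Delta>_def by linarith
 have AB: "\<bar>A k\<bar> <= 2 * B + 2 * d1" if "k \<in> {1..r}" for k
  using A\<Delta>[OF that] \<Delta>B[OF that] by linarith
 have A'A: "\<bar>A' k l - A k\<bar> <= 2 * d2" if "k \<in> {1..r}" "l <= r'" for k l
  using btl[OF u that] btl[OF v that] unfolding A_def A'_def by linarith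
 define \<gamma> where "\<gamma> l e = diff_value ?E \<tau> u v t z (fst e) * diff_value ?E \<tau> u v (t + l) z (snd e)" for l e
 have z01: "z e \<in> {0..1}" if "e \<in> pairs n" for e using Dom_snd[OF pt that] by simp
 have \<gamma>b: "\<bar>\<gamma> l e\<bar> <= 1 / m\<^sup>2" if l: "l <= r'" for l e
 proof -
  have "\<bar>diff_value ?E \<tau> u v t z (fst e)\<bar> <= 1 / m"
   by (rule diff_value_bound[OF V u v z01 m]) (use big[of 0] in auto)
  moreover have "\<bar>diff_value ?E \<tau> u v (t + l) z (snd e)\<bar> <= 1 / m"
   by (rule diff_value_bound[OF V u v z01 m]) (use big[OF l] in auto)
  ultimately have "\<bar>diff_value ?E \<tau> u v t z (fst e)\<bar> * \<bar>diff_value ?E \<tau> u v (t + l) z (snd e)\<bar> <= (1 / m) * (1 / m)"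
   using m by (intro mult_mono) auto
  then show ?thesis by (simp add: \<gamma>_def abs_mult power2_eq_square)
 qed
 have inner: "(\<Sum>i\<in>{1..n}. diff_value ?E \<tau> u v s z i * q k (\<theta> i)) = a u k s - a v k s" for k s
 proof -
  have "(\<Sum>i\<in>{1..n}. norm_value ?E (\<tau> x) x s z i * q k (\<theta> i)) = a x k s" if x: "x \<in> {1..n}" for x
  proof -
   have "(\<Sum>i\<in>{1..n}. norm_value ?E (\<tau> x) x s z i * q k (\<theta> i))
     = (\<Sum>i\<in>sphere ?E x s. norm_value ?E (\<tau> x) x s z i * q k (\<theta> i))"
    using sphere_subset[OF part_edges_subset x]
    by (intro sum.mono_neutral_right) (auto simp: norm_value_def path_value_def nbr_vec_outside)
   then show ?thesis unfolding a_def layer_avg_def norm_value_def by (simp add: sum_divide_distrib mult.commute)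
  qed
  then show ?thesis using u v by (simp add: diff_value_def left_diff_distrib sum_subtractf)
 qed
 \<comment> \<open>Finite rank splits the form in the full mean matrix into products of differences
   of layer averages.\<close>
 have full: "(\<Sum>e\<in>pairs n. \<gamma> l e * Fv e \<theta>) = (\<Sum>k=1..r. lam k * (lam k ^ t * A k) * (lam k ^ (t + l) * A' k l))" for l
 proof -
  have "(\<Sum>e\<in>pairs n. \<gamma> l e * Fv e \<theta>) = (\<Sum>i\<in>{1..n}. \<Sum>j\<in>{1..n}. \<Sum>k=1..r.
    lam k * (diff_value ?E \<tau> u v t z i * q k (\<theta> i)) * (diff_value ?E \<tau> u v (t + l) z j * q k (\<theta> j)))"
   unfolding sum.cartesian_product' \<gamma>_def Fv_def f_rank fst_conv snd_conv sum_distrib_left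
   by (intro sum.cong refl) (simp add: mult_ac)
  also have "... = (\<Sum>i\<in>{1..n}. \<Sum>k=1..r. \<Sum>j\<in>{1..n}.
    lam k * (diff_value ?E \<tau> u v t z i * q k (\<theta> i)) * (diff_value ?E \<tau> u v (t + l) z j * q k (\<theta> j)))"
   by (intro sum.cong refl sum.swap)
  also have "... = (\<Sum>k=1..r. \<Sum>i\<in>{1..n}. \<Sum>j\<in>{1..n}.
    lam k * (diff_value ?E \<tau> u v t z i * q k (\<theta> i)) * (diff_value ?E \<tau> u v (t + l) z j * q k (\<theta> j)))"
   by (rule sum.swap)
  also have "... = (\<Sum>k=1..r. lam k * (a u k t - a v k t) * (a u k (t + l) - a v k (t + l)))"
   by (intro sum.cong refl) (simp only: sum_distrib_left[symmetric] sum_distrib_right[symmetric] inner)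
  also have "... = (\<Sum>k=1..r. lam k * (lam k ^ t * A k) * (lam k ^ (t + l) * A' k l))"
  proof (intro sum.cong refl)
   fix k assume "k \<in> {1..r}"
   then have "lam k \<noteq> 0" by (rule lam0)
   then have "a x k s = lam k ^ s * b x k s" for x s by (simp add: b_def)
   then show "lam k * (a u k t - a v k t) * (a u k (t + l) - a v k (t + l)) = lam k * (lam k ^ t * A k) * (lam k ^ (t + l) * A' k l)"
    by (simp add: A_def A'_def right_diff_distrib)
  qed
  finally show ?thesis .
 qed
 have tp: "0 < thin_prob p" by (rule thin_bounds(1))
 \<comment> \<open>Three corrections separate the form from its mean: the fluctuation off the first
   part, the thinned pairs inside it, and the mean over the first part. The last two are bounded by
   counting pairs.\<close>
 have form: "\<bar>pair_form c \<tau> u v t (t + l) z / thin_prob p - (\<Sum>e\<in>pairs n. \<gamma> l e * Fv e \<theta>)\<bar>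
   <= t0 / thin_prob p + real n * D / m\<^sup>2 + K3 / (thin_prob p * m\<^sup>2)" if l: "l \<in> {1..r'}" for l
 proof -
  have lr: "l <= r'" using l by simp
  have E1s: "?E \<subseteq> pairs n" and Eis: "ind_edges n c \<subseteq> pairs n" by (auto simp: part_edges_def ind_edges_def)
  let ?bil = "bilinear_dev c \<tau> u v t (t + l) (TZ \<xi>)"
  let ?I = "\<Sum>e\<in>ind_edges n c. \<gamma> l e * z e" and ?G = "\<Sum>e\<in>?E. \<gamma> l e * Fv e \<theta>"
  have E2: "(\<Sum>e\<in>pairs n. \<gamma> l e * (of_bool (e \<in> part_edges n Part2 c) * z e))
    = (\<Sum>e\<in>pairs n - ?E. \<gamma> l e * (of_bool (e \<in> part_edges n Part2 c) * z e))"
   by (rule sum.mono_neutral_right) (auto simp: part_edges_def)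
  have EI: "(\<Sum>e\<in>pairs n. \<gamma> l e * (of_bool (e \<in> ind_edges n c) * z e)) = ?I"
   using Eis by (intro sum.mono_neutral_cong_right) auto
  have EF: "(\<Sum>e\<in>pairs n. \<gamma> l e * Fv e \<theta>) = (\<Sum>e\<in>pairs n - ?E. \<gamma> l e * Fv e \<theta>) + ?G"
   by (rule sum.subset_diff[OF E1s]) simp
  have "pair_form c \<tau> u v t (t + l) z = (\<Sum>e\<in>pairs n. \<gamma> l e * (of_bool (e \<in> part_edges n Part2 c) * z e)
    + \<gamma> l e * (of_bool (e \<in> ind_edges n c) * z e))"
   unfolding pair_form_def \<gamma>_def by (intro sum.cong refl) (simp add: algebra_simps)
  then have pf: "pair_form c \<tau> u v t (t + l) z = (\<Sum>e\<in>pairs n - ?E. \<gamma> l e * (of_bool (e \<in> part_edges n Part2 c) * z e)) + ?I"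
   unfolding sum.distrib E2 EI .
  have bl: "?bil = (\<Sum>e\<in>pairs n - ?E. \<gamma> l e * (of_bool (e \<in> part_edges n Part2 c) * z e))
    - thin_prob p * (\<Sum>e\<in>pairs n - ?E. \<gamma> l e * Fv e \<theta>)"
   unfolding bilinear_dev_def TZeq fst_conv snd_conv sum_distrib_left sum_subtractf[symmetric] \<gamma>_def
   by (intro sum.cong refl) (simp add: algebra_simps)
  have "pair_form c \<tau> u v t (t + l) z - thin_prob p * (\<Sum>e\<in>pairs n. \<gamma> l e * Fv e \<theta>) = ?bil + ?I - thin_prob p * ?G"
   unfolding pf bl EF by (simp add: algebra_simps)
  then have "pair_form c \<tau> u v t (t + l) z / thin_prob p - (\<Sum>e\<in>pairs n. \<gamma> l e * Fv e \<theta>) = ?bil / thin_prob p + ?I / thin_prob p - ?G"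
   using tp by (simp add: field_simps)
  moreover have "\<bar>?bil / thin_prob p\<bar> <= t0 / thin_prob p"
   using bil[OF l] tp by (simp add: abs_divide divide_right_mono)
  moreover have "\<bar>?I / thin_prob p\<bar> <= K3 / (thin_prob p * m\<^sup>2)"
  proof -
   have "\<bar>?I\<bar> <= real (card (ind_edges n c)) * (1 / m\<^sup>2)"
   proof (rule order_trans[OF sum_abs], rule sum_bounded_above)
    fix e assume "e \<in> ind_edges n c"
    then have "z e \<in> {0..1}" using Eis z01 by blast
    then have "\<bar>\<gamma> l e\<bar> * \<bar>z e\<bar> <= (1 / m\<^sup>2) * 1" using \<gamma>b[OF lr] m by (intro mult_mono) auto
    then show "\<bar>\<gamma> l e * z e\<bar> <= 1 / m\<^sup>2" by (simp add: abs_mult)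
   qed
   also have "... <= K3 * (1 / m\<^sup>2)" using K3 by (intro mult_right_mono) auto
   finally show ?thesis using tp by (simp add: abs_divide field_simps)
  qed
  moreover have "\<bar>?G\<bar> <= real n * D / m\<^sup>2"
  proof -
   have "\<bar>?G\<bar> <= real (card ?E) * (1 / m\<^sup>2)"
   proof (rule order_trans[OF sum_abs], rule sum_bounded_above)
    fix e
    have "\<bar>\<gamma> l e\<bar> * \<bar>Fv e \<theta>\<bar> <= (1 / m\<^sup>2) * 1" using \<gamma>b[OF lr] m by (intro mult_mono) auto
    then show "\<bar>\<gamma> l e * Fv e \<theta>\<bar> <= 1 / m\<^sup>2" by (simp add: abs_mult)
   qed
   also have "real (card ?E) <= real n * D"
   proof -
    have fj: "finite {j. (i, j) \<in> ?E}" for i by (rule finite_subset[of _ "{1..n}"]) (use E1s in auto)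
    have ES: "?E = (SIGMA i:{1..n}. {j. (i, j) \<in> ?E})" using E1s by auto
    have "card (SIGMA i:{1..n}. {j. (i, j) \<in> ?E}) = (\<Sum>i\<in>{1..n}. card {j. (i, j) \<in> ?E})"
     by (rule card_SigmaI) (use fj in auto)
    with arg_cong[OF ES, of card] have "card ?E = (\<Sum>i\<in>{1..n}. card {j. (i, j) \<in> ?E})" by (rule trans)
    then have "real (card ?E) = (\<Sum>i\<in>{1..n}. real (card {j. (i, j) \<in> ?E}))" by simp
    also have "... <= real (card {1..n}) * D" using deg by (intro sum_bounded_above) auto
    finally show ?thesis by simp
   qed
   finally show ?thesis by (simp add: divide_right_mono)
  qed
  ultimately show ?thesis by linarith
 qed
 \<comment> \<open>If the layers \<open>t + l\<close> agreed exactly with layer \<open>t\<close>,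
   the equation for the weights would leave just the squares of the eigenvalues.\<close>
 have main: "(\<Sum>l=1..r'. w l * (\<Sum>k=1..r. lam k * (lam k ^ t * A k) * (lam k ^ (t + l) * A k))) = (\<Sum>k=1..r. (lam k)\<^sup>2 * (A k)\<^sup>2)"
 proof -
  have "(\<Sum>l=1..r'. w l * (\<Sum>k=1..r. lam k * (lam k ^ t * A k) * (lam k ^ (t + l) * A k)))
    = (\<Sum>k=1..r. \<Sum>l=1..r'. w l * (lam k * (lam k ^ t * A k) * (lam k ^ (t + l) * A k)))"
   unfolding sum_distrib_left by (rule sum.swap)
  also have "... = (\<Sum>k=1..r. (A k)\<^sup>2 * (lam k ^ (2 * t + 2) * (\<Sum>l=1..r'. lam k ^ (l - 1) * w l)))"
  proof (intro sum.cong refl)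
   fix k
   have "w l * (lam k * (lam k ^ t * A k) * (lam k ^ (t + l) * A k)) = (A k)\<^sup>2 * (lam k ^ (2 * t + 2) * (lam k ^ (l - 1) * w l))"
    if "l \<in> {1..r'}" for l
   proof -
    obtain l' where l': "l = Suc l'" using \<open>l \<in> {1..r'}\<close> not0_implies_Suc[of l] by fastforce
    have p2: "lam k ^ (2 * t + 2) = lam k ^ t * lam k ^ t * (lam k * lam k)"
     by (simp add: power_add mult_2 power2_eq_square)
    have "lam k * lam k ^ t * lam k ^ (t + l) = lam k ^ (2 * t + 2) * lam k ^ (l - 1)"
     unfolding l' p2 by (simp add: power_add mult_ac)
    then have "(A k)\<^sup>2 * w l * (lam k * lam k ^ t * lam k ^ (t + l)) = (A k)\<^sup>2 * w l * (lam k ^ (2 * t + 2) * lam k ^ (l - 1))" by (rule arg_cong)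
    then show ?thesis by (simp only: power2_eq_square mult_ac)
   qed
   then show "(\<Sum>l=1..r'. w l * (lam k * (lam k ^ t * A k) * (lam k ^ (t + l) * A k)))
     = (A k)\<^sup>2 * (lam k ^ (2 * t + 2) * (\<Sum>l=1..r'. lam k ^ (l - 1) * w l))"
    unfolding sum_distrib_left by (intro sum.cong refl)
  qed
  also have "... = (\<Sum>k=1..r. (lam k)\<^sup>2 * (A k)\<^sup>2)"
   using w unfolding solves_weights_def by (intro sum.cong refl) simp
  finally show ?thesis .
 qed
 have err2: "\<bar>\<Sum>k=1..r. lam k * (lam k ^ t * A k) * (lam k ^ (t + l) * (A' k l - A k))\<bar>
   <= real r * (\<Lambda> ^ (2 * t + r' + 1) * ((2 * B + 2 * d1) * (2 * d2)))" if l: "l \<in> {1..r'}" for l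
 proof -
  have "\<bar>\<Sum>k=1..r. lam k * (lam k ^ t * A k) * (lam k ^ (t + l) * (A' k l - A k))\<bar>
    <= real (card {1..r}) * (\<Lambda> ^ (2 * t + r' + 1) * ((2 * B + 2 * d1) * (2 * d2)))"
  proof (rule order_trans[OF sum_abs], rule sum_bounded_above)
   fix k assume k: "k \<in> {1..r}"
   have "\<bar>lam k * (lam k ^ t * A k) * (lam k ^ (t + l) * (A' k l - A k))\<bar> = \<bar>lam k\<bar> ^ (2 * t + l + 1) * (\<bar>A k\<bar> * \<bar>A' k l - A k\<bar>)"
   proof -
    have "2 * t + l + 1 = Suc (t + (t + l))" by simp
    then show ?thesis by (simp only: power_Suc power_add power_abs abs_mult mult_ac)
   qed
   also have "... <= \<Lambda> ^ (2 * t + r' + 1) * ((2 * B + 2 * d1) * (2 * d2))"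
   proof (intro mult_mono)
    have "\<bar>lam k\<bar> ^ (2 * t + l + 1) <= \<Lambda> ^ (2 * t + l + 1)" using lam0[OF k] by (intro power_mono) auto
    also have "... <= \<Lambda> ^ (2 * t + r' + 1)" using l \<Lambda> by (intro power_increasing) auto
    finally show "\<bar>lam k\<bar> ^ (2 * t + l + 1) <= \<Lambda> ^ (2 * t + r' + 1)" .
   qed (use AB[OF k] A'A[OF k, of l] l \<Lambda> B d0 in auto)
   finally show "\<bar>lam k * (lam k ^ t * A k) * (lam k ^ (t + l) * (A' k l - A k))\<bar>
     <= \<Lambda> ^ (2 * t + r' + 1) * ((2 * B + 2 * d1) * (2 * d2))" .
  qed
  then show ?thesis by simp
 qed
 have err1: "\<bar>(\<Sum>k=1..r. (lam k)\<^sup>2 * (A k)\<^sup>2) - ldist (\<theta> u) (\<theta> v)\<bar> <= real r * \<Lambda>\<^sup>2 * (2 * d1 * (4 * B + 2 * d1))"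
 proof -
  have "\<bar>(\<Sum>k=1..r. (lam k)\<^sup>2 * (A k)\<^sup>2) - ldist (\<theta> u) (\<theta> v)\<bar> <= real (card {1..r}) * (\<Lambda>\<^sup>2 * (2 * d1 * (4 * B + 2 * d1)))"
   unfolding ldist_def sum_subtractf[symmetric]
  proof (rule order_trans[OF sum_abs], rule sum_bounded_above)
   fix k assume k: "k \<in> {1..r}"
   have eq: "(lam k)\<^sup>2 * (A k)\<^sup>2 - (lam k)\<^sup>2 * (q k (\<theta> u) - q k (\<theta> v))\<^sup>2 = (lam k)\<^sup>2 * ((A k - \<Delta> k) * (A k + \<Delta> k))"
    unfolding \<Delta>_def[symmetric] by (simp add: power2_eq_square algebra_simps)
   have "\<bar>A k + \<Delta> k\<bar> <= 4 * B + 2 * d1" using AB[OF k] \<Delta>B[OF k] by linarith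
   then have pl: "\<bar>A k - \<Delta> k\<bar> * \<bar>A k + \<Delta> k\<bar> <= (2 * d1) * (4 * B + 2 * d1)"
    using A\<Delta>[OF k] d0 by (intro mult_mono) auto
   have ll: "\<bar>lam k\<bar>\<^sup>2 <= \<Lambda>\<^sup>2" using lam0[OF k] by (intro power_mono) auto
   have "\<bar>lam k\<bar>\<^sup>2 * (\<bar>A k - \<Delta> k\<bar> * \<bar>A k + \<Delta> k\<bar>) <= \<Lambda>\<^sup>2 * ((2 * d1) * (4 * B + 2 * d1))"
    by (rule mult_mono[OF ll pl]) auto
   then show "\<bar>(lam k)\<^sup>2 * (A k)\<^sup>2 - (lam k)\<^sup>2 * (q k (\<theta> u) - q k (\<theta> v))\<^sup>2\<bar> <= \<Lambda>\<^sup>2 * (2 * d1 * (4 * B + 2 * d1))"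
    unfolding eq by (simp add: abs_mult)
  qed
  then show ?thesis by (simp add: mult.assoc)
 qed
 define X3 where "X3 = t0 / thin_prob p + real n * D / m\<^sup>2 + K3 / (thin_prob p * m\<^sup>2)"
 define X2 where "X2 = real r * (\<Lambda> ^ (2 * t + r' + 1) * ((2 * B + 2 * d1) * (2 * d2)))"
 have "dist_est r' w t c \<tau> z u v - (\<Sum>k=1..r. (lam k)\<^sup>2 * (A k)\<^sup>2)
   = (\<Sum>l=1..r'. w l * (pair_form c \<tau> u v t (t + l) z / thin_prob p - (\<Sum>e\<in>pairs n. \<gamma> l e * Fv e \<theta>)
     + (\<Sum>k=1..r. lam k * (lam k ^ t * A k) * (lam k ^ (t + l) * (A' k l - A k)))))"
 proof -
  have "w l * (pair_form c \<tau> u v t (t + l) z / thin_prob p - (\<Sum>e\<in>pairs n. \<gamma> l e * Fv e \<theta>)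
     + (\<Sum>k=1..r. lam k * (lam k ^ t * A k) * (lam k ^ (t + l) * (A' k l - A k))))
   = w l * pair_form c \<tau> u v t (t + l) z / thin_prob p - w l * (\<Sum>k=1..r. lam k * (lam k ^ t * A k) * (lam k ^ (t + l) * A k))" for l
   unfolding full right_diff_distrib sum_subtractf by (simp add: algebra_simps)
  then have "(\<Sum>l=1..r'. w l * (pair_form c \<tau> u v t (t + l) z / thin_prob p - (\<Sum>e\<in>pairs n. \<gamma> l e * Fv e \<theta>)
     + (\<Sum>k=1..r. lam k * (lam k ^ t * A k) * (lam k ^ (t + l) * (A' k l - A k)))))
    = (\<Sum>l=1..r'. w l * pair_form c \<tau> u v t (t + l) z / thin_prob p)
     - (\<Sum>l=1..r'. w l * (\<Sum>k=1..r. lam k * (lam k ^ t * A k) * (lam k ^ (t + l) * A k)))"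
   by (simp only: sum_subtractf)
  then show ?thesis unfolding main dist_est_def by (simp add: sum_divide_distrib)
 qed
 also have "\<bar>...\<bar> <= real (card {1..r'}) * (Zb * (X3 + X2))"
 proof (rule order_trans[OF sum_abs], rule sum_bounded_above)
  fix l assume l: "l \<in> {1..r'}"
  have "\<bar>pair_form c \<tau> u v t (t + l) z / thin_prob p - (\<Sum>e\<in>pairs n. \<gamma> l e * Fv e \<theta>)
     + (\<Sum>k=1..r. lam k * (lam k ^ t * A k) * (lam k ^ (t + l) * (A' k l - A k)))\<bar> <= X3 + X2"
   using form[OF l] err2[OF l] unfolding X3_def X2_def by linarith
  then show "\<bar>w l * (pair_form c \<tau> u v t (t + l) z / thin_prob p - (\<Sum>e\<in>pairs n. \<gamma> l e * Fv e \<theta>)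
     + (\<Sum>k=1..r. lam k * (lam k ^ t * A k) * (lam k ^ (t + l) * (A' k l - A k))))\<bar> <= Zb * (X3 + X2)"
   unfolding abs_mult[of "w l"] using Zb(1)[OF l] Zb(2) by (intro mult_mono) auto
 qed
 finally have "\<bar>dist_est r' w t c \<tau> z u v - (\<Sum>k=1..r. (lam k)\<^sup>2 * (A k)\<^sup>2)\<bar> <= real r' * Zb * X2 + real r' * Zb * X3"
  by (simp add: algebra_simps)
 with err1 show ?thesis unfolding X2_def[symmetric] X3_def[symmetric] by linarith
qed

definition near_set where
 "near_set r' w t \<eta> u v c \<tau> z = {e \<in> part_edges n Part3 c.
  dist_est r' w t c \<tau> z u (fst e) < \<eta> \<and> dist_est r' w t c \<tau> z v (snd e) < \<eta>}"

definition close_pairs :: "nat => nat => real => (nat => real) => edges" where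
 "close_pairs u v \<delta> \<theta> = {a \<in> {1..n}. \<bar>\<theta> u - \<theta> a\<bar> <= \<delta>} \<times> {b \<in> {1..n}. \<bar>\<theta> v - \<theta> b\<bar> <= \<delta>}"

lemma near_samples_eq:
 assumes "u \<in> {1..n}" "v \<in> {1..n}" "\<xi> \<in> space M"
 shows "near_samples n X (d_hat n p X r' w t \<xi>) \<eta> \<xi> u v = near_set r' w t \<eta> u v (coinsv \<xi>) (trees \<xi>) (Zs \<xi>)"
proof -
 have "d_hat n p X r' w t \<xi> u' a = dist_est r' w t (coinsv \<xi>) (trees \<xi>) (Zs \<xi>) u' a"
  if "u' \<in> {1..n}" "a \<in> {1..n}" for u' a using d_hat_eq[OF that assms(3)] .
 then show ?thesis
  unfolding near_samples_def near_set_def Epart_eq using assms(1,2) part_edges_subset[of n Part3 "coinsv \<xi>"]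
  by (auto simp: subset_iff)
qed

lemma nn_estimate_near_set:
 fixes r' w t \<eta> u v \<xi>
 assumes u: "u \<in> {1..n}" and v: "v \<in> {1..n}" and \<xi>: "\<xi> \<in> space M"
 defines "S \<equiv> near_set r' w t \<eta> u v (coinsv \<xi>) (trees \<xi>) (Zs \<xi>)"
 shows "nn_estimate n X (d_hat n p X r' w t \<xi>) \<eta> \<xi> u v
  = (if S = {} then fallback X u v \<xi> else (\<Sum>e\<in>S. Zs \<xi> e) / real (card S))"
proof -
 have "(\<Sum>(a, b)\<in>S. mat_on (Epart n X Part3 \<xi>) (Mmat n X \<xi>) a b) = (\<Sum>e\<in>S. Zs \<xi> e)"
 proof (intro sum.cong refl)
  fix e assume e: "e \<in> S"
  then have "e \<in> part_edges n Part3 (coinsv \<xi>)" by (simp add: S_def near_set_def)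
  moreover then have "e \<in> pairs n" using part_edges_subset by blast
  ultimately show "(case e of (a, b) \<Rightarrow> mat_on (Epart n X Part3 \<xi>) (Mmat n X \<xi>) a b) = Zs \<xi> e"
   using mat_on_eq[of Part3 "fst e" "snd e" \<xi>] by (cases e) simp
 qed
 then show ?thesis
  unfolding nn_estimate_def near_samples_eq[OF u v \<xi>] Let_def S_def[symmetric] by simp
qed

text \<open>Pairs whose latent positions are within 1/K pass both threshold tests, so the sample is
  large. Every pair that passes has \<open>ldist\<close> at most \<open>2 * \<eta>\<close> on both
  sides, which bounds the bias; the term \<open>2 * x\<close> is the noise of the average.\<close>

lemma nn_estimate_error:
 fixes \<xi> \<eta> x r' w t K u v
 defines "c \<equiv> coinsv \<xi>" and "\<tau> \<equiv> trees \<xi>" and "\<theta> \<equiv> thetas \<xi>" and "z \<equiv> Zs \<xi>"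
 defines "S \<equiv> near_set r' w t \<eta> u v c \<tau> z" and "R \<equiv> close_pairs u v (1 / real K) \<theta>"
 defines "N0 \<equiv> p * ((real n / (4 * real K))\<^sup>2) / 8"
 assumes \<xi>: "\<xi> \<in> space M" and u: "u \<in> {1..n}" and v: "v \<in> {1..n}" and K: "0 < K" and \<eta>: "0 < \<eta>"
  and est: "\<And>u v. u \<in> {1..n} ==> v \<in> {1..n} ==> \<bar>dist_est r' w t c \<tau> z u v - ldist (\<theta> u) (\<theta> v)\<bar> <= \<eta> / 2"
  and small: "real r * (B * L)\<^sup>2 * (1 / real K)\<^sup>2 < \<eta> / 2"
  and cover: "\<And>i. i < K ==> real n / (4 * real K) <= real (card {u \<in> {1..n}. theta X u \<xi> \<in> {real i / real K..real (Suc i) / real K}})"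
  and sample: "(real n / (4 * real K))\<^sup>2 <= real (card R) ==> p * real (card R) / 8 <= real (card (part_edges n Part3 c \<inter> R))"
  and noise: "N0 <= real (card S) ==> \<bar>\<Sum>e\<in>S. z e - Fv e \<theta>\<bar> <= 2 * x * real (card S)"
 shows "\<bar>nn_estimate n X (d_hat n p X r' w t \<xi>) \<eta> \<xi> u v - Fmat f X \<xi> u v\<bar> <= 2 * x + 2 * (real r * B) * sqrt (2 * \<eta>)"
proof -
 have \<theta>u: "\<theta> i = theta X i \<xi>" if "i \<in> {1..n}" for i using that by (simp add: \<theta>_def theta_vec_def)
 have cov: "real n / (4 * real K) <= real (card {a \<in> {1..n}. \<bar>\<theta> i - \<theta> a\<bar> <= 1 / real K})" if i: "i \<in> {1..n}" for i
 proof -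
  have t01: "\<theta> i \<in> {0..1}" using theta_range[OF i \<xi>] \<theta>u[OF i] by simp
  obtain j where j: "j < K" "\<theta> i \<in> {real j / real K..real (Suc j) / real K}"
  \<comment> \<open>The right end point belongs to the last interval, which rounding down would
    miss.\<close>
  proof (cases "\<theta> i = 1")
   case True
   have "real (Suc (K - 1)) / real K = 1" using K by simp
   moreover have "real (K - 1) / real K <= 1" using K by simp
   ultimately show ?thesis using that[of "K - 1"] K True by simp
  next
   case False
   let ?j = "nat \<lfloor>\<theta> i * real K\<rfloor>"
   have p0: "0 <= \<theta> i * real K" using t01 by simp
   have le: "real ?j <= \<theta> i * real K" using p0 by linarith
   have ge: "\<theta> i * real K < real (Suc ?j)" using p0 by linarith
   have "\<theta> i * real K < 1 * real K" using t01 False K by (intro mult_strict_right_mono) auto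
   then have "real ?j < real K" using le by simp
   then have "?j < K" by simp
   moreover have "real ?j / real K <= \<theta> i" using le K by (simp add: divide_le_eq)
   moreover have "\<theta> i <= real (Suc ?j) / real K" using ge K by (simp only: pos_le_divide_eq of_nat_0_less_iff)
   ultimately show ?thesis using that[of ?j] by simp
  qed
  have "{a \<in> {1..n}. theta X a \<xi> \<in> {real j / real K..real (Suc j) / real K}} \<subseteq> {a \<in> {1..n}. \<bar>\<theta> i - \<theta> a\<bar> <= 1 / real K}"
  proof clarify
   fix a assume a: "a \<in> {1..n}" "theta X a \<xi> \<in> {real j / real K..real (Suc j) / real K}"
   have "real (Suc j) / real K = real j / real K + 1 / real K" by (simp add: add_divide_distrib)
   then show "\<bar>\<theta> i - \<theta> a\<bar> <= 1 / real K" using a j(2) \<theta>u[OF a(1)] by auto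
  qed
  then have "card {a \<in> {1..n}. theta X a \<xi> \<in> {real j / real K..real (Suc j) / real K}} <= card {a \<in> {1..n}. \<bar>\<theta> i - \<theta> a\<bar> <= 1 / real K}"
   by (intro card_mono) auto
  then show ?thesis using cover[OF j(1)] by linarith
 qed
 have cR: "(real n / (4 * real K))\<^sup>2 <= real (card R)"
 proof -
  have "real n / (4 * real K) * (real n / (4 * real K)) <= real (card {a \<in> {1..n}. \<bar>\<theta> u - \<theta> a\<bar> <= 1 / real K}) * real (card {b \<in> {1..n}. \<bar>\<theta> v - \<theta> b\<bar> <= 1 / real K})"
   using cov[OF u] cov[OF v] by (intro mult_mono) auto
  then show ?thesis by (simp add: R_def close_pairs_def card_cartesian_product power2_eq_square)
 qed
 have near: "ldist (\<theta> i) (\<theta> a) < \<eta> / 2" if "\<bar>\<theta> i - \<theta> a\<bar> <= 1 / real K" for i a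
 proof -
  have "\<bar>\<theta> i - \<theta> a\<bar>\<^sup>2 <= (1 / real K)\<^sup>2" using that by (intro power_mono) auto
  then have "real r * (B * L)\<^sup>2 * \<bar>\<theta> i - \<theta> a\<bar>\<^sup>2 <= real r * (B * L)\<^sup>2 * (1 / real K)\<^sup>2"
   by (intro mult_left_mono) auto
  with ldist_le[of "\<theta> i" "\<theta> a"] small show ?thesis by linarith
 qed
 have RS: "part_edges n Part3 c \<inter> R \<subseteq> S"
 proof
  fix e assume e: "e \<in> part_edges n Part3 c \<inter> R"
  then have ab: "fst e \<in> {1..n}" "\<bar>\<theta> u - \<theta> (fst e)\<bar> <= 1 / real K" "snd e \<in> {1..n}" "\<bar>\<theta> v - \<theta> (snd e)\<bar> <= 1 / real K"
   by (auto simp: R_def close_pairs_def)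
  have "dist_est r' w t c \<tau> z u (fst e) < \<eta>" using est[OF u ab(1)] near[OF ab(2)] by linarith
  moreover have "dist_est r' w t c \<tau> z v (snd e) < \<eta>" using est[OF v ab(3)] near[OF ab(4)] by linarith
  ultimately show "e \<in> S" using e by (simp add: S_def near_set_def)
 qed
 have finS: "finite S" unfolding S_def near_set_def by simp
 have N0: "N0 <= real (card S)"
 proof -
  have "N0 <= p * real (card R) / 8" unfolding N0_def using cR p_pos by (intro divide_right_mono mult_left_mono) auto
  also have "... <= real (card (part_edges n Part3 c \<inter> R))" by (rule sample[OF cR])
  also have "... <= real (card S)" using card_mono[OF finS RS] by simp
  finally show ?thesis .
 qed
 have N0p: "0 < N0" unfolding N0_def using p_pos n_pos K by simp
 then have cS: "0 < real (card S)" using N0 by linarith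
 then have Sne: "S \<noteq> {}" by auto
 have Fd: "\<bar>Fv e \<theta> - Fmat f X \<xi> u v\<bar> <= 2 * (real r * B) * sqrt (2 * \<eta>)" if e: "e \<in> S" for e
 proof -
  have ab: "fst e \<in> {1..n}" "snd e \<in> {1..n}" using e part_edges_subset[of n Part3 c] by (auto simp: S_def near_set_def)
  have S2: "dist_est r' w t c \<tau> z u (fst e) < \<eta>" "dist_est r' w t c \<tau> z v (snd e) < \<eta>"
   using e by (simp_all add: S_def near_set_def)
  have l1: "ldist (\<theta> u) (\<theta> (fst e)) <= 2 * \<eta>" "ldist (\<theta> v) (\<theta> (snd e)) <= 2 * \<eta>"
   using S2 est[OF u ab(1)] est[OF v ab(2)] \<eta> by linarith+
  have rB: "0 <= real r * B" using B by simp
  have "\<bar>f (\<theta> u) (\<theta> (snd e)) - f (\<theta> (fst e)) (\<theta> (snd e))\<bar> <= real r * B * sqrt (2 * \<eta>)"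
   using f_diff_le_ldist[of "\<theta> u" "\<theta> (snd e)" "\<theta> (fst e)"] mult_left_mono[OF real_sqrt_le_mono[OF l1(1)] rB] by linarith
  moreover have "\<bar>f (\<theta> v) (\<theta> u) - f (\<theta> (snd e)) (\<theta> u)\<bar> <= real r * B * sqrt (2 * \<eta>)"
   using f_diff_le_ldist[of "\<theta> v" "\<theta> u" "\<theta> (snd e)"] mult_left_mono[OF real_sqrt_le_mono[OF l1(2)] rB] by linarith
  moreover have "Fmat f X \<xi> u v = f (\<theta> u) (\<theta> v)" using \<theta>u[OF u] \<theta>u[OF v] by (simp add: Fmat_def)
  ultimately show ?thesis
   unfolding Fv_def using f_sym[of "\<theta> v" "\<theta> u"] f_sym[of "\<theta> (snd e)" "\<theta> u"] by linarith
 qed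
 have est_eq: "nn_estimate n X (d_hat n p X r' w t \<xi>) \<eta> \<xi> u v = (\<Sum>e\<in>S. z e) / real (card S)"
  using Sne unfolding nn_estimate_near_set[OF u v \<xi>] S_def c_def \<tau>_def z_def by simp
 have "(\<Sum>e\<in>S. z e) / real (card S) - Fmat f X \<xi> u v
   = (\<Sum>e\<in>S. z e - Fv e \<theta>) / real (card S) + (\<Sum>e\<in>S. Fv e \<theta> - Fmat f X \<xi> u v) / real (card S)"
  using cS by (simp add: sum_subtractf diff_divide_distrib)
 moreover have "\<bar>(\<Sum>e\<in>S. z e - Fv e \<theta>) / real (card S)\<bar> <= 2 * x"
  using noise[OF N0] cS by (simp add: abs_divide divide_le_eq)
 moreover have "\<bar>(\<Sum>e\<in>S. Fv e \<theta> - Fmat f X \<xi> u v) / real (card S)\<bar> <= 2 * (real r * B) * sqrt (2 * \<eta>)"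
 proof -
  have "\<bar>\<Sum>e\<in>S. Fv e \<theta> - Fmat f X \<xi> u v\<bar> <= real (card S) * (2 * (real r * B) * sqrt (2 * \<eta>))"
   by (rule order_trans[OF sum_abs]) (rule sum_bounded_above[OF Fd])
  then show ?thesis using cS by (simp add: abs_divide divide_le_eq mult.commute)
 qed
 ultimately show ?thesis unfolding est_eq by linarith
qed

end

section \<open>Uniform error for a fixed number of vertices\<close>

context rank_instance
begin

lemma dist_est_measurable:
 assumes V: "valid_trees c \<tau>" and u: "u \<in> {1..n}" and v: "v \<in> {1..n}"
 shows "(%z. dist_est r' w t c \<tau> z u v) \<in> borel_measurable (Z_space n)"
proof -
 have "(%z. diff_value (edges1 c) \<tau> u v s z i) \<in> borel_measurable (Z_space n)" for s i
  by (rule diff_value_measurable(2)[OF V u v])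
 moreover have "(%z. z e) \<in> borel_measurable (Z_space n)" if "e \<in> pairs n" for e
  unfolding Z_space_def using that by (rule measurable_component_singleton)
 ultimately show ?thesis unfolding dist_est_def pair_form_def
  by (intro borel_measurable_times borel_measurable_const borel_measurable_sum borel_measurable_add)
qed

lemma near_set_subset: "near_set r' w t \<eta> u v c \<tau> z \<subseteq> part_edges n Part3 c"
 by (auto simp: near_set_def)

lemma near_set_measurable:
 assumes V: "valid_trees c \<tau>" and u: "u \<in> {1..n}" and v: "v \<in> {1..n}"
 shows "Measurable.pred (Z_space n) (%z. e \<in> near_set r' w t \<eta> u v c \<tau> z)"
proof (cases "e \<in> part_edges n Part3 c")
 case True
 then have e: "fst e \<in> {1..n}" "snd e \<in> {1..n}" using part_edges_subset[of n Part3 c] by auto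
 note [measurable] = dist_est_measurable[OF V u e(1)] dist_est_measurable[OF V v e(2)]
 show ?thesis unfolding near_set_def mem_Collect_eq by measurable
qed (simp add: near_set_def)

text \<open>The distance estimate reads entries of the first two parts only, so the third part is
  fresh for the average.\<close>

lemma near_set_upd:
 assumes V: "valid_trees c \<tau>" and u: "u \<in> {1..n}" and v: "v \<in> {1..n}" and e: "e \<in> part_edges n Part3 c"
 shows "near_set r' w t \<eta> u v c \<tau> (z(e := b)) = near_set r' w t \<eta> u v c \<tau> z"
proof -
 have d: "dist_est r' w t c \<tau> (z(e := b)) x y = dist_est r' w t c \<tau> z x y"
  if x: "x \<in> {1..n}" and y: "y \<in> {1..n}" for x y
 proof -
  have "(z(e := b)) e' = z e'" if "e' \<in> edges1 c" for e'
   using that e by (auto simp: part_edges_def)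
  then have "diff_value (edges1 c) \<tau> x y s (z(e := b)) i = diff_value (edges1 c) \<tau> x y s z i" for s i
   using V x y by (intro diff_value_cong) (auto simp: valid_trees_def)
  moreover have "of_bool (e' \<in> part_edges n Part2 c) * (z(e := b)) e' = of_bool (e' \<in> part_edges n Part2 c) * z e'"
   "of_bool (e' \<in> ind_edges n c) * (z(e := b)) e' = of_bool (e' \<in> ind_edges n c) * z e'" for e'
   using e by (auto simp: part_edges_def ind_edges_def)
  ultimately show ?thesis unfolding dist_est_def pair_form_def by (simp only:)
 qed
 show ?thesis unfolding near_set_def
 proof (intro Collect_cong conj_cong refl)
  fix e' assume "e' \<in> part_edges n Part3 c"
  then have "fst e' \<in> {1..n}" "snd e' \<in> {1..n}" using part_edges_subset[of n Part3 c] by auto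
  then show "(dist_est r' w t c \<tau> (z(e := b)) u (fst e') < \<eta>) = (dist_est r' w t c \<tau> z u (fst e') < \<eta>)"
   "(dist_est r' w t c \<tau> (z(e := b)) v (snd e') < \<eta>) = (dist_est r' w t c \<tau> z v (snd e') < \<eta>)"
   using d u v by simp_all
 qed
qed

lemma close_pairs_subset: "close_pairs u v \<delta> \<theta> \<subseteq> pairs n"
 by (auto simp: close_pairs_def)

lemma close_pairs_measurable:
 assumes u: "u \<in> {1..n}" and v: "v \<in> {1..n}"
 shows "Measurable.pred (latent_space n) (%\<theta>. e \<in> close_pairs u v \<delta> \<theta>)"
proof (cases "e \<in> pairs n")
 case True
 have [measurable]: "(%\<theta>. \<theta> i) \<in> borel_measurable (latent_space n)" if "i \<in> {1..n}" for i
  unfolding latent_space_def using that by (rule measurable_component_singleton)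
 have [measurable]: "(%\<theta>. \<theta> (fst e)) \<in> borel_measurable (latent_space n)" "(%\<theta>. \<theta> (snd e)) \<in> borel_measurable (latent_space n)"
  "(%\<theta>. \<theta> u) \<in> borel_measurable (latent_space n)" "(%\<theta>. \<theta> v) \<in> borel_measurable (latent_space n)"
  unfolding latent_space_def using True u v by (auto intro!: measurable_component_singleton)
 have "(%\<theta>. e \<in> close_pairs u v \<delta> \<theta>) = (%\<theta>. \<bar>\<theta> u - \<theta> (fst e)\<bar> <= \<delta> \<and> \<bar>\<theta> v - \<theta> (snd e)\<bar> <= \<delta>)"
  using True by (auto simp: close_pairs_def)
 then show ?thesis by simp
next
 case False
 then have "(%\<theta>. e \<in> close_pairs u v \<delta> \<theta>) = (%\<theta>. False)" using close_pairs_subset by blast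
 then show ?thesis by simp
qed

lemma union_bound:
 assumes "finite I" "\<And>i. i \<in> I ==> A i \<in> sets M" "\<And>i. i \<in> I ==> prob (A i) <= b"
 shows "(\<Union>i\<in>I. A i) \<in> sets M" and "prob (\<Union>i\<in>I. A i) <= real (card I) * b"
proof -
 show "(\<Union>i\<in>I. A i) \<in> sets M" using assms by auto
 have "prob (\<Union>i\<in>I. A i) <= (\<Sum>i\<in>I. prob (A i))"
  using assms by (intro finite_measure_subadditive_finite) auto
 also have "... <= real (card I) * b" using assms by (intro sum_bounded_above) auto
 finally show "prob (\<Union>i\<in>I. A i) <= real (card I) * b" .
qed

lemma ex_union_bound:
 assumes "finite I" "\<And>i. i \<in> I ==> {\<xi> \<in> space M. P i \<xi>} \<in> sets M"
  "\<And>i. i \<in> I ==> prob {\<xi> \<in> space M. P i \<xi>} <= b"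
 shows "{\<xi> \<in> space M. \<exists>i\<in>I. P i \<xi>} \<in> sets M" and "prob {\<xi> \<in> space M. \<exists>i\<in>I. P i \<xi>} <= real (card I) * b"
proof -
 have eq: "{\<xi> \<in> space M. \<exists>i\<in>I. P i \<xi>} = (\<Union>i\<in>I. {\<xi> \<in> space M. P i \<xi>})" by auto
 show "{\<xi> \<in> space M. \<exists>i\<in>I. P i \<xi>} \<in> sets M" and "prob {\<xi> \<in> space M. \<exists>i\<in>I. P i \<xi>} <= real (card I) * b"
  unfolding eq using union_bound[OF assms(1), of "%i. {\<xi> \<in> space M. P i \<xi>}"] assms(2,3) by auto
qed

lemma ex2_union_bound:
 assumes I: "finite I" and J: "finite J" and m: "\<And>i j. i \<in> I ==> j \<in> J ==> {\<xi> \<in> space M. P i j \<xi>} \<in> sets M"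
  and b: "\<And>i j. i \<in> I ==> j \<in> J ==> prob {\<xi> \<in> space M. P i j \<xi>} <= b"
 shows "{\<xi> \<in> space M. \<exists>i\<in>I. \<exists>j\<in>J. P i j \<xi>} \<in> sets M"
  and "prob {\<xi> \<in> space M. \<exists>i\<in>I. \<exists>j\<in>J. P i j \<xi>} <= real (card I) * (real (card J) * b)"
proof -
 have 1: "{\<xi> \<in> space M. \<exists>j\<in>J. P i j \<xi>} \<in> sets M" "prob {\<xi> \<in> space M. \<exists>j\<in>J. P i j \<xi>} <= real (card J) * b" if "i \<in> I" for i
  by (rule ex_union_bound[OF J m[OF that] b[OF that]]; assumption)+
 show "{\<xi> \<in> space M. \<exists>i\<in>I. \<exists>j\<in>J. P i j \<xi>} \<in> sets M"
  by (rule ex_union_bound(1)[OF I 1])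
 show "prob {\<xi> \<in> space M. \<exists>i\<in>I. \<exists>j\<in>J. P i j \<xi>} <= real (card I) * (real (card J) * b)"
  by (rule ex_union_bound(2)[OF I 1])
qed

lemma ex3_union_bound:
 assumes I: "finite I" and J: "finite J" and K: "finite K"
  and m: "\<And>i j k. i \<in> I ==> j \<in> J ==> k \<in> K ==> {\<xi> \<in> space M. P i j k \<xi>} \<in> sets M"
  and b: "\<And>i j k. i \<in> I ==> j \<in> J ==> k \<in> K ==> prob {\<xi> \<in> space M. P i j k \<xi>} <= b"
 shows "{\<xi> \<in> space M. \<exists>i\<in>I. \<exists>j\<in>J. \<exists>k\<in>K. P i j k \<xi>} \<in> sets M"
  and "prob {\<xi> \<in> space M. \<exists>i\<in>I. \<exists>j\<in>J. \<exists>k\<in>K. P i j k \<xi>} <= real (card I) * (real (card J) * (real (card K) * b))"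
proof -
 have 1: "{\<xi> \<in> space M. \<exists>k\<in>K. P i j k \<xi>} \<in> sets M" "prob {\<xi> \<in> space M. \<exists>k\<in>K. P i j k \<xi>} <= real (card K) * b"
  if "i \<in> I" "j \<in> J" for i j
  by (rule ex_union_bound[OF K m[OF that] b[OF that]]; assumption)+
 show "{\<xi> \<in> space M. \<exists>i\<in>I. \<exists>j\<in>J. \<exists>k\<in>K. P i j k \<xi>} \<in> sets M"
  by (rule ex2_union_bound(1)[OF I J 1])
 show "prob {\<xi> \<in> space M. \<exists>i\<in>I. \<exists>j\<in>J. \<exists>k\<in>K. P i j k \<xi>} <= real (card I) * (real (card J) * (real (card K) * b))"
  by (rule ex2_union_bound(2)[OF I J 1])
qed

lemma prob_disj:
 assumes "{\<xi> \<in> space M. P \<xi>} \<in> sets M" "prob {\<xi> \<in> space M. P \<xi>} <= a"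
  and "{\<xi> \<in> space M. Q \<xi>} \<in> sets M" "prob {\<xi> \<in> space M. Q \<xi>} <= b"
 shows "{\<xi> \<in> space M. P \<xi> \<or> Q \<xi>} \<in> sets M" "prob {\<xi> \<in> space M. P \<xi> \<or> Q \<xi>} <= a + b"
proof -
 have eq: "{\<xi> \<in> space M. P \<xi> \<or> Q \<xi>} = {\<xi> \<in> space M. P \<xi>} \<union> {\<xi> \<in> space M. Q \<xi>}" by auto
 show "{\<xi> \<in> space M. P \<xi> \<or> Q \<xi>} \<in> sets M" unfolding eq using assms by auto
 show "prob {\<xi> \<in> space M. P \<xi> \<or> Q \<xi>} <= a + b"
  unfolding eq using measure_Un_le[OF assms(1,3)] assms(2,4) by linarith
qed

lemma coins_event: "{\<xi> \<in> space M. P (coinsv \<xi>)} \<in> sets M"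
 using joint_event[of "%c \<tau> x. P c"] by simp

text \<open>One summand for each bad event of the next theorem, in the order degrees, expansion,
  thinned pairs, layers, bilinear form, coverage, sample size, noise.\<close>

definition failure_prob :: "nat => nat => real => real => real => real => real => real => nat => real" where
 "failure_prob r' t m K3 Lw s t0 x K =
  real n * exp (- real n * p / 2000) + ((1 + exp (- real n * p / 50)) ^ n - 1) + (real n)\<^sup>2 * p\<^sup>2 / K3
  + real n * (real r * (real (t + r') * (4 * exp (- Lw / (16 * B\<^sup>2)))))
  + real n * (real n * (real r' * (2 * exp (thin_prob p * s\<^sup>2 * (real n)\<^sup>2 / m ^ 4 - s * t0))))
  + real K * exp (- real n / (4 * real K))
  + real n * (real n * exp (- p * (real n / (4 * real K))\<^sup>2 / 8))
  + real n * (real n * (2 * exp (- x\<^sup>2 * (p * (real n / (4 * real K))\<^sup>2 / 8))))"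

theorem uniform_error_event:
 fixes t K :: nat and w :: "nat => real" and g \<sigma> Zb Lw K3 t0 s x \<eta> :: real
 defines "r' \<equiv> num_distinct r lam" and "m \<equiv> g ^ t" and "d1 \<equiv> 2 * (sqrt Lw * (1 + \<Lambda>)) * \<sigma>"
  and "d2 \<equiv> 2 * (sqrt Lw * (1 + \<Lambda>)) * \<sigma> ^ Suc t"
 assumes g: "g = real n * p / 10 - 2" "2 <= g" and D: "1 <= 0.275 * real n * p"
  and size: "p * (0.275 * real n * p) ^ (t + r' - 1) <= 0.08"
  and Lw: "0 < Lw" "Lw <= g" and \<sigma>: "\<sigma> = 1 / (\<mu> * sqrt g)" "\<sigma> <= 1 / 2"
  and w: "solves_weights r lam t w" and Zb: "\<And>l. l \<in> {1..r'} ==> \<bar>w l\<bar> <= Zb" "0 <= Zb"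
  and s: "0 < s" "s <= m\<^sup>2" and K3: "0 < K3" and K: "0 < K" and x: "0 < x" "x <= 1" and \<eta>: "0 < \<eta>"
  and err: "real r * \<Lambda>\<^sup>2 * (2 * d1 * (4 * B + 2 * d1))
   + real r' * Zb * (real r * (\<Lambda> ^ (2 * t + r' + 1) * ((2 * B + 2 * d1) * (2 * d2))))
   + real r' * Zb * (t0 / thin_prob p + real n * (0.275 * real n * p) / m\<^sup>2 + K3 / (thin_prob p * m\<^sup>2)) <= \<eta> / 2"
  and small: "real r * (B * L)\<^sup>2 * (1 / real K)\<^sup>2 < \<eta> / 2"
 shows "\<exists>Bad\<in>sets M. prob Bad <= failure_prob r' t m K3 Lw s t0 x K \<and>
  (\<forall>\<xi>\<in>space M - Bad. \<forall>u\<in>{1..n}. \<forall>v\<in>{1..n}.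
    \<bar>nn_estimate n X (d_hat n p X r' w t \<xi>) \<eta> \<xi> u v - Fmat f X \<xi> u v\<bar> <= 2 * x + 2 * (real r * B) * sqrt (2 * \<eta>))"
proof -
 let ?E = "%\<xi>. edges1 (coinsv \<xi>)"
 define c where "c = coinsv" 
 \<comment> \<open>Chosen such that \<open>(\<epsilon> i)\<^sup>2 * g ^ Suc i = Lw\<close>: all
   layers have the same failure probability, and the errors shrink geometrically with the
   layer.\<close>
 define \<epsilon> where "\<epsilon> i = sqrt (Lw / g ^ Suc i)" for i
 define R where "R u v \<xi> = close_pairs u v (1 / real K) (thetas \<xi>)" for u v \<xi>
 define S where "S u v \<xi> = near_set r' w t \<eta> u v (coinsv \<xi>) (trees \<xi>) (Zs \<xi>)" for u v \<xi>
 define r0 where "r0 = (real n / (4 * real K))\<^sup>2"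
 define N0 where "N0 = p * r0 / 8"
 define P1 where "P1 \<xi> \<longleftrightarrow> (\<exists>i\<in>{1..n}. real (card {j. (i, j) \<in> ?E \<xi>}) > 0.275 * real n * p)" for \<xi>
 define P2 where "P2 \<xi> \<longleftrightarrow> (\<exists>A\<subseteq>{1..n}. A \<noteq> {} \<and> p * real (card A) <= 0.08 \<and>
   real (card (out_nbrs (?E \<xi>) A)) < real n * p * real (card A) / 10)" for \<xi>
 define P3 where "P3 \<xi> \<longleftrightarrow> real (card (ind_edges n (coinsv \<xi>))) > K3" for \<xi>
 define Q4 where "Q4 u k i \<xi> \<longleftrightarrow> g ^ Suc i <= real (card (sphere (?E \<xi>) u (Suc i))) \<and>
   \<bar>layer_avg (q k) (?E \<xi>) (tree X u \<xi>) u (Suc i) (thetas \<xi>) (Zs \<xi>)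
    - lam k * layer_avg (q k) (?E \<xi>) (tree X u \<xi>) u i (thetas \<xi>) (Zs \<xi>)\<bar> > \<epsilon> i * (1 + \<bar>lam k\<bar>)" for u k i \<xi>
 define Q5 where "Q5 u v l \<xi> \<longleftrightarrow> big_layers m (?E \<xi>) u v t (t + l) \<and>
   \<bar>bilinear_dev (coinsv \<xi>) (trees \<xi>) u v t (t + l) (TZ \<xi>)\<bar> > t0" for u v l \<xi>
 define P6 where "P6 \<xi> \<longleftrightarrow> (\<exists>i<K. real (card {u \<in> {1..n}. theta X u \<xi> \<in> {real i / real K..real (Suc i) / real K}}) < real n / (4 * real K))" for \<xi>
 define Q7 where "Q7 u v \<xi> \<longleftrightarrow> r0 <= real (card (R u v \<xi>)) \<and>
   real (card (part_edges n Part3 (coinsv \<xi>) \<inter> R u v \<xi>)) < p * real (card (R u v \<xi>)) / 8" for u v \<xi>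
 define Q8 where "Q8 u v \<xi> \<longleftrightarrow> N0 <= real (card (S u v \<xi>)) \<and>
   \<bar>\<Sum>e\<in>S u v \<xi>. Zs \<xi> e - Fv e (thetas \<xi>)\<bar> > 2 * x * real (card (S u v \<xi>))" for u v \<xi>
 define P4 where "P4 \<xi> \<longleftrightarrow> (\<exists>u\<in>{1..n}. \<exists>k\<in>{1..r}. \<exists>i\<in>{..<t + r'}. Q4 u k i \<xi>)" for \<xi>
 define P5 where "P5 \<xi> \<longleftrightarrow> (\<exists>u\<in>{1..n}. \<exists>v\<in>{1..n}. \<exists>l\<in>{1..r'}. Q5 u v l \<xi>)" for \<xi>
 define P7 where "P7 \<xi> \<longleftrightarrow> (\<exists>u\<in>{1..n}. \<exists>v\<in>{1..n}. Q7 u v \<xi>)" for \<xi>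
 define P8 where "P8 \<xi> \<longleftrightarrow> (\<exists>u\<in>{1..n}. \<exists>v\<in>{1..n}. Q8 u v \<xi>)" for \<xi>
 have g0: "0 < g" and m0: "0 < m" using g by (auto simp: m_def)
 have B1: "{\<xi> \<in> space M. P1 \<xi>} \<in> sets M" "prob {\<xi> \<in> space M. P1 \<xi>} <= real n * exp (- real n * p / 2000)"
  unfolding P1_def by (rule coins_event, rule outdegree_event)
 have B2: "{\<xi> \<in> space M. P2 \<xi>} \<in> sets M" "prob {\<xi> \<in> space M. P2 \<xi>} <= (1 + exp (- real n * p / 50)) ^ n - 1"
  unfolding P2_def by (rule coins_event, rule expansion_event)
 have B3: "{\<xi> \<in> space M. P3 \<xi>} \<in> sets M" "prob {\<xi> \<in> space M. P3 \<xi>} <= (real n)\<^sup>2 * p\<^sup>2 / K3"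
  unfolding P3_def by (rule coins_event, rule ind_edges_event[OF K3])
 have \<epsilon>: "0 < \<epsilon> i" "\<epsilon> i <= 4 * B" "(\<epsilon> i)\<^sup>2 * g ^ Suc i = Lw" for i
 proof -
  have gi: "0 < g ^ Suc i" using g0 by simp
  show "0 < \<epsilon> i" using Lw gi by (simp add: \<epsilon>_def)
  have "g ^ 1 <= g ^ Suc i" using g by (intro power_increasing) auto
  then have "Lw <= g ^ Suc i" using Lw(2) unfolding power_one_right by (rule order_trans[rotated])
  then have "Lw / g ^ Suc i <= 1" by (simp only: divide_le_eq_1_pos[OF gi])
  then have "\<epsilon> i <= sqrt 1" unfolding \<epsilon>_def by (rule real_sqrt_le_mono)
  then show "\<epsilon> i <= 4 * B" using B by simp
  have "(\<epsilon> i)\<^sup>2 = Lw / g ^ Suc i" unfolding \<epsilon>_def using Lw gi by (intro real_sqrt_pow2) simp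
  then show "(\<epsilon> i)\<^sup>2 * g ^ Suc i = Lw" using gi g0 by simp
 qed
 have L4: "{\<xi> \<in> space M. Q4 u k i \<xi>} \<in> sets M" "prob {\<xi> \<in> space M. Q4 u k i \<xi>} <= 4 * exp (- Lw / (16 * B\<^sup>2))"
  if u: "u \<in> {1..n}" and k: "k \<in> {1..r}" for u k i
 proof -
  have gi: "0 < g ^ Suc i" using g0 by simp
  show "{\<xi> \<in> space M. Q4 u k i \<xi>} \<in> sets M"
   unfolding Q4_def by (rule layer_event(1)[OF qm[OF k] qB[OF k] B eig[OF k] u \<epsilon>(1,2) gi])
  have "prob {\<xi> \<in> space M. Q4 u k i \<xi>} <= 4 * exp (- (\<epsilon> i)\<^sup>2 * g ^ Suc i / (16 * B\<^sup>2))"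
   unfolding Q4_def by (rule layer_event(2)[OF qm[OF k] qB[OF k] B eig[OF k] u \<epsilon>(1,2) gi])
  also have "- (\<epsilon> i)\<^sup>2 * g ^ Suc i = - Lw" using \<epsilon>(3)[of i] by simp
  finally show "prob {\<xi> \<in> space M. Q4 u k i \<xi>} <= 4 * exp (- Lw / (16 * B\<^sup>2))" .
 qed
 have B4: "{\<xi> \<in> space M. P4 \<xi>} \<in> sets M"
  "prob {\<xi> \<in> space M. P4 \<xi>} <= real (card {1..n}) * (real (card {1..r}) * (real (card {..<t + r'}) * (4 * exp (- Lw / (16 * B\<^sup>2)))))"
  unfolding P4_def by (rule ex3_union_bound[OF finite_atLeastAtMost finite_atLeastAtMost finite_lessThan L4]; assumption)+
 have L5: "{\<xi> \<in> space M. Q5 u v l \<xi>} \<in> sets M"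
  "prob {\<xi> \<in> space M. Q5 u v l \<xi>} <= 2 * exp (thin_prob p * s\<^sup>2 * (real n)\<^sup>2 / m ^ 4 - s * t0)"
  if "u \<in> {1..n}" "v \<in> {1..n}" for u v l
  unfolding Q5_def by (rule bilinear_event[OF that m0 s])+
 have L7: "{\<xi> \<in> space M. Q7 u v \<xi>} \<in> sets M" "prob {\<xi> \<in> space M. Q7 u v \<xi>} <= exp (- p * r0 / 8)"
  if "u \<in> {1..n}" "v \<in> {1..n}" for u v
  unfolding Q7_def R_def by (rule sample_event[OF close_pairs_subset close_pairs_measurable[OF that]])+
 have L8: "{\<xi> \<in> space M. Q8 u v \<xi>} \<in> sets M" "prob {\<xi> \<in> space M. Q8 u v \<xi>} <= 2 * exp (- x\<^sup>2 * N0)"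
  if "u \<in> {1..n}" "v \<in> {1..n}" for u v
  unfolding Q8_def S_def
  by (rule noise_event[where S = "near_set r' w t \<eta> u v", OF near_set_subset near_set_measurable[OF _ that] near_set_upd[OF _ that] x]; assumption)+
 have B5: "{\<xi> \<in> space M. P5 \<xi>} \<in> sets M"
  "prob {\<xi> \<in> space M. P5 \<xi>} <= real (card {1..n}) * (real (card {1..n}) * (real (card {1..r'}) * (2 * exp (thin_prob p * s\<^sup>2 * (real n)\<^sup>2 / m ^ 4 - s * t0))))"
  unfolding P5_def by (rule ex3_union_bound[OF finite_atLeastAtMost finite_atLeastAtMost finite_atLeastAtMost L5]; assumption)+
 have B6: "{\<xi> \<in> space M. P6 \<xi>} \<in> sets M" "prob {\<xi> \<in> space M. P6 \<xi>} <= real K * exp (- real n / (4 * real K))"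
  unfolding P6_def by (rule coverage_event[OF K])+
 have B7: "{\<xi> \<in> space M. P7 \<xi>} \<in> sets M"
  "prob {\<xi> \<in> space M. P7 \<xi>} <= real (card {1..n}) * (real (card {1..n}) * exp (- p * r0 / 8))"
  unfolding P7_def by (rule ex2_union_bound[OF finite_atLeastAtMost finite_atLeastAtMost L7]; assumption)+
 have B8: "{\<xi> \<in> space M. P8 \<xi>} \<in> sets M"
  "prob {\<xi> \<in> space M. P8 \<xi>} <= real (card {1..n}) * (real (card {1..n}) * (2 * exp (- x\<^sup>2 * N0)))"
  unfolding P8_def by (rule ex2_union_bound[OF finite_atLeastAtMost finite_atLeastAtMost L8]; assumption)+
 define Bad where "Bad = {\<xi> \<in> space M. P1 \<xi> \<or> P2 \<xi> \<or> P3 \<xi> \<or> P4 \<xi> \<or> P5 \<xi> \<or> P6 \<xi> \<or> P7 \<xi> \<or> P8 \<xi>}"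
 note U = prob_disj[OF B1 prob_disj[OF B2 prob_disj[OF B3 prob_disj[OF B4 prob_disj[OF B5 prob_disj[OF B6 prob_disj[OF B7 B8]]]]]]]
 have Bm: "Bad \<in> sets M" unfolding Bad_def by (rule U(1))
 have "prob Bad <= failure_prob r' t m K3 Lw s t0 x K"
  using U(2) unfolding Bad_def[symmetric] by (simp add: failure_prob_def N0_def r0_def algebra_simps)
 moreover have "\<bar>nn_estimate n X (d_hat n p X r' w t \<xi>) \<eta> \<xi> u v - Fmat f X \<xi> u v\<bar> <= 2 * x + 2 * (real r * B) * sqrt (2 * \<eta>)"
  if \<xi>B: "\<xi> \<in> space M - Bad" and u: "u \<in> {1..n}" and v: "v \<in> {1..n}" for \<xi> u v
 proof -
  have \<xi>: "\<xi> \<in> space M" and good: "\<not> P1 \<xi>" "\<not> P2 \<xi>" "\<not> P3 \<xi>" "\<not> P4 \<xi>" "\<not> P5 \<xi>" "\<not> P6 \<xi>" "\<not> P7 \<xi>" "\<not> P8 \<xi>"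
   using \<xi>B by (simp_all add: Bad_def)
  have deg: "real (card {j. (i, j) \<in> ?E \<xi>}) <= 0.275 * real n * p" if "i \<in> {1..n}" for i
   using good(1) that unfolding P1_def by force
  have ex: "real n * p * real (card A) / 10 <= real (card (out_nbrs (?E \<xi>) A))"
   if "A \<subseteq> {1..n}" "A \<noteq> {}" "p * real (card A) <= 0.08" for A
   using good(2) that unfolding P2_def by force
  have grow: "g ^ i <= real (card (sphere (?E \<xi>) u' i))" if "u' \<in> {1..n}" "i <= t + r'" for u' i
   by (rule sphere_growth[OF part_edges_subset that(1) deg ex D size g]) (use that in auto)
  have big: "m <= real (card (sphere (?E \<xi>) u' (t + l)))" if "u' \<in> {1..n}" "l <= r'" for u' l
  proof -
   have "m <= g ^ (t + l)" unfolding m_def using g by (intro power_increasing) auto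
   also have "... <= real (card (sphere (?E \<xi>) u' (t + l)))" using that by (intro grow) auto
   finally show ?thesis .
  qed
  \<comment> \<open>Written as \<open>\<mu> * \<sigma>\<close>, the ratio \<open>1 / sqrt g\<close>
    of successive errors stays at most 1/2 after division by any eigenvalue.\<close>
  have \<mu>\<sigma>: "\<mu> * \<sigma> = 1 / sqrt g" using \<mu>(1) g0 by (simp add: \<sigma>(1))
  have step: "\<bar>layer_avg (q k) (?E \<xi>) (trees \<xi> u') u' (Suc i) (thetas \<xi>) (Zs \<xi>)
    - lam k * layer_avg (q k) (?E \<xi>) (trees \<xi> u') u' i (thetas \<xi>) (Zs \<xi>)\<bar>
    <= (sqrt Lw * (1 + \<Lambda>)) * (\<mu> * \<sigma>) ^ Suc i"
   if u': "u' \<in> {1..n}" and k: "k \<in> {1..r}" and i: "i < t + r'" for u' k i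
  proof -
   have "\<not> Q4 u' k i \<xi>" using good(4) u' k i unfolding P4_def by auto
   moreover have "g ^ Suc i <= real (card (sphere (?E \<xi>) u' (Suc i)))" using i by (intro grow[OF u']) auto
   moreover have "trees \<xi> u' = tree X u' \<xi>" using u' by (simp add: trees_def)
   ultimately have "\<bar>layer_avg (q k) (?E \<xi>) (trees \<xi> u') u' (Suc i) (thetas \<xi>) (Zs \<xi>)
    - lam k * layer_avg (q k) (?E \<xi>) (trees \<xi> u') u' i (thetas \<xi>) (Zs \<xi>)\<bar> <= \<epsilon> i * (1 + \<bar>lam k\<bar>)"
    unfolding Q4_def by simp
   also have "... <= \<epsilon> i * (1 + \<Lambda>)" using \<Lambda>(2)[OF k] \<epsilon>(1)[of i] by (intro mult_left_mono) auto
   also have "\<epsilon> i = sqrt Lw * (\<mu> * \<sigma>) ^ Suc i"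
    unfolding \<epsilon>_def \<mu>\<sigma> by (simp only: real_sqrt_divide real_sqrt_power power_one_over) simp
   finally show ?thesis by (simp only: mult_ac)
  qed
  have bil: "\<bar>bilinear_dev (coinsv \<xi>) (trees \<xi>) u' v' t (t + l) (TZ \<xi>)\<bar> <= t0"
   if "u' \<in> {1..n}" "v' \<in> {1..n}" "l \<in> {1..r'}" for u' v' l
  proof -
   have "\<not> Q5 u' v' l \<xi>" using good(5) that unfolding P5_def by blast
   moreover have "big_layers m (?E \<xi>) u' v' t (t + l)"
    using big[OF that(1), of 0] big[OF that(2), of 0] big[OF that(1), of l] big[OF that(2), of l] that(3)
    unfolding big_layers_def by simp
   ultimately show ?thesis unfolding Q5_def by simp
  qed
  have \<sigma>0: "0 <= \<sigma>" using \<mu>(1) g0 by (simp add: \<sigma>(1))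
  have e0: "0 <= sqrt Lw * (1 + \<Lambda>)" using Lw \<Lambda> by simp
  have K3': "real (card (ind_edges n (coinsv \<xi>))) <= K3" using good(3) unfolding P3_def by simp
  have est: "\<bar>dist_est r' w t (coinsv \<xi>) (trees \<xi>) (Zs \<xi>) u' v' - ldist (thetas \<xi> u') (thetas \<xi> v')\<bar> <= \<eta> / 2"
   if u': "u' \<in> {1..n}" and v': "v' \<in> {1..n}" for u' v'
  proof (rule order_trans[OF _ err])
   show "\<bar>dist_est r' w t (coinsv \<xi>) (trees \<xi>) (Zs \<xi>) u' v' - ldist (thetas \<xi> u') (thetas \<xi> v')\<bar> \<le>
    real r * \<Lambda>\<^sup>2 * (2 * d1 * (4 * B + 2 * d1))
   + real r' * Zb * (real r * (\<Lambda> ^ (2 * t + r' + 1) * ((2 * B + 2 * d1) * (2 * d2))))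
   + real r' * Zb * (t0 / thin_prob p + real n * (0.275 * real n * p) / m\<^sup>2 + K3 / (thin_prob p * m\<^sup>2))"
    unfolding d1_def d2_def
    by (rule dist_est_error[OF \<xi> u' v' step \<sigma>0 \<sigma>(2) e0 w r'_def[THEN meta_eq_to_obj_eq] Zb m0 big[OF u'] big[OF v'] bil[OF u' v'] K3' deg])
  qed
  show ?thesis
  proof (rule nn_estimate_error[OF \<xi> u v K \<eta> est small])
   fix i assume "i < K"
   then show "real n / (4 * real K) <= real (card {u \<in> {1..n}. theta X u \<xi> \<in> {real i / real K..real (Suc i) / real K}})"
    using good(6) unfolding P6_def by force
  next
   assume "(real n / (4 * real K))\<^sup>2 <= real (card (close_pairs u v (1 / real K) (thetas \<xi>)))"
   moreover have "\<not> Q7 u v \<xi>" using good(7) u v unfolding P7_def by blast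
   ultimately show "p * real (card (close_pairs u v (1 / real K) (thetas \<xi>))) / 8
     <= real (card (part_edges n Part3 (coinsv \<xi>) \<inter> close_pairs u v (1 / real K) (thetas \<xi>)))"
    unfolding Q7_def R_def r0_def by simp
  next
   assume "p * (real n / (4 * real K))\<^sup>2 / 8 <= real (card (near_set r' w t \<eta> u v (coinsv \<xi>) (trees \<xi>) (Zs \<xi>)))"
   moreover have "\<not> Q8 u v \<xi>" using good(8) u v unfolding P8_def by blast
   ultimately show "\<bar>\<Sum>e\<in>near_set r' w t \<eta> u v (coinsv \<xi>) (trees \<xi>) (Zs \<xi>). Zs \<xi> e - Fv e (thetas \<xi>)\<bar>
     <= 2 * x * real (card (near_set r' w t \<eta> u v (coinsv \<xi>) (trees \<xi>) (Zs \<xi>)))"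
    unfolding Q8_def S_def N0_def r0_def by simp
  qed
 qed
 ultimately show ?thesis using Bm by blast
qed

lemma Fmat_measurable:
 assumes "u \<in> {1..n}" "v \<in> {1..n}" shows "(%\<xi>. Fmat f X \<xi> u v) \<in> borel_measurable M"
proof -
 have "(%\<xi>. (theta X u \<xi>, theta X v \<xi>)) \<in> measurable M (borel \<Otimes>\<^sub>M borel)" using assms by measurable
 from measurable_compose[OF this f_meas] show ?thesis by (simp add: Fmat_def)
qed

text \<open>The estimate is a finite case distinction over coins and trees, and in each case a
  measurable function of the entries and the fallback value.\<close>

lemma nn_estimate_measurable:
 assumes u: "u \<in> {1..n}" and v: "v \<in> {1..n}"
 shows "(%\<xi>. nn_estimate n X (d_hat n p X r' w t \<xi>) \<eta> \<xi> u v) \<in> borel_measurable M"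
proof -
 let ?S = "%c \<tau> z. near_set r' w t \<eta> u v c \<tau> z"
 define H where "H c \<tau> pt = (\<Sum>e\<in>?S c \<tau> (snd pt). snd pt e) / real (card (?S c \<tau> (snd pt)))" for c \<tau> and pt :: "(nat => real) \<times> (nat \<times> nat => real)"
 have mem: "Measurable.pred LZ (%pt. e \<in> ?S c \<tau> (snd pt))" if "valid_trees c \<tau>" for c \<tau> e
  by (rule measurable_compose[OF measurable_snd near_set_measurable[OF that u v]])
 have Hm: "H c \<tau> \<in> borel_measurable LZ" if V: "valid_trees c \<tau>" for c \<tau>
 proof -
  note [measurable] = mem[OF V]
  have zm [measurable]: "(%pt. snd pt e) \<in> borel_measurable LZ" if "e \<in> part_edges n Part3 c" for e
  proof -
   have "e \<in> pairs n" using that part_edges_subset by blast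
   then show ?thesis unfolding Z_space_def
    by (intro measurable_compose[OF measurable_snd]) (rule measurable_component_singleton)
  qed
  have sumS: "(\<Sum>e\<in>?S c \<tau> z. h e) = (\<Sum>e\<in>part_edges n Part3 c. of_bool (e \<in> ?S c \<tau> z) * h e)" for z and h :: "nat \<times> nat => real"
   using near_set_subset by (intro sum.mono_neutral_cong_left) auto
  have "H c \<tau> pt = (\<Sum>e\<in>part_edges n Part3 c. of_bool (e \<in> ?S c \<tau> (snd pt)) * snd pt e)
    / (\<Sum>e\<in>part_edges n Part3 c. of_bool (e \<in> ?S c \<tau> (snd pt)) * 1)" for pt
   unfolding H_def sumS[symmetric] by simp
  then have "H c \<tau> = (%pt. (\<Sum>e\<in>part_edges n Part3 c. of_bool (e \<in> ?S c \<tau> (snd pt)) * snd pt e)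
    / (\<Sum>e\<in>part_edges n Part3 c. of_bool (e \<in> ?S c \<tau> (snd pt)) * 1))" by (rule ext)
  moreover have "(%pt. (\<Sum>e\<in>part_edges n Part3 c. of_bool (e \<in> ?S c \<tau> (snd pt)) * snd pt e)
    / (\<Sum>e\<in>part_edges n Part3 c. of_bool (e \<in> ?S c \<tau> (snd pt)) * (1::real))) \<in> borel_measurable LZ"
   by (intro borel_measurable_divide borel_measurable_sum borel_measurable_times borel_measurable_const zm) measurable
  ultimately show ?thesis by simp
 qed
 have ev: "{\<xi> \<in> space M. P (coinsv \<xi>) (trees \<xi>) (TZ \<xi>)} \<in> sets M"
  if "\<And>c \<tau>. valid_trees c \<tau> ==> Measurable.pred LZ (P c \<tau>)" for P
 proof -
  have "{\<xi> \<in> space M. valid_trees (coinsv \<xi>) (trees \<xi>) \<and> P (coinsv \<xi>) (trees \<xi>) (TZ \<xi>)} \<in> sets M"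
   by (rule joint_event[where P = "%c \<tau> x. valid_trees c \<tau> \<and> P c \<tau> x"]) (use that in auto)
  also have "{\<xi> \<in> space M. valid_trees (coinsv \<xi>) (trees \<xi>) \<and> P (coinsv \<xi>) (trees \<xi>) (TZ \<xi>)} = {\<xi> \<in> space M. P (coinsv \<xi>) (trees \<xi>) (TZ \<xi>)}"
   using valid_trees_data by auto
  finally show ?thesis .
 qed
 have e1: "{\<xi> \<in> space M. ?S (coinsv \<xi>) (trees \<xi>) (Zs \<xi>) = {}} \<in> sets M"
 proof -
  have "{\<xi> \<in> space M. ?S (coinsv \<xi>) (trees \<xi>) (snd (TZ \<xi>)) = {}} \<in> sets M"
  proof (rule ev[of "%c \<tau> pt. ?S c \<tau> (snd pt) = {}"])
   fix c \<tau> assume V: "valid_trees c \<tau>"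
   note [measurable] = mem[OF V]
   have "(%pt :: (nat => real) \<times> (nat \<times> nat => real). ?S c \<tau> (snd pt) = {}) = (%pt. \<forall>e\<in>part_edges n Part3 c. e \<notin> ?S c \<tau> (snd pt))"
    using near_set_subset by (intro ext) blast
   moreover have "Measurable.pred LZ (%pt. \<forall>e\<in>part_edges n Part3 c. e \<notin> ?S c \<tau> (snd pt))" by measurable
   ultimately show "Measurable.pred LZ (%pt. ?S c \<tau> (snd pt) = {})" by (simp only:)
  qed
  then show ?thesis by (simp add: TZ_def)
 qed
 have e2: "(%\<xi>. H (coinsv \<xi>) (trees \<xi>) (TZ \<xi>)) \<in> borel_measurable M"
 proof (rule measurableI)
  fix A :: "real set" assume A: "A \<in> sets borel"
  have "{\<xi> \<in> space M. H (coinsv \<xi>) (trees \<xi>) (TZ \<xi>) \<in> A} \<in> sets M"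
   by (rule ev[of "%c \<tau> pt. H c \<tau> pt \<in> A"]) (intro measurable_compose[OF Hm], use A in auto)
  then show "(%\<xi>. H (coinsv \<xi>) (trees \<xi>) (TZ \<xi>)) -` A \<inter> space M \<in> sets M"
   by (simp add: vimage_def Int_def conj_commute)
 qed simp
 have fb: "fallback X u v \<in> borel_measurable M" using model u v by (simp add: icf_model_def M_def)
 have "(%\<xi>. if ?S (coinsv \<xi>) (trees \<xi>) (Zs \<xi>) = {} then fallback X u v \<xi> else H (coinsv \<xi>) (trees \<xi>) (TZ \<xi>)) \<in> borel_measurable M"
  by (rule measurable_If[OF fb e2 e1])
 moreover have "nn_estimate n X (d_hat n p X r' w t \<xi>) \<eta> \<xi> u v
   = (if ?S (coinsv \<xi>) (trees \<xi>) (Zs \<xi>) = {} then fallback X u v \<xi> else H (coinsv \<xi>) (trees \<xi>) (TZ \<xi>))"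
  if \<xi>: "\<xi> \<in> space M" for \<xi>
  unfolding nn_estimate_near_set[OF u v \<xi>] H_def TZ_def by simp
 ultimately show ?thesis by (subst measurable_cong) auto
qed

lemma nn_estimate_range:
 assumes u: "u \<in> {1..n}" and v: "v \<in> {1..n}" and \<xi>: "\<xi> \<in> space M"
 shows "nn_estimate n X (d_hat n p X r' w t \<xi>) \<eta> \<xi> u v \<in> {0..1}"
proof -
 let ?S = "near_set r' w t \<eta> u v (coinsv \<xi>) (trees \<xi>) (Zs \<xi>)"
 have "fallback X u v \<in> space M \<rightarrow> {0..1}" using model u v unfolding icf_model_def M_def by blast
 then have "fallback X u v \<xi> \<in> {0..1}" using \<xi> by blast
 moreover have z: "Zs \<xi> e \<in> {0..1}" if "e \<in> ?S" for e
 proof -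
  have "e \<in> pairs n" using that near_set_subset part_edges_subset by blast
  then show ?thesis using Z_range[OF _ \<xi>] by (simp add: Z_vec_def)
 qed
 moreover have "(\<Sum>e\<in>?S. Zs \<xi> e) <= real (card ?S) * 1" by (rule sum_bounded_above) (use z in auto)
 moreover have "0 <= (\<Sum>e\<in>?S. Zs \<xi> e)" by (rule sum_nonneg) (use z in auto)
 ultimately show ?thesis unfolding nn_estimate_near_set[OF u v \<xi>]
  by (auto simp: divide_le_eq)
qed

text \<open>Estimate and target lie in [0, 1], so the squared error is at most 1 on the bad event,
  whose probability is simply added.\<close>

lemma MSE_bound:
 fixes r' w t \<eta> b pf
 defines "Fh \<equiv> %\<xi>. nn_estimate n X (d_hat n p X r' w t \<xi>) \<eta> \<xi>"
 assumes Bad: "Bad \<in> sets M" "prob Bad <= pf" and good: "\<forall>\<xi>\<in>space M - Bad. \<forall>u\<in>{1..n}. \<forall>v\<in>{1..n}. \<bar>Fh \<xi> u v - Fmat f X \<xi> u v\<bar> <= b"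
 shows "0 <= MSE n f X Fh" "MSE n f X Fh <= b\<^sup>2 + pf"
  and "1 - pf <= measure (spc X) {\<xi> \<in> space (spc X). Max {\<bar>Fh \<xi> u v - Fmat f X \<xi> u v\<bar> | u v. u \<in> {1..n} \<and> v \<in> {1..n}} <= b}"
proof -
 let ?d = "%\<xi> u v. \<bar>Fh \<xi> u v - Fmat f X \<xi> u v\<bar>"
 have d [measurable]: "(%\<xi>. ?d \<xi> u v) \<in> borel_measurable M" if "u \<in> {1..n}" "v \<in> {1..n}" for u v
  unfolding Fh_def using nn_estimate_measurable[OF that] Fmat_measurable[OF that] by (intro borel_measurable_abs borel_measurable_diff)
 have d1: "?d \<xi> u v <= 1" if "u \<in> {1..n}" "v \<in> {1..n}" "\<xi> \<in> space M" for \<xi> u v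
  using nn_estimate_range[OF that] f01[of "theta X u \<xi>" "theta X v \<xi>"] unfolding Fh_def Fmat_def
  by (smt (verit) atLeastAtMost_iff)
 have pw: "(\<Sum>u=1..n. \<Sum>v=1..n. (Fh \<xi> u v - Fmat f X \<xi> u v)\<^sup>2) <= (real n)\<^sup>2 * (b\<^sup>2 + indicat_real Bad \<xi>)"
  if \<xi>: "\<xi> \<in> space M" for \<xi>
 proof -
  have "(Fh \<xi> u v - Fmat f X \<xi> u v)\<^sup>2 <= b\<^sup>2 + indicat_real Bad \<xi>" if uv: "u \<in> {1..n}" "v \<in> {1..n}" for u v
  proof (cases "\<xi> \<in> Bad")
   case True
   have "\<bar>?d \<xi> u v\<bar>\<^sup>2 <= 1\<^sup>2" using d1[OF uv \<xi>] by (intro power_mono) auto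
   then show ?thesis using True by (simp add: add_increasing)
  next
   case False
   then have "?d \<xi> u v <= b" using good \<xi> uv by blast
   then have "?d \<xi> u v ^ 2 <= b\<^sup>2" by (intro power_mono) auto
   then show ?thesis using False by simp
  qed
  then have "(\<Sum>u=1..n. \<Sum>v=1..n. (Fh \<xi> u v - Fmat f X \<xi> u v)\<^sup>2) <= real (card {1..n}) * (real (card {1..n}) * (b\<^sup>2 + indicat_real Bad \<xi>))"
   by (intro sum_bounded_above)
  then show ?thesis by (simp add: power2_eq_square mult.assoc)
 qed
 show "0 <= MSE n f X Fh" unfolding MSE_def
  by (intro mult_nonneg_nonneg Bochner_Integration.integral_nonneg sum_nonneg) auto
 have "(LINT \<xi>|M. (\<Sum>u=1..n. \<Sum>v=1..n. (Fh \<xi> u v - Fmat f X \<xi> u v)\<^sup>2)) <= (LINT \<xi>|M. (real n)\<^sup>2 * (b\<^sup>2 + indicat_real Bad \<xi>))"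
 proof (rule integral_mono')
  show "integrable M (%\<xi>. (real n)\<^sup>2 * (b\<^sup>2 + indicat_real Bad \<xi>))"
   using Bad(1) by (intro integrable_mult_right Bochner_Integration.integrable_add integrable_real_indicator) (auto simp: emeasure_eq_measure)
 qed (use pw in \<open>auto intro!: sum_nonneg\<close>)
 also have "... = (real n)\<^sup>2 * (b\<^sup>2 + prob Bad)"
 proof -
  have "integrable M (indicat_real Bad)" using Bad(1) by (intro integrable_real_indicator) (auto simp: emeasure_eq_measure)
  then show ?thesis using Bad(1) by (simp add: prob_space)
 qed
 also have "... <= (real n)\<^sup>2 * (b\<^sup>2 + pf)" using Bad(2) by (intro mult_left_mono) auto
 finally show "MSE n f X Fh <= b\<^sup>2 + pf" unfolding MSE_def M_def[symmetric] using n_pos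
  by (simp add: divide_le_eq mult.commute)
 let ?Q = "{\<xi> \<in> space M. \<forall>u\<in>{1..n}. \<forall>v\<in>{1..n}. ?d \<xi> u v <= b}"
 have Q: "?Q \<in> sets M" by measurable
 have "{\<xi> \<in> space M. Max {?d \<xi> u v | u v. u \<in> {1..n} \<and> v \<in> {1..n}} <= b} = ?Q"
 proof -
  have gen: "{h u v | u v. u \<in> I \<and> v \<in> J} = (%(u, v). h u v) ` (I \<times> J)" for h :: "nat => nat => real" and I J
   by auto
  have "Max {?d \<xi> u v | u v. u \<in> {1..n} \<and> v \<in> {1..n}} <= b \<longleftrightarrow> (\<forall>u\<in>{1..n}. \<forall>v\<in>{1..n}. ?d \<xi> u v <= b)" for \<xi>
  proof -
   have eq: "{?d \<xi> u v | u v. u \<in> {1..n} \<and> v \<in> {1..n}} = (%(u, v). ?d \<xi> u v) ` pairs n" by (rule gen)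
   have "1 \<in> {1..n}" using n_pos by simp
   then have "pairs n \<noteq> {}" by blast
   then show ?thesis unfolding eq by (subst Max_le_iff) auto
  qed
  then show ?thesis by simp
 qed
 moreover have "1 - prob Bad = prob (space M - Bad)" using prob_compl[OF Bad(1)] by simp
 moreover have "prob (space M - Bad) <= prob ?Q" using good by (intro finite_measure_mono Q) auto
 ultimately show "1 - pf <= measure (spc X) {\<xi> \<in> space (spc X). Max {?d \<xi> u v | u v. u \<in> {1..n} \<and> v \<in> {1..n}} <= b}"
  using Bad(2) unfolding M_def[symmetric] by simp
qed

end

section \<open>Asymptotics\<close>

context
 fixes \<kappa> \<rho> :: real
 assumes \<kappa>: "0 < \<kappa>" and \<rho>: "0 < \<rho>" "\<rho> < \<kappa>"
begin

text \<open>The depth is o(ln n). Hence a constant to the power \<open>t\<close> is n^o(1), which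
  tames the weights, and the number of layers costs at most a factor ln n.\<close>

lemma tree_depth_asymp:
 "(%n. (ln (0.08 / (ln (real n) powr (1 + \<kappa>) / real n)) / ln (0.275 * ln (real n) powr (1 + \<kappa>)) + c) / ln (real n)) \<longlonglongrightarrow> 0"
 using \<kappa> by real_asymp

text \<open>The lower growth rate np/10 - 2 and the rate 0.275 np that fixes the depth have
  asymptotically equal logarithms, so the layers reach size n^(1 - o(1)).\<close>

lemma layer_size_asymp:
 "(%n. (ln (0.08 / (ln (real n) powr (1 + \<kappa>) / real n)) / ln (0.275 * ln (real n) powr (1 + \<kappa>)) - c)
  * ln (ln (real n) powr (1 + \<kappa>) / 10 - 2) / ln (real n)) \<longlonglongrightarrow> 1"
 using \<kappa> by real_asymp

lemma depth_at_top:
 "filterlim (%n. ln (0.08 / (ln (real n) powr (1 + \<kappa>) / real n)) / ln (0.275 * ln (real n) powr (1 + \<kappa>))) at_top sequentially"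
 using \<kappa> by real_asymp

text \<open>The numerator has exponent \<open>(\<rho> / 2 - \<kappa>) / 2\<close>, which is below
  \<open>- (\<kappa> - \<rho>) / 2\<close> by \<open>\<rho> / 4\<close>; this gap is the room left
  by the exponent \<open>1 + \<rho> / 2\<close>.\<close>

lemma step_error_asymp:
 "(%n. sqrt (ln (real n) powr (1 + \<rho> / 2)) * (1 / sqrt (ln (real n) powr (1 + \<kappa>) / 10 - 2)) / ln (real n) powr (- (1 / 2) * (\<kappa> - \<rho>))) \<longlonglongrightarrow> 0"
proof -
 have "(%n. ln (real n) powr (1 + \<rho> / 2) * (1 / (ln (real n) powr (1 + \<kappa>) / 10 - 2)) / ln (real n) powr (- (\<kappa> - \<rho>))) \<longlonglongrightarrow> 0"
  using \<kappa> \<rho> by real_asymp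
 from tendsto_real_sqrt[OF this]
 have "(%n. sqrt (ln (real n) powr (1 + \<rho> / 2)) * (1 / sqrt (ln (real n) powr (1 + \<kappa>) / 10 - 2)) / sqrt (ln (real n) powr (- (\<kappa> - \<rho>)))) \<longlonglongrightarrow> 0"
  by (simp add: real_sqrt_mult real_sqrt_divide)
 moreover have "sqrt (ln (real n) powr (- (\<kappa> - \<rho>))) = ln (real n) powr (- (1 / 2) * (\<kappa> - \<rho>))" for n
 proof -
  have "sqrt (ln (real n) powr a) = ln (real n) powr (a * (1 / 2))" for a
   by (simp add: powr_half_sqrt[symmetric] powr_powr)
  moreover have "- (1 / 2) * (\<kappa> - \<rho>) = - (\<kappa> - \<rho>) * (1 / 2)" by linarith
  ultimately show ?thesis by presburger
 qed
 ultimately show ?thesis by (simp only:)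
qed

lemma power_error_asymp:
 "(%n. real n powr (- 2 / 5) / ln (real n) powr (- (1 / 2) * (\<kappa> - \<rho>))) \<longlonglongrightarrow> 0"
 "(%n. real n powr (1 / 20) * (real n powr (- 1 / 5) + 0.275 * ln (real n) powr (1 + \<kappa>) * real n powr (- 4 / 5) + 4 * real n powr (- 11 / 20))
   / ln (real n) powr (- (1 / 2) * (\<kappa> - \<rho>))) \<longlonglongrightarrow> 0"
 "(%n. (1 / ln (real n) powr \<kappa>)\<^sup>2 / ln (real n) powr (- (1 / 2) * (\<kappa> - \<rho>))) \<longlonglongrightarrow> 0"
 using \<kappa> \<rho> by real_asymp+

lemma failure_asymp1:
 "(%n. real n * exp (- (ln (real n) powr (1 + \<kappa>)) / 2000) / ln (real n) powr (- (1 / 2) * (\<kappa> - \<rho>))) \<longlonglongrightarrow> 0"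
 using \<kappa> \<rho> by real_asymp

lemma failure_asymp2:
 "(%n. (exp (real n * exp (- (ln (real n) powr (1 + \<kappa>)) / 50)) - 1) / ln (real n) powr (- (1 / 2) * (\<kappa> - \<rho>))) \<longlonglongrightarrow> 0"
 using \<kappa> \<rho> by real_asymp

lemma failure_asymp3:
 "(%n. (ln (real n) powr (1 + \<kappa>))\<^sup>2 / real n powr (1 / 4) / ln (real n) powr (- (1 / 2) * (\<kappa> - \<rho>))) \<longlonglongrightarrow> 0"
 using \<kappa> \<rho> by real_asymp

text \<open>An exponent above 1 makes the exponential smaller than every power of n, which pays for
  the union over vertices and layers.\<close>

lemma failure_asymp4:
 assumes "0 < b"
 shows "(%n. real n * (ln (real n) * exp (- (ln (real n) powr (1 + \<rho> / 2)) / b)) / ln (real n) powr (- (1 / 2) * (\<kappa> - \<rho>))) \<longlonglongrightarrow> 0"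
 using \<kappa> \<rho> assms by real_asymp

lemma failure_asymp5:
 "(%n. real n * (real n * exp (ln (real n) powr (1 + \<kappa>) - ln (real n) powr (1 + \<kappa>) * real n powr (1 / 10) / 4))
  / ln (real n) powr (- (1 / 2) * (\<kappa> - \<rho>))) \<longlonglongrightarrow> 0"
 using \<kappa> \<rho> by real_asymp

lemma failure_asymp6:
 "(%n. (ln (real n) powr \<kappa> + 1) * exp (- real n / (4 * (ln (real n) powr \<kappa> + 1)))
  / ln (real n) powr (- (1 / 2) * (\<kappa> - \<rho>))) \<longlonglongrightarrow> 0"
 using \<kappa> \<rho> by real_asymp

lemma failure_asymp7:
 "(%n. real n * (real n * exp (- (ln (real n) powr (- (1 / 2) * (\<kappa> - \<rho>)) * (ln (real n) powr (1 + \<kappa>) / real n) * (real n / (4 * (ln (real n) powr \<kappa> + 1)))\<^sup>2 / 8)))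
  / ln (real n) powr (- (1 / 2) * (\<kappa> - \<rho>))) \<longlonglongrightarrow> 0"
 using \<kappa> \<rho> by real_asymp

lemma scale_asymp:
 "filterlim (%n. ln (real n) powr (1 + \<kappa>)) at_top sequentially"
 "(%n. ln (real n) powr (1 + \<kappa>) / real n) \<longlonglongrightarrow> 0"
 "(%n. ln (real n) powr (- (1 / 4) * (\<kappa> - \<rho>))) \<longlonglongrightarrow> 0"
 "(%n. ln (real n) powr (1 + \<rho> / 2) / (ln (real n) powr (1 + \<kappa>) / 10 - 2)) \<longlonglongrightarrow> 0"
 using \<kappa> \<rho> by real_asymp+

end

text \<open>Bounds \<open>failure_prob\<close> under the parameter choices below. The factor 3 joins
  the terms for sample size and noise, which receive a common exponent.\<close>

definition log_failure :: "real => real => real => nat => nat => nat => real" where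
 "log_failure \<kappa> \<rho> b r r' n = (let ell = ln (real n); G = ell powr (1 + \<kappa>); D = ell powr (- (1 / 2) * (\<kappa> - \<rho>)); K = ell powr \<kappa> + 1 in
  real n * exp (- G / 2000) + (exp (real n * exp (- G / 50)) - 1) + G\<^sup>2 / real n powr (1 / 4)
  + 4 * real r * (real n * (ell * exp (- (ell powr (1 + \<rho> / 2)) / b)))
  + 2 * real r' * (real n * (real n * exp (G - G * real n powr (1 / 10) / 4)))
  + K * exp (- real n / (4 * K))
  + 3 * (real n * (real n * exp (- (D * (G / real n) * (real n / (4 * K))\<^sup>2 / 8)))))"

context rank_instance
begin

text \<open>All free parameters are fixed as powers of n and ln n. The numerical hypotheses are
  inequalities that hold for all large \<open>n\<close>, which keeps limits out of this
  argument.\<close>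

theorem uniform_error_log:
 fixes \<kappa> \<rho> C c1 \<eta> :: real and t r' :: nat and w :: "nat => real"
 defines "ell \<equiv> ln (real n)"
 defines "G \<equiv> ell powr (1 + \<kappa>)" and "D \<equiv> ell powr (- (1 / 2) * (\<kappa> - \<rho>))"
 defines "g \<equiv> G / 10 - 2" and "T \<equiv> ln (0.08 / (G / real n)) / ln (0.275 * G)"
 defines "d1 \<equiv> 2 * (sqrt (ell powr (1 + \<rho> / 2)) * (1 + \<Lambda>)) * (1 / (\<mu> * sqrt g))"
 assumes r': "r' = num_distinct r lam" and p: "p = G / real n" and t: "t = nat \<lceil>T - real r'\<rceil>"
  and w: "solves_weights r lam t w" and C: "0 <= C" "\<And>l. l \<in> {1..r'} ==> \<bar>w l\<bar> <= C * (1 / \<mu>) ^ (2 * t)"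
  and \<mu>1: "\<mu> <= 1" and \<kappa>: "0 < \<kappa>" and \<rho>: "\<rho> < \<kappa>" and c1: "0 < c1" and \<eta>: "c1 * D <= \<eta>"
  and ell: "1 <= ell" and g: "2 <= g" and G: "1 < 0.275 * G" and T: "real r' < T"
  and t1: "(T + (1 + real r')) <= ell" and t2: "(T + 1) * ln (\<Lambda>\<^sup>2 / \<mu> ^ 3) <= ell / 20" and t3: "0.9 * ell <= (T - real r') * ln g"
  and Lw: "ell powr (1 + \<rho> / 2) <= g" and \<sigma>: "1 / (\<mu> * sqrt g) <= 1 / 2" and d1: "d1 <= 1"
  and e1: "real r * \<Lambda>\<^sup>2 * (2 * d1 * (4 * B + 2)) <= c1 / 8 * D"
  and e2: "real r' * real r * C * \<Lambda> ^ (r' + 1) * (2 * B + 2) * 2 * real n powr (- 2 / 5) <= c1 / 8 * D"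
  and e3: "real r' * C * (real n powr (1 / 20) * (real n powr (- 1 / 5) + 0.275 * G * real n powr (- 4 / 5) + 4 * real n powr (- 11 / 20))) <= c1 / 8 * D"
  and e4: "real r * (B * L)\<^sup>2 * (1 / ell powr \<kappa>)\<^sup>2 < c1 / 2 * D"
 shows "\<exists>Bad\<in>sets M. prob Bad <= log_failure \<kappa> \<rho> (16 * B\<^sup>2) r r' n \<and>
  (\<forall>\<xi>\<in>space M - Bad. \<forall>u\<in>{1..n}. \<forall>v\<in>{1..n}.
    \<bar>nn_estimate n X (d_hat n p X r' w t \<xi>) \<eta> \<xi> u v - Fmat f X \<xi> u v\<bar>
     <= 2 * ell powr (- (1 / 4) * (\<kappa> - \<rho>)) + 2 * (real r * B) * sqrt (2 * \<eta>))"
proof -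
 define N where "N = real n"
 have N: "0 < N" using n_pos by (simp add: N_def)
 have npG: "N * p = G" unfolding p N_def using n_pos by simp
 have G0: "0 < G" using less_trans[OF zero_less_one G] by (simp add: zero_less_mult_iff)
 have g0: "0 < g" using g by simp
 have ell_N: "ell = ln N" by (simp add: ell_def N_def)
 have Npw: "N powr a = exp (a * ell)" for a using N by (simp add: powr_def ell_N)
 have Nadd: "N powr a * N powr b = N powr (a + b)" for a b by (simp add: powr_add)
 have tb: "T - real r' <= real t" "real t < T - real r' + 1" "1 <= t"
  unfolding t using T by linarith+
 have D0: "0 < D" unfolding D_def using ell by simp
 have D1: "D <= 1"
 proof -
  have "D <= ell powr 0" unfolding D_def using ell \<rho> by (intro powr_mono) auto
  then show ?thesis using ell by simp
 qed
 have \<eta>0: "0 < \<eta>" using \<eta> c1 D0 by (meson less_le_trans mult_pos_pos)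
 define m where "m = g ^ t"
 have m0: "0 < m" using g0 by (simp add: m_def)
 \<comment> \<open>Collects the factors exponential in the depth: \<open>1 / \<mu>\<^sup>2\<close>
   from the weights, \<open>\<Lambda>\<^sup>2\<close> from the two layer averages, and
   \<open>1 / \<mu>\<close> from the accumulated error \<open>\<sigma> ^ t\<close>.\<close>
 define A where "A = \<Lambda>\<^sup>2 / \<mu> ^ 3"
 have \<mu>3: "0 < \<mu> ^ 3" "\<mu> ^ 3 <= 1" using \<mu>(1) \<mu>1 by (auto intro: power_le_one)
 have A1: "1 <= A" unfolding A_def using \<mu>3 \<Lambda> by (simp add: le_divide_eq) (meson one_le_power order_trans)
 have pw: "a ^ k = exp (real k * ln a)" if "0 < a" for a :: real and k
  using that by (simp add: exp_of_nat_mult)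
 have At: "A ^ t <= N powr (1 / 20)"
 proof -
  have "real t * ln A <= (T + 1) * ln A" using tb A1 by (intro mult_right_mono) auto
  also have "... <= ell / 20" using t2 by (simp add: A_def)
  finally show ?thesis using A1 by (simp add: pw Npw)
 qed
 have mN: "N powr (9 / 10) <= m"
 proof -
  have "(T - real r') * ln g <= real t * ln g" using tb g by (intro mult_right_mono) auto
  then have "9 / 10 * ell <= real t * ln g" using t3 by simp
  then show ?thesis unfolding m_def pw[OF g0] Npw by simp
 qed
 \<comment> \<open>The depth is chosen for this: \<open>0.275 * G\<close> to the power
   \<open>T\<close> is \<open>0.08 / p\<close>, and \<open>t + r' - 1\<close> is at most
   \<open>T\<close>.\<close>
 have size: "p * (0.275 * real n * p) ^ (t + r' - 1) <= 0.08"
 proof -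
  have eq: "0.275 * real n * p = 0.275 * G" using npG by (simp add: N_def mult.assoc)
  have l0: "0 < ln (0.275 * G)" using G by simp
  have "real (t + r' - 1) <= T" using tb by (simp add: of_nat_diff)
  then have "real (t + r' - 1) * ln (0.275 * G) <= T * ln (0.275 * G)" using l0 by (intro mult_right_mono) auto
  also have "... = ln (0.08 / p)" unfolding T_def p using l0 by simp
  finally have "(0.275 * G) ^ (t + r' - 1) <= exp (ln (0.08 / p))" using G by (subst pw) auto
  then have "(0.275 * G) ^ (t + r' - 1) <= 0.08 / p" using p_pos by simp
  then show ?thesis unfolding eq using p_pos by (simp add: field_simps)
 qed
 define Lw where "Lw = ell powr (1 + \<rho> / 2)"
 define \<sigma> where "\<sigma> = 1 / (\<mu> * sqrt g)"
 define Zb where "Zb = C * (1 / \<mu>) ^ (2 * t)"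
 \<comment> \<open>Bins of width about (ln n)^(-kappa) make the squared distance within a bin
   negligible against the threshold.\<close>
 define K where "K = nat \<lceil>ell powr \<kappa>\<rceil>"
 define Kb where "Kb = ell powr \<kappa> + 1"
 \<comment> \<open>The exponents fit the layer size \<open>m\<close>, at least
   \<open>N powr (9 / 10)\<close>: \<open>s\<close> is below \<open>m\<^sup>2\<close>, the variance
   term is at most \<open>G\<close>, and \<open>s * t0\<close> is at least
   \<open>G * N powr (1 / 10) / 4\<close>, while \<open>t0 / thin_prob p = N powr (- 1 / 5)\<close>
   still beats the weights, which are at most \<open>C * N powr (1 / 20)\<close>. The mean number of
   thinned pairs is at most \<open>G\<^sup>2\<close>, far below \<open>K3\<close>.\<close>
 define s where "s = N powr (13 / 10)"
 define t0 where "t0 = thin_prob p * N powr (- 1 / 5)"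
 define K3 where "K3 = N powr (1 / 4)"
 define x where "x = ell powr (- (1 / 4) * (\<kappa> - \<rho>))"
 have tp: "0 < thin_prob p" "thin_prob p <= p" "p / 4 <= thin_prob p" using thin_bounds by auto
 have lk: "1 <= ell powr \<kappa>" using ell \<kappa> by (simp add: ge_one_powr_ge_zero)
 have K: "0 < K" "ell powr \<kappa> <= real K" "real K <= Kb" using lk unfolding K_def Kb_def by linarith+
 have x2: "x\<^sup>2 = D" unfolding x_def D_def power2_eq_square powr_add[symmetric] by (rule arg_cong[of _ _ "%a. ell powr a"]) simp
 have x01: "0 < x" "x <= 1"
 proof -
  show "0 < x" unfolding x_def using ell by simp
  have "x <= ell powr 0" unfolding x_def using ell \<rho> by (intro powr_mono) auto
  then show "x <= 1" using ell by simp
 qed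
 have s: "0 < s" "s <= m\<^sup>2"
 proof -
  show "0 < s" using N by (simp add: s_def)
  have "1 <= N" using n_pos by (simp add: N_def)
  then have "s <= N powr (9 / 10 + 9 / 10)" unfolding s_def by (intro powr_mono) auto
  also have "... = (N powr (9 / 10))\<^sup>2" by (simp only: powr_add power2_eq_square)
  also have "... <= m\<^sup>2" using mN by (intro power_mono) auto
  finally show "s <= m\<^sup>2" .
 qed
 have \<sigma>0: "0 < \<sigma>" using \<mu>(1) g0 by (simp add: \<sigma>_def)
 have d1_eq: "d1 = 2 * (sqrt Lw * (1 + \<Lambda>)) * \<sigma>" by (simp add: d1_def Lw_def \<sigma>_def)
 have d10: "0 <= d1" unfolding d1_eq using \<sigma>0 \<Lambda> by (intro mult_nonneg_nonneg) (auto simp: Lw_def)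
 have Zb0: "0 <= Zb" unfolding Zb_def using C \<mu> by simp
 have Zt: "Zb * \<Lambda> ^ (2 * t) * (1 / \<mu>) ^ t = C * A ^ t"
 proof -
  have "(1 / \<mu>) ^ (2 * t) * \<Lambda> ^ (2 * t) * (1 / \<mu>) ^ t = ((1 / \<mu>)\<^sup>2) ^ t * (\<Lambda>\<^sup>2) ^ t * (1 / \<mu>) ^ t"
   by (simp only: power_mult)
  also have "... = ((1 / \<mu>)\<^sup>2 * \<Lambda>\<^sup>2 * (1 / \<mu>)) ^ t" by (simp only: power_mult_distrib)
  also have "(1 / \<mu>)\<^sup>2 * \<Lambda>\<^sup>2 * (1 / \<mu>) = A" by (simp add: A_def power2_eq_square power3_eq_cube)
  finally show ?thesis unfolding Zb_def by (simp add: mult.assoc)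
 qed
 have Zb1: "Zb <= C * N powr (1 / 20)"
 proof -
  have "1 * 1 <= \<Lambda> ^ (2 * t) * (1 / \<mu>) ^ t" using \<Lambda> \<mu> \<mu>1 by (intro mult_mono one_le_power) auto
  then have "Zb * 1 <= Zb * (\<Lambda> ^ (2 * t) * (1 / \<mu>) ^ t)" using Zb0 by (intro mult_left_mono) auto
  also have "... = C * A ^ t" using Zt by (simp add: mult.assoc)
  also have "... <= C * N powr (1 / 20)" using At C by (intro mult_left_mono) auto
  finally show ?thesis by simp
 qed
 have sqm: "1 / sqrt m <= N powr (- 9 / 20)"
 proof -
  have "N powr (9 / 20) = sqrt (N powr (9 / 10))" using N by (simp add: powr_half_sqrt[symmetric] powr_powr)
  also have "... <= sqrt m" using mN by (rule real_sqrt_le_mono)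
  finally have "1 / sqrt m <= 1 / N powr (9 / 20)" using N by (intro divide_left_mono) (auto simp: m0)
  then show ?thesis by (simp add: powr_minus_divide)
 qed
 \<comment> \<open>The factor \<open>1 / sqrt m\<close>, produced by the growth of the layers, is
   what beats the exponential factors collected in \<open>A\<close>.\<close>
 have \<sigma>t: "\<sigma> ^ Suc t = \<sigma> * ((1 / \<mu>) ^ t * (1 / sqrt m))"
  unfolding power_Suc \<sigma>_def m_def real_sqrt_power by (simp add: power_mult_distrib power_divide)
 define E2 where "E2 = real r' * Zb * (real r * (\<Lambda> ^ (2 * t + r' + 1) * ((2 * B + 2 * d1) * (2 * (2 * (sqrt Lw * (1 + \<Lambda>)) * \<sigma> ^ Suc t)))))"
 have E2: "E2 <= c1 / 8 * D"
 proof -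
  have "E2 = real r' * real r * \<Lambda> ^ (r' + 1) * (Zb * \<Lambda> ^ (2 * t) * (1 / \<mu>) ^ t) * (2 * B + 2 * d1) * 2 * (2 * (sqrt Lw * (1 + \<Lambda>)) * \<sigma>) * (1 / sqrt m)"
   unfolding E2_def \<sigma>t by (simp only: power_add power_one_right mult_ac)
  also have "... = real r' * real r * \<Lambda> ^ (r' + 1) * (C * A ^ t) * (2 * B + 2 * d1) * 2 * d1 * (1 / sqrt m)"
   unfolding Zt d1_eq ..
  also have "... <= real r' * real r * \<Lambda> ^ (r' + 1) * (C * N powr (1 / 20)) * (2 * B + 2) * 2 * 1 * N powr (- 9 / 20)"
   using C At \<Lambda> B d1 d10 sqm m0 A1 by (intro mult_mono mult_nonneg_nonneg) auto
  also have "... = real r' * real r * C * \<Lambda> ^ (r' + 1) * (2 * B + 2) * 2 * (N powr (1 / 20) * N powr (- 9 / 20))"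
   by (simp only: mult_ac mult_1_left mult_1_right)
  also have "N powr (1 / 20) * N powr (- 9 / 20) = N powr (- 2 / 5)" unfolding Nadd by simp
  also have "real r' * real r * C * \<Lambda> ^ (r' + 1) * (2 * B + 2) * 2 * N powr (- 2 / 5) <= c1 / 8 * D" using e2 by (simp add: N_def)
  finally show ?thesis .
 qed
 have m2: "N powr (9 / 5) <= m\<^sup>2"
 proof -
  have "N powr (9 / 5) = (N powr (9 / 10))\<^sup>2" by (simp add: power2_eq_square Nadd)
  also have "... <= m\<^sup>2" using mN by (intro power_mono) auto
  finally show ?thesis .
 qed
 define E3 where "E3 = real r' * Zb * (t0 / thin_prob p + real n * (0.275 * real n * p) / m\<^sup>2 + K3 / (thin_prob p * m\<^sup>2))"
 have E3: "E3 <= c1 / 8 * D"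
 proof -
  have a: "t0 / thin_prob p = N powr (- 1 / 5)" using tp by (simp add: t0_def)
  have b: "real n * (0.275 * real n * p) / m\<^sup>2 <= 0.275 * G * N powr (- 4 / 5)"
  proof -
   have "real n * (0.275 * real n * p) / m\<^sup>2 = 0.275 * G * (N / m\<^sup>2)" unfolding npG[symmetric] N_def by simp
   also have "... <= 0.275 * G * (N / N powr (9 / 5))" using m2 G0 N by (intro mult_left_mono divide_left_mono) (auto simp: zero_less_mult_iff intro: zero_less_power[OF m0])
   also have "N / N powr (9 / 5) = N powr (- 4 / 5)" using N powr_diff[of N 1 "9 / 5"] by simp
   finally show ?thesis .
  qed
  have c: "K3 / (thin_prob p * m\<^sup>2) <= 4 * N powr (- 11 / 20)"
  proof -
   have "1 / N <= p" unfolding p N_def using G n_pos by (intro divide_right_mono) auto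
   then have "1 / (4 * N) <= thin_prob p" using tp by simp
   then have "(1 / (4 * N)) * N powr (9 / 5) <= thin_prob p * m\<^sup>2" using m2 tp N by (intro mult_mono) auto
   then have "K3 / (thin_prob p * m\<^sup>2) <= K3 / ((1 / (4 * N)) * N powr (9 / 5))"
    using N tp m0 by (intro divide_left_mono) (auto simp: K3_def)
   also have "... = 4 * (N powr (1 / 4) * (N powr 1 / N powr (9 / 5)))" unfolding K3_def using N by simp
   also have "N powr (1 / 4) * (N powr 1 / N powr (9 / 5)) = N powr (- 11 / 20)" unfolding powr_diff[symmetric] Nadd by simp
   finally show ?thesis .
  qed
  have "E3 <= real r' * (C * N powr (1 / 20)) * (N powr (- 1 / 5) + 0.275 * G * N powr (- 4 / 5) + 4 * N powr (- 11 / 20))"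
   unfolding E3_def using a b c Zb1 Zb0 C tp m0 p_pos by (intro mult_mono add_mono mult_nonneg_nonneg add_nonneg_nonneg) (auto simp: K3_def)
  also have "... <= c1 / 8 * D" using e3 by (simp add: N_def mult_ac)
  finally show ?thesis .
 qed
 have E1: "real r * \<Lambda>\<^sup>2 * (2 * d1 * (4 * B + 2 * d1)) <= c1 / 8 * D"
 proof (rule order_trans[OF _ e1])
  show "real r * \<Lambda>\<^sup>2 * (2 * d1 * (4 * B + 2 * d1)) <= real r * \<Lambda>\<^sup>2 * (2 * d1 * (4 * B + 2))"
   using d1 d10 B by (intro mult_left_mono) auto
 qed
 have err: "real r * \<Lambda>\<^sup>2 * (2 * d1 * (4 * B + 2 * d1)) + E2 + E3 <= \<eta> / 2"
 proof -
  have "0 <= c1 * D" using c1 D0 by simp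
  then show ?thesis using E1 E2 E3 \<eta> by linarith
 qed
 have small: "real r * (B * L)\<^sup>2 * (1 / real K)\<^sup>2 < \<eta> / 2"
 proof -
  have "1 / real K <= 1 / ell powr \<kappa>" using K lk by (intro divide_left_mono mult_pos_pos) auto
  then have "(1 / real K)\<^sup>2 <= (1 / ell powr \<kappa>)\<^sup>2" by (intro power_mono) auto
  then have "real r * (B * L)\<^sup>2 * (1 / real K)\<^sup>2 <= real r * (B * L)\<^sup>2 * (1 / ell powr \<kappa>)\<^sup>2" by (intro mult_left_mono) auto
  then show ?thesis using e4 \<eta> by linarith
 qed
 have Lwp: "0 < Lw" "Lw <= g" using Lw ell by (auto simp: Lw_def)
 have gp: "g = real n * p / 10 - 2" using npG by (simp add: g_def N_def)
 have Dg: "1 <= 0.275 * real n * p" using G npG by (simp add: N_def mult.assoc)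
 have "\<exists>Bad\<in>sets M. prob Bad <= failure_prob r' t m K3 Lw s t0 x K \<and>
  (\<forall>\<xi>\<in>space M - Bad. \<forall>u\<in>{1..n}. \<forall>v\<in>{1..n}.
    \<bar>nn_estimate n X (d_hat n p X r' w t \<xi>) \<eta> \<xi> u v - Fmat f X \<xi> u v\<bar> <= 2 * x + 2 * (real r * B) * sqrt (2 * \<eta>))"
  unfolding m_def r'
  by (rule uniform_error_event[OF gp g Dg size[unfolded r'] Lwp \<sigma>_def \<sigma>[folded \<sigma>_def] w C(2)[folded Zb_def, unfolded r'] Zb0
     s[unfolded m_def] _ K(1) x01 \<eta>0 err[unfolded E2_def E3_def d1_eq r' m_def] small])
   (use N in \<open>auto simp: K3_def\<close>)
 moreover have "failure_prob r' t m K3 Lw s t0 x K <= log_failure \<kappa> \<rho> (16 * B\<^sup>2) r r' n"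
 proof -
  define F7 where "F7 = N * (N * exp (- (D * (G / N) * (N / (4 * Kb))\<^sup>2 / 8)))"
  have f1: "real n * exp (- real n * p / 2000) = N * exp (- G / 2000)" using npG by (simp add: N_def)
  have f2: "(1 + exp (- real n * p / 50)) ^ n - 1 <= exp (N * exp (- G / 50)) - 1"
  proof -
   have "(1 + exp (- real n * p / 50)) ^ n <= (exp (exp (- real n * p / 50))) ^ n" by (intro power_mono exp_ge_add_one_self) (simp add: add_nonneg_nonneg)
   also have "... = exp (N * exp (- G / 50))" using npG by (simp add: N_def exp_of_nat_mult)
   finally show ?thesis by simp
  qed
  have f3: "(real n)\<^sup>2 * p\<^sup>2 / K3 = G\<^sup>2 / N powr (1 / 4)" unfolding npG[symmetric] by (simp add: K3_def N_def power_mult_distrib)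
  have f4: "real n * (real r * (real (t + r') * (4 * exp (- Lw / (16 * B\<^sup>2))))) <= 4 * real r * (N * (ell * exp (- Lw / (16 * B\<^sup>2))))"
  proof -
   have "real (t + r') <= ell" using tb t1 by simp
   then have "4 * real r * (N * (real (t + r') * exp (- Lw / (16 * B\<^sup>2)))) <= 4 * real r * (N * (ell * exp (- Lw / (16 * B\<^sup>2))))"
    using N by (intro mult_left_mono mult_right_mono) auto
   then show ?thesis unfolding N_def by (simp only: mult_ac)
  qed
  have f5: "real n * (real n * (real r' * (2 * exp (thin_prob p * s\<^sup>2 * (real n)\<^sup>2 / m ^ 4 - s * t0))))
    <= 2 * real r' * (N * (N * exp (G - G * N powr (1 / 10) / 4)))"
  proof -
   have "thin_prob p * s\<^sup>2 * N\<^sup>2 / m ^ 4 <= G"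
   proof -
    have "s\<^sup>2 * N\<^sup>2 = N powr (13 / 10) * N powr (13 / 10) * (N powr 1 * N powr 1)" unfolding s_def using N by (simp add: power2_eq_square)
    also have "... = N powr (23 / 5)" unfolding Nadd by simp
    finally have sN: "s\<^sup>2 * N\<^sup>2 = N powr (23 / 5)" .
    have "N powr (18 / 5) = (N powr (9 / 5))\<^sup>2" by (simp add: power2_eq_square Nadd)
    also have "... <= (m\<^sup>2)\<^sup>2" using m2 by (intro power_mono) auto
    finally have m4: "N powr (18 / 5) <= m ^ 4" by (simp add: power_mult[symmetric])
    have "thin_prob p * s\<^sup>2 * N\<^sup>2 / m ^ 4 = thin_prob p * N powr (23 / 5) / m ^ 4" using sN by (simp add: mult.assoc)
    also have "... <= p * N powr (23 / 5) / N powr (18 / 5)" using tp m4 N p_pos by (intro frac_le mult_right_mono) auto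
    also have "... = p * N"
    proof -
     have e: "N powr (23 / 5) / N powr (18 / 5) = N" using N powr_diff[of N "23 / 5" "18 / 5"] by simp
     show ?thesis unfolding times_divide_eq_right[symmetric] e ..
    qed
    finally show ?thesis using npG by (simp add: mult.commute)
   qed
   moreover have "G * N powr (1 / 10) / 4 <= s * t0"
   proof -
    have "s * t0 = thin_prob p * (N powr (13 / 10) * N powr (- 1 / 5))" by (simp add: s_def t0_def)
    also have "N powr (13 / 10) * N powr (- 1 / 5) = N powr 1 * N powr (1 / 10)" unfolding Nadd by simp
    also have "N powr 1 = N" using N by simp
    finally have "s * t0 = thin_prob p * (N * N powr (1 / 10))" .
    moreover have "p / 4 * (N * N powr (1 / 10)) <= thin_prob p * (N * N powr (1 / 10))" using tp N by (intro mult_right_mono) auto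
    moreover have "p / 4 * (N * N powr (1 / 10)) = G * N powr (1 / 10) / 4" unfolding npG[symmetric] by simp
    ultimately show ?thesis by linarith
   qed
   ultimately have "exp (thin_prob p * s\<^sup>2 * N\<^sup>2 / m ^ 4 - s * t0) <= exp (G - G * N powr (1 / 10) / 4)" by simp
   then have "2 * real r' * (N * (N * exp (thin_prob p * s\<^sup>2 * N\<^sup>2 / m ^ 4 - s * t0))) <= 2 * real r' * (N * (N * exp (G - G * N powr (1 / 10) / 4)))"
    using N by (intro mult_left_mono) auto
   then show ?thesis unfolding N_def by (simp only: mult_ac)
  qed
  have Kp: "0 < real K" "0 < Kb" using K by auto
  have f6: "real K * exp (- real n / (4 * real K)) <= Kb * exp (- N / (4 * Kb))"
  proof -
   have "N / (4 * Kb) <= N / (4 * real K)" using K N Kp by (intro divide_left_mono) auto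
   then show ?thesis using K Kp by (intro mult_mono) (auto simp: N_def)
  qed
  have N0: "D * (G / N) * (N / (4 * Kb))\<^sup>2 / 8 <= D * (p * (real n / (4 * real K))\<^sup>2 / 8)"
  proof -
   have "N / (4 * Kb) <= N / (4 * real K)" using K N Kp by (intro divide_left_mono) auto
   then have "(N / (4 * Kb))\<^sup>2 <= (N / (4 * real K))\<^sup>2" using N Kp by (intro power_mono) auto
   then have "D * p / 8 * (N / (4 * Kb))\<^sup>2 <= D * p / 8 * (N / (4 * real K))\<^sup>2" using D0 p_pos by (intro mult_left_mono) auto
   then show ?thesis by (simp add: p N_def mult_ac)
  qed
  have f8: "real n * (real n * (2 * exp (- x\<^sup>2 * (p * (real n / (4 * real K))\<^sup>2 / 8)))) <= 2 * F7"
  proof -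
   have "exp (- x\<^sup>2 * (p * (real n / (4 * real K))\<^sup>2 / 8)) <= exp (- (D * (G / N) * (N / (4 * Kb))\<^sup>2 / 8))" using N0 by (simp add: x2)
   then have "N * (N * (2 * exp (- x\<^sup>2 * (p * (real n / (4 * real K))\<^sup>2 / 8)))) <= N * (N * (2 * exp (- (D * (G / N) * (N / (4 * Kb))\<^sup>2 / 8))))"
    using N by (intro mult_left_mono) auto
   then show ?thesis unfolding F7_def by (simp add: N_def)
  qed
  have f7: "real n * (real n * exp (- p * (real n / (4 * real K))\<^sup>2 / 8)) <= F7"
  proof -
   have "D * (p * (real n / (4 * real K))\<^sup>2 / 8) <= 1 * (p * (real n / (4 * real K))\<^sup>2 / 8)" using D1 p_pos by (intro mult_right_mono) auto
   with N0 have "exp (- p * (real n / (4 * real K))\<^sup>2 / 8) <= exp (- (D * (G / N) * (N / (4 * Kb))\<^sup>2 / 8))" by simp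
   then have "N * (N * exp (- p * (real n / (4 * real K))\<^sup>2 / 8)) <= F7" unfolding F7_def using N by (intro mult_left_mono) auto
   then show ?thesis by (simp add: N_def)
  qed
  have "log_failure \<kappa> \<rho> (16 * B\<^sup>2) r r' n = N * exp (- G / 2000) + (exp (N * exp (- G / 50)) - 1) + G\<^sup>2 / N powr (1 / 4)
   + 4 * real r * (N * (ell * exp (- Lw / (16 * B\<^sup>2)))) + 2 * real r' * (N * (N * exp (G - G * N powr (1 / 10) / 4)))
   + Kb * exp (- N / (4 * Kb)) + 3 * F7"
   unfolding log_failure_def Let_def N_def Lw_def F7_def Kb_def G_def D_def ell_def ..
  then show ?thesis unfolding failure_prob_def using f1 f2 f3 f4 f5 f6 f7 f8 by linarith
 qed
 ultimately show ?thesis unfolding x_def by (meson order_trans)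
qed

end

section \<open>Extension of the function and its eigenfunctions to the whole line\<close>

lemma integral_unif01:
 fixes g :: "real => real"
 assumes [measurable]: "g \<in> borel_measurable borel"
 shows "(\<integral>y. g y \<partial>unif01) = (LINT y|lebesgue_on {0..1}. g y)"
proof -
 have u: "unif01 = density lborel (%x. ennreal (indicat_real {0..1} x))"
  unfolding uniform_measure_def by (intro density_cong) (auto simp: indicator_def)
 have "(\<integral>y. g y \<partial>unif01) = (\<integral>y. indicat_real {0..1} y *\<^sub>R g y \<partial>lborel)"
  unfolding u by (rule integral_density) auto
 also have "... = (\<integral>y. indicat_real {0..1} y *\<^sub>R g y \<partial>lebesgue)"
  by (rule integral_completion[symmetric]) auto
 also have "... = (LINT y|lebesgue_on {0..1}. g y)" by (rule integral_restrict_space[symmetric]) auto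
 finally show ?thesis .
qed

text \<open>Orthonormality removes all terms of the rank expansion but one.\<close>

lemma has_rank_eigen:
 assumes rank: "has_rank f r lam q" and k: "k \<in> {1..r}" and a: "a \<in> {0..1}"
 shows "(LINT y|lebesgue_on {0..1}. q k y * f a y) = lam k * q k a"
  and "integrable (lebesgue_on {0..1}) (%y. q k y * f a y)"
proof -
 interpret U: finite_measure "lebesgue_on {0..1::real}" by (rule finite_measure_lebesgue_on) auto
 have fr: "f x y = (\<Sum>j=1..r. lam j * q j x * q j y)" if "x \<in> {0..1}" "y \<in> {0..1}" for x y
  using rank that unfolding has_rank_def by blast
 have qm: "q j \<in> borel_measurable (lebesgue_on {0..1})" if "j \<in> {1..r}" for j
  using rank that unfolding has_rank_def by blast
 have orth: "(LINT x|lebesgue_on {0..1}. q i x * q j x) = (if i = j then 1 else 0)" if "i \<in> {1..r}" "j \<in> {1..r}" for i j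
  using rank that unfolding has_rank_def by blast
 obtain B where B: "\<And>j y. j \<in> {1..r} ==> y \<in> {0..1} ==> \<bar>q j y\<bar> <= B"
  using rank unfolding has_rank_def by blast
 have int: "integrable (lebesgue_on {0..1}) (%y. q i y * q j y)" if ij: "i \<in> {1..r}" "j \<in> {1..r}" for i j
 proof (rule U.integrable_const_bound)
  have "\<bar>q i y\<bar> * \<bar>q j y\<bar> <= B * B" if "y \<in> {0..1}" for y
   using B[OF ij(1) that] B[OF ij(2) that] by (intro mult_mono) auto
  then have "norm (q i y * q j y) <= B * B" if "y \<in> {0..1}" for y using that by (simp add: abs_mult)
  then show "AE y in lebesgue_on {0..1}. norm (q i y * q j y) <= B * B" by (intro AE_I2) simp
 qed (use qm[OF ij(1)] qm[OF ij(2)] in measurable)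
 have eq: "q k y * f a y = (\<Sum>j=1..r. lam j * q j a * (q k y * q j y))" if "y \<in> space (lebesgue_on {0..1})" for y
 proof -
  have "y \<in> {0..1}" using that by simp
  then show ?thesis unfolding fr[OF a \<open>y \<in> {0..1}\<close>] sum_distrib_left by (intro sum.cong refl) (simp only: mult_ac)
 qed
 have "(LINT y|lebesgue_on {0..1}. q k y * f a y) = (LINT y|lebesgue_on {0..1}. (\<Sum>j=1..r. lam j * q j a * (q k y * q j y)))"
  by (rule Bochner_Integration.integral_cong[OF refl eq])
 also have "... = (\<Sum>j=1..r. lam j * q j a * (LINT y|lebesgue_on {0..1}. q k y * q j y))"
  using int[OF k] by (subst Bochner_Integration.integral_sum) auto
 also have "... = (\<Sum>j=1..r. lam j * q j a * (if k = j then 1 else 0))" using orth[OF k] by (intro sum.cong refl) simp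
 also have "... = lam k * q k a" using k by (simp add: if_distrib cong: if_cong)
 finally show "(LINT y|lebesgue_on {0..1}. q k y * f a y) = lam k * q k a" .
 have "integrable (lebesgue_on {0..1}) (%y. \<Sum>j=1..r. lam j * q j a * (q k y * q j y))"
  using int[OF k] by (intro Bochner_Integration.integrable_sum integrable_mult_right) auto
 then show "integrable (lebesgue_on {0..1}) (%y. q k y * f a y)"
  by (subst Bochner_Integration.integrable_cong[OF refl eq])
qed

text \<open>A retraction of the line onto the unit interval. Composition with it extends
  \<open>f\<close> and \<open>q\<close> while preserving bounds and Lipschitz constants.\<close>

definition clamp01 :: "real => real" where "clamp01 x = max 0 (min 1 x)"

lemma clamp01_range [simp]: "clamp01 x \<in> {0..1}" by (simp add: clamp01_def)

lemma clamp01_id: "x \<in> {0..1} ==> clamp01 x = x" by (simp add: clamp01_def)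

lemma clamp01_dist: "\<bar>clamp01 x - clamp01 y\<bar> <= \<bar>x - y\<bar>" by (simp add: clamp01_def)

text \<open>The latent positions lie in the unit interval, so an extension of \<open>f\<close>
  describes the same model.\<close>

lemma icf_model_cong:
 assumes "icf_model n p f X" "\<And>x y. x \<in> {0..1} ==> y \<in> {0..1} ==> f x y = f' x y"
 shows "icf_model n p f' X"
  and "u \<in> {1..n} ==> v \<in> {1..n} ==> \<xi> \<in> space (spc X) ==> Fmat f' X \<xi> u v = Fmat f X \<xi> u v"
proof -
 have th: "theta X u \<xi> \<in> {0..1}" if "u \<in> {1..n}" "\<xi> \<in> space (spc X)" for u \<xi>
  using assms(1) that unfolding icf_model_def latent_model_def Let_def by blast
 show F: "Fmat f' X \<xi> u v = Fmat f X \<xi> u v" if "u \<in> {1..n}" "v \<in> {1..n}" "\<xi> \<in> space (spc X)" for u v \<xi>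
  unfolding Fmat_def using assms(2)[OF th th] that by simp
 have "AE \<xi> in spc X. real_cond_exp (spc X) (latent_algebra n X) (Zvar X (u, v)) \<xi> = Fmat f' X \<xi> u v"
  if uv: "u \<in> {1..n}" "v \<in> {1..n}" for u v
 proof -
  have "AE \<xi> in spc X. real_cond_exp (spc X) (latent_algebra n X) (Zvar X (u, v)) \<xi> = Fmat f X \<xi> u v"
   using assms(1) uv unfolding icf_model_def latent_model_def Let_def by blast
  with AE_space show ?thesis by eventually_elim (simp add: F[OF uv])
 qed
 then have "latent_model n f' X"
  using assms(1) unfolding icf_model_def latent_model_def Let_def by blast
 then show "icf_model n p f' X" using assms(1) unfolding icf_model_def by blast
qed

text \<open>The constants are chosen before \<open>n\<close>, \<open>p\<close> and the probability
  space, so all bounds derived from them are uniform.\<close>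

lemma rank_instance_exists:
 assumes lf: "latent_function f" and rank: "has_rank f r lam q"
 shows "\<exists>f' q' B L \<mu> \<Lambda>. (\<forall>x\<in>{0..1}. \<forall>y\<in>{0..1}. f x y = f' x y) \<and> 1 <= B \<and> 0 <= L \<and> 0 < \<mu> \<and> \<mu> <= 1 \<and> 1 <= \<Lambda> \<and>
  (\<forall>k\<in>{1..r}. \<mu> <= \<bar>lam k\<bar>) \<and>
  (\<forall>n p (X :: 'a icf). 0 < n \<longrightarrow> 0 < p \<longrightarrow> p <= 1 \<longrightarrow> icf_model n p f' X \<longrightarrow> rank_instance n p f' X (spc X) r lam q' B L \<mu> \<Lambda>)"
proof -
 define f' where "f' x y = f (clamp01 x) (clamp01 y)" for x y
 define q' where "q' k x = q k (clamp01 x)" for k x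
 obtain L where L: "L-lipschitz_on ({0..1} \<times> {0..1}) (%(x, y). f x y)" using lf unfolding latent_function_def by blast
 have L0: "0 <= L" by (rule lipschitz_on_nonneg[OF L])
 have f01: "f' x y \<in> {0..1}" for x y using lf clamp01_range unfolding latent_function_def f'_def by blast
 have lip: "\<bar>f' x y - f' x' y\<bar> <= L * \<bar>x - x'\<bar>" for x x' y
 proof -
  have "dist ((%(x, y). f x y) (clamp01 x, clamp01 y)) ((%(x, y). f x y) (clamp01 x', clamp01 y)) <= L * dist (clamp01 x, clamp01 y) (clamp01 x', clamp01 y)"
   by (rule lipschitz_onD[OF L]) (simp_all del: atLeastAtMost_iff)
  also have "... <= L * \<bar>x - x'\<bar>"
   using clamp01_dist[of x x'] L0 by (intro mult_left_mono) (simp_all add: dist_Pair_Pair dist_real_def)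
  finally show ?thesis by (simp add: f'_def dist_real_def)
 qed
 have fm: "(%x. f' (fst x) (snd x)) \<in> borel_measurable (borel \<Otimes>\<^sub>M borel)"
 proof -
  have "continuous_on UNIV (%x :: real \<times> real. (clamp01 (fst x), clamp01 (snd x)))"
   unfolding clamp01_def by (intro continuous_intros)
  then have "continuous_on UNIV ((%(x, y). f x y) \<circ> (%x. (clamp01 (fst x), clamp01 (snd x))))"
   by (rule continuous_on_compose) (rule continuous_on_subset[OF lipschitz_on_continuous_on[OF L]], auto simp del: atLeastAtMost_iff)
  then show ?thesis unfolding borel_prod
   by (intro borel_measurable_continuous_onI) (simp add: f'_def comp_def)
 qed
 obtain B0 where B0: "\<And>j y. j \<in> {1..r} ==> y \<in> {0..1} ==> \<bar>q j y\<bar> <= B0"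
  using rank unfolding has_rank_def by blast
 define B where "B = max 1 B0"
 have B: "1 <= B" by (simp add: B_def)
 have qB: "\<bar>q' k y\<bar> <= B" if "k \<in> {1..r}" for k y using B0[OF that, of "clamp01 y"] by (simp add: q'_def B_def del: atLeastAtMost_iff)
 have lam0: "lam k \<noteq> 0" if "k \<in> {1..r}" for k using rank that unfolding has_rank_def by blast
 interpret U: finite_measure "lebesgue_on {0..1::real}" by (rule finite_measure_lebesgue_on) auto
 \<comment> \<open>The given measurability refers to Lebesgue sets of the unit interval. The
   extension is Borel because it is Lipschitz: \<open>lam k\<close> times it is an integral against
   the extended function.\<close>
 have qm: "q' k \<in> borel_measurable borel" if k: "k \<in> {1..r}" for k
 proof -
  have l0: "0 < \<bar>lam k\<bar>" using lam0[OF k] by simp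
  have "(B * L / \<bar>lam k\<bar>)-lipschitz_on UNIV (q' k)"
  proof (rule lipschitz_onI)
   fix x x' :: real
   let ?x = "clamp01 x" and ?x' = "clamp01 x'"
   have i: "integrable (lebesgue_on {0..1}) (%y. q k y * f (clamp01 x) y)" for x by (rule has_rank_eigen(2)[OF rank k clamp01_range])
   have "lam k * (q' k x - q' k x') = (LINT y|lebesgue_on {0..1}. q k y * f ?x y - q k y * f ?x' y)"
    unfolding Bochner_Integration.integral_diff[OF i i] has_rank_eigen(1)[OF rank k clamp01_range] q'_def by (simp add: right_diff_distrib)
   also have "\<bar>...\<bar> <= (LINT y|lebesgue_on {0..1}. \<bar>q k y * f ?x y - q k y * f ?x' y\<bar>)"
    using integral_norm_bound[of "lebesgue_on {0..1}" "%y. q k y * f ?x y - q k y * f ?x' y"] by simp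
   also have "... <= (LINT y|lebesgue_on {0..1::real}. B * L * \<bar>x - x'\<bar>)"
   proof (rule integral_mono)
    fix y assume "y \<in> space (lebesgue_on {0..1::real})"
    then have y: "y \<in> {0..1}" by simp
    have "\<bar>f ?x y - f ?x' y\<bar> <= L * \<bar>x - x'\<bar>" using lip[of x y x'] clamp01_id[OF y] by (simp add: f'_def)
    moreover have "\<bar>q k y\<bar> <= B" using qB[OF k, of y] clamp01_id[OF y] by (simp add: q'_def)
    ultimately have "\<bar>q k y\<bar> * \<bar>f ?x y - f ?x' y\<bar> <= B * (L * \<bar>x - x'\<bar>)" using B by (intro mult_mono) auto
    then show "\<bar>q k y * f ?x y - q k y * f ?x' y\<bar> <= B * L * \<bar>x - x'\<bar>"
     by (simp add: abs_mult right_diff_distrib[symmetric] mult.assoc)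
   next
    show "integrable (lebesgue_on {0..1}) (%y. \<bar>q k y * f ?x y - q k y * f ?x' y\<bar>)"
     by (intro integrable_abs Bochner_Integration.integrable_diff i)
   qed simp
   also have "... = B * L * \<bar>x - x'\<bar>" by (simp add: measure_restrict_space)
   finally have "\<bar>lam k\<bar> * \<bar>q' k x - q' k x'\<bar> <= B * L * \<bar>x - x'\<bar>" by (simp add: abs_mult)
   then have "\<bar>q' k x - q' k x'\<bar> <= B * L * \<bar>x - x'\<bar> / \<bar>lam k\<bar>" using l0 by (simp add: pos_le_divide_eq mult.commute)
   then show "dist (q' k x) (q' k x') <= B * L / \<bar>lam k\<bar> * dist x x'" by (simp add: dist_real_def)
  qed (use B L0 in simp)
  then show ?thesis by (intro borel_measurable_continuous_onI lipschitz_on_continuous_on)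
 qed
 have eig: "(\<integral>y. q' k y * f' a y \<partial>unif01) = lam k * q' k a" if k: "k \<in> {1..r}" for k a
 proof -
  have fs: "(%y. f' a y) \<in> borel_measurable borel"
   using measurable_compose[OF _ fm, of "%y. (a, y)" borel] by simp
  have "(\<integral>y. q' k y * f' a y \<partial>unif01) = (LINT y|lebesgue_on {0..1}. q' k y * f' a y)"
   by (rule integral_unif01) (intro borel_measurable_times qm[OF k] fs)
  also have "... = (LINT y|lebesgue_on {0..1}. q k y * f (clamp01 a) y)"
   by (rule Bochner_Integration.integral_cong) (auto simp: q'_def f'_def clamp01_id)
  also have "... = lam k * q' k a" unfolding q'_def by (rule has_rank_eigen(1)[OF rank k clamp01_range])
  finally show ?thesis .
 qed
 have fr: "f' x y = (\<Sum>k=1..r. lam k * q' k x * q' k y)" for x y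
  using rank clamp01_range[of x] clamp01_range[of y] unfolding has_rank_def f'_def q'_def by blast
 \<comment> \<open>The inserted 1 gives \<open>\<mu> <= 1\<close> and \<open>1 <= \<Lambda>\<close>,
   and keeps the sets nonempty when \<open>r = 0\<close>.\<close>
 define \<mu> where "\<mu> = Min (insert 1 ((%k. \<bar>lam k\<bar>) ` {1..r}))"
 define \<Lambda> where "\<Lambda> = Max (insert 1 ((%k. \<bar>lam k\<bar>) ` {1..r}))"
 have "0 < \<mu>" unfolding \<mu>_def using lam0 by (subst Min_gr_iff) auto
 moreover have "\<mu> <= 1" unfolding \<mu>_def by (rule Min_le) auto
 moreover have "\<mu> <= \<bar>lam k\<bar>" if "k \<in> {1..r}" for k unfolding \<mu>_def using that by (intro Min_le) auto
 ultimately have \<mu>: "0 < \<mu>" "\<mu> <= 1" "\<And>k. k \<in> {1..r} ==> \<mu> <= \<bar>lam k\<bar>" .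
 have "1 <= \<Lambda>" unfolding \<Lambda>_def by (rule Max_ge) auto
 moreover have "\<bar>lam k\<bar> <= \<Lambda>" if "k \<in> {1..r}" for k unfolding \<Lambda>_def using that by (intro Max_ge) auto
 ultimately have \<Lambda>: "1 <= \<Lambda>" "\<And>k. k \<in> {1..r} ==> \<bar>lam k\<bar> <= \<Lambda>" .
 have inst: "rank_instance n p f' X (spc X) r lam q' B L \<mu> \<Lambda>"
  if "0 < n" "0 < p" "p <= 1" "icf_model n p f' X" for n p and X :: "'a icf"
  by (intro rank_instance.intro icf_instance.intro rank_instance_axioms.intro) (use that f01 fm fr qm qB eig lip \<mu> \<Lambda> B L0 in \<open>assumption | auto\<close>)+
 have "f x y = f' x y" if "x \<in> {0..1}" "y \<in> {0..1}" for x y using that by (simp only: f'_def clamp01_id)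
 then show ?thesis using B L0 \<mu> \<Lambda>(1) inst by blast
qed

section \<open>Limits and conclusion\<close>

lemma eventually_mult_less:
 fixes y D :: "nat => real"
 assumes "(%n. y n / D n) \<longlonglongrightarrow> 0" "\<forall>\<^sub>F n in sequentially. 0 < D n" "0 < c"
 shows "\<forall>\<^sub>F n in sequentially. K * y n < c * D n"
proof -
 have "(%n. K * (y n / D n)) \<longlonglongrightarrow> 0" using tendsto_mult_right_zero[OF assms(1)] .
 then have "\<forall>\<^sub>F n in sequentially. K * (y n / D n) < c" using assms(3) by (rule order_tendstoD)
 with assms(2) show ?thesis by eventually_elim (simp add: pos_divide_less_eq)
qed

text \<open>All terms are smaller than every power of n, except the Markov bound for the thinned
  pairs, which is n^(-1/4) up to logarithms.\<close>

lemma log_failure_asymp: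
 assumes "0 < \<kappa>" "0 < \<rho>" "\<rho> < \<kappa>" "0 < b"
 shows "(%n. log_failure \<kappa> \<rho> b r r' n / ln (real n) powr (- (1 / 2) * (\<kappa> - \<rho>))) \<longlonglongrightarrow> 0"
proof -
 note a = assms(1-3)
 show ?thesis unfolding log_failure_def Let_def add_divide_distrib times_divide_eq_right[symmetric]
  by (intro tendsto_add_zero tendsto_mult_right_zero)
   (use failure_asymp1[OF a] failure_asymp2[OF a] failure_asymp3[OF a] failure_asymp4[OF a assms(4)]
    failure_asymp5[OF a] failure_asymp6[OF a] failure_asymp7[OF a] in \<open>simp_all only: times_divide_eq_right\<close>)
qed

theorem theorem4p2:
  fixes f :: "real \<Rightarrow> real \<Rightarrow> real"
    and r r' :: nat
    and lam :: "nat \<Rightarrow> real"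
    and q :: "nat \<Rightarrow> real \<Rightarrow> real"
    and \<kappa> \<rho> :: real
    and p \<eta> :: "nat \<Rightarrow> real"
    and t :: "nat \<Rightarrow> nat"
    and z :: "nat \<Rightarrow> nat \<Rightarrow> real"
    and X :: "nat \<Rightarrow> 'a icf"
    and F_hat :: "nat \<Rightarrow> 'a \<Rightarrow> nat \<Rightarrow> nat \<Rightarrow> real"
  assumes "latent_function f"
    and "has_rank f r lam q"
    and "r' = num_distinct r lam"
    and "\<kappa> > 0"
    and "0 < \<rho>" and "\<rho> < \<kappa>"
    and "\<And>n. p n = ln (real n) powr (1 + \<kappa>) / real n"
    and "\<And>n. t n = nat \<lceil>ln (0.08 / p n) / ln (0.275 * real n * p n) - real r'\<rceil>"
    and "\<And>n. solves_weights r lam (t n) (z n)"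
    and "\<forall>\<^sub>F n in sequentially. \<eta> n > 0"
    and "\<eta> \<in> \<Theta>(\<lambda>n. ln (real n) powr (- (1 / 2) * (\<kappa> - \<rho>)))"
    and "\<forall>\<^sub>F n in sequentially. icf_model n (p n) f (X n)"
    and "\<And>n \<omega>. F_hat n \<omega> =
           nn_estimate n (X n) (d_hat n (p n) (X n) r' (z n) (t n) \<omega>) (\<eta> n) \<omega>"
  shows "(\<exists>C. (\<lambda>n. measure (spc (X n)) {\<omega> \<in> space (spc (X n)).
             Max {\<bar>F_hat n \<omega> u v - Fmat f (X n) \<omega> u v\<bar> | u v. u \<in> {1..n} \<and> v \<in> {1..n}}
               \<le> C * ln (real n) powr (- (1 / 4) * (\<kappa> - \<rho>))}) \<longlonglongrightarrow> 1)
       \<and> (\<lambda>n. MSE n f (X n) (F_hat n))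
           \<in> O(\<lambda>n. ln (real n) powr (- (1 / 2) * (\<kappa> - \<rho>)))"
proof -
 define D where "D n = ln (real n) powr (- (1 / 2) * (\<kappa> - \<rho>))" for n
 define x where "x n = ln (real n) powr (- (1 / 4) * (\<kappa> - \<rho>))" for n
 define G where "G n = ln (real n) powr (1 + \<kappa>)" for n
 define g where "g n = G n / 10 - 2" for n
 define T where "T n = ln (0.08 / (G n / real n)) / ln (0.275 * G n)" for n
 note \<kappa> = assms(4-6)
 obtain f' q' B L \<mu> \<Lambda> where f': "\<forall>x\<in>{0..1}. \<forall>y\<in>{0..1}. f x y = f' x y"
  and pos: "1 <= B" "0 <= L" "0 < \<mu>" "\<mu> <= 1" "1 <= \<Lambda>" and \<mu>lam: "\<forall>k\<in>{1..r}. \<mu> <= \<bar>lam k\<bar>"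
  and inst: "\<forall>n p (X :: 'a icf). 0 < n \<longrightarrow> 0 < p \<longrightarrow> p <= 1 \<longrightarrow> icf_model n p f' X \<longrightarrow> rank_instance n p f' X (spc X) r lam q' B L \<mu> \<Lambda>"
  using rank_instance_exists[OF assms(1,2)] by blast
 obtain C where C: "0 <= C" "\<And>\<mu> t z b. 0 < \<mu> ==> \<forall>k\<in>{1..r}. \<mu> <= \<bar>lam k\<bar> ==> solves_weights r lam t z ==>
   b \<in> {1..num_distinct r lam} ==> \<bar>z b\<bar> <= C * (1 / \<mu>) ^ (2 * t)"
 proof -
  have "lam k \<noteq> 0" if "k \<in> {1..r}" for k using assms(2) that unfolding has_rank_def by blast
  from weights_bound[of r lam, OF this] obtain C where "0 <= C" "\<forall>\<mu> t z. 0 < \<mu> \<longrightarrow> (\<forall>k\<in>{1..r}. \<mu> <= \<bar>lam k\<bar>) \<longrightarrow> solves_weights r lam t z \<longrightarrow>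
    (\<forall>b\<in>{1..num_distinct r lam}. \<bar>z b\<bar> <= C * (1 / \<mu>) ^ (2 * t))" by blast
  then show ?thesis by (intro that[of C]) blast+
 qed
 have Deq: "D = (%n. ln (real n) powr (- (1 / 2) * (\<kappa> - \<rho>)))" by (simp add: D_def fun_eq_iff)
 \<comment> \<open>The two constants make the order of the threshold explicit: eventually
   \<open>c1 * D n <= \<eta> n\<close> and \<open>\<eta> n <= c2 * D n\<close>.\<close>
 obtain c1 where c1: "0 < c1" "\<forall>\<^sub>F n in sequentially. c1 * norm (D n) <= norm (\<eta> n)"
  using bigthetaD2[OF assms(11)[folded Deq]] by (elim landau_omega.bigE) auto
 obtain c2 where c2: "0 < c2" "\<forall>\<^sub>F n in sequentially. norm (\<eta> n) <= c2 * norm (D n)"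
  using bigthetaD1[OF assms(11)[folded Deq]] by (elim landau_o.bigE) auto
 have l1: "\<forall>\<^sub>F n in sequentially. 1 <= ln (real n)"
  by real_asymp
 have Gtop: "filterlim G at_top sequentially" unfolding G_def using scale_asymp(1)[OF \<kappa>] .
 have Gge: "\<forall>\<^sub>F n in sequentially. c <= G n" for c using Gtop by (simp add: filterlim_at_top)
 have Dp: "\<forall>\<^sub>F n in sequentially. 0 < D n" using l1 by eventually_elim (simp add: D_def)
 \<comment> \<open>The error rate is the square root of the threshold scale, because differences of
   \<open>f\<close> are controlled by the square root of \<open>ldist\<close>.\<close>
 have x2: "(x n)\<^sup>2 = D n" for n
  unfolding x_def D_def power2_eq_square powr_add[symmetric] by (rule arg_cong[of _ _ "%a. ln (real n) powr a"]) simp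
 have D0: "D \<longlonglongrightarrow> 0"
 proof -
  have "(%n. (x n)\<^sup>2) \<longlonglongrightarrow> 0\<^sup>2" unfolding x_def by (rule tendsto_power[OF scale_asymp(3)[OF \<kappa>]])
  then show ?thesis unfolding x2 by simp
 qed
 note less = eventually_mult_less
 define y where "y n = sqrt (ln (real n) powr (1 + \<rho> / 2)) * (1 / sqrt (g n))" for n
 have yD: "(%n. y n / D n) \<longlonglongrightarrow> 0" unfolding y_def g_def G_def D_def by (rule step_error_asymp[OF \<kappa>])
 define Y where "Y = 2 * (1 + \<Lambda>) / \<mu>"
 have d1: "2 * (sqrt (ln (real n) powr (1 + \<rho> / 2)) * (1 + \<Lambda>)) * (1 / (\<mu> * sqrt (g n))) = Y * y n" for n
  by (simp add: Y_def y_def)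
 \<comment> \<open>The 2 comes from the noise, the rest from the bias with
   \<open>\<eta> n <= c2 * D n\<close>.\<close>
 define b where "b = (2 + 2 * (real r * B) * sqrt (2 * c2))"
 define pf where "pf n = log_failure \<kappa> \<rho> (16 * B\<^sup>2) r r' n" for n
 have lp: "\<forall>\<^sub>F n in sequentially. 0 < ln (real n)" using l1 by eventually_elim simp
 have n0: "\<forall>\<^sub>F n in sequentially. 0 < n" by (rule eventually_gt_at_top)
 \<comment> \<open>The value 40 gives \<open>2 <= g n\<close> and \<open>1 < 0.275 * G n\<close>;
   the other bound gives \<open>2 / \<mu> <= sqrt (g n)\<close>.\<close>
 have e_g: "\<forall>\<^sub>F n in sequentially. max 40 (20 + 10 * (2 / \<mu>)\<^sup>2) <= G n" by (rule Gge)
 have e_T: "\<forall>\<^sub>F n in sequentially. real r' + 1 <= T n"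
  using depth_at_top[OF \<kappa>] unfolding filterlim_at_top T_def G_def by blast
 have e_p: "\<forall>\<^sub>F n in sequentially. G n / real n < 1"
  unfolding G_def by (rule order_tendstoD(2)[OF scale_asymp(2)[OF \<kappa>]]) simp
 have e_t1: "\<forall>\<^sub>F n in sequentially. 1 * (T n + (1 + real r')) < 1 * ln (real n)"
  unfolding T_def G_def by (rule less[OF tree_depth_asymp[OF \<kappa>] lp]) simp
 have e_t2: "\<forall>\<^sub>F n in sequentially. ln (\<Lambda>\<^sup>2 / \<mu> ^ 3) * (T n + 1) < (1 / 20) * ln (real n)"
  unfolding T_def G_def by (rule less[OF tree_depth_asymp[OF \<kappa>] lp]) simp
 have e_t3: "\<forall>\<^sub>F n in sequentially. 0.9 < (T n - real r') * ln (g n) / ln (real n)"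
  unfolding T_def G_def g_def by (rule order_tendstoD(1)[OF layer_size_asymp[OF \<kappa>]]) simp
 have e_Lw: "\<forall>\<^sub>F n in sequentially. ln (real n) powr (1 + \<rho> / 2) / g n < 1"
  unfolding g_def G_def by (rule order_tendstoD(2)[OF scale_asymp(4)[OF \<kappa>]]) simp
 have e_D: "\<forall>\<^sub>F n in sequentially. D n < 1" by (rule order_tendstoD(2)[OF D0]) simp
 have e_d1: "\<forall>\<^sub>F n in sequentially. Y * y n < 1 * D n" by (rule less[OF yD Dp]) simp
 have e_1: "\<forall>\<^sub>F n in sequentially. (real r * \<Lambda>\<^sup>2 * (2 * (4 * B + 2)) * Y) * y n < c1 / 8 * D n"
  by (rule less[OF yD Dp]) (use c1 in simp)
 have e_2: "\<forall>\<^sub>F n in sequentially. (real r' * real r * C * \<Lambda> ^ (r' + 1) * (2 * B + 2) * 2) * real n powr (- 2 / 5) < c1 / 8 * D n"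
  using c1 power_error_asymp(1)[OF \<kappa>] by (intro less[OF _ Dp]) (simp_all add: D_def)
 have e_3: "\<forall>\<^sub>F n in sequentially. (real r' * C) * (real n powr (1 / 20) * (real n powr (- 1 / 5) + 0.275 * G n * real n powr (- 4 / 5) + 4 * real n powr (- 11 / 20))) < c1 / 8 * D n"
  unfolding G_def D_def by (rule less[OF power_error_asymp(2)[OF \<kappa>] Dp[unfolded D_def]]) (use c1 in simp)
 have e_4: "\<forall>\<^sub>F n in sequentially. (real r * (B * L)\<^sup>2) * (1 / ln (real n) powr \<kappa>)\<^sup>2 < c1 / 2 * D n"
  unfolding D_def by (rule less[OF power_error_asymp(3)[OF \<kappa>] Dp[unfolded D_def]]) (use c1 in simp)
 \<comment> \<open>The numerical conditions are gathered so that, from some \<open>n\<close> on, a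
   single instance can be treated with constants that do not vary with \<open>n\<close>.\<close>
 have main: "\<forall>\<^sub>F n in sequentially. 0 <= MSE n f (X n) (F_hat n) \<and> MSE n f (X n) (F_hat n) <= b\<^sup>2 * D n + pf n \<and>
   prob_space (spc (X n)) \<and>
   1 - pf n <= measure (spc (X n)) {\<omega> \<in> space (spc (X n)).
      Max {\<bar>F_hat n \<omega> u v - Fmat f (X n) \<omega> u v\<bar> | u v. u \<in> {1..n} \<and> v \<in> {1..n}} <= b * x n}"
  using n0 l1 e_g e_T e_p e_t1 e_t2 e_t3 e_Lw e_D e_d1 e_1 e_2 e_3 e_4 c1(2) c2(2) assms(10,12)
 proof eventually_elim
  case (elim n)
  note l1 = elim(2)
  have nG: "p n = G n / real n" by (simp add: assms(7) G_def)
  have G0: "40 <= G n" "20 + 10 * (2 / \<mu>)\<^sup>2 <= G n" using elim(3) by auto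
  have g2: "2 <= g n" using G0 by (simp add: g_def)
  have Dpos: "0 < D n" using l1 by (simp add: D_def)
  have t: "t n = nat \<lceil>T n - real r'\<rceil>"
  proof -
   have "0.275 * real n * p n = 0.275 * G n" using elim(1) by (simp add: nG)
   then show ?thesis unfolding assms(8) T_def nG by simp
  qed
  have pp: "0 < p n" "p n <= 1" using elim(1,5) G0 by (auto simp: nG)
  have \<eta>: "c1 * D n <= \<eta> n" "\<eta> n <= c2 * D n"
   using elim(16-18) Dpos by auto
  have \<sigma>: "1 / (\<mu> * sqrt (g n)) <= 1 / 2"
  proof -
   have "(2 / \<mu>)\<^sup>2 <= g n" using G0 by (simp add: g_def)
   then have "2 / \<mu> <= sqrt (g n)" by (rule real_le_rsqrt)
   then have "2 <= \<mu> * sqrt (g n)" using pos by (simp add: pos_divide_le_eq mult.commute)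
   then show ?thesis by (simp add: divide_le_eq)
  qed
  have t3: "0.9 * ln (real n) <= (T n - real r') * ln (g n)"
   using elim(8) l1 by (simp add: pos_less_divide_eq)
  have Lw: "ln (real n) powr (1 + \<rho> / 2) <= g n" using elim(9) g2 by (simp add: pos_divide_less_eq)
  have eqc: "f x y = f' x y" if "x \<in> {0..1}" "y \<in> {0..1}" for x y using f' that by blast
  note mc = icf_model_cong[OF elim(19) eqc]
  interpret rank_instance n "p n" f' "X n" "spc (X n)" r lam q' B L \<mu> \<Lambda>
   using inst elim(1) pp mc(1) by blast
  have wb: "\<bar>z n l\<bar> <= C * (1 / \<mu>) ^ (2 * t n)" if "l \<in> {1..r'}" for l
   using C(2)[OF pos(3) \<mu>lam assms(9)[of n]] that unfolding assms(3) by blast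
  have G1: "1 < 0.275 * G n" using G0 by simp
  have Tr: "real r' < T n" using elim(4) by simp
  have h1: "T n + (1 + real r') <= ln (real n)" using elim(6) by simp
  have h2: "(T n + 1) * ln (\<Lambda>\<^sup>2 / \<mu> ^ 3) <= ln (real n) / 20" using elim(7) by (simp add: mult.commute)
  have h3: "Y * y n <= 1" using elim(10,11) by simp
  have h4: "real r * \<Lambda>\<^sup>2 * (2 * (Y * y n) * (4 * B + 2)) <= c1 / 8 * D n" using elim(12) by (simp add: mult_ac)
  have h6: "real r' * C * (real n powr (1 / 20) * (real n powr (- 1 / 5) + 0.275 * G n * real n powr (- 4 / 5) + 4 * real n powr (- 11 / 20))) <= c1 / 8 * D n"
   using elim(14) by simp
  obtain Bad where Bad: "Bad \<in> sets (spc (X n))" "prob Bad <= pf n"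
   and good: "\<forall>\<omega>\<in>space (spc (X n)) - Bad. \<forall>u\<in>{1..n}. \<forall>v\<in>{1..n}.
    \<bar>nn_estimate n (X n) (d_hat n (p n) (X n) r' (z n) (t n) \<omega>) (\<eta> n) \<omega> u v - Fmat f' (X n) \<omega> u v\<bar>
     <= 2 * x n + 2 * (real r * B) * sqrt (2 * \<eta> n)"
   using uniform_error_log[where \<kappa> = \<kappa> and \<rho> = \<rho> and w = "z n" and t = "t n" and C = C and \<eta> = "\<eta> n" and ?c1.0 = c1,
    folded G_def D_def x_def, folded g_def T_def, unfolded d1,
    OF assms(3) nG t assms(9) C(1) wb pos(4) \<kappa>(1) \<kappa>(3) c1(1) \<eta>(1) l1 g2 G1 Tr h1 h2 t3 Lw \<sigma> h3 h4 less_imp_le[OF elim(13)] h6 elim(15)]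
   unfolding pf_def by blast
  have bx: "2 * x n + 2 * (real r * B) * sqrt (2 * \<eta> n) <= b * x n"
  proof -
   have "sqrt (2 * \<eta> n) <= sqrt (2 * c2 * (x n)\<^sup>2)" using \<eta>(2) by (simp add: x2 mult.assoc)
   also have "... = sqrt (2 * c2) * x n" by (simp add: real_sqrt_mult x_def)
   finally have "2 * (real r * B) * sqrt (2 * \<eta> n) <= 2 * (real r * B) * (sqrt (2 * c2) * x n)"
    using pos by (intro mult_left_mono) auto
   then show ?thesis by (simp add: b_def algebra_simps)
  qed
  have good': "\<forall>\<omega>\<in>space (spc (X n)) - Bad. \<forall>u\<in>{1..n}. \<forall>v\<in>{1..n}. \<bar>F_hat n \<omega> u v - Fmat f' (X n) \<omega> u v\<bar> <= b * x n"
   unfolding assms(13) using good bx by (meson order_trans)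
  have Fh: "F_hat n = (%\<omega>. nn_estimate n (X n) (d_hat n (p n) (X n) r' (z n) (t n) \<omega>) (\<eta> n) \<omega>)"
   by (rule ext) (rule assms(13))
  note R = MSE_bound[OF Bad good'[unfolded Fh], folded Fh, folded assms(13)]
  have "MSE n f' (X n) (F_hat n) = MSE n f (X n) (F_hat n)"
   unfolding MSE_def using mc(2) by (intro arg_cong2[where f = "(*)"] refl Bochner_Integration.integral_cong sum.cong) auto
  moreover have "{\<omega> \<in> space (spc (X n)). Max {\<bar>F_hat n \<omega> u v - Fmat f' (X n) \<omega> u v\<bar> | u v. u \<in> {1..n} \<and> v \<in> {1..n}} <= b * x n}
   = {\<omega> \<in> space (spc (X n)). Max {\<bar>F_hat n \<omega> u v - Fmat f (X n) \<omega> u v\<bar> | u v. u \<in> {1..n} \<and> v \<in> {1..n}} <= b * x n}"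
  proof (intro Collect_cong conj_cong refl)
   fix \<omega> assume \<omega>: "\<omega> \<in> space (spc (X n))"
   have "{\<bar>F_hat n \<omega> u v - Fmat f' (X n) \<omega> u v\<bar> | u v. u \<in> {1..n} \<and> v \<in> {1..n}} = {\<bar>F_hat n \<omega> u v - Fmat f (X n) \<omega> u v\<bar> | u v. u \<in> {1..n} \<and> v \<in> {1..n}}"
    using mc(2)[OF _ _ _ _ \<omega>] by (intro Collect_cong ex_cong1) (metis (no_types, lifting))
   then show "(Max {\<bar>F_hat n \<omega> u v - Fmat f' (X n) \<omega> u v\<bar> | u v. u \<in> {1..n} \<and> v \<in> {1..n}} <= b * x n)
    = (Max {\<bar>F_hat n \<omega> u v - Fmat f (X n) \<omega> u v\<bar> | u v. u \<in> {1..n} \<and> v \<in> {1..n}} <= b * x n)" by (simp only:)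
  qed
  ultimately show ?case using R prob_space_axioms by (simp add: power_mult_distrib x2)
 qed
 \<comment> \<open>The failure probability is of smaller order than \<open>D n\<close>, not merely
   o(1); this is what the mean squared error requires.\<close>
 have pfD: "(%n. pf n / D n) \<longlonglongrightarrow> 0" unfolding pf_def D_def using pos by (intro log_failure_asymp \<kappa>) auto
 have "pf \<longlonglongrightarrow> 0"
 proof -
  have "(%n. pf n / D n * D n) \<longlonglongrightarrow> 0 * 0" by (rule tendsto_mult[OF pfD D0])
  moreover have "\<forall>\<^sub>F n in sequentially. pf n / D n * D n = pf n" using Dp by eventually_elim simp
  ultimately show ?thesis using tendsto_cong by force
 qed
 then have low: "(%n. 1 - pf n) \<longlonglongrightarrow> 1" using tendsto_diff[of "%_. 1" "1::real" sequentially pf 0] by simp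
 have "(%n. measure (spc (X n)) {\<omega> \<in> space (spc (X n)).
      Max {\<bar>F_hat n \<omega> u v - Fmat f (X n) \<omega> u v\<bar> | u v. u \<in> {1..n} \<and> v \<in> {1..n}} <= b * x n}) \<longlonglongrightarrow> 1"
 proof (rule tendsto_sandwich[OF _ _ low tendsto_const])
  show "\<forall>\<^sub>F n in sequentially. 1 - pf n <= measure (spc (X n)) {\<omega> \<in> space (spc (X n)).
      Max {\<bar>F_hat n \<omega> u v - Fmat f (X n) \<omega> u v\<bar> | u v. u \<in> {1..n} \<and> v \<in> {1..n}} <= b * x n}"
   using main by eventually_elim blast
  show "\<forall>\<^sub>F n in sequentially. measure (spc (X n)) {\<omega> \<in> space (spc (X n)).
      Max {\<bar>F_hat n \<omega> u v - Fmat f (X n) \<omega> u v\<bar> | u v. u \<in> {1..n} \<and> v \<in> {1..n}} <= b * x n} <= 1"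
   using main by eventually_elim (blast intro: prob_space.prob_le_1)
 qed
 moreover have "(%n. MSE n f (X n) (F_hat n)) \<in> O(D)"
 proof (rule bigoI[of _ "b\<^sup>2 + 1"])
  have "\<forall>\<^sub>F n in sequentially. 1 * pf n < 1 * D n" by (rule less[OF pfD Dp]) simp
  with main Dp show "\<forall>\<^sub>F n in sequentially. norm (MSE n f (X n) (F_hat n)) <= (b\<^sup>2 + 1) * norm (D n)"
   by eventually_elim (simp add: distrib_right)
 qed
 ultimately show ?thesis unfolding x_def Deq by blast
qed

end
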